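(* Let $\Omega\subset\mathbb{R}^n$ be a smooth bounded open domain, let $\lambda_1$ be the first eigenvalue of $-\Delta$ in $W^{1,2}_0(\Omega)$, and let $g_1,g_2\in W^{1,2}(\Omega)$ satisfy $g_1^-,g_2^-\in W^{1,2}_0(\Omega)$ and $g_1,g_2\not\equiv 0$. Then for every $\lambda>-\lambda_1$ there exists $(u,v)\in W^{1,2}(\Omega)\times W^{1,2}(\Omega)$ solving $$\begin{cases}\Delta u=(1+\lambda v)\chi_{\{u>0\}} & \text{in }\Omega,\\ \Delta v=(1+\lambda u)\chi_{\{v>0\}} & \text{in }\Omega,\\ u,v\ge 0 & \text{in }\Omega,\\ u=g_1,\ v=g_2 & \text{on }\partial\Omega.\end{cases}$$
   Context: For a function $g$, $g^{\pm}=\max\{\pm g,0\}$; the condition $g_i^-\in W^{1,2}_0(\Omega)$ is the meaning of "$g_i\ge 0$ on $\partial\Omega$". $\chi_E$ is the characteristic function of $E$. The equations are understood in the weak (distributional) sense, the inequalities $u,v\ge0$ a.e., and the boundary conditions in the sense $u-g_1,\ v-g_2\in W^{1,2}_0(\Omega)$. The first eigenvalue is $\lambda_1=\inf_{\varphi\in W^{1,2}_0(\Omega)\setminus\{0\}}\frac{\int_\Omega|\nabla\varphi|^2dx}{\int_\Omega|\varphi|^2dx}>0$. *)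

theory Defs
  imports "HOL-Analysis.Analysis"
begin

text \<open>
  Functions on \<open>\<Omega>\<close> are represented by total functions; only their values on \<open>\<Omega>\<close>, up to null sets,
  matter in the Sobolev notions below, since all integrals are taken over \<^term>\<open>lebesgue_on \<Omega>\<close>.
\<close>

text \<open>For open \<open>S\<close> this says that all iterated directional derivatives up to order \<open>k\<close> exist (as
  Frechet derivatives of the preceding ones) and are continuous on \<open>S\<close>, i.e. that \<open>f\<close> is \<open>C\<^sup>k\<close>.\<close>

fun Ck_on :: "nat \<Rightarrow> 'a::euclidean_space set \<Rightarrow> ('a \<Rightarrow> 'b::real_normed_vector) \<Rightarrow> bool" where
  "Ck_on 0 S f \<longleftrightarrow> continuous_on S f"
| "Ck_on (Suc k) S f \<longleftrightarrow>
     (\<forall>x\<in>S. f differentiable (at x)) \<and>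
     (\<forall>h. Ck_on k S (\<lambda>x. frechet_derivative f (at x) h))"

definition smooth_on :: "'a::euclidean_space set \<Rightarrow> ('a \<Rightarrow> 'b::real_normed_vector) \<Rightarrow> bool" where
  "smooth_on S f \<longleftrightarrow> (\<forall>k. Ck_on k S f)"

text \<open>Near each boundary point, \<open>\<Omega>\<close> is the region strictly above the graph of a smooth function, in a
  suitably rotated coordinate system. The last axis of that system is the unit vector \<open>e\<close>, and
  \<open>x - (x \<bullet> e) e\<close> stands for the remaining coordinates (the projection onto the hyperplane
  orthogonal to \<open>e\<close>).\<close>

definition smooth_boundary :: "'a::euclidean_space set \<Rightarrow> bool" where
  "smooth_boundary \<Omega> \<longleftrightarrow>
     (\<forall>p\<in>frontier \<Omega>. \<exists>r>0. \<exists>e (\<gamma> :: 'a \<Rightarrow> real). norm e = 1 \<and> smooth_on UNIV \<gamma> \<and>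
        \<Omega> \<inter> ball p r = {x \<in> ball p r. x \<bullet> e > \<gamma> (x - (x \<bullet> e) *\<^sub>R e)})"

definition smooth_bounded_domain :: "'a::euclidean_space set \<Rightarrow> bool" where
  "smooth_bounded_domain \<Omega> \<longleftrightarrow>
     open \<Omega> \<and> connected \<Omega> \<and> \<Omega> \<noteq> {} \<and> bounded \<Omega> \<and> smooth_boundary \<Omega>"

definition test_function :: "'a::euclidean_space set \<Rightarrow> ('a \<Rightarrow> real) \<Rightarrow> bool" where
  "test_function \<Omega> \<phi> \<longleftrightarrow>
     smooth_on UNIV \<phi> \<and> compact (closure {x. \<phi> x \<noteq> 0}) \<and> closure {x. \<phi> x \<noteq> 0} \<subseteq> \<Omega>"

definition gradient :: "('a::euclidean_space \<Rightarrow> real) \<Rightarrow> 'a \<Rightarrow> 'a" where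
  "gradient \<phi> x = (\<Sum>b\<in>Basis. frechet_derivative \<phi> (at x) b *\<^sub>R b)"

definition locally_integrable_on ::
    "'a::euclidean_space set \<Rightarrow> ('a \<Rightarrow> 'b::euclidean_space) \<Rightarrow> bool" where
  "locally_integrable_on \<Omega> f \<longleftrightarrow> (\<forall>K. compact K \<and> K \<subseteq> \<Omega> \<longrightarrow> f absolutely_integrable_on K)"

definition L2 :: "'a::euclidean_space set \<Rightarrow> ('a \<Rightarrow> 'b::euclidean_space) set" where
  "L2 \<Omega> = {f. f \<in> borel_measurable (lebesgue_on \<Omega>) \<and>
              integrable (lebesgue_on \<Omega>) (\<lambda>x. (norm (f x))\<^sup>2)}"

definition has_weak_gradient ::
    "'a::euclidean_space set \<Rightarrow> ('a \<Rightarrow> real) \<Rightarrow> ('a \<Rightarrow> 'a) \<Rightarrow> bool" where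
  "has_weak_gradient \<Omega> f G \<longleftrightarrow>
     locally_integrable_on \<Omega> f \<and> locally_integrable_on \<Omega> G \<and>
     (\<forall>\<phi>. test_function \<Omega> \<phi> \<longrightarrow>
        (LINT x|lebesgue_on \<Omega>. f x *\<^sub>R gradient \<phi> x) = - (LINT x|lebesgue_on \<Omega>. \<phi> x *\<^sub>R G x))"

text \<open>The weak gradient is determined only up to null sets; an arbitrary representative is chosen.\<close>

definition weak_grad :: "'a::euclidean_space set \<Rightarrow> ('a \<Rightarrow> real) \<Rightarrow> 'a \<Rightarrow> 'a" where
  "weak_grad \<Omega> f = (SOME G. has_weak_gradient \<Omega> f G)"

definition W12 :: "'a::euclidean_space set \<Rightarrow> ('a \<Rightarrow> real) set" where
  "W12 \<Omega> = {f \<in> L2 \<Omega>. \<exists>G\<in>L2 \<Omega>. has_weak_gradient \<Omega> f G}"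

definition W12_norm :: "'a::euclidean_space set \<Rightarrow> ('a \<Rightarrow> real) \<Rightarrow> real" where
  "W12_norm \<Omega> f =
     sqrt ((LINT x|lebesgue_on \<Omega>. (f x)\<^sup>2) + (LINT x|lebesgue_on \<Omega>. (norm (weak_grad \<Omega> f x))\<^sup>2))"

text \<open>\<open>W\<^sub>0\<^sup>1\<^sup>,\<^sup>2(\<Omega>)\<close>, the closure of the test functions in \<open>W\<^sup>1\<^sup>,\<^sup>2(\<Omega>)\<close>.\<close>

definition W12_0 :: "'a::euclidean_space set \<Rightarrow> ('a \<Rightarrow> real) set" where
  "W12_0 \<Omega> = {f \<in> W12 \<Omega>. \<exists>\<phi> :: nat \<Rightarrow> 'a \<Rightarrow> real. (\<forall>k. test_function \<Omega> (\<phi> k)) \<and>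
                 (\<lambda>k. W12_norm \<Omega> (\<lambda>x. f x - \<phi> k x)) \<longlonglongrightarrow> 0}"

text \<open>Being the zero element of \<open>W\<^sup>1\<^sup>,\<^sup>2(\<Omega>)\<close>.\<close>

definition zero_on :: "'a::euclidean_space set \<Rightarrow> ('a \<Rightarrow> real) \<Rightarrow> bool" where
  "zero_on \<Omega> f \<longleftrightarrow> (AE x in lebesgue_on \<Omega>. f x = 0)"

definition negative_part :: "('a \<Rightarrow> real) \<Rightarrow> 'a \<Rightarrow> real" where
  "negative_part g x = max (- g x) 0"

definition first_eigenvalue :: "'a::euclidean_space set \<Rightarrow> real" where
  "first_eigenvalue \<Omega> =
     (INF \<phi> \<in> {\<phi> \<in> W12_0 \<Omega>. \<not> zero_on \<Omega> \<phi>}.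
        (LINT x|lebesgue_on \<Omega>. (norm (weak_grad \<Omega> \<phi> x))\<^sup>2) / (LINT x|lebesgue_on \<Omega>. (\<phi> x)\<^sup>2))"

text \<open>\<open>\<Delta> u = f\<close> in \<open>\<Omega>\<close> in the weak sense, for \<open>u\<close> in \<open>W\<^sup>1\<^sup>,\<^sup>2(\<Omega>)\<close>.\<close>

definition weak_laplace_eq :: "'a::euclidean_space set \<Rightarrow> ('a \<Rightarrow> real) \<Rightarrow> ('a \<Rightarrow> real) \<Rightarrow> bool" where
  "weak_laplace_eq \<Omega> u f \<longleftrightarrow>
     u \<in> W12 \<Omega> \<and> locally_integrable_on \<Omega> f \<and>
     (\<forall>\<phi>. test_function \<Omega> \<phi> \<longrightarrow>
        - (LINT x|lebesgue_on \<Omega>. weak_grad \<Omega> u x \<bullet> gradient \<phi> x) = (LINT x|lebesgue_on \<Omega>. f x * \<phi> x))"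

end

theory Submission
  imports Defs
begin

text \<open>
  For given \<open>f\<close>, minimising \<open>\<integral> \<bar>\<nabla>u\<bar>\<^sup>2/2 + f u\<close> over the nonnegative functions with boundary values \<open>g\<close> yields
  a solution operator \<open>u = S f\<close> of the obstacle problem, which is antitone and Lipschitz on \<open>L\<^sup>2\<close> with constant
  \<open>1/\<lambda>\<^sub>1\<close>. The variational inequality implies \<open>0 \<le> f - \<Delta>u \<le> f \<chi>\<close> with \<open>\<chi>\<close> the characteristic function of
  \<open>{u = 0}\<close>, so that \<open>\<Delta>u\<close> is a function in \<open>L\<^sup>2\<close>. By interior \<open>W\<^sup>2\<^sup>,\<^sup>2\<close> regularity \<open>\<Delta>u\<close> vanishes a.e. on \<open>{u = 0}\<close>;
  on \<open>{u > 0}\<close> it equals \<open>f\<close>. Here \<open>f\<close> may change sign, and no sign condition on the right-hand side is needed.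
  The system is the fixed point problem \<open>u = S\<^sub>1 (1 + \<mu> v)\<close>, \<open>v = S\<^sub>2 (1 + \<mu> u)\<close>. Alternating iteration converges,
  by contraction for \<open>\<mu> < 0\<close> and by monotonicity for \<open>\<mu> \<ge> 0\<close>.
\<close>

section \<open>Square-integrable functions\<close>

text \<open>The two signs of \<open>\<mu>\<close> call for different mechanisms. Composing a
  solution operator with \<open>v \<mapsto> 1 + \<mu> v\<close> multiplies L2 distances by at most
  \<open>\<bar>\<mu>\<bar>\<close> over the first eigenvalue; for negative \<open>\<mu>\<close> the
  assumption says exactly that the eigenvalue is positive and this factor below 1. For positive
  \<open>\<mu>\<close> the factor may exceed 1, but then \<open>1 + \<mu> v\<close> increases with
  \<open>v\<close> and order replaces distance. The equation is harder than existence. Variations of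
  the minimiser must stay nonnegative, so on the contact set only one direction is available, and
  there the inequality leaves \<open>f - \<Delta>u\<close> undetermined between 0 and
  \<open>f\<close>. This bracket still decides the matter: it makes the distribution
  \<open>\<Delta>u\<close> an L2 function, for such right-hand sides interior regularity applies,
  and regularity fixes the missing value. The discontinuous factor \<open>\<chi>\<close> is never
  passed to a limit: only the unknowns converge, and the obstacle problems are solved afresh with
  the limit as datum.\<close>

definition sqint :: "'a::euclidean_space set \<Rightarrow> ('a \<Rightarrow> 'b::euclidean_space) \<Rightarrow> real" where
  "sqint \<Omega> f = (LINT x|lebesgue_on \<Omega>. (norm (f x))\<^sup>2)"

definition ip :: "'a::euclidean_space set \<Rightarrow> ('a \<Rightarrow> 'b::euclidean_space) \<Rightarrow> ('a \<Rightarrow> 'b) \<Rightarrow> real" where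
  "ip \<Omega> f g = (LINT x|lebesgue_on \<Omega>. f x \<bullet> g x)"

text \<open>Meaningful only together with membership in \<open>L2\<close>: the Bochner integral of a
  non-integrable function is 0. The lemmas on limits therefore carry the memberships as separate
  hypotheses.\<close>

definition L2_lim :: "'a::euclidean_space set \<Rightarrow> (nat \<Rightarrow> 'a \<Rightarrow> 'b::euclidean_space) \<Rightarrow> ('a \<Rightarrow> 'b) \<Rightarrow> bool" where
  "L2_lim \<Omega> F f \<longleftrightarrow> (\<lambda>k. sqint \<Omega> (\<lambda>x. F k x - f x)) \<longlonglongrightarrow> 0"

lemma L2_meas: "f \<in> L2 \<Omega> \<Longrightarrow> f \<in> borel_measurable (lebesgue_on \<Omega>)"
  and L2_int: "f \<in> L2 \<Omega> \<Longrightarrow> integrable (lebesgue_on \<Omega>) (\<lambda>x. (norm (f x))\<^sup>2)"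
  by (auto simp: L2_def)

lemma L2_dominated:
  assumes "g \<in> borel_measurable (lebesgue_on \<Omega>)" "integrable (lebesgue_on \<Omega>) w"
    "AE x in lebesgue_on \<Omega>. (norm (g x))\<^sup>2 \<le> w x"
  shows "g \<in> L2 \<Omega>"
proof -
  have "(\<lambda>x. (norm (g x))\<^sup>2) \<in> borel_measurable (lebesgue_on \<Omega>)"
    using assms(1) by measurable
  then have "integrable (lebesgue_on \<Omega>) (\<lambda>x. (norm (g x))\<^sup>2)"
    using assms(3) by (intro Bochner_Integration.integrable_bound[OF assms(2)]) auto
  then show ?thesis using assms(1) by (simp add: L2_def)
qed

lemma norm_add_sq_le: "(norm (a + b))\<^sup>2 \<le> 2 * (norm a)\<^sup>2 + 2 * (norm (b::'b::real_inner))\<^sup>2"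
proof -
  have "0 \<le> (norm (a - b))\<^sup>2" by simp
  then show ?thesis by (simp add: power2_norm_eq_inner algebra_simps inner_commute)
qed

lemma L2_add: "f \<in> L2 \<Omega> \<Longrightarrow> g \<in> L2 \<Omega> \<Longrightarrow> (\<lambda>x. f x + g x) \<in> L2 \<Omega>"
  by (rule L2_dominated[where w="\<lambda>x. 2 * (norm (f x))\<^sup>2 + 2 * (norm (g x))\<^sup>2"])
     (auto simp: norm_add_sq_le L2_def)

lemma L2_scaleR: "f \<in> L2 \<Omega> \<Longrightarrow> (\<lambda>x. c *\<^sub>R f x) \<in> L2 \<Omega>"
  by (auto simp: L2_def power_mult_distrib)

lemma L2_cmult: "f \<in> L2 \<Omega> \<Longrightarrow> (\<lambda>x. c * f x :: real) \<in> L2 \<Omega>"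
  using L2_scaleR[of f \<Omega> c] by simp

lemma L2_minus: "f \<in> L2 \<Omega> \<Longrightarrow> (\<lambda>x. - f x) \<in> L2 \<Omega>"
  using L2_scaleR[of f \<Omega> "-1"] by simp

lemma L2_diff: "f \<in> L2 \<Omega> \<Longrightarrow> g \<in> L2 \<Omega> \<Longrightarrow> (\<lambda>x. f x - g x) \<in> L2 \<Omega>"
  using L2_add[of f \<Omega> "\<lambda>x. - g x"] L2_minus[of g] by simp

lemma L2_zero: "(\<lambda>x. 0) \<in> L2 \<Omega>"
  by (simp add: L2_def)

lemma L2_sum: "(\<And>i. i \<in> I \<Longrightarrow> f i \<in> L2 \<Omega>) \<Longrightarrow> (\<lambda>x. \<Sum>i\<in>I. f i x) \<in> L2 \<Omega>"
  by (induction I rule: infinite_finite_induct) (auto simp: L2_zero L2_add)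

lemma L2_bound:
  assumes f: "f \<in> L2 \<Omega>" and g: "g \<in> borel_measurable (lebesgue_on \<Omega>)"
    and le: "AE x in lebesgue_on \<Omega>. norm (g x) \<le> C * norm (f x)"
  shows "g \<in> L2 \<Omega>"
proof (rule L2_dominated[OF g])
  show "integrable (lebesgue_on \<Omega>) (\<lambda>x. C\<^sup>2 * (norm (f x))\<^sup>2)" using L2_int[OF f] by simp
  show "AE x in lebesgue_on \<Omega>. (norm (g x))\<^sup>2 \<le> C\<^sup>2 * (norm (f x))\<^sup>2"
    using le by eventually_elim (metis norm_ge_zero power_mono power_mult_distrib)
qed

lemma L2_bounded_scaleR:
  assumes f: "f \<in> L2 \<Omega>" and a: "a \<in> borel_measurable (lebesgue_on \<Omega>)" "\<And>x. \<bar>a x :: real\<bar> \<le> C"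
  shows "(\<lambda>x. a x *\<^sub>R f x) \<in> L2 \<Omega>"
proof (rule L2_bound[OF f])
  show "(\<lambda>x. a x *\<^sub>R f x) \<in> borel_measurable (lebesgue_on \<Omega>)" using a(1) L2_meas[OF f] by measurable
qed (auto intro!: AE_I2 mult_right_mono a)

lemma L2_cong_AE:
  assumes "f \<in> L2 \<Omega>" "AE x in lebesgue_on \<Omega>. f x = g x" "g \<in> borel_measurable (lebesgue_on \<Omega>)"
  shows "g \<in> L2 \<Omega>"
proof (rule L2_bound[OF assms(1,3)])
  show "AE x in lebesgue_on \<Omega>. norm (g x) \<le> 1 * norm (f x)" using assms(2) by eventually_elim simp
qed

lemma L2_ip_integrable:
  assumes f: "f \<in> L2 \<Omega>" and g: "g \<in> L2 \<Omega>"
  shows "integrable (lebesgue_on \<Omega>) (\<lambda>x. f x \<bullet> g x)"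
proof (rule Bochner_Integration.integrable_bound)
  show "integrable (lebesgue_on \<Omega>) (\<lambda>x. (norm (f x))\<^sup>2 + (norm (g x))\<^sup>2)"
    using f g by (auto simp: L2_def)
  show "(\<lambda>x. f x \<bullet> g x) \<in> borel_measurable (lebesgue_on \<Omega>)"
    using L2_meas[OF f] L2_meas[OF g] by measurable
  have "\<bar>a \<bullet> b\<bar> \<le> (norm a)\<^sup>2 + (norm b)\<^sup>2" for a b :: 'b
    using Cauchy_Schwarz_ineq2[of a b] sum_squares_bound[of "norm a" "norm b"]
      mult_nonneg_nonneg[of "norm a" "norm b"] by (simp add: power2_eq_square)
  then show "AE x in lebesgue_on \<Omega>. norm (f x \<bullet> g x) \<le> norm ((norm (f x))\<^sup>2 + (norm (g x))\<^sup>2)"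
    by simp
qed

lemma L2_mult_integrable:
  "f \<in> L2 \<Omega> \<Longrightarrow> g \<in> L2 \<Omega> \<Longrightarrow> integrable (lebesgue_on \<Omega>) (\<lambda>x. f x * g x :: real)"
  using L2_ip_integrable[of f \<Omega> g] by simp

lemma sqint_nonneg: "0 \<le> sqint \<Omega> f"
  by (simp add: sqint_def)

lemma sqint_ip: "sqint \<Omega> f = ip \<Omega> f f"
  by (simp add: sqint_def ip_def power2_norm_eq_inner)

lemma ip_commute: "ip \<Omega> f g = ip \<Omega> g f"
  by (simp add: ip_def inner_commute)

lemma ip_add_left:
  "f \<in> L2 \<Omega> \<Longrightarrow> g \<in> L2 \<Omega> \<Longrightarrow> h \<in> L2 \<Omega> \<Longrightarrow> ip \<Omega> (\<lambda>x. f x + g x) h = ip \<Omega> f h + ip \<Omega> g h"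
  by (simp add: ip_def inner_add_left L2_ip_integrable)

lemma ip_scaleR_left: "ip \<Omega> (\<lambda>x. c *\<^sub>R f x) h = c * ip \<Omega> f h"
  by (simp add: ip_def)

lemma ip_cmult_left: "ip \<Omega> (\<lambda>x. c * f x :: real) h = c * ip \<Omega> f h"
  by (simp add: ip_def mult.assoc)

lemma ip_minus_left: "ip \<Omega> (\<lambda>x. - f x) h = - ip \<Omega> f h"
  using ip_scaleR_left[of \<Omega> "-1" f h] by simp

lemma ip_diff_left:
  "f \<in> L2 \<Omega> \<Longrightarrow> g \<in> L2 \<Omega> \<Longrightarrow> h \<in> L2 \<Omega> \<Longrightarrow> ip \<Omega> (\<lambda>x. f x - g x) h = ip \<Omega> f h - ip \<Omega> g h"
  by (simp add: ip_def inner_diff_left L2_ip_integrable)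

lemma ip_add_right:
  "f \<in> L2 \<Omega> \<Longrightarrow> g \<in> L2 \<Omega> \<Longrightarrow> h \<in> L2 \<Omega> \<Longrightarrow> ip \<Omega> h (\<lambda>x. f x + g x) = ip \<Omega> h f + ip \<Omega> h g"
  by (simp add: ip_commute[of \<Omega> h] ip_add_left)

lemma ip_diff_right:
  "f \<in> L2 \<Omega> \<Longrightarrow> g \<in> L2 \<Omega> \<Longrightarrow> h \<in> L2 \<Omega> \<Longrightarrow> ip \<Omega> h (\<lambda>x. f x - g x) = ip \<Omega> h f - ip \<Omega> h g"
  by (simp add: ip_commute[of \<Omega> h] ip_diff_left)

lemma ip_scaleR_right: "ip \<Omega> h (\<lambda>x. c *\<^sub>R f x) = c * ip \<Omega> h f"
  by (simp add: ip_def)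

lemma ip_cmult_right: "ip \<Omega> h (\<lambda>x. c * f x :: real) = c * ip \<Omega> h f"
  by (simp add: ip_commute[of \<Omega> h] ip_cmult_left)

lemma ip_minus_right: "ip \<Omega> h (\<lambda>x. - f x) = - ip \<Omega> h f"
  by (simp add: ip_commute[of \<Omega> h] ip_minus_left)

lemma ip_cong_AE:
  assumes "f \<in> L2 \<Omega>" "f' \<in> L2 \<Omega>" "g \<in> L2 \<Omega>" "g' \<in> L2 \<Omega>"
    "AE x in lebesgue_on \<Omega>. f x = f' x" "AE x in lebesgue_on \<Omega>. g x = g' x"
  shows "ip \<Omega> f g = ip \<Omega> f' g'"
  unfolding ip_def
proof (rule integral_cong_AE)
  show "AE x in lebesgue_on \<Omega>. f x \<bullet> g x = f' x \<bullet> g' x" using assms(5,6) by eventually_elim simp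
qed (use assms L2_ip_integrable in blast)+

lemma sqint_cong_AE:
  assumes "f \<in> L2 \<Omega>" "f' \<in> L2 \<Omega>" "AE x in lebesgue_on \<Omega>. f x = f' x"
  shows "sqint \<Omega> f = sqint \<Omega> f'"
  unfolding sqint_ip by (rule ip_cong_AE[OF assms(1,2,1,2,3,3)])

lemma sqint_scaleR: "sqint \<Omega> (\<lambda>x. c *\<^sub>R f x) = c\<^sup>2 * sqint \<Omega> f"
  by (simp add: sqint_def power_mult_distrib)

lemma sqint_diff_commute: "sqint \<Omega> (\<lambda>x. f x - g x) = sqint \<Omega> (\<lambda>x. g x - f x)"
  by (simp add: sqint_def norm_minus_commute)

lemma sqint_add:
  assumes "f \<in> L2 \<Omega>" "g \<in> L2 \<Omega>"
  shows "sqint \<Omega> (\<lambda>x. f x + g x) = sqint \<Omega> f + 2 * ip \<Omega> f g + sqint \<Omega> g"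
  using assms by (simp add: sqint_ip ip_add_left ip_add_right L2_add ip_commute[of \<Omega> g f])

lemma sqint_diff:
  assumes "f \<in> L2 \<Omega>" "g \<in> L2 \<Omega>"
  shows "sqint \<Omega> (\<lambda>x. f x - g x) = sqint \<Omega> f - 2 * ip \<Omega> f g + sqint \<Omega> g"
  using assms by (simp add: sqint_ip ip_diff_left ip_diff_right L2_diff ip_commute[of \<Omega> g f])

lemma sqint_add_le:
  assumes "f \<in> L2 \<Omega>" "g \<in> L2 \<Omega>"
  shows "sqint \<Omega> (\<lambda>x. f x + g x) \<le> 2 * sqint \<Omega> f + 2 * sqint \<Omega> g"
  using sqint_nonneg[of \<Omega> "\<lambda>x. f x - g x"] by (simp add: sqint_diff sqint_add assms)

lemma sqint_diff_le:
  assumes "f \<in> L2 \<Omega>" "g \<in> L2 \<Omega>"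
  shows "sqint \<Omega> (\<lambda>x. f x - g x) \<le> 2 * sqint \<Omega> f + 2 * sqint \<Omega> g"
  using sqint_nonneg[of \<Omega> "\<lambda>x. f x + g x"] by (simp add: sqint_diff sqint_add assms)

lemma sqint_triangle:
  assumes "f \<in> L2 \<Omega>" "g \<in> L2 \<Omega>" "h \<in> L2 \<Omega>"
  shows "sqint \<Omega> (\<lambda>x. f x - g x) \<le> 2 * sqint \<Omega> (\<lambda>x. f x - h x) + 2 * sqint \<Omega> (\<lambda>x. g x - h x)"
  using sqint_diff_le[of "\<lambda>x. f x - h x" \<Omega> "\<lambda>x. g x - h x"] assms by (simp add: L2_diff)

lemma sqint_mono:
  assumes "f \<in> L2 \<Omega>" "g \<in> L2 \<Omega>" "AE x in lebesgue_on \<Omega>. norm (f x) \<le> norm (g x)"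
  shows "sqint \<Omega> f \<le> sqint \<Omega> g"
  unfolding sqint_def
proof (rule integral_mono_AE)
  show "AE x in lebesgue_on \<Omega>. (norm (f x))\<^sup>2 \<le> (norm (g x))\<^sup>2"
    using assms(3) by eventually_elim (simp add: power_mono)
qed (use assms in \<open>auto simp: L2_int\<close>)

lemma sqint_eq_0:
  assumes "f \<in> L2 \<Omega>"
  shows "sqint \<Omega> f = 0 \<longleftrightarrow> (AE x in lebesgue_on \<Omega>. f x = 0)"
  unfolding sqint_def using integral_nonneg_eq_0_iff_AE[OF L2_int[OF assms]] by simp

text \<open>No sign of \<open>c\<close> is given, so \<open>c = 0\<close> is treated apart and
  \<open>c < 0\<close> is refuted; the vertex \<open>t = - b / c\<close> then yields the bound. With
  \<open>a = 0\<close> the conclusion is \<open>b = 0\<close>, which is how a first-order condition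
  is extracted in \<open>Riesz_test\<close>.\<close>

lemma quadratic_nonneg_discriminant:
  fixes a b c :: real
  assumes "\<And>t. 0 \<le> a + 2 * t * b + t\<^sup>2 * c"
  shows "b\<^sup>2 \<le> a * c"
proof (cases "c = 0")
  case True
  have "b = 0"
  proof (rule ccontr)
    assume "b \<noteq> 0"
    \<comment> \<open>At this \<open>t\<close> the affine function \<open>a + 2 * t * b\<close>
      takes the value -1.\<close>
    then show False using assms[of "- (a + 1) / (2 * b)"] True by (simp add: field_simps)
  qed
  then show ?thesis using True by simp
next
  case False
  have "0 \<le> c"
  proof (rule ccontr)
    assume "\<not> 0 \<le> c"
    then have c: "c < 0" by simp
    \<comment> \<open>Chosen so that \<open>t * c\<close> cancels
      \<open>\<bar>a\<bar> + 2 * \<bar>b\<bar>\<close> and leaves \<open>c - 1\<close>; the final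
      \<open>+ 1\<close> guarantees \<open>t \<ge> 1\<close>, which permits
      \<open>a \<le> \<bar>a\<bar> * t\<close>.\<close>
    define t where "t = (\<bar>a\<bar> + 2 * \<bar>b\<bar> + 1) / (- c) + 1"
    have t: "t \<ge> 1" "t * c = - (\<bar>a\<bar> + 2 * \<bar>b\<bar> + 1) + c" using c by (auto simp: t_def field_simps)
    have "a + 2 * t * b + t\<^sup>2 * c \<le> \<bar>a\<bar> * t + 2 * t * \<bar>b\<bar> + t\<^sup>2 * c"
    proof -
      have "a \<le> \<bar>a\<bar> * t" using t(1) mult_left_mono[of 1 t "\<bar>a\<bar>"] by linarith
      moreover have "t * b \<le> t * \<bar>b\<bar>" using t(1) by (intro mult_left_mono) auto
      ultimately show ?thesis by simp
    qed
    also have "\<dots> = t * (\<bar>a\<bar> + 2 * \<bar>b\<bar> + t * c)" by (simp add: algebra_simps power2_eq_square)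
    also have "\<dots> = t * (c - 1)" using t(2) by simp
    also have "\<dots> < 0" using t(1) c by (simp add: mult_pos_neg)
    finally show False using assms[of t] by simp
  qed
  then have c: "c > 0" using False by simp
  have "0 \<le> a + 2 * (- b / c) * b + (- b / c)\<^sup>2 * c" by (rule assms)
  then show ?thesis using c by (simp add: field_simps power2_eq_square)
qed

lemma ip_Cauchy_Schwarz:
  assumes "f \<in> L2 \<Omega>" "g \<in> L2 \<Omega>"
  shows "(ip \<Omega> f g)\<^sup>2 \<le> sqint \<Omega> f * sqint \<Omega> g"
proof (rule quadratic_nonneg_discriminant)
  fix t :: real
  have "0 \<le> sqint \<Omega> (\<lambda>x. f x + t *\<^sub>R g x)" by (rule sqint_nonneg)
  also have "\<dots> = sqint \<Omega> f + 2 * t * ip \<Omega> f g + t\<^sup>2 * sqint \<Omega> g"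
    using assms by (simp add: sqint_add L2_scaleR ip_scaleR_right sqint_scaleR)
  finally show "0 \<le> sqint \<Omega> f + 2 * t * ip \<Omega> f g + t\<^sup>2 * sqint \<Omega> g" .
qed

lemma ip_abs_le:
  assumes "f \<in> L2 \<Omega>" "g \<in> L2 \<Omega>"
  shows "\<bar>ip \<Omega> f g\<bar> \<le> sqrt (sqint \<Omega> f) * sqrt (sqint \<Omega> g)"
  using real_sqrt_le_mono[OF ip_Cauchy_Schwarz[OF assms]] by (simp add: real_sqrt_mult)

section \<open>Convergence in L2\<close>

lemma L2_lim_ip:
  assumes "L2_lim \<Omega> F f" "L2_lim \<Omega> G g" "\<And>k. F k \<in> L2 \<Omega>" "\<And>k. G k \<in> L2 \<Omega>" "f \<in> L2 \<Omega>" "g \<in> L2 \<Omega>"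
  shows "(\<lambda>k. ip \<Omega> (F k) (G k)) \<longlonglongrightarrow> ip \<Omega> f g"
proof -
  \<comment> \<open>Expansion of \<open>ip \<Omega> (F k) (G k)\<close> around the limits: one term
    with two small factors, two terms with one, and the limit itself. Cauchy-Schwarz disposes of the
    first three.\<close>
  let ?a = "\<lambda>k. ip \<Omega> (\<lambda>x. F k x - f x) (\<lambda>x. G k x - g x)"
  let ?b = "\<lambda>k. ip \<Omega> f (\<lambda>x. G k x - g x)" and ?c = "\<lambda>k. ip \<Omega> (\<lambda>x. F k x - f x) g"
  have F: "(\<lambda>k. sqrt (sqint \<Omega> (\<lambda>x. F k x - f x))) \<longlonglongrightarrow> 0"
    using tendsto_real_sqrt[OF assms(1)[unfolded L2_lim_def]] by simp
  have G: "(\<lambda>k. sqrt (sqint \<Omega> (\<lambda>x. G k x - g x))) \<longlonglongrightarrow> 0"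
    using tendsto_real_sqrt[OF assms(2)[unfolded L2_lim_def]] by simp
  have "?a \<longlonglongrightarrow> 0"
    by (rule Lim_null_comparison[OF _ tendsto_mult_zero[OF F G]])
       (auto intro!: always_eventually ip_abs_le L2_diff assms)
  moreover have "?b \<longlonglongrightarrow> 0"
    by (rule Lim_null_comparison[OF _ tendsto_mult_right_zero[OF G, of "sqrt (sqint \<Omega> f)"]])
       (auto intro!: always_eventually ip_abs_le L2_diff assms)
  moreover have "?c \<longlonglongrightarrow> 0"
    by (rule Lim_null_comparison[OF _ tendsto_mult_left_zero[OF F, of "sqrt (sqint \<Omega> g)"]])
       (auto intro!: always_eventually ip_abs_le L2_diff assms)
  ultimately have "(\<lambda>k. ?a k + ?b k + ?c k + ip \<Omega> f g) \<longlonglongrightarrow> 0 + 0 + 0 + ip \<Omega> f g"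
    by (intro tendsto_intros)
  moreover have "?a k + ?b k + ?c k + ip \<Omega> f g = ip \<Omega> (F k) (G k)" for k
    using assms by (simp add: ip_diff_left ip_diff_right L2_diff)
  ultimately show ?thesis by simp
qed

lemma L2_lim_const: "L2_lim \<Omega> (\<lambda>k. f) f"
  by (simp add: L2_lim_def sqint_def)

lemma L2_lim_sqint:
  assumes "L2_lim \<Omega> F f" "\<And>k. F k \<in> L2 \<Omega>" "f \<in> L2 \<Omega>"
  shows "(\<lambda>k. sqint \<Omega> (F k)) \<longlonglongrightarrow> sqint \<Omega> f"
  unfolding sqint_ip using L2_lim_ip[OF assms(1,1,2,2,3,3)] .

lemma L2_lim_le:
  assumes "a \<longlonglongrightarrow> 0" "\<And>k. sqint \<Omega> (\<lambda>x. F k x - f x) \<le> a k"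
  shows "L2_lim \<Omega> F f"
  unfolding L2_lim_def
  by (rule tendsto_sandwich[OF _ _ tendsto_const assms(1)]) (auto simp: sqint_nonneg assms(2))

lemma L2_lim_add:
  assumes "L2_lim \<Omega> F f" "L2_lim \<Omega> G g" "\<And>k. F k \<in> L2 \<Omega>" "\<And>k. G k \<in> L2 \<Omega>" "f \<in> L2 \<Omega>" "g \<in> L2 \<Omega>"
  shows "L2_lim \<Omega> (\<lambda>k x. F k x + G k x) (\<lambda>x. f x + g x)"
proof (rule L2_lim_le)
  show "(\<lambda>k. 2 * sqint \<Omega> (\<lambda>x. F k x - f x) + 2 * sqint \<Omega> (\<lambda>x. G k x - g x)) \<longlonglongrightarrow> 0"
    using tendsto_add[OF tendsto_mult_right_zero[of _ _ 2] tendsto_mult_right_zero[of _ _ 2]]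
      assms(1,2) by (force simp: L2_lim_def)
  show "sqint \<Omega> (\<lambda>x. F k x + G k x - (f x + g x))
      \<le> 2 * sqint \<Omega> (\<lambda>x. F k x - f x) + 2 * sqint \<Omega> (\<lambda>x. G k x - g x)" for k
    using sqint_add_le[of "\<lambda>x. F k x - f x" \<Omega> "\<lambda>x. G k x - g x"] assms
    by (simp add: L2_diff algebra_simps)
qed

lemma L2_lim_scaleR:
  assumes "L2_lim \<Omega> F f"
  shows "L2_lim \<Omega> (\<lambda>k x. c *\<^sub>R F k x) (\<lambda>x. c *\<^sub>R f x)"
proof (rule L2_lim_le)
  show "(\<lambda>k. c\<^sup>2 * sqint \<Omega> (\<lambda>x. F k x - f x)) \<longlonglongrightarrow> 0"
    using assms by (simp add: L2_lim_def tendsto_mult_right_zero)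
  show "sqint \<Omega> (\<lambda>x. c *\<^sub>R F k x - c *\<^sub>R f x) \<le> c\<^sup>2 * sqint \<Omega> (\<lambda>x. F k x - f x)" for k
    by (simp add: sqint_scaleR[symmetric] scaleR_diff_right)
qed

lemma L2_lim_diff:
  assumes "L2_lim \<Omega> F f" "L2_lim \<Omega> G g" "\<And>k. F k \<in> L2 \<Omega>" "\<And>k. G k \<in> L2 \<Omega>" "f \<in> L2 \<Omega>" "g \<in> L2 \<Omega>"
  shows "L2_lim \<Omega> (\<lambda>k x. F k x - G k x) (\<lambda>x. f x - g x)"
  using L2_lim_add[OF assms(1) L2_lim_scaleR[OF assms(2), of "-1"]] assms by (simp add: L2_minus)

lemma L2_lim_bound:
  assumes "L2_lim \<Omega> F f" "\<And>k. F k \<in> L2 \<Omega>" "f \<in> L2 \<Omega>"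
    "\<And>k. H k \<in> L2 \<Omega>" "h \<in> L2 \<Omega>"
    "\<And>k. AE x in lebesgue_on \<Omega>. norm (H k x - h x) \<le> C * norm (F k x - f x)"
  shows "L2_lim \<Omega> H h"
proof (rule L2_lim_le)
  show "(\<lambda>k. C\<^sup>2 * sqint \<Omega> (\<lambda>x. F k x - f x)) \<longlonglongrightarrow> 0"
    using assms(1) by (simp add: L2_lim_def tendsto_mult_right_zero)
  fix k
  have "sqint \<Omega> (\<lambda>x. H k x - h x) \<le> sqint \<Omega> (\<lambda>x. C *\<^sub>R (F k x - f x))"
  proof (rule sqint_mono)
    show "AE x in lebesgue_on \<Omega>. norm (H k x - h x) \<le> norm (C *\<^sub>R (F k x - f x))"
      using assms(6)[of k]
      by eventually_elim (simp, meson abs_ge_self mult_right_mono norm_ge_zero order_trans)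
  qed (use assms in \<open>auto intro!: L2_diff L2_scaleR\<close>)
  then show "sqint \<Omega> (\<lambda>x. H k x - h x) \<le> C\<^sup>2 * sqint \<Omega> (\<lambda>x. F k x - f x)"
    by (simp only: sqint_scaleR)
qed

lemma L2_lim_subseq: "L2_lim \<Omega> F f \<Longrightarrow> strict_mono r \<Longrightarrow> L2_lim \<Omega> (\<lambda>k. F (r k)) f"
  unfolding L2_lim_def by (drule (1) LIMSEQ_subseq_LIMSEQ) (simp add: o_def)

lemma L2_lim_AE_subseq:
  assumes "L2_lim \<Omega> F f" "\<And>k. F k \<in> L2 \<Omega>" "f \<in> L2 \<Omega>"
  obtains r :: "nat \<Rightarrow> nat" where "strict_mono r" "AE x in lebesgue_on \<Omega>. (\<lambda>k. F (r k) x) \<longlonglongrightarrow> f x"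
proof -
  have "\<exists>r::nat\<Rightarrow>nat. strict_mono r \<and> (AE x in lebesgue_on \<Omega>. (\<lambda>n. (norm (F (r n) x - f x))\<^sup>2) \<longlonglongrightarrow> 0)"
  proof (rule tendsto_L1_AE_subseq)
    show "integrable (lebesgue_on \<Omega>) (\<lambda>x. (norm (F n x - f x))\<^sup>2)" for n
      by (intro L2_int L2_diff assms)
    show "(\<lambda>n. LINT x|lebesgue_on \<Omega>. norm ((norm (F n x - f x))\<^sup>2)) \<longlonglongrightarrow> 0"
      using assms(1) by (simp add: L2_lim_def sqint_def)
  qed
  then obtain r where r: "strict_mono r"
    "AE x in lebesgue_on \<Omega>. (\<lambda>n. (norm (F (r n) x - f x))\<^sup>2) \<longlonglongrightarrow> 0" by blast
  have "AE x in lebesgue_on \<Omega>. (\<lambda>k. F (r k) x) \<longlonglongrightarrow> f x"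
    using r(2)
  proof eventually_elim
    fix x assume "(\<lambda>n. (norm (F (r n) x - f x))\<^sup>2) \<longlonglongrightarrow> 0"
    from tendsto_real_sqrt[OF this] have "(\<lambda>n. norm (F (r n) x - f x)) \<longlonglongrightarrow> 0" by simp
    then show "(\<lambda>k. F (r k) x) \<longlonglongrightarrow> f x" by (simp add: LIM_zero_iff tendsto_norm_zero_iff)
  qed
  then show ?thesis using r(1) that by blast
qed

lemma L2_lim_dominated:
  assumes F: "\<And>k. F k \<in> borel_measurable (lebesgue_on \<Omega>)" and f: "f \<in> borel_measurable (lebesgue_on \<Omega>)"
    and w: "integrable (lebesgue_on \<Omega>) w"
    and le: "\<And>k. AE x in lebesgue_on \<Omega>. (norm (F k x - f x))\<^sup>2 \<le> w x"
    and lim: "AE x in lebesgue_on \<Omega>. (\<lambda>k. F k x) \<longlonglongrightarrow> f x"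
  shows "L2_lim \<Omega> F f"
proof -
  have "(\<lambda>k. LINT x|lebesgue_on \<Omega>. (norm (F k x - f x))\<^sup>2) \<longlonglongrightarrow> (LINT x|lebesgue_on \<Omega>. 0)"
  proof (rule integral_dominated_convergence[OF _ _ w])
    show "AE x in lebesgue_on \<Omega>. (\<lambda>i. (norm (F i x - f x))\<^sup>2) \<longlonglongrightarrow> 0"
      using lim
    proof eventually_elim
      fix x assume "(\<lambda>k. F k x) \<longlonglongrightarrow> f x"
      then have "(\<lambda>k. norm (F k x - f x)) \<longlonglongrightarrow> 0" by (simp add: LIM_zero_iff tendsto_norm_zero_iff)
      from tendsto_power[OF this, of 2] show "(\<lambda>i. (norm (F i x - f x))\<^sup>2) \<longlonglongrightarrow> 0" by simp
    qed
    show "AE x in lebesgue_on \<Omega>. norm ((norm (F i x - f x))\<^sup>2) \<le> w x" for i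
      using le[of i] by simp
    show "(\<lambda>x. (norm (F i x - f x))\<^sup>2) \<in> borel_measurable (lebesgue_on \<Omega>)" for i
      using F[of i] f by measurable
  qed auto
  then show ?thesis by (simp add: L2_lim_def sqint_def)
qed

text \<open>The difference of the sequence with itself converges to \<open>f - g\<close>, so the
  constant \<open>sqint\<close> of that difference must be 0.\<close>

lemma L2_lim_unique:
  assumes "L2_lim \<Omega> F f" "L2_lim \<Omega> F g" "\<And>k. F k \<in> L2 \<Omega>" "f \<in> L2 \<Omega>" "g \<in> L2 \<Omega>"
  shows "AE x in lebesgue_on \<Omega>. f x = g x"
proof -
  have "(\<lambda>k. sqint \<Omega> (\<lambda>x. (F k x - F k x) - (f x - g x))) \<longlonglongrightarrow> 0"
    using L2_lim_diff[OF assms(1,2,3,3,4,5)] by (simp add: L2_lim_def)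
  then have "sqint \<Omega> (\<lambda>x. f x - g x) = 0"
    by (simp add: LIMSEQ_const_iff) (metis sqint_diff_commute)
  then show ?thesis using sqint_eq_0[OF L2_diff[OF assms(4,5)]] by simp
qed

section \<open>Completeness of L2\<close>

definition L2_Cauchy :: "'a::euclidean_space set \<Rightarrow> (nat \<Rightarrow> 'a \<Rightarrow> 'b::euclidean_space) \<Rightarrow> bool" where
  "L2_Cauchy \<Omega> F \<longleftrightarrow> (\<forall>e>0. \<exists>N. \<forall>m\<ge>N. \<forall>n\<ge>N. sqint \<Omega> (\<lambda>x. F m x - F n x) < e)"

lemma L2_lim_imp_Cauchy:
  assumes "L2_lim \<Omega> F f" "\<And>k. F k \<in> L2 \<Omega>" "f \<in> L2 \<Omega>"
  shows "L2_Cauchy \<Omega> F"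
  unfolding L2_Cauchy_def
proof (intro allI impI)
  fix e :: real assume "e > 0"
  then obtain N where N: "\<And>k. k \<ge> N \<Longrightarrow> sqint \<Omega> (\<lambda>x. F k x - f x) < e / 4"
    using order_tendstoD(2)[OF assms(1)[unfolded L2_lim_def], of "e/4"]
    by (auto simp: eventually_sequentially)
  have "sqint \<Omega> (\<lambda>x. F m x - F n x) < e" if "m \<ge> N" "n \<ge> N" for m n
    using sqint_triangle[OF assms(2)[of m] assms(2)[of n] assms(3)] N[OF that(1)] N[OF that(2)] by simp
  then show "\<exists>N. \<forall>m\<ge>N. \<forall>n\<ge>N. sqint \<Omega> (\<lambda>x. F m x - F n x) < e" by blast
qed

lemma L2_nn_integral:
  "f \<in> L2 \<Omega> \<Longrightarrow> (\<integral>\<^sup>+x. ennreal ((norm (f x))\<^sup>2) \<partial>lebesgue_on \<Omega>) = ennreal (sqint \<Omega> f)"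
  unfolding sqint_def by (intro nn_integral_eq_integral L2_int) auto

text \<open>Riesz-Fischer. A rapidly converging subsequence has summable increments at almost every
  point, which produces a candidate limit; Fatou's lemma then turns the Cauchy bounds into L2 bounds
  against that candidate for the whole sequence.\<close>

lemma L2_complete:
  fixes F :: "nat \<Rightarrow> 'a::euclidean_space \<Rightarrow> 'b::euclidean_space"
  assumes C: "L2_Cauchy \<Omega> F" and F: "\<And>k. F k \<in> L2 \<Omega>"
  obtains f where "f \<in> L2 \<Omega>" "L2_lim \<Omega> F f"
proof -
  let ?M = "lebesgue_on \<Omega>"
  have "\<exists>N. \<forall>m\<ge>N. \<forall>n\<ge>N. sqint \<Omega> (\<lambda>x. F m x - F n x) < (1/8)^j" for j
    using C unfolding L2_Cauchy_def by (metis zero_less_divide_1_iff zero_less_numeral zero_less_power)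
  then obtain N where N: "\<And>j m n. m \<ge> N j \<Longrightarrow> n \<ge> N j \<Longrightarrow> sqint \<Omega> (\<lambda>x. F m x - F n x) < (1/8)^j"
    by metis
  \<comment> \<open>The sum dominates \<open>N n\<close>, and the added \<open>n\<close> makes
    \<open>r\<close> strictly increasing.\<close>
  define r where "r n = (\<Sum>i\<le>n. N i) + n" for n
  have rN: "r n \<ge> N n" for n unfolding r_def using member_le_sum[of n "{..n}" N] by simp
  have rS: "r n < r (Suc n)" for n by (simp add: r_def)
  have rmono: "strict_mono r" by (simp add: rS strict_mono_Suc_iff)
  define d where "d n x = F (r (Suc n)) x - F (r n) x" for n x
  have dL: "d n \<in> L2 \<Omega>" for n unfolding d_def by (intro L2_diff F)
  \<comment> \<open>The rate \<open>(1/8)^n\<close> leaves room for the weight \<open>4^n\<close>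
    below: the weighted integrals are still at most \<open>(1/2)^n\<close>, so the weighted series
    is finite a.e. and the increments are eventually below \<open>(1/2)^n\<close> at almost every
    point.\<close>
  have dsmall: "sqint \<Omega> (d n) \<le> (1/8)^n" for n
    unfolding d_def using N[of n "r (Suc n)" "r n"] rN[of n] rS[of n] by simp
  have meas[measurable]: "F k \<in> borel_measurable ?M" "d n \<in> borel_measurable ?M" for k n
    using F dL L2_meas by blast+
  have "(\<integral>\<^sup>+x. (\<Sum>n. ennreal (4^n * (norm (d n x))\<^sup>2)) \<partial>?M) = (\<Sum>n. \<integral>\<^sup>+x. ennreal (4^n * (norm (d n x))\<^sup>2) \<partial>?M)"
    by (rule nn_integral_suminf) measurable
  also have "\<dots> \<le> (\<Sum>n. ennreal ((1/2)^n))"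
  proof (rule suminf_le)
    fix n
    have "(\<integral>\<^sup>+x. ennreal (4^n * (norm (d n x))\<^sup>2) \<partial>?M) = ennreal (4^n) * ennreal (sqint \<Omega> (d n))"
      by (simp add: ennreal_mult' nn_integral_cmult L2_nn_integral dL)
    also have "\<dots> \<le> ennreal (4^n) * ennreal ((1/8)^n)"
      by (intro mult_left_mono ennreal_leI dsmall) auto
    also have "\<dots> = ennreal ((1/2)^n)"
      by (simp add: ennreal_mult''[symmetric] power_mult_distrib[symmetric])
    finally show "(\<integral>\<^sup>+x. ennreal (4^n * (norm (d n x))\<^sup>2) \<partial>?M) \<le> ennreal ((1/2)^n)" .
  qed auto
  also have "\<dots> < \<infinity>"
    by (subst suminf_ennreal_eq[OF _ geometric_sums]) auto
  finally have "AE x in ?M. (\<Sum>n. ennreal (4^n * (norm (d n x))\<^sup>2)) \<noteq> \<infinity>"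
    by (intro nn_integral_noteq_infinite) auto
  then have conv: "AE x in ?M. convergent (\<lambda>n. F (r n) x)"
  proof eventually_elim
    fix x assume "(\<Sum>n. ennreal (4^n * (norm (d n x))\<^sup>2)) \<noteq> \<infinity>"
    then have "summable (\<lambda>n. 4^n * (norm (d n x))\<^sup>2)"
      by (intro summable_suminf_not_top) (auto simp: top_unique)
    then have "(\<lambda>n. 4^n * (norm (d n x))\<^sup>2) \<longlonglongrightarrow> 0" by (rule summable_LIMSEQ_zero)
    from tendsto_real_sqrt[OF this] have "(\<lambda>n. 2^n * norm (d n x)) \<longlonglongrightarrow> 0"
      by (simp add: real_sqrt_mult real_sqrt_power)
    then obtain n0 where n0: "\<And>n. n \<ge> n0 \<Longrightarrow> 2^n * norm (d n x) < 1"
      using order_tendstoD(2)[of "\<lambda>n. 2^n * norm (d n x)" 0 sequentially 1]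
      by (auto simp: eventually_sequentially)
    have "summable (\<lambda>n. norm (d n x))"
    proof (rule summable_comparison_test_ev)
      show "\<forall>\<^sub>F n in sequentially. norm (norm (d n x)) \<le> (1/2)^n"
        unfolding eventually_sequentially
      proof (intro exI allI impI)
        fix n assume "n0 \<le> n"
        from n0[OF this] show "norm (norm (d n x)) \<le> (1/2)^n" by (simp add: field_simps)
      qed
    qed simp
    then have "summable (\<lambda>n. d n x)" by (rule summable_norm_cancel)
    then have "convergent (\<lambda>n. \<Sum>i<n. d i x)" by (simp add: summable_iff_convergent)
    moreover have "(\<Sum>i<n. d i x) = F (r n) x - F (r 0) x" for n
      by (induction n) (auto simp: d_def)
    ultimately have "convergent (\<lambda>n. (F (r n) x - F (r 0) x) + F (r 0) x)"
      by (intro convergent_add convergent_const) simp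
    then show "convergent (\<lambda>n. F (r n) x)" by simp
  qed
  define f where "f x = lim (\<lambda>n. F (r n) x)" for x
  have [measurable]: "f \<in> borel_measurable ?M" unfolding f_def by measurable
  have lim: "AE x in ?M. (\<lambda>n. F (r n) x) \<longlonglongrightarrow> f x"
    using conv by eventually_elim (simp add: f_def convergent_LIMSEQ_iff)
  \<comment> \<open>Fatou along the subsequence: a bound on the distance of \<open>F k\<close> to
    all later members passes to its distance from \<open>f\<close>. It is stated with nonnegative
    integrals since integrability of the limit is not yet known.\<close>
  have key: "(\<integral>\<^sup>+x. ennreal ((norm (F k x - f x))\<^sup>2) \<partial>?M) \<le> ennreal e"
    if "\<And>n. n \<ge> k \<Longrightarrow> sqint \<Omega> (\<lambda>x. F k x - F n x) \<le> e" for k e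
  proof -
    have "(\<integral>\<^sup>+x. ennreal ((norm (F k x - f x))\<^sup>2) \<partial>?M)
        = (\<integral>\<^sup>+x. liminf (\<lambda>n. ennreal ((norm (F k x - F (r n) x))\<^sup>2)) \<partial>?M)"
    proof (rule nn_integral_cong_AE, use lim in eventually_elim)
      fix x assume "(\<lambda>n. F (r n) x) \<longlonglongrightarrow> f x"
      then have "(\<lambda>n. ennreal ((norm (F k x - F (r n) x))\<^sup>2)) \<longlonglongrightarrow> ennreal ((norm (F k x - f x))\<^sup>2)"
        by (intro tendsto_ennrealI tendsto_intros)
      then show "ennreal ((norm (F k x - f x))\<^sup>2) = liminf (\<lambda>n. ennreal ((norm (F k x - F (r n) x))\<^sup>2))"
        using lim_imp_Liminf[OF sequentially_bot] by metis
    qed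
    also have "\<dots> \<le> liminf (\<lambda>n. \<integral>\<^sup>+x. ennreal ((norm (F k x - F (r n) x))\<^sup>2) \<partial>?M)"
      by (rule nn_integral_liminf) measurable
    also have "\<dots> \<le> limsup (\<lambda>n. \<integral>\<^sup>+x. ennreal ((norm (F k x - F (r n) x))\<^sup>2) \<partial>?M)"
      by (rule Liminf_le_Limsup) simp
    also have "\<dots> \<le> ennreal e"
    proof (rule Limsup_bounded, unfold eventually_sequentially, intro exI allI impI)
      fix n assume "n \<ge> k"
      then have "r n \<ge> k" using seq_suble[OF rmono, of n] by simp
      then show "(\<integral>\<^sup>+x. ennreal ((norm (F k x - F (r n) x))\<^sup>2) \<partial>?M) \<le> ennreal e"
        using that[of "r n"] by (simp add: L2_nn_integral L2_diff F ennreal_leI)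
    qed
    finally show ?thesis .
  qed
  have fin: "(\<lambda>x. F k x - f x) \<in> L2 \<Omega> \<and> sqint \<Omega> (\<lambda>x. F k x - f x) \<le> e"
    if "\<And>n. n \<ge> k \<Longrightarrow> sqint \<Omega> (\<lambda>x. F k x - F n x) \<le> e" "e \<ge> 0" for k e
  proof -
    have L: "(\<lambda>x. F k x - f x) \<in> L2 \<Omega>"
      unfolding L2_def using key[OF that(1)]
      by (auto intro!: integrableI_bounded simp: le_less_trans)
    from key[OF that(1)] L that(2) show ?thesis
      by (auto simp: L2_nn_integral)
  qed
  \<comment> \<open>Only differences to members of the sequence are controlled so far;
    \<open>f\<close> itself is recovered by subtraction. The bound 1 is
    \<open>(1/8)^0\<close>.\<close>
  have "(\<lambda>x. F (N 0) x - f x) \<in> L2 \<Omega>"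
    using fin[of "N 0" 1] N[of 0 "N 0"] by (simp add: less_imp_le)
  from L2_diff[OF F[of "N 0"] this] have "f \<in> L2 \<Omega>" by simp
  moreover have "L2_lim \<Omega> F f"
    unfolding L2_lim_def
  proof (rule LIMSEQ_I)
    fix e :: real assume e: "e > 0"
    then obtain K where K: "\<And>m n. m \<ge> K \<Longrightarrow> n \<ge> K \<Longrightarrow> sqint \<Omega> (\<lambda>x. F m x - F n x) < e / 2"
      using C unfolding L2_Cauchy_def by (metis half_gt_zero)
    show "\<exists>no. \<forall>n\<ge>no. norm (sqint \<Omega> (\<lambda>x. F n x - f x) - 0) < e"
    proof (intro exI allI impI)
      fix n assume "n \<ge> K"
      then have "sqint \<Omega> (\<lambda>x. F n x - f x) \<le> e / 2"
        using fin[of n "e/2"] K[of n] e by (simp add: less_imp_le)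
      then show "norm (sqint \<Omega> (\<lambda>x. F n x - f x) - 0) < e" using e by (simp add: sqint_nonneg)
    qed
  qed
  ultimately show ?thesis using that by blast
qed

section \<open>Smooth functions and test functions\<close>

text \<open>\<open>frechet_derivative\<close> is a choice; by uniqueness of derivatives any explicit
  formula \<open>D\<close> can stand in for it. The closure properties below give such a formula and
  conclude by induction on the order.\<close>

lemma Ck_on_UNIV_SucI:
  assumes "\<And>x. (f has_derivative D x) (at x)" "\<And>h. Ck_on k UNIV (\<lambda>x. D x h)"
  shows "Ck_on (Suc k) UNIV f"
proof -
  have "frechet_derivative f (at x) = D x" for x using frechet_derivative_at[OF assms(1)] by simp
  then show ?thesis using assms by (auto simp: differentiable_def)
qed

lemma Ck_on_Suc_has_derivative:
  "Ck_on (Suc k) UNIV f \<Longrightarrow> (f has_derivative frechet_derivative f (at x)) (at x)"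
  by (simp add: frechet_derivative_works)

lemma Ck_on_SucD: "Ck_on (Suc k) UNIV f \<Longrightarrow> Ck_on k UNIV f"
proof (induction k arbitrary: f)
  case 0
  then show ?case
    by (auto intro!: continuous_at_imp_continuous_on differentiable_imp_continuous_within)
next
  case (Suc k)
  then show ?case by (metis Ck_on.simps(2))
qed

lemma Ck_on_const: "Ck_on k UNIV (\<lambda>x. c)"
proof (induction k arbitrary: c)
  case (Suc k)
  show ?case by (rule Ck_on_UNIV_SucI[where D="\<lambda>x h. 0"]) (auto simp: Suc)
qed simp

lemma Ck_on_bounded_linear:
  assumes "bounded_linear f"
  shows "Ck_on k UNIV f"
proof (cases k)
  case 0
  then show ?thesis using assms by (simp add: linear_continuous_on)
next
  case (Suc k)
  show ?thesis unfolding Suc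
    by (rule Ck_on_UNIV_SucI[where D="\<lambda>x. f"])
       (auto simp: Ck_on_const assms bounded_linear_imp_has_derivative)
qed

lemma Ck_on_add:
  "Ck_on k UNIV f \<Longrightarrow> Ck_on k UNIV g \<Longrightarrow> Ck_on k UNIV (\<lambda>x. f x + g x)"
proof (induction k arbitrary: f g)
  case (Suc k)
  show ?case
    by (rule Ck_on_UNIV_SucI[OF has_derivative_add[OF Suc.prems[THEN Ck_on_Suc_has_derivative]]])
       (use Suc in auto)
qed (simp add: continuous_on_add)

lemma Ck_on_mult:
  fixes f g :: "_ \<Rightarrow> real"
  shows "Ck_on k UNIV f \<Longrightarrow> Ck_on k UNIV g \<Longrightarrow> Ck_on k UNIV (\<lambda>x. f x * g x)"
proof (induction k arbitrary: f g)
  case (Suc k)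
  show ?case
    by (rule Ck_on_UNIV_SucI[OF has_derivative_mult[OF Suc.prems[THEN Ck_on_Suc_has_derivative]]])
       (use Suc.prems in \<open>auto intro!: Ck_on_add Suc.IH Ck_on_SucD[OF Suc.prems(1)] Ck_on_SucD[OF Suc.prems(2)]\<close>)
qed (simp add: continuous_on_mult)

text \<open>On the real line the derivative of \<open>\<psi>\<close> is multiplication by its value
  at 1. This turns the chain rule into a product of two functions, one of which is again a
  composition covered by the induction hypothesis.\<close>

lemma Ck_on_compose:
  fixes f :: "_ \<Rightarrow> real" and \<psi> :: "real \<Rightarrow> real"
  shows "Ck_on k UNIV \<psi> \<Longrightarrow> Ck_on k UNIV f \<Longrightarrow> Ck_on k UNIV (\<lambda>x. \<psi> (f x))"
proof (induction k arbitrary: \<psi> f)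
  case 0
  then show ?case using continuous_on_compose2[of UNIV \<psi> UNIV f] by simp
next
  case (Suc k)
  note D = Suc.prems[THEN Ck_on_Suc_has_derivative]
  have "frechet_derivative \<psi> (at t) s = frechet_derivative \<psi> (at t) 1 * s" for s t
  proof -
    have "frechet_derivative \<psi> (at t) (s *\<^sub>R 1) = s *\<^sub>R frechet_derivative \<psi> (at t) 1"
      by (rule linear_scale[OF has_derivative_linear[OF D(1)]])
    then show ?thesis by (simp add: mult.commute)
  qed
  then have eq: "frechet_derivative \<psi> (at (f x)) (frechet_derivative f (at x) h)
      = frechet_derivative \<psi> (at (f x)) 1 * frechet_derivative f (at x) h" for x h .
  show ?case
  proof (rule Ck_on_UNIV_SucI)
    show "((\<lambda>x. \<psi> (f x)) has_derivative
        (\<lambda>h. frechet_derivative \<psi> (at (f x)) (frechet_derivative f (at x) h))) (at x)" for x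
      by (rule has_derivative_compose[OF D(2) D(1)])
    show "Ck_on k UNIV (\<lambda>x. frechet_derivative \<psi> (at (f x)) (frechet_derivative f (at x) h))" for h
      unfolding eq using Suc.prems
      by (intro Ck_on_mult Suc.IH[of "\<lambda>t. frechet_derivative \<psi> (at t) 1" f] Ck_on_SucD[OF Suc.prems(2)]) auto
  qed
qed

lemma Ck_on_affine:
  shows "Ck_on k UNIV f \<Longrightarrow> Ck_on k UNIV (\<lambda>x. f (c *\<^sub>R x + a) :: real)"
proof (induction k arbitrary: f)
  case 0
  then show ?case using continuous_on_compose2[of UNIV f UNIV "\<lambda>x. c *\<^sub>R x + a"]
    by (simp add: continuous_intros)
next
  case (Suc k)
  note D = Suc.prems[THEN Ck_on_Suc_has_derivative]
  show ?case
  proof (rule Ck_on_UNIV_SucI)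
    show "((\<lambda>x. f (c *\<^sub>R x + a)) has_derivative
        (\<lambda>h. frechet_derivative f (at (c *\<^sub>R x + a)) (c *\<^sub>R h))) (at x)" for x
      by (rule has_derivative_compose[OF _ D]) (auto intro!: derivative_eq_intros)
    show "Ck_on k UNIV (\<lambda>x. frechet_derivative f (at (c *\<^sub>R x + a)) (c *\<^sub>R h))" for h
      using Suc.IH[of "\<lambda>x. frechet_derivative f (at x) (c *\<^sub>R h)"] Suc.prems by simp
  qed
qed

text \<open>The derivative is a product of copies of the function itself and of a derivative of
  \<open>f\<close>, so the induction closes through the product rule. \<open>Ck_on_sqrt\<close> and
  \<open>Ck_on_arctan\<close> reduce to this; roots and \<open>arctan\<close> are the smooth
  substitutes for truncations later on.\<close>

lemma Ck_on_inverse: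
  fixes f :: "_ \<Rightarrow> real"
  assumes "\<And>x. f x \<noteq> 0"
  shows "Ck_on k UNIV f \<Longrightarrow> Ck_on k UNIV (\<lambda>x. inverse (f x))"
proof (induction k)
  case 0
  then show ?case using assms by (simp add: continuous_on_inverse)
next
  case (Suc k)
  show ?case
  proof (rule Ck_on_UNIV_SucI)
    show "((\<lambda>x. inverse (f x)) has_derivative
      (\<lambda>h. - 1 * (inverse (f x) * frechet_derivative f (at x) h * inverse (f x)))) (at x)" for x
      using Deriv.has_derivative_inverse[OF assms Ck_on_Suc_has_derivative[OF Suc.prems], of x] by simp
    show "Ck_on k UNIV (\<lambda>x. - 1 * (inverse (f x) * frechet_derivative f (at x) h * inverse (f x)))" for h
      using Suc Ck_on_SucD[OF Suc.prems] by (intro Ck_on_mult Ck_on_const) auto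
  qed
qed

lemma Ck_on_sqrt:
  fixes f :: "_ \<Rightarrow> real"
  assumes pos: "\<And>x. f x > 0"
  shows "Ck_on k UNIV f \<Longrightarrow> Ck_on k UNIV (\<lambda>x. sqrt (f x))"
proof (induction k)
  case 0
  then show ?case by (simp add: continuous_on_real_sqrt)
next
  case (Suc k)
  have nz: "sqrt (f x) \<noteq> 0" for x using pos[of x] by simp
  show ?case
  proof (rule Ck_on_UNIV_SucI)
    show "((\<lambda>x. sqrt (f x)) has_derivative
      (\<lambda>h. frechet_derivative f (at x) h * (inverse (sqrt (f x)) * (1 / 2)))) (at x)" for x
      using has_derivative_real_sqrt[OF pos Ck_on_Suc_has_derivative[OF Suc.prems], of x] pos[of x]
      by (simp add: divide_simps mult.commute)
    show "Ck_on k UNIV (\<lambda>x. frechet_derivative f (at x) h * (inverse (sqrt (f x)) * (1 / 2)))" for h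
      using Suc.prems Ck_on_SucD[OF Suc.prems] Suc.IH
      by (intro Ck_on_mult Ck_on_const Ck_on_inverse nz) auto
  qed
qed

lemma Ck_on_arctan:
  fixes f :: "_ \<Rightarrow> real"
  shows "Ck_on k UNIV f \<Longrightarrow> Ck_on k UNIV (\<lambda>x. arctan (f x))"
proof (induction k)
  case 0
  then show ?case by (simp add: continuous_on_arctan)
next
  case (Suc k)
  have nz: "1 + f x * f x \<noteq> 0" for x using add_pos_nonneg[of 1 "f x * f x"] by simp
  show ?case
  proof (rule Ck_on_UNIV_SucI)
    show "((\<lambda>x. arctan (f x)) has_derivative
      (\<lambda>h. frechet_derivative f (at x) h * inverse (1 + f x * f x))) (at x)" for x
      using has_derivative_arctan[OF Ck_on_Suc_has_derivative[OF Suc.prems], of x]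
      by (simp add: power2_eq_square)
    show "Ck_on k UNIV (\<lambda>x. frechet_derivative f (at x) h * inverse (1 + f x * f x))" for h
      using Suc.prems Ck_on_SucD[OF Suc.prems]
      by (intro Ck_on_mult Ck_on_add Ck_on_const Ck_on_inverse nz) auto
  qed
qed

named_theorems smooth_intros

lemma smooth_const [smooth_intros]: "smooth_on UNIV (\<lambda>x. c)"
  by (simp add: smooth_on_def Ck_on_const)

lemma smooth_bounded_linear: "bounded_linear f \<Longrightarrow> smooth_on UNIV f"
  by (simp add: smooth_on_def Ck_on_bounded_linear)

lemma smooth_id [smooth_intros]: "smooth_on UNIV (\<lambda>x. x)"
  by (simp add: smooth_bounded_linear)

lemma smooth_add [smooth_intros]:
  "smooth_on UNIV f \<Longrightarrow> smooth_on UNIV g \<Longrightarrow> smooth_on UNIV (\<lambda>x. f x + g x)"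
  by (simp add: smooth_on_def Ck_on_add)

lemma smooth_mult [smooth_intros]:
  "smooth_on UNIV f \<Longrightarrow> smooth_on UNIV g \<Longrightarrow> smooth_on UNIV (\<lambda>x. f x * g x :: real)"
  by (simp add: smooth_on_def Ck_on_mult)

lemma smooth_minus [smooth_intros]: "smooth_on UNIV f \<Longrightarrow> smooth_on UNIV (\<lambda>x. - f x :: real)"
  using smooth_mult[OF smooth_const, of f "-1"] by simp

lemma smooth_diff [smooth_intros]:
  "smooth_on UNIV f \<Longrightarrow> smooth_on UNIV g \<Longrightarrow> smooth_on UNIV (\<lambda>x. f x - g x :: real)"
  using smooth_add[OF _ smooth_minus, of f g] by simp

lemma smooth_sum [smooth_intros]:
  "(\<And>i. i \<in> I \<Longrightarrow> smooth_on UNIV (f i)) \<Longrightarrow> smooth_on UNIV (\<lambda>x. \<Sum>i\<in>I. f i x)"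
  by (induction I rule: infinite_finite_induct) (auto intro: smooth_intros)

lemma smooth_compose:
  "smooth_on UNIV \<psi> \<Longrightarrow> smooth_on UNIV f \<Longrightarrow> smooth_on UNIV (\<lambda>x. (\<psi> :: real \<Rightarrow> real) (f x))"
  by (simp add: smooth_on_def Ck_on_compose)

lemma smooth_affine: "smooth_on UNIV f \<Longrightarrow> smooth_on UNIV (\<lambda>x. f (c *\<^sub>R x + a) :: real)"
  by (simp add: smooth_on_def Ck_on_affine)

lemma smooth_sqrt [smooth_intros]:
  "(\<And>x. f x > 0) \<Longrightarrow> smooth_on UNIV f \<Longrightarrow> smooth_on UNIV (\<lambda>x. sqrt (f x))"
  by (simp add: smooth_on_def Ck_on_sqrt)

lemma smooth_arctan [smooth_intros]: "smooth_on UNIV f \<Longrightarrow> smooth_on UNIV (\<lambda>x. arctan (f x))"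
  by (simp add: smooth_on_def Ck_on_arctan)

lemma smooth_inner [smooth_intros]: "smooth_on UNIV (\<lambda>x. x \<bullet> a)"
  by (simp add: smooth_bounded_linear bounded_linear_inner_left)

lemma smooth_has_derivative:
  "smooth_on UNIV f \<Longrightarrow> (f has_derivative frechet_derivative f (at x)) (at x)"
  unfolding smooth_on_def using Ck_on_Suc_has_derivative by blast

lemma smooth_frechet_derivative [smooth_intros]:
  "smooth_on UNIV f \<Longrightarrow> smooth_on UNIV (\<lambda>x. frechet_derivative f (at x) h)"
  unfolding smooth_on_def by (metis Ck_on.simps(2))

lemma smooth_continuous: "smooth_on UNIV f \<Longrightarrow> continuous_on UNIV f"
  unfolding smooth_on_def by (metis Ck_on.simps(1))

text \<open>The span of these functions is closed under differentiation, so that they are all smooth.\<close>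

definition exp_bump :: "nat \<Rightarrow> real \<Rightarrow> real" where
  "exp_bump n t = (if t > 0 then inverse t ^ n * exp (- inverse t) else 0)"

lemma exp_bump_tendsto_0: "(exp_bump n \<longlongrightarrow> 0) (at 0)"
proof -
  have "((\<lambda>t. inverse t ^ n / exp (inverse t)) \<longlongrightarrow> (0::real)) (at_right 0)"
    by (rule filterlim_compose[OF tendsto_power_div_exp_0 filterlim_inverse_at_top_right])
  then have R: "(exp_bump n \<longlongrightarrow> 0) (at_right 0)"
  proof (rule Lim_transform_eventually)
    show "\<forall>\<^sub>F t in at_right 0. inverse t ^ n / exp (inverse t) = exp_bump n t"
      unfolding eventually_at_right_field
      by (intro exI[of _ 1]) (auto simp: exp_bump_def exp_minus field_simps)
  qed
  have L: "(exp_bump n \<longlongrightarrow> 0) (at_left 0)"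
  proof (rule Lim_transform_eventually[OF tendsto_const])
    show "\<forall>\<^sub>F t in at_left 0. 0 = exp_bump n t"
      unfolding eventually_at_left_field by (intro exI[of _ "-1"]) (auto simp: exp_bump_def)
  qed
  show ?thesis using filterlim_split_at[OF L R] .
qed

lemma exp_bump_derivative:
  "(exp_bump n has_real_derivative (exp_bump (n + 2) t - of_nat n * exp_bump (n + 1) t)) (at t)"
proof -
  consider "t > 0" | "t < 0" | "t = 0" by linarith
  then show ?thesis
  proof cases
    case 1
    have "((\<lambda>t. inverse t ^ n * exp (- inverse t)) has_real_derivative
        of_nat n * inverse t ^ (n - 1) * (- (inverse t * inverse t)) * exp (- inverse t)
        + inverse t ^ n * (exp (- inverse t) * (inverse t * inverse t))) (at t)"
      using 1 by (auto intro!: derivative_eq_intros simp: mult_ac)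
    \<comment> \<open>The exponent \<open>n - 1\<close> is cut off at \<open>n = 0\<close>, where
      the factor \<open>of_nat n\<close> vanishes anyway; hence the case distinction on
      \<open>n\<close>.\<close>
    also have "of_nat n * inverse t ^ (n - 1) * (- (inverse t * inverse t)) * exp (- inverse t)
        + inverse t ^ n * (exp (- inverse t) * (inverse t * inverse t))
        = exp_bump (n + 2) t - of_nat n * exp_bump (n + 1) t"
      using 1 by (cases n) (auto simp: exp_bump_def mult_ac)
    finally have "((\<lambda>t. inverse t ^ n * exp (- inverse t)) has_real_derivative
        (exp_bump (n + 2) t - of_nat n * exp_bump (n + 1) t)) (at t)" .
    then show ?thesis
      by (rule has_field_derivative_transform_within_open[where S="{0<..}"]) (auto simp: 1 exp_bump_def)
  next
    case 2
    have "((\<lambda>t. 0) has_real_derivative (exp_bump (n + 2) t - of_nat n * exp_bump (n + 1) t)) (at t)"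
      using 2 by (simp add: exp_bump_def)
    then show ?thesis
      by (rule has_field_derivative_transform_within_open[where S="{..<0}"]) (auto simp: 2 exp_bump_def)
  next
    case 3
    \<comment> \<open>At 0 the difference quotient of \<open>exp_bump n\<close> is
      \<open>exp_bump (Suc n)\<close>, because division by \<open>h\<close> adds one power of
      \<open>inverse h\<close>; it tends to 0.\<close>
    have "((\<lambda>h. (exp_bump n (0 + h) - exp_bump n 0) / h) \<longlongrightarrow> 0) (at 0)"
    proof (rule Lim_transform_eventually[OF exp_bump_tendsto_0[of "Suc n"]])
      show "\<forall>\<^sub>F h in at 0. exp_bump (Suc n) h = (exp_bump n (0 + h) - exp_bump n 0) / h"
        by (rule always_eventually) (auto simp: exp_bump_def field_simps)
    qed
    then have "(exp_bump n has_real_derivative 0) (at 0)" by (simp only: DERIV_def)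
    then show ?thesis using 3 by (simp add: exp_bump_def[of _ 0])
  qed
qed

lemma smooth_exp_bump: "smooth_on UNIV (exp_bump n)"
proof -
  have "Ck_on k UNIV (exp_bump n)" for k
  proof (induction k arbitrary: n)
    case 0
    then show ?case using exp_bump_derivative
      by (auto intro!: continuous_at_imp_continuous_on DERIV_isCont)
  next
    case (Suc k)
    show ?case
    proof (rule Ck_on_UNIV_SucI)
      show "(exp_bump n has_derivative
          (\<lambda>h. (exp_bump (n + 2) t + (- of_nat n) * exp_bump (n + 1) t) * h)) (at t)" for t
        using exp_bump_derivative[of n t] by (simp add: has_field_derivative_def)
    qed (intro Ck_on_mult Ck_on_add Ck_on_const Suc)
  qed
  then show ?thesis by (simp add: smooth_on_def)
qed

lemma exp_bump_0: "exp_bump 0 t = (if t > 0 then exp (- inverse t) else 0)"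
  by (simp add: exp_bump_def)

section \<open>Calculus of test functions and gradients\<close>

lemma test_functionI:
  assumes "smooth_on UNIV \<phi>" "compact K" "K \<subseteq> \<Omega>" "\<And>x. x \<notin> K \<Longrightarrow> \<phi> x = 0"
  shows "test_function \<Omega> \<phi>"
proof -
  have "closure {x. \<phi> x \<noteq> 0} \<subseteq> K"
    by (rule closure_minimal) (use assms in \<open>auto simp: compact_imp_closed\<close>)
  moreover from this have "compact (closure {x. \<phi> x \<noteq> 0})"
    using compact_Int_closed[OF assms(2) closed_closure, of "{x. \<phi> x \<noteq> 0}"] by (simp only: Int_absorb1)
  ultimately show ?thesis using assms(1,3) unfolding test_function_def by blast
qed

lemma test_functionE:
  assumes "test_function \<Omega> \<phi>"
  obtains K where "compact K" "K \<subseteq> \<Omega>" "\<And>x. x \<notin> K \<Longrightarrow> \<phi> x = 0"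
  using assms that[of "closure {x. \<phi> x \<noteq> 0}"] closure_subset[of "{x. \<phi> x \<noteq> 0}"]
  unfolding test_function_def by blast

lemma test_smooth: "test_function \<Omega> \<phi> \<Longrightarrow> smooth_on UNIV \<phi>"
  by (simp add: test_function_def)

lemma test_outside: "test_function \<Omega> \<phi> \<Longrightarrow> x \<notin> \<Omega> \<Longrightarrow> \<phi> x = 0"
  by (elim test_functionE) blast

lemma test_mult_smooth:
  assumes "test_function \<Omega> \<phi>" "smooth_on UNIV f"
  shows "test_function \<Omega> (\<lambda>x. f x * \<phi> x)"
proof -
  obtain K where "compact K" "K \<subseteq> \<Omega>" "\<And>x. x \<notin> K \<Longrightarrow> \<phi> x = 0"
    using assms(1) test_functionE by metis
  then show ?thesis
    by (intro test_functionI[of _ K] smooth_intros assms test_smooth[OF assms(1)]) auto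
qed

lemma test_cmult: "test_function \<Omega> \<phi> \<Longrightarrow> test_function \<Omega> (\<lambda>x. c * \<phi> x)"
  by (rule test_mult_smooth) (auto intro: smooth_intros)

lemma test_add:
  assumes "test_function \<Omega> \<phi>" "test_function \<Omega> \<psi>"
  shows "test_function \<Omega> (\<lambda>x. \<phi> x + \<psi> x)"
proof -
  obtain K L where "compact K" "K \<subseteq> \<Omega>" "\<And>x. x \<notin> K \<Longrightarrow> \<phi> x = 0"
    "compact L" "L \<subseteq> \<Omega>" "\<And>x. x \<notin> L \<Longrightarrow> \<psi> x = 0"
    using assms test_functionE by metis
  then show ?thesis using assms
    by (intro test_functionI[of _ "K \<union> L"]) (auto simp: test_smooth intro: smooth_intros)
qed

lemma test_diff:
  "test_function \<Omega> \<phi> \<Longrightarrow> test_function \<Omega> \<psi> \<Longrightarrow> test_function \<Omega> (\<lambda>x. \<phi> x - \<psi> x)"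
  using test_add[OF _ test_cmult, of \<Omega> \<phi> \<psi> "-1"] by simp

lemma test_zero: "test_function \<Omega> (\<lambda>x. 0)"
  by (rule test_functionI[of _ "{}"]) (auto intro: smooth_intros)

lemma test_compose:
  assumes "test_function \<Omega> \<phi>" "smooth_on UNIV \<psi>" "\<psi> 0 = 0"
  shows "test_function \<Omega> (\<lambda>x. \<psi> (\<phi> x) :: real)"
proof -
  obtain K where "compact K" "K \<subseteq> \<Omega>" "\<And>x. x \<notin> K \<Longrightarrow> \<phi> x = 0"
    using assms(1) test_functionE by metis
  then show ?thesis
    using smooth_compose[OF assms(2) test_smooth[OF assms(1)]]
    by (intro test_functionI[of _ K]) (auto simp: assms)
qed

lemma test_frechet:
  assumes "test_function \<Omega> \<phi>"
  shows "test_function \<Omega> (\<lambda>x. frechet_derivative \<phi> (at x) h)"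
proof -
  obtain K where K: "compact K" "K \<subseteq> \<Omega>" "\<And>x. x \<notin> K \<Longrightarrow> \<phi> x = 0"
    using assms test_functionE by metis
  show ?thesis
  proof (rule test_functionI[OF _ K(1,2)])
    fix x assume x: "x \<notin> K"
    have "(\<phi> has_derivative (\<lambda>h. 0)) (at x)"
      by (rule has_derivative_transform_within_open[where s="- K" and f="\<lambda>x. 0"])
         (use K x in \<open>auto simp: compact_imp_closed\<close>)
    from frechet_derivative_at[OF this] show "frechet_derivative \<phi> (at x) h = 0" by (rule fun_cong[OF sym])
  qed (intro smooth_intros test_smooth[OF assms])
qed

lemma gradient_inner:
  assumes "(\<phi> has_derivative D) (at x)"
  shows "gradient \<phi> x \<bullet> h = D h"
proof -
  have D: "frechet_derivative \<phi> (at x) = D" using frechet_derivative_at[OF assms] by simp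
  have "D h = D (\<Sum>b\<in>Basis. (h \<bullet> b) *\<^sub>R b)" by (simp add: euclidean_representation)
  also have "\<dots> = (\<Sum>b\<in>Basis. (h \<bullet> b) * D b)"
    using has_derivative_linear[OF assms] by (simp add: linear_sum linear_scale)
  finally show ?thesis unfolding gradient_def D
    by (simp add: inner_sum_left inner_sum_right inner_commute mult.commute)
qed

lemma gradient_eqI:
  assumes "(\<phi> has_derivative (\<lambda>h. a \<bullet> h)) (at x)"
  shows "gradient \<phi> x = a"
  using gradient_inner[OF assms] by (metis euclidean_eqI inner_commute)

lemma gradient_smooth_inner: "smooth_on UNIV \<phi> \<Longrightarrow> gradient \<phi> x \<bullet> h = frechet_derivative \<phi> (at x) h"
  by (rule gradient_inner[OF smooth_has_derivative])

lemma smooth_has_gradient: "smooth_on UNIV \<phi> \<Longrightarrow> (\<phi> has_derivative (\<lambda>h. gradient \<phi> x \<bullet> h)) (at x)"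
  using smooth_has_derivative[of \<phi> x] by (simp add: gradient_smooth_inner)

lemma gradient_add:
  "smooth_on UNIV \<phi> \<Longrightarrow> smooth_on UNIV \<psi> \<Longrightarrow> gradient (\<lambda>x. \<phi> x + \<psi> x) x = gradient \<phi> x + gradient \<psi> x"
  by (rule gradient_eqI, rule has_derivative_eq_rhs[OF has_derivative_add[OF smooth_has_gradient smooth_has_gradient]])
     (auto simp: inner_add_left)

lemma gradient_diff:
  "smooth_on UNIV \<phi> \<Longrightarrow> smooth_on UNIV \<psi> \<Longrightarrow> gradient (\<lambda>x. \<phi> x - \<psi> x) x = gradient \<phi> x - gradient \<psi> x"
  by (rule gradient_eqI, rule has_derivative_eq_rhs[OF has_derivative_diff[OF smooth_has_gradient smooth_has_gradient]])
     (auto simp: inner_diff_left)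

lemma gradient_mult:
  "smooth_on UNIV \<phi> \<Longrightarrow> smooth_on UNIV \<psi> \<Longrightarrow>
    gradient (\<lambda>x. \<phi> x * \<psi> x) x = \<phi> x *\<^sub>R gradient \<psi> x + \<psi> x *\<^sub>R gradient \<phi> x"
  by (rule gradient_eqI, rule has_derivative_eq_rhs[OF has_derivative_mult[OF smooth_has_gradient smooth_has_gradient]])
     (auto simp: inner_add_left mult.commute)

lemma gradient_cmult: "smooth_on UNIV \<phi> \<Longrightarrow> gradient (\<lambda>x. c * \<phi> x) x = c *\<^sub>R gradient \<phi> x"
  by (rule gradient_eqI, rule has_derivative_eq_rhs[OF has_derivative_mult_right[OF smooth_has_gradient]]) auto

lemma gradient_compose:
  assumes "smooth_on UNIV \<phi>" "\<And>t. (\<psi> has_real_derivative \<psi>' t) (at t)"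
  shows "gradient (\<lambda>x. \<psi> (\<phi> x)) x = \<psi>' (\<phi> x) *\<^sub>R gradient \<phi> x"
  by (rule gradient_eqI, rule has_derivative_eq_rhs[OF has_derivative_compose[OF smooth_has_gradient[OF assms(1)]
    assms(2)[unfolded has_field_derivative_def]]]) auto

lemma gradient_test_outside:
  assumes "test_function \<Omega> \<phi>" "x \<notin> \<Omega>"
  shows "gradient \<phi> x = 0"
  unfolding gradient_def using test_outside[OF test_frechet[OF assms(1)] assms(2)] by simp

section \<open>Integration by parts and the Poincare inequality\<close>

declare lebesgue_on_UNIV_eq [simp]

lemma continuous_measurable_lebesgue_on:
  "continuous_on UNIV f \<Longrightarrow> f \<in> borel_measurable (lebesgue_on \<Omega>)"
  by (intro measurable_restrict_space1 measurable_completion) (simp add: borel_measurable_continuous_onI)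

lemma integrable_indicator_compact:
  assumes "compact K" "\<Omega> \<in> sets lebesgue"
  shows "integrable (lebesgue_on \<Omega>) (indicator K :: _ \<Rightarrow> real)"
proof -
  have "\<Omega> \<inter> K \<in> lmeasurable"
    using fmeasurable_Int_fmeasurable[OF lmeasurable_compact[OF assms(1)] assms(2)] by (simp add: Int_commute)
  then have "integrable lebesgue (indicator (\<Omega> \<inter> K) :: _ \<Rightarrow> real)"
    by (intro integrable_real_indicator) (auto simp: fmeasurable_def)
  also have "indicator (\<Omega> \<inter> K) = (\<lambda>x. indicator \<Omega> x *\<^sub>R (indicator K x :: real))"
    by (auto simp: fun_eq_iff indicator_def)
  finally show ?thesis using assms(2) by (simp add: integrable_restrict_space del: real_scaleR_def)
qed

lemma compact_support_bounded:
  fixes f :: "'a::euclidean_space \<Rightarrow> 'b::real_normed_vector"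
  assumes "continuous_on UNIV f" "compact K" "\<And>x. x \<notin> K \<Longrightarrow> f x = 0"
  obtains C where "C \<ge> 0" "\<And>x. norm (f x) \<le> C"
proof -
  have "bounded (f ` K)"
    using assms by (meson compact_continuous_image compact_imp_bounded continuous_on_subset subset_UNIV)
  then obtain C where "\<And>x. x \<in> K \<Longrightarrow> norm (f x) \<le> C" unfolding bounded_iff by blast
  then have "norm (f x) \<le> max C 0" for x using assms(3)[of x] by (cases "x \<in> K") (auto simp: le_max_iff_disj)
  then show ?thesis using that[of "max C 0"] by simp
qed

lemma bounded_support_L2:
  assumes "f \<in> borel_measurable (lebesgue_on \<Omega>)" "compact K" "\<And>x. x \<notin> K \<Longrightarrow> f x = 0"
    "\<Omega> \<in> sets lebesgue" "\<And>x. norm (f x) \<le> C"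
  shows "f \<in> L2 \<Omega>"
proof (rule L2_dominated[OF assms(1)])
  show "integrable (lebesgue_on \<Omega>) (\<lambda>x. C\<^sup>2 * indicator K x)"
    using integrable_indicator_compact[OF assms(2,4)] by simp
  show "AE x in lebesgue_on \<Omega>. (norm (f x))\<^sup>2 \<le> C\<^sup>2 * indicator K x"
    using assms(3,5) by (auto simp: indicator_def intro!: power_mono)
qed

lemma bounded_support_integrable:
  fixes f :: "'a::euclidean_space \<Rightarrow> 'b::euclidean_space"
  assumes "f \<in> borel_measurable (lebesgue_on \<Omega>)" "compact K" "\<And>x. x \<notin> K \<Longrightarrow> f x = 0"
    "\<Omega> \<in> sets lebesgue" "\<And>x. norm (f x) \<le> C"
  shows "integrable (lebesgue_on \<Omega>) f"
proof (rule Bochner_Integration.integrable_bound[OF _ assms(1)])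
  show "integrable (lebesgue_on \<Omega>) (\<lambda>x. C * indicator K x)"
    using integrable_indicator_compact[OF assms(2,4)] by simp
  show "AE x in lebesgue_on \<Omega>. norm (f x) \<le> norm (C * indicator K x)"
    using assms(3,5) by (auto simp: indicator_def intro!: order_trans[OF _ abs_ge_self])
qed

lemma compact_support_L2:
  assumes "continuous_on UNIV f" "compact K" "\<And>x. x \<notin> K \<Longrightarrow> f x = 0" "\<Omega> \<in> sets lebesgue"
  shows "f \<in> L2 \<Omega>"
  by (metis compact_support_bounded[OF assms(1-3)]
      bounded_support_L2[OF continuous_measurable_lebesgue_on[OF assms(1)] assms(2,3,4)])

lemma compact_support_integrable:
  fixes f :: "'a::euclidean_space \<Rightarrow> 'b::euclidean_space"
  assumes "continuous_on UNIV f" "compact K" "\<And>x. x \<notin> K \<Longrightarrow> f x = 0" "\<Omega> \<in> sets lebesgue"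
  shows "integrable (lebesgue_on \<Omega>) f"
  by (metis compact_support_bounded[OF assms(1-3)]
      bounded_support_integrable[OF continuous_measurable_lebesgue_on[OF assms(1)] assms(2,3,4)])

lemma test_continuous: "test_function \<Omega> \<phi> \<Longrightarrow> continuous_on UNIV \<phi>"
  by (simp add: smooth_continuous test_smooth)

lemma smooth_gradient_continuous: "smooth_on UNIV \<phi> \<Longrightarrow> continuous_on UNIV (gradient \<phi>)"
  unfolding gradient_def
  by (intro continuous_intros smooth_continuous smooth_intros)

lemma test_gradient_support:
  assumes "test_function \<Omega> \<phi>"
  obtains K where "compact K" "K \<subseteq> \<Omega>" "\<And>x. x \<notin> K \<Longrightarrow> \<phi> x = 0" "\<And>x. x \<notin> K \<Longrightarrow> gradient \<phi> x = 0"
proof -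
  obtain K where K: "compact K" "K \<subseteq> \<Omega>" "\<And>x. x \<notin> K \<Longrightarrow> \<phi> x = 0"
    using assms test_functionE by metis
  then have "test_function K \<phi>" by (intro test_functionI[of _ K]) (auto simp: test_smooth[OF assms])
  then show ?thesis using that[OF K] gradient_test_outside by blast
qed

lemma test_L2:
  assumes "test_function U \<phi>" "\<Omega> \<in> sets lebesgue"
  shows "\<phi> \<in> L2 \<Omega>" "gradient \<phi> \<in> L2 \<Omega>"
  using assms
  by (metis compact_support_L2 test_gradient_support smooth_gradient_continuous test_continuous test_smooth)+

lemma test_bounded:
  assumes "test_function \<Omega> \<phi>"
  obtains C where "C \<ge> 0" "\<And>x. \<bar>\<phi> x\<bar> \<le> C"
  using assms compact_support_bounded[OF test_continuous[OF assms]]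
  by (metis real_norm_def test_functionE)

lemma test_gradient_bounded:
  assumes "test_function \<Omega> \<phi>"
  obtains C where "C \<ge> 0" "\<And>x. norm (gradient \<phi> x) \<le> C"
  using assms compact_support_bounded[OF smooth_gradient_continuous[OF test_smooth[OF assms]]]
  by (metis test_gradient_support)

lemma test_measurable: "test_function U \<phi> \<Longrightarrow> \<phi> \<in> borel_measurable (lebesgue_on \<Omega>)"
  by (simp add: continuous_measurable_lebesgue_on test_continuous)

lemma test_gradient_measurable: "test_function U \<phi> \<Longrightarrow> gradient \<phi> \<in> borel_measurable (lebesgue_on \<Omega>)"
  by (simp add: continuous_measurable_lebesgue_on smooth_gradient_continuous test_smooth)

lemma test_integrable:
  assumes "test_function U \<phi>" "\<Omega> \<in> sets lebesgue"
  shows "integrable (lebesgue_on \<Omega>) \<phi>"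
  using assms by (metis compact_support_integrable test_functionE test_continuous)

lemma test_integrable_lebesgue: "test_function U \<phi> \<Longrightarrow> integrable lebesgue \<phi>"
  using test_integrable[of U \<phi> UNIV] by (simp add: lebesgue_on_UNIV_eq)

lemma lint_lebesgue_on:
  fixes f :: "'a::euclidean_space \<Rightarrow> 'b::euclidean_space"
  assumes "\<Omega> \<in> sets lebesgue" "\<And>x. x \<notin> \<Omega> \<Longrightarrow> f x = 0"
  shows "(LINT x|lebesgue_on \<Omega>. f x) = (LINT x|lebesgue. f x)"
proof -
  have "(LINT x|lebesgue_on \<Omega>. f x) = (LINT x|lebesgue. indicator \<Omega> x *\<^sub>R f x)"
    using assms(1) by (simp add: integral_restrict_space)
  also have "\<dots> = (LINT x|lebesgue. f x)"
    by (rule Bochner_Integration.integral_cong) (auto simp: indicator_def assms(2))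
  finally show ?thesis .
qed

lemma integrable_lebesgue_on:
  fixes f :: "'a::euclidean_space \<Rightarrow> 'b::euclidean_space"
  assumes "\<Omega> \<in> sets lebesgue" "\<And>x. x \<notin> \<Omega> \<Longrightarrow> f x = 0"
  shows "integrable (lebesgue_on \<Omega>) f \<longleftrightarrow> integrable lebesgue f"
proof -
  have "integrable (lebesgue_on \<Omega>) f \<longleftrightarrow> integrable lebesgue (\<lambda>x. indicator \<Omega> x *\<^sub>R f x)"
    using assms(1) by (simp add: integrable_restrict_space)
  also have "(\<lambda>x. indicator \<Omega> x *\<^sub>R f x) = f"
    by (auto simp: fun_eq_iff indicator_def assms(2))
  finally show ?thesis .
qed

text \<open>Continuity makes \<open>f\<close> Borel measurable, so the integral can be moved from
  \<open>lebesgue\<close> to \<open>lborel\<close>, where translation invariance is an identity of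
  measures.\<close>

lemma lebesgue_integral_translate:
  fixes f :: "'a::euclidean_space \<Rightarrow> real"
  assumes f: "continuous_on UNIV f"
  shows "(LINT x|lebesgue. f (x + a)) = (LINT x|lebesgue. f x)"
proof -
  have [measurable]: "f \<in> borel_measurable borel" using f by (rule borel_measurable_continuous_onI)
  have "(LINT x|lebesgue. f x) = (LINT x|lborel. f x)" by (simp add: integral_completion)
  also have "\<dots> = (LINT x|distr lborel borel ((+) a). f x)" by (simp add: lborel_distr_plus)
  also have "\<dots> = (LINT x|lborel. f (a + x))" by (subst integral_distr) auto
  also have "\<dots> = (LINT x|lebesgue. f (a + x))"
    by (subst integral_completion) auto
  finally show ?thesis by (simp add: add.commute)
qed

lemma smooth_MVT:
  fixes \<phi> :: "'a::euclidean_space \<Rightarrow> real"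
  assumes "smooth_on UNIV \<phi>"
  obtains t where "0 < t" "t < 1" "\<phi> (x + h) - \<phi> x = gradient \<phi> (x + t *\<^sub>R h) \<bullet> h"
proof -
  have D: "((\<lambda>t. \<phi> (x + t *\<^sub>R h)) has_real_derivative gradient \<phi> (x + t *\<^sub>R h) \<bullet> h) (at t)" for t
  proof -
    have "((\<lambda>t. \<phi> (x + t *\<^sub>R h)) has_derivative (\<lambda>s. gradient \<phi> (x + t *\<^sub>R h) \<bullet> (s *\<^sub>R h))) (at t)"
      by (rule has_derivative_compose[OF _ smooth_has_gradient[OF assms]]) (auto intro!: derivative_eq_intros)
    then show ?thesis by (simp add: has_field_derivative_def mult.commute[of _ "gradient \<phi> (x + t *\<^sub>R h) \<bullet> h"])
  qed
  obtain t where "0 < t" "t < 1" "\<phi> (x + 1 *\<^sub>R h) - \<phi> (x + 0 *\<^sub>R h) = (1 - 0) * (gradient \<phi> (x + t *\<^sub>R h) \<bullet> h)"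
    using MVT2[of 0 1 "\<lambda>t. \<phi> (x + t *\<^sub>R h)" "\<lambda>t. gradient \<phi> (x + t *\<^sub>R h) \<bullet> h"] D by auto
  then show ?thesis using that by simp
qed

lemma test_Lipschitz:
  assumes "test_function U \<phi>"
  obtains C where "C \<ge> 0" "\<And>x h. \<bar>\<phi> (x + h) - \<phi> x\<bar> \<le> C * norm h"
proof -
  obtain C where C: "C \<ge> 0" "\<And>x. norm (gradient \<phi> x) \<le> C" using test_gradient_bounded[OF assms] by blast
  have "\<bar>\<phi> (x + h) - \<phi> x\<bar> \<le> C * norm h" for x h
  proof -
    obtain t where "\<phi> (x + h) - \<phi> x = gradient \<phi> (x + t *\<^sub>R h) \<bullet> h"
      using smooth_MVT[OF test_smooth[OF assms]] by metis
    then have "\<bar>\<phi> (x + h) - \<phi> x\<bar> \<le> norm (gradient \<phi> (x + t *\<^sub>R h)) * norm h"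
      by (simp add: Cauchy_Schwarz_ineq2)
    also have "\<dots> \<le> C * norm h" by (intro mult_right_mono C) auto
    finally show ?thesis .
  qed
  then show ?thesis using that C(1) by blast
qed

text \<open>The derivative is the dominated limit of difference quotients, and each of these has
  integral 0 by translation invariance. All integration by parts in the development rests on this
  fact.\<close>

lemma integral_test_derivative_eq_0:
  fixes \<phi> :: "'a::euclidean_space \<Rightarrow> real"
  assumes \<phi>: "test_function U \<phi>"
  shows "(LINT x|lebesgue. frechet_derivative \<phi> (at x) h) = 0"
proof -
  define s where "s n = 1 / real (Suc n)" for n
  have s: "s n > 0" "s n \<le> 1" "s n \<noteq> 0" for n by (auto simp: s_def)
  have s0: "s \<longlonglongrightarrow> 0" unfolding s_def by (rule LIMSEQ_Suc[OF lim_1_over_n])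
  obtain K where K: "compact K" "\<And>x. x \<notin> K \<Longrightarrow> \<phi> x = 0" using \<phi> test_functionE by metis
  obtain C where C: "C \<ge> 0" "\<And>x h. \<bar>\<phi> (x + h) - \<phi> x\<bar> \<le> C * norm h" using test_Lipschitz[OF \<phi>] by blast
  \<comment> \<open>Contains the supports of all difference quotients, since the step sizes
    \<open>s n\<close> lie between 0 and 1.\<close>
  define L where "L = {x - t | x t. x \<in> K \<and> t \<in> (\<lambda>c. c *\<^sub>R h) ` {0..1::real}}"
  have Lc: "compact L" unfolding L_def
    by (intro compact_differences K compact_continuous_image continuous_intros) auto
  have KL: "K \<subseteq> L"
  proof
    fix x assume "x \<in> K"
    then show "x \<in> L" unfolding L_def
      by (intro CollectI exI[of _ x] exI[of _ "0::'a"]) (auto intro!: image_eqI[of _ _ 0])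
  qed
  let ?q = "\<lambda>n x. (\<phi> (x + s n *\<^sub>R h) - \<phi> x) / s n"
  have contq: "continuous_on UNIV (?q n)" for n
    by (intro continuous_intros continuous_on_compose2[OF test_continuous[OF \<phi>]] test_continuous[OF \<phi>])
       (auto simp: s)
  have "(\<lambda>n. LINT x|lebesgue. ?q n x) \<longlonglongrightarrow> (LINT x|lebesgue. frechet_derivative \<phi> (at x) h)"
  proof (rule integral_dominated_convergence[where w="\<lambda>x. C * norm h * indicator L x"])
    show "integrable lebesgue (\<lambda>x. C * norm h * indicator L x)"
      using integrable_indicator_compact[OF Lc, of UNIV] by simp
    show "?q n \<in> borel_measurable lebesgue" for n
      using continuous_measurable_lebesgue_on[OF contq, where \<Omega>=UNIV] by simp
    show "(\<lambda>x. frechet_derivative \<phi> (at x) h) \<in> borel_measurable lebesgue"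
      using test_measurable[OF test_frechet[OF \<phi>], where \<Omega>=UNIV] by simp
    show "AE x in lebesgue. (\<lambda>n. ?q n x) \<longlonglongrightarrow> frechet_derivative \<phi> (at x) h"
    proof (rule AE_I2)
      fix x
      have "((\<lambda>t. x + t *\<^sub>R h) has_derivative (\<lambda>t. t *\<^sub>R h)) (at 0)"
        by (auto intro!: derivative_eq_intros)
      then have "((\<lambda>t. \<phi> (x + t *\<^sub>R h)) has_derivative (\<lambda>t. frechet_derivative \<phi> (at x) (t *\<^sub>R h))) (at 0)"
        using has_derivative_compose[of "\<lambda>t. x + t *\<^sub>R h" "\<lambda>t. t *\<^sub>R h" 0 UNIV \<phi> "frechet_derivative \<phi> (at x)"]
          smooth_has_derivative[OF test_smooth[OF \<phi>], of x] by simp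
      also have "(\<lambda>t. frechet_derivative \<phi> (at x) (t *\<^sub>R h)) = (*) (frechet_derivative \<phi> (at x) h)"
        using linear_scale[OF has_derivative_linear[OF smooth_has_derivative[OF test_smooth[OF \<phi>]]]]
        by (auto simp: fun_eq_iff mult.commute)
      finally have "((\<lambda>t. (\<phi> (x + (0 + t) *\<^sub>R h) - \<phi> (x + 0 *\<^sub>R h)) / t) \<longlongrightarrow> frechet_derivative \<phi> (at x) h) (at 0)"
        unfolding has_field_derivative_def[symmetric] DERIV_def .
      moreover have "filterlim s (at 0) sequentially"
        using s0 s by (auto simp: filterlim_at)
      ultimately show "(\<lambda>n. ?q n x) \<longlonglongrightarrow> frechet_derivative \<phi> (at x) h"
        using filterlim_compose by force
    qed
    show "AE x in lebesgue. norm (?q n x) \<le> C * norm h * indicator L x" for n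
    proof (rule AE_I2)
      fix x
      show "norm (?q n x) \<le> C * norm h * indicator L x"
      proof (cases "x \<in> L")
        case True
        then show ?thesis using C(2)[of x "s n *\<^sub>R h"] s[of n] by (simp add: divide_simps mult_ac)
      next
        case False
        then have "x \<notin> K" using KL by blast
        moreover have "x + s n *\<^sub>R h \<notin> K"
        proof
          assume "x + s n *\<^sub>R h \<in> K"
          then have "x \<in> L" unfolding L_def using s[of n]
            by (intro CollectI exI[of _ "x + s n *\<^sub>R h"] exI[of _ "s n *\<^sub>R h"]) auto
          then show False using False by blast
        qed
        ultimately show ?thesis using False K by simp
      qed
    qed
  qed
  moreover have "(LINT x|lebesgue. ?q n x) = 0" for n
  proof -
    have i1: "integrable lebesgue \<phi>" by (rule test_integrable_lebesgue[OF \<phi>])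
    have "test_function UNIV (\<lambda>x. \<phi> (1 *\<^sub>R x + s n *\<^sub>R h))"
    proof (rule test_functionI)
      show "smooth_on UNIV (\<lambda>x. \<phi> (1 *\<^sub>R x + s n *\<^sub>R h))" by (rule smooth_affine[OF test_smooth[OF \<phi>]])
      show "compact ((\<lambda>y. y - s n *\<^sub>R h) ` K)" by (intro compact_continuous_image continuous_intros K)
    next
      fix x assume "x \<notin> (\<lambda>y. y - s n *\<^sub>R h) ` K"
      then have "x + s n *\<^sub>R h \<notin> K" by (metis add_diff_cancel_right' image_eqI)
      then show "\<phi> (1 *\<^sub>R x + s n *\<^sub>R h) = 0" using K(2) by simp
    qed auto
    from test_integrable_lebesgue[OF this] have i2: "integrable lebesgue (\<lambda>x. \<phi> (x + s n *\<^sub>R h))" by simp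
    show ?thesis using i1 i2 lebesgue_integral_translate[OF test_continuous[OF \<phi>], of "s n *\<^sub>R h"] by simp
  qed
  ultimately have "(\<lambda>n::nat. 0) \<longlonglongrightarrow> (LINT x|lebesgue. frechet_derivative \<phi> (at x) h)" by (simp only:)
  then show ?thesis by (simp add: LIMSEQ_const_iff)
qed

lemma frechet_mult:
  fixes f g :: "'a::euclidean_space \<Rightarrow> real"
  assumes "smooth_on UNIV f" "smooth_on UNIV g"
  shows "frechet_derivative (\<lambda>x. f x * g x) (at x) h
    = f x * frechet_derivative g (at x) h + g x * frechet_derivative f (at x) h"
  using gradient_mult[OF assms, of x]
  by (simp add: gradient_smooth_inner[symmetric] assms smooth_mult inner_add_left)

text \<open>Compact support is asked of one factor only: the product with a smooth function is again
  a test function, and its derivative integrates to 0.\<close>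

lemma integration_by_parts_test:
  fixes f \<phi> :: "'a::euclidean_space \<Rightarrow> real"
  assumes \<phi>: "test_function \<Omega> \<phi>" and f: "smooth_on UNIV f" and \<Omega>: "\<Omega> \<in> sets lebesgue"
  shows "(LINT x|lebesgue_on \<Omega>. f x * frechet_derivative \<phi> (at x) h)
    = - (LINT x|lebesgue_on \<Omega>. \<phi> x * frechet_derivative f (at x) h)"
proof -
  have t1: "test_function \<Omega> (\<lambda>x. f x * frechet_derivative \<phi> (at x) h)"
    by (intro test_mult_smooth test_frechet \<phi> f)
  have t2: "test_function \<Omega> (\<lambda>x. \<phi> x * frechet_derivative f (at x) h)"
    using test_mult_smooth[OF \<phi> smooth_frechet_derivative[OF f, of h]] by (simp add: mult.commute)
  have "0 = (LINT x|lebesgue. frechet_derivative (\<lambda>x. f x * \<phi> x) (at x) h)"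
    by (rule integral_test_derivative_eq_0[OF test_mult_smooth[OF \<phi> f], symmetric])
  also have "\<dots> = (LINT x|lebesgue. f x * frechet_derivative \<phi> (at x) h + \<phi> x * frechet_derivative f (at x) h)"
    by (simp add: frechet_mult f test_smooth[OF \<phi>])
  also have "\<dots> = (LINT x|lebesgue. f x * frechet_derivative \<phi> (at x) h)
      + (LINT x|lebesgue. \<phi> x * frechet_derivative f (at x) h)"
    by (intro Bochner_Integration.integral_add test_integrable_lebesgue[OF t1] test_integrable_lebesgue[OF t2])
  also have "\<dots> = (LINT x|lebesgue_on \<Omega>. f x * frechet_derivative \<phi> (at x) h)
      + (LINT x|lebesgue_on \<Omega>. \<phi> x * frechet_derivative f (at x) h)"
    using lint_lebesgue_on[OF \<Omega> test_outside[OF t1]] lint_lebesgue_on[OF \<Omega> test_outside[OF t2]] by simp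
  finally show ?thesis by simp
qed

lemma continuous_locally_integrable:
  fixes f :: "'a::euclidean_space \<Rightarrow> 'b::euclidean_space"
  assumes "continuous_on UNIV f"
  shows "locally_integrable_on \<Omega> f"
  unfolding locally_integrable_on_def
proof (intro allI impI)
  fix K assume K: "compact K \<and> K \<subseteq> \<Omega>"
  then obtain a b where "K \<subseteq> cbox a b" using bounded_subset_cbox_symmetric compact_imp_bounded by metis
  moreover have "f absolutely_integrable_on cbox a b"
    by (intro absolutely_integrable_continuous continuous_on_subset[OF assms]) auto
  moreover have "K \<in> sets lebesgue" using K by (simp add: lmeasurable_compact fmeasurableD)
  ultimately show "f absolutely_integrable_on K" using set_integrable_subset by blast
qed

lemma gradient_integrable_mult:
  assumes "test_function U \<phi>" "continuous_on UNIV f" "\<Omega> \<in> sets lebesgue"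
  shows "integrable (lebesgue_on \<Omega>) (\<lambda>x. f x *\<^sub>R gradient \<phi> x)"
proof -
  obtain K where K: "compact K" "\<And>x. x \<notin> K \<Longrightarrow> gradient \<phi> x = 0"
    using test_gradient_support[OF assms(1)] by metis
  then show ?thesis
    by (intro compact_support_integrable[OF _ K(1)])
       (auto intro!: continuous_on_scaleR assms smooth_gradient_continuous test_smooth[OF assms(1)])
qed

lemma gradient_integrable_mult2:
  assumes "test_function U \<phi>" "smooth_on UNIV f" "\<Omega> \<in> sets lebesgue"
  shows "integrable (lebesgue_on \<Omega>) (\<lambda>x. \<phi> x *\<^sub>R gradient f x)"
proof -
  obtain K where K: "compact K" "\<And>x. x \<notin> K \<Longrightarrow> \<phi> x = 0"
    using test_gradient_support[OF assms(1)] by metis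
  then show ?thesis
    by (intro compact_support_integrable[OF _ K(1)])
       (auto intro!: continuous_on_scaleR assms smooth_gradient_continuous test_continuous[OF assms(1)])
qed

lemma smooth_has_weak_gradient:
  fixes f :: "'a::euclidean_space \<Rightarrow> real"
  assumes f: "smooth_on UNIV f" and \<Omega>: "\<Omega> \<in> sets lebesgue"
  shows "has_weak_gradient \<Omega> f (gradient f)"
  unfolding has_weak_gradient_def
proof (intro conjI allI impI)
  fix \<phi> :: "'a \<Rightarrow> real" assume \<phi>: "test_function \<Omega> \<phi>"
  note i1 = gradient_integrable_mult[OF \<phi> smooth_continuous[OF f] \<Omega>]
  note i2 = gradient_integrable_mult2[OF \<phi> f \<Omega>]
  show "(LINT x|lebesgue_on \<Omega>. f x *\<^sub>R gradient \<phi> x) = - (LINT x|lebesgue_on \<Omega>. \<phi> x *\<^sub>R gradient f x)"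
  proof (rule euclidean_eqI)
    fix b :: 'a assume "b \<in> Basis"
    then show "(LINT x|lebesgue_on \<Omega>. f x *\<^sub>R gradient \<phi> x) \<bullet> b = - (LINT x|lebesgue_on \<Omega>. \<phi> x *\<^sub>R gradient f x) \<bullet> b"
      using integration_by_parts_test[OF \<phi> f \<Omega>, of b]
      by (simp add: integral_inner_left[symmetric] i1 i2 gradient_smooth_inner f test_smooth[OF \<phi>])
  qed
qed (auto intro!: continuous_locally_integrable smooth_continuous smooth_gradient_continuous f)

text \<open>A coordinate \<open>x \<bullet> b\<close> has derivative 1 in the direction
  \<open>b\<close> and is at most \<open>R\<close> in absolute value on the domain. Inserting that
  derivative next to the square of \<open>\<phi>\<close> and integrating by parts brings in one
  factor \<open>gradient \<phi>\<close>.\<close>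

lemma Poincare_test:
  fixes \<Omega> :: "'a::euclidean_space set"
  assumes "bounded \<Omega>" "\<Omega> \<in> sets lebesgue"
  obtains P where "P > 0" "\<And>\<phi>. test_function \<Omega> \<phi> \<Longrightarrow> sqint \<Omega> \<phi> \<le> P * sqint \<Omega> (gradient \<phi>)"
proof -
  obtain R where R: "R > 0" "\<And>x. x \<in> \<Omega> \<Longrightarrow> norm x \<le> R" using assms(1) bounded_pos by blast
  have "sqint \<Omega> \<phi> \<le> (4 * R\<^sup>2) * sqint \<Omega> (gradient \<phi>)" if \<phi>: "test_function \<Omega> \<phi>" for \<phi>
  proof -
    obtain b :: 'a where b: "b \<in> Basis" using nonempty_Basis by blast
    note L = test_L2[OF \<phi> assms(2)]
    have D: "frechet_derivative (\<lambda>x. x \<bullet> b) (at x) b = 1" for x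
      using fun_cong[OF frechet_derivative_at[OF bounded_linear_imp_has_derivative[OF bounded_linear_inner_left[of b]]], of b x] b
      by simp
    have t: "test_function \<Omega> (\<lambda>x. \<phi> x * \<phi> x)" by (rule test_mult_smooth[OF \<phi> test_smooth[OF \<phi>]])
    have "sqint \<Omega> \<phi> = (LINT x|lebesgue_on \<Omega>. (\<phi> x * \<phi> x) * frechet_derivative (\<lambda>x. x \<bullet> b) (at x) b)"
      unfolding D sqint_def by (simp add: power2_eq_square)
    also have "\<dots> = - (LINT x|lebesgue_on \<Omega>. (x \<bullet> b) * frechet_derivative (\<lambda>x. \<phi> x * \<phi> x) (at x) b)"
      using integration_by_parts_test[OF t smooth_inner[of b] assms(2), of b] by simp
    also have "\<dots> = (LINT x|lebesgue_on \<Omega>. - ((x \<bullet> b) * frechet_derivative (\<lambda>x. \<phi> x * \<phi> x) (at x) b))"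
      by simp
    also have "\<dots> \<le> (LINT x|lebesgue_on \<Omega>. (1/2) * (norm (\<phi> x))\<^sup>2 + 2 * R\<^sup>2 * (norm (gradient \<phi> x))\<^sup>2)"
    proof (rule integral_mono)
      have "test_function \<Omega> (\<lambda>x. - 1 * ((x \<bullet> b) * frechet_derivative (\<lambda>x. \<phi> x * \<phi> x) (at x) b))"
        by (intro test_cmult test_mult_smooth test_frechet t smooth_intros)
      from test_integrable[OF this assms(2)]
      show "integrable (lebesgue_on \<Omega>) (\<lambda>x. - ((x \<bullet> b) * frechet_derivative (\<lambda>x. \<phi> x * \<phi> x) (at x) b))"
        by simp
      show "integrable (lebesgue_on \<Omega>) (\<lambda>x. (1/2) * (norm (\<phi> x))\<^sup>2 + 2 * R\<^sup>2 * (norm (gradient \<phi> x))\<^sup>2)"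
        using L[THEN L2_int] by simp
      fix x assume "x \<in> space (lebesgue_on \<Omega>)"
      then have x: "norm x \<le> R" using R(2) by simp
      have xb: "\<bar>x \<bullet> b\<bar> \<le> R" using Basis_le_norm[OF b, of x] x by simp
      have gb: "\<bar>gradient \<phi> x \<bullet> b\<bar> \<le> norm (gradient \<phi> x)" by (rule Basis_le_norm[OF b])
      have absle: "- 2 * (p * (q * r)) \<le> 2 * (\<bar>p\<bar> * (\<bar>q\<bar> * \<bar>r\<bar>))" for p q r :: real
        using abs_ge_minus_self[of "p * (q * r)"] by (simp add: abs_mult)
      have "- ((x \<bullet> b) * frechet_derivative (\<lambda>x. \<phi> x * \<phi> x) (at x) b)
          = - 2 * ((x \<bullet> b) * (\<phi> x * (gradient \<phi> x \<bullet> b)))"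
        by (simp add: frechet_mult test_smooth[OF \<phi>] gradient_smooth_inner)
      also have "\<dots> \<le> 2 * (\<bar>x \<bullet> b\<bar> * (\<bar>\<phi> x\<bar> * \<bar>gradient \<phi> x \<bullet> b\<bar>))"
        by (rule absle)
      also have "\<dots> \<le> 2 * (R * (\<bar>\<phi> x\<bar> * norm (gradient \<phi> x)))"
        using R(1) by (intro mult_left_mono mult_mono xb gb) auto
      \<comment> \<open>Young's inequality, balanced so that half of
        \<open>sqint \<Omega> \<phi>\<close> can be absorbed on the left; this is the origin of
        \<open>4 * R\<^sup>2\<close>.\<close>
      also have "\<dots> \<le> (1/2) * (norm (\<phi> x))\<^sup>2 + 2 * R\<^sup>2 * (norm (gradient \<phi> x))\<^sup>2"
        using zero_le_power2[of "\<bar>\<phi> x\<bar> - 2 * R * norm (gradient \<phi> x)"]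
        by (simp add: power2_eq_square algebra_simps)
      finally show "- ((x \<bullet> b) * frechet_derivative (\<lambda>x. \<phi> x * \<phi> x) (at x) b)
          \<le> (1/2) * (norm (\<phi> x))\<^sup>2 + 2 * R\<^sup>2 * (norm (gradient \<phi> x))\<^sup>2" .
    qed
    also have "\<dots> = (1/2) * sqint \<Omega> \<phi> + 2 * R\<^sup>2 * sqint \<Omega> (gradient \<phi>)"
      using L[THEN L2_int] by (simp add: sqint_def)
    finally show ?thesis by simp
  qed
  then show ?thesis using that[of "4 * R\<^sup>2"] R(1) by simp
qed

section \<open>Mollification\<close>

lemma L2_lim_eventually:
  assumes "L2_lim \<Omega> F f" "e > 0"
  obtains k0 where "\<And>k. k \<ge> k0 \<Longrightarrow> sqint \<Omega> (\<lambda>x. F k x - f x) < e"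
  using order_tendstoD(2)[OF assms(1)[unfolded L2_lim_def] assms(2)] by (auto simp: eventually_sequentially)

lemma lint_norm_bound:
  fixes f :: "'a \<Rightarrow> 'b::euclidean_space"
  assumes "integrable M f" "integrable M g" "\<And>x. norm (f x) \<le> g x"
  shows "norm (integral\<^sup>L M f) \<le> integral\<^sup>L M g"
proof -
  have "norm (integral\<^sup>L M f) \<le> (LINT x|M. norm (f x))" by (rule integral_norm_bound)
  also have "\<dots> \<le> integral\<^sup>L M g" using assms by (intro integral_mono) auto
  finally show ?thesis .
qed

lemma mem_thickeningI:
  fixes x :: "'a::real_normed_vector"
  assumes "y \<in> K" "dist x y \<le> r"
  shows "x \<in> {a + b |a b. a \<in> K \<and> b \<in> cball 0 r}"
proof -
  have "\<exists>a b. x = a + b \<and> a \<in> K \<and> b \<in> cball 0 r"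
    by (rule exI[of _ y], rule exI[of _ "x - y"]) (use assms in \<open>auto simp: dist_norm norm_minus_commute\<close>)
  then show ?thesis by blast
qed

section \<open>Convolution with a test function\<close>

definition conv :: "('a::euclidean_space \<Rightarrow> real) \<Rightarrow> ('a \<Rightarrow> real) \<Rightarrow> 'a \<Rightarrow> real" where
  "conv \<theta> f x = (LINT y|lebesgue. \<theta> (x - y) * f y)"

lemma test_reflect:
  assumes "test_function UNIV \<theta>"
  shows "test_function UNIV (\<lambda>y. \<theta> (x - y))"
proof -
  obtain K where K: "compact K" "\<And>x. x \<notin> K \<Longrightarrow> \<theta> x = 0" using assms test_functionE by metis
  have "test_function UNIV (\<lambda>y. \<theta> ((-1) *\<^sub>R y + x))"
  proof (rule test_functionI)
    show "smooth_on UNIV (\<lambda>y. \<theta> ((-1) *\<^sub>R y + x))" by (rule smooth_affine[OF test_smooth[OF assms]])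
    show "compact ((\<lambda>z. x - z) ` K)" by (intro compact_continuous_image continuous_intros K)
  next
    fix y assume "y \<notin> (\<lambda>z. x - z) ` K"
    then have "x - y \<notin> K" by (metis diff_diff_eq2 add_diff_cancel_left' image_eqI)
    then show "\<theta> ((-1) *\<^sub>R y + x) = 0" using K(2)[of "x - y"] by simp
  qed auto
  then show ?thesis by simp
qed

lemma gradient_reflect:
  assumes "smooth_on UNIV \<theta>"
  shows "gradient (\<lambda>y. \<theta> (x - y)) y = - gradient \<theta> (x - y)"
proof (rule gradient_eqI)
  show "((\<lambda>y. \<theta> (x - y)) has_derivative (\<lambda>h. - gradient \<theta> (x - y) \<bullet> h)) (at y)"
    by (rule has_derivative_eq_rhs[OF has_derivative_compose[OF _ smooth_has_gradient[OF assms]]])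
       (auto intro!: derivative_eq_intros)
qed

lemma bounded_scaleR_integrable:
  fixes f :: "'a \<Rightarrow> real" and g :: "'a \<Rightarrow> 'b::euclidean_space"
  assumes "integrable M f" "g \<in> borel_measurable M" "\<And>x. norm (g x) \<le> C"
  shows "integrable M (\<lambda>x. f x *\<^sub>R g x)"
proof (rule Bochner_Integration.integrable_bound[of M "\<lambda>x. C * f x"])
  show "AE x in M. norm (f x *\<^sub>R g x) \<le> norm (C * f x)"
  proof (rule AE_I2)
    fix x
    have "norm (g x) \<le> \<bar>C\<bar>" using assms(3)[of x] by linarith
    then show "norm (f x *\<^sub>R g x) \<le> norm (C * f x)"
      using mult_left_mono[of "norm (g x)" "\<bar>C\<bar>" "\<bar>f x\<bar>"] by (simp add: abs_mult mult.commute)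
  qed
qed (use assms in auto)

lemma conv_integrable:
  assumes "test_function UNIV \<theta>" "integrable lebesgue f"
  shows "integrable lebesgue (\<lambda>y. \<theta> (x - y) * f y)"
proof -
  obtain C where C: "\<And>x. \<bar>\<theta> x\<bar> \<le> C" using test_bounded[OF assms(1)] by blast
  show ?thesis
    using bounded_scaleR_integrable[OF assms(2), of "\<lambda>y. \<theta> (x - y)" C] C
      test_measurable[OF test_reflect[OF assms(1)], where \<Omega>=UNIV] by (simp add: mult.commute)
qed

lemma conv_gradient_integrable:
  assumes "test_function UNIV \<theta>" "integrable lebesgue f"
  shows "integrable lebesgue (\<lambda>y. f y *\<^sub>R gradient \<theta> (x - y))"
proof -
  obtain C where C: "\<And>x. norm (gradient \<theta> x) \<le> C" using test_gradient_bounded[OF assms(1)] by blast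
  have "continuous_on UNIV (\<lambda>y. gradient \<theta> (x - y))"
    by (rule continuous_on_compose2[OF smooth_gradient_continuous[OF test_smooth[OF assms(1)]]])
       (auto intro!: continuous_intros)
  then show ?thesis
    using C continuous_measurable_lebesgue_on[where \<Omega>=UNIV]
    by (intro bounded_scaleR_integrable[OF assms(2)]) auto
qed

lemma gradient_Lipschitz:
  assumes "test_function UNIV \<theta>"
  obtains C where "C \<ge> 0" "\<And>x h. norm (gradient \<theta> (x + h) - gradient \<theta> x) \<le> C * norm h"
proof -
  let ?D = "\<lambda>b x. frechet_derivative \<theta> (at x) b"
  have "\<exists>C. C \<ge> 0 \<and> (\<forall>x h. \<bar>?D b (x + h) - ?D b x\<bar> \<le> C * norm h)" for b
    using test_Lipschitz[OF test_frechet[OF assms, of b]] by metis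
  then obtain C where C: "\<And>b. C b \<ge> 0" "\<And>b x h. \<bar>?D b (x + h) - ?D b x\<bar> \<le> C b * norm h" by metis
  have "norm (gradient \<theta> (x + h) - gradient \<theta> x) \<le> (\<Sum>b\<in>Basis. C b) * norm h" for x h
  proof -
    have "norm (gradient \<theta> (x + h) - gradient \<theta> x)
        \<le> (\<Sum>b\<in>Basis. \<bar>(gradient \<theta> (x + h) - gradient \<theta> x) \<bullet> b\<bar>)" by (rule norm_le_l1)
    also have "\<dots> \<le> (\<Sum>b\<in>Basis. C b * norm h)"
      by (intro sum_mono) (simp add: inner_diff_left gradient_smooth_inner test_smooth[OF assms] C)
    finally show ?thesis by (simp add: sum_distrib_right)
  qed
  then show ?thesis using that[of "\<Sum>b\<in>Basis. C b"] C(1) by (simp add: sum_nonneg)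
qed

text \<open>Since \<open>gradient \<theta>\<close> is Lipschitz, the first-order Taylor remainder of
  \<open>\<theta>\<close> is at most \<open>C * (norm h)\<^sup>2\<close> uniformly in the base
  point. Integrating it against \<open>f\<close> costs only the L1 norm of \<open>f\<close>, so the
  derivative passes under the integral with an explicit error.\<close>

lemma conv_has_derivative:
  assumes \<theta>: "test_function UNIV \<theta>" and f: "integrable lebesgue f"
  shows "(conv \<theta> f has_derivative (\<lambda>h. (LINT y|lebesgue. f y *\<^sub>R gradient \<theta> (x - y)) \<bullet> h)) (at x)"
proof -
  obtain C where C: "C \<ge> 0" "\<And>x h. norm (gradient \<theta> (x + h) - gradient \<theta> x) \<le> C * norm h"
    using gradient_Lipschitz[OF \<theta>] by blast
  have taylor: "\<bar>\<theta> (z + h) - \<theta> z - gradient \<theta> z \<bullet> h\<bar> \<le> C * (norm h)\<^sup>2" for z h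
  proof -
    obtain t where t: "0 < t" "t < 1" "\<theta> (z + h) - \<theta> z = gradient \<theta> (z + t *\<^sub>R h) \<bullet> h"
      using smooth_MVT[OF test_smooth[OF \<theta>]] by metis
    have "\<bar>\<theta> (z + h) - \<theta> z - gradient \<theta> z \<bullet> h\<bar> = \<bar>(gradient \<theta> (z + t *\<^sub>R h) - gradient \<theta> z) \<bullet> h\<bar>"
      by (simp add: t(3) inner_diff_left)
    also have "\<dots> \<le> norm (gradient \<theta> (z + t *\<^sub>R h) - gradient \<theta> z) * norm h" by (rule Cauchy_Schwarz_ineq2)
    also have "\<dots> \<le> (C * norm (t *\<^sub>R h)) * norm h" by (intro mult_right_mono C) auto
    also have "\<dots> = t * (C * (norm h)\<^sup>2)" using t by (simp add: power2_eq_square)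
    also have "\<dots> \<le> 1 * (C * (norm h)\<^sup>2)" using t C by (intro mult_right_mono) auto
    finally show ?thesis by simp
  qed
  note ic = conv_integrable[OF \<theta> f] and ig = conv_gradient_integrable[OF \<theta> f, of x]
  let ?V = "LINT y|lebesgue. f y *\<^sub>R gradient \<theta> (x - y)" and ?N = "LINT y|lebesgue. \<bar>f y\<bar>"
  have est: "norm (conv \<theta> f z - conv \<theta> f x - ?V \<bullet> (z - x)) \<le> C * (norm (z - x))\<^sup>2 * ?N" for z
  proof -
    have igi: "integrable lebesgue (\<lambda>y. f y * (gradient \<theta> (x - y) \<bullet> (z - x)))"
      using integrable_inner_left[OF ig, of "z - x"] by simp
    have "?V \<bullet> (z - x) = (LINT y|lebesgue. f y * (gradient \<theta> (x - y) \<bullet> (z - x)))"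
      using integral_inner_left[OF ig, of "z - x"] by simp
    then have "conv \<theta> f z - conv \<theta> f x - ?V \<bullet> (z - x)
      = (LINT y|lebesgue. \<theta> (z - y) * f y - \<theta> (x - y) * f y - f y * (gradient \<theta> (x - y) \<bullet> (z - x)))"
      by (simp add: conv_def ic igi)
    also have "norm \<dots> \<le> (LINT y|lebesgue. C * (norm (z - x))\<^sup>2 * \<bar>f y\<bar>)"
    proof (rule lint_norm_bound)
      show "integrable lebesgue (\<lambda>y. \<theta> (z - y) * f y - \<theta> (x - y) * f y - f y * (gradient \<theta> (x - y) \<bullet> (z - x)))"
        by (intro Bochner_Integration.integrable_diff ic igi)
      show "integrable lebesgue (\<lambda>y. C * (norm (z - x))\<^sup>2 * \<bar>f y\<bar>)" using f by simp
      fix y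
      have "\<theta> (z - y) * f y - \<theta> (x - y) * f y - f y * (gradient \<theta> (x - y) \<bullet> (z - x))
        = (\<theta> ((x - y) + (z - x)) - \<theta> (x - y) - gradient \<theta> (x - y) \<bullet> (z - x)) * f y"
        by (simp add: algebra_simps)
      then show "norm (\<theta> (z - y) * f y - \<theta> (x - y) * f y - f y * (gradient \<theta> (x - y) \<bullet> (z - x)))
          \<le> C * (norm (z - x))\<^sup>2 * \<bar>f y\<bar>"
        using taylor[of "x - y" "z - x"] by (simp add: abs_mult mult_right_mono)
    qed
    finally show ?thesis using f by simp
  qed
  show ?thesis
  proof (rule has_derivativeI_sandwich[where e=1 and H="\<lambda>z. C * ?N * norm (z - x)"])
    show "((\<lambda>z. C * ?N * norm (z - x)) \<longlongrightarrow> 0) (at x)" by (auto intro!: tendsto_eq_intros)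
    fix z assume "z \<noteq> x"
    then have "norm (z - x) > 0" by simp
    then show "norm (conv \<theta> f z - conv \<theta> f x - ?V \<bullet> (z - x)) / norm (z - x) \<le> C * ?N * norm (z - x)"
      using est[of z] by (simp add: divide_le_eq power2_eq_square mult_ac)
  qed (auto intro: bounded_linear_inner_right)
qed

lemma gradient_conv:
  assumes "test_function UNIV \<theta>" "integrable lebesgue f"
  shows "gradient (conv \<theta> f) x = (LINT y|lebesgue. f y *\<^sub>R gradient \<theta> (x - y))"
  by (rule gradient_eqI[OF conv_has_derivative[OF assms]])

text \<open>A directional derivative of the convolution is the convolution with a derivative of
  \<open>\<theta>\<close>, which is again a test function; hence the induction generalises over
  \<open>\<theta>\<close>.\<close>

lemma smooth_conv:
  assumes "test_function UNIV \<theta>" "integrable lebesgue f"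
  shows "smooth_on UNIV (conv \<theta> f)"
proof -
  have D: "(LINT y|lebesgue. f y *\<^sub>R gradient \<theta> (x - y)) \<bullet> h = conv (\<lambda>z. frechet_derivative \<theta> (at z) h) f x"
    if "test_function UNIV \<theta>" for \<theta> x h
    using integral_inner_left[OF conv_gradient_integrable[OF that assms(2)], of x h]
    by (simp add: conv_def gradient_smooth_inner test_smooth[OF that] mult.commute)
  have "Ck_on k UNIV (conv \<theta> f)" if "test_function UNIV \<theta>" for k \<theta>
    using that
  proof (induction k arbitrary: \<theta>)
    case 0
    then show ?case using conv_has_derivative[OF _ assms(2)] has_derivative_continuous
      by (auto intro!: continuous_at_imp_continuous_on) blast
  next
    case (Suc k)
    show ?case
      by (rule Ck_on_UNIV_SucI[OF conv_has_derivative[OF Suc.prems assms(2)]])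
         (simp add: D Suc test_frechet)
  qed
  then show ?thesis using assms(1) by (simp add: smooth_on_def)
qed

text \<open>The argument is a polynomial in \<open>x\<close>, so that no smoothness is lost at the
  origin, as it would be with \<open>norm x\<close>. The function vanishes outside the ball of
  radius \<open>1 / real (Suc k)\<close>; the successor keeps this radius defined for
  \<open>k = 0\<close>.\<close>

definition mollifier_raw :: "nat \<Rightarrow> 'a::euclidean_space \<Rightarrow> real" where
  "mollifier_raw k x = exp_bump 0 (1 - (real (Suc k))\<^sup>2 * (x \<bullet> x))"

definition mollifier :: "nat \<Rightarrow> 'a::euclidean_space \<Rightarrow> real" where
  "mollifier k x = mollifier_raw k x / (LINT y|lebesgue. mollifier_raw k (y::'a))"

lemma smooth_inner_self: "smooth_on UNIV (\<lambda>x::'a::euclidean_space. x \<bullet> x)"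
  by (subst euclidean_inner) (intro smooth_intros)

lemma mollifier_raw_outside:
  assumes "norm x > 1 / real (Suc k)"
  shows "mollifier_raw k x = 0"
proof -
  have "real (Suc k) * norm x > 1" using assms by (simp add: field_simps)
  then have "(real (Suc k) * norm x)\<^sup>2 > 1" by simp
  then show ?thesis by (simp add: mollifier_raw_def exp_bump_0 power_mult_distrib power2_norm_eq_inner)
qed

lemma mollifier_raw_nonneg: "mollifier_raw k x \<ge> 0"
  by (simp add: mollifier_raw_def exp_bump_0)

lemma test_mollifier_raw: "test_function UNIV (mollifier_raw k)"
proof (rule test_functionI)
  show "smooth_on UNIV (mollifier_raw k :: 'a \<Rightarrow> real)"
    unfolding mollifier_raw_def
    by (intro smooth_compose[OF smooth_exp_bump] smooth_diff smooth_const smooth_mult smooth_inner_self)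
  show "mollifier_raw k x = 0" if "x \<notin> cball 0 (1 / real (Suc k))" for x :: 'a
    using that by (intro mollifier_raw_outside) auto
qed auto

lemma mollifier_raw_integral_pos: "(LINT y|lebesgue. mollifier_raw k (y::'a::euclidean_space)) > 0"
proof -
  \<comment> \<open>On half the support radius the argument of the bump is at least 1/2, so the bump
    is at least \<open>exp (- 2)\<close> there.\<close>
  let ?r = "1 / (2 * real (Suc k))"
  have "0 < exp (- 2) * measure lebesgue (ball (0::'a) ?r)"
    by (intro mult_pos_pos content_ball_pos) auto
  also have "\<dots> = (LINT y|lebesgue. exp (- 2) * indicator (ball (0::'a) ?r) y)" by simp
  also have "\<dots> \<le> (LINT y|lebesgue. mollifier_raw k (y::'a))"
  proof (rule integral_mono)
    show "integrable lebesgue (\<lambda>y. exp (- 2) * indicator (ball (0::'a) ?r) y :: real)"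
      by (intro integrable_mult_right integrable_real_indicator) (use lmeasurable_ball[of "0::'a" ?r] in \<open>auto simp: fmeasurable_def\<close>)
    show "integrable lebesgue (mollifier_raw k :: 'a \<Rightarrow> real)"
      by (rule test_integrable_lebesgue[OF test_mollifier_raw])
    fix y :: 'a
    show "exp (- 2) * indicator (ball (0::'a) ?r) y \<le> mollifier_raw k y"
    proof (cases "y \<in> ball 0 ?r")
      case True
      then have "real (Suc k) * norm y \<le> 1 / 2" by (simp add: field_simps)
      then have "(real (Suc k) * norm y)\<^sup>2 \<le> (1/2)\<^sup>2" by (intro power_mono) auto
      then have le: "(real (Suc k))\<^sup>2 * (y \<bullet> y) \<le> 1 / 2"
        by (simp add: power_mult_distrib power2_norm_eq_inner[symmetric] power2_eq_square[of "1/2::real"])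
      then have "inverse (1 - (real (Suc k))\<^sup>2 * (y \<bullet> y)) \<le> inverse (1 / 2)"
        by (intro le_imp_inverse_le) auto
      then show ?thesis using True le by (simp add: mollifier_raw_def exp_bump_0)
    qed (simp add: mollifier_raw_nonneg)
  qed
  finally show ?thesis .
qed

lemma mollifier_outside: "norm x > 1 / real (Suc k) \<Longrightarrow> mollifier k x = 0"
  by (simp add: mollifier_def mollifier_raw_outside)

lemma mollifier_nonneg: "mollifier k x \<ge> 0"
  using mollifier_raw_integral_pos[where 'a='a, of k] by (simp add: mollifier_def mollifier_raw_nonneg)

lemma mollifier_even: "mollifier k (x - y) = mollifier k (y - x)"
  by (simp add: mollifier_def mollifier_raw_def inner_diff_left inner_diff_right inner_commute add.commute)

lemma test_mollifier: "test_function UNIV (mollifier k)"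
  using test_cmult[OF test_mollifier_raw[where 'a='a, of k], of "1 / (LINT y|lebesgue. mollifier_raw k (y::'a))"]
  by (simp add: mollifier_def[abs_def])

lemma mollifier_integral: "(LINT y|lebesgue. mollifier k (y - x)) = 1"
  using lebesgue_integral_translate[OF test_continuous[OF test_mollifier], of k "- x"]
    mollifier_raw_integral_pos[where 'a='a, of k]
  by (simp add: mollifier_def)

lemma mollifier_integral': "(LINT y|lebesgue. mollifier k (x - y)) = 1"
  by (subst mollifier_even) (rule mollifier_integral)

lemma conv_eq_0:
  assumes "\<And>y. norm (x - y) \<le> 1 / real (Suc k) \<Longrightarrow> f y = 0"
  shows "conv (mollifier k) f x = 0"
proof -
  have "mollifier k (x - y) * f y = 0" for y
    using assms[of y] mollifier_outside[of k "x - y"] by (cases "norm (x - y) \<le> 1 / real (Suc k)") auto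
  then have "(\<lambda>y. mollifier k (x - y) * f y) = (\<lambda>y. 0)" by (intro ext)
  then show ?thesis by (simp only: conv_def) simp
qed

lemma test_conv:
  assumes f: "integrable lebesgue f" and K: "compact K" "\<And>x. x \<notin> K \<Longrightarrow> f x = 0"
    and sub: "(\<Union>x\<in>K. cball x (1 / real (Suc k))) \<subseteq> \<Omega>"
  shows "test_function \<Omega> (conv (mollifier k) f)"
proof (rule test_functionI)
  show "smooth_on UNIV (conv (mollifier k) f)" by (rule smooth_conv[OF test_mollifier f])
  let ?L = "{x + y |x y. x \<in> K \<and> y \<in> cball 0 (1 / real (Suc k))}"
  show "compact ?L" by (intro compact_sums K) auto
  show "?L \<subseteq> \<Omega>" using sub by (fastforce simp: dist_norm)
  fix x assume x: "x \<notin> ?L"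
  show "conv (mollifier k) f x = 0"
  proof (rule conv_eq_0)
    fix y assume "norm (x - y) \<le> 1 / real (Suc k)"
    then have "y \<notin> K" using x by (force intro: exI[of _ y] exI[of _ "x - y"])
    then show "f y = 0" by (rule K(2))
  qed
qed

lemma eventually_subset_mollifier:
  assumes "compact K" "open \<Omega>" "K \<subseteq> \<Omega>"
  shows "\<exists>k0. \<forall>k\<ge>k0. (\<Union>x\<in>K. cball x (1 / real (Suc k))) \<subseteq> \<Omega>"
proof -
  obtain e where e: "e > 0" "(\<Union>x\<in>K. cball x e) \<subseteq> \<Omega>"
    using compact_subset_open_imp_cball_epsilon_subset[OF assms] by blast
  obtain k0 where k0: "1 / real (Suc k0) < e" using nat_approx_posE[OF e(1)] by auto
  have "(\<Union>x\<in>K. cball x (1 / real (Suc k))) \<subseteq> \<Omega>" if "k \<ge> k0" for k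
  proof -
    have "1 / real (Suc k) \<le> 1 / real (Suc k0)" using that by (intro divide_left_mono) auto
    then have "cball x (1 / real (Suc k)) \<subseteq> cball x e" for x using k0 by (intro subset_cball) auto
    then show ?thesis using e(2) by blast
  qed
  then show ?thesis by blast
qed

text \<open>Mollifies the indicator of a thickening \<open>L\<close> of \<open>K\<close>. The
  mollifier radius is spent twice, once to thicken \<open>K\<close> and once by the convolution,
  hence it is taken below \<open>e / 2\<close>.\<close>

lemma smooth_cutoff:
  assumes K: "compact K" "open \<Omega>" "K \<subseteq> \<Omega>"
  obtains \<eta> where "test_function \<Omega> \<eta>" "\<And>x. 0 \<le> \<eta> x" "\<And>x. \<eta> x \<le> 1" "\<And>x. x \<in> K \<Longrightarrow> \<eta> x = 1"
proof -
  obtain e where e: "e > 0" "(\<Union>x\<in>K. cball x e) \<subseteq> \<Omega>"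
    using compact_subset_open_imp_cball_epsilon_subset[OF K] by blast
  obtain k where k: "1 / real (Suc k) < e / 2" using nat_approx_posE[of "e/2"] e(1) by auto
  define L where "L = {x + y |x y. x \<in> K \<and> y \<in> cball 0 (1 / real (Suc k))}"
  have L: "compact L" unfolding L_def by (intro compact_sums K) auto
  let ?f = "indicator L :: 'a \<Rightarrow> real"
  have f: "integrable lebesgue ?f" using integrable_indicator_compact[OF L, of UNIV] by simp
  note i = conv_integrable[OF test_mollifier f] and
    i' = test_integrable_lebesgue[OF test_reflect[OF test_mollifier]]
  have sub: "(\<Union>x\<in>L. cball x (1 / real (Suc k))) \<subseteq> \<Omega>"
  proof
    fix z assume "z \<in> (\<Union>x\<in>L. cball x (1 / real (Suc k)))"
    then obtain x y where xy: "x \<in> K" "norm y \<le> 1 / real (Suc k)" "dist (x + y) z \<le> 1 / real (Suc k)"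
      unfolding L_def by auto
    have "dist x z \<le> dist x (x + y) + dist (x + y) z" by (rule dist_triangle)
    also have "\<dots> \<le> e" using xy k by (simp add: dist_norm)
    finally have "z \<in> (\<Union>x\<in>K. cball x e)" using xy(1) by auto
    then show "z \<in> \<Omega>" using e(2) by blast
  qed
  show ?thesis
  proof
    show "test_function \<Omega> (conv (mollifier k) ?f)"
      by (rule test_conv[OF f L _ sub]) auto
    fix x
    show "0 \<le> conv (mollifier k) ?f x" unfolding conv_def
      by (intro integral_nonneg_AE) (auto simp: mollifier_nonneg)
    have "conv (mollifier k) ?f x \<le> (LINT y|lebesgue. mollifier k (x - y))" unfolding conv_def
      by (intro integral_mono i i') (auto simp: mollifier_nonneg indicator_def)
    then show "conv (mollifier k) ?f x \<le> 1" by (simp add: mollifier_integral')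
  next
    fix x assume x: "x \<in> K"
    have "mollifier k (x - y) * ?f y = mollifier k (x - y)" for y
    proof (cases "norm (x - y) \<le> 1 / real (Suc k)")
      case True
      then have "y \<in> L" using x unfolding L_def
        by (intro CollectI exI[of _ x] exI[of _ "y - x"]) (auto simp: norm_minus_commute)
      then show ?thesis by simp
    qed (simp add: mollifier_outside)
    then have "(\<lambda>y. mollifier k (x - y) * ?f y) = (\<lambda>y. mollifier k (x - y))" by (intro ext)
    then show "conv (mollifier k) ?f x = 1" by (simp only: conv_def mollifier_integral')
  qed
qed

text \<open>The mollifier is a probability density, and the variance of \<open>f\<close> under it,
  taken around the mean \<open>?m\<close>, is nonnegative.\<close>

lemma conv_Jensen:
  assumes f: "integrable lebesgue f" "integrable lebesgue (\<lambda>x. (f x)\<^sup>2)"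
  shows "(conv (mollifier k) f x)\<^sup>2 \<le> conv (mollifier k) (\<lambda>x. (f x)\<^sup>2) x"
proof -
  let ?r = "\<lambda>y. mollifier k (x - y)" and ?m = "conv (mollifier k) f x"
  note i1 = conv_integrable[OF test_mollifier f(1), of k x]
  note i2 = conv_integrable[OF test_mollifier f(2), of k x]
  have i3: "integrable lebesgue ?r" by (rule test_integrable_lebesgue[OF test_reflect[OF test_mollifier]])
  have "0 \<le> (LINT y|lebesgue. ?r y * (f y - ?m)\<^sup>2)"
    by (intro integral_nonneg_AE) (auto simp: mollifier_nonneg)
  also have "(\<lambda>y. ?r y * (f y - ?m)\<^sup>2) = (\<lambda>y. ?r y * (f y)\<^sup>2 - 2 * ?m * (?r y * f y) + ?m\<^sup>2 * ?r y)"
    by (simp add: power2_diff algebra_simps fun_eq_iff power2_eq_square)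
  also have "(LINT y|lebesgue. ?r y * (f y)\<^sup>2 - 2 * ?m * (?r y * f y) + ?m\<^sup>2 * ?r y)
      = conv (mollifier k) (\<lambda>x. (f x)\<^sup>2) x - 2 * ?m * ?m + ?m\<^sup>2"
    using i1 i2 i3 by (simp add: conv_def mollifier_integral')
  finally show ?thesis by (simp add: power2_eq_square)
qed

text \<open>Tonelli's theorem, with the inner integral of the kernel equal to 1. It is applied over
  \<open>lborel\<close>, so the Lebesgue measurable \<open>g\<close> is first replaced by an a.e.
  equal Borel function. Together with \<open>conv_Jensen\<close> it makes mollification a
  contraction of L2.\<close>

lemma conv_nn_integral:
  fixes g :: "'a::euclidean_space \<Rightarrow> real"
  assumes g: "integrable lebesgue g" "\<And>x. g x \<ge> 0"
  shows "(\<integral>\<^sup>+x. ennreal (conv (mollifier k) g x) \<partial>lebesgue) = ennreal (LINT x|lebesgue. g x)"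
proof -
  let ?\<rho> = "mollifier k :: 'a \<Rightarrow> real"
  obtain g' where g'[measurable]: "g' \<in> borel_measurable lborel" and ae: "AE x in lborel. g x = g' x"
    using completion_ex_borel_measurable_real[of g lborel] g(1) by (auto simp: borel_measurable_integrable)
  have [measurable]: "?\<rho> \<in> borel_measurable borel"
    by (intro borel_measurable_continuous_onI test_continuous[OF test_mollifier])
  have c: "ennreal (conv ?\<rho> g x) = (\<integral>\<^sup>+y. ennreal (?\<rho> (x - y)) * ennreal (g' y) \<partial>lborel)" for x
  proof -
    have "ennreal (conv ?\<rho> g x) = (\<integral>\<^sup>+y. ennreal (?\<rho> (x - y) * g y) \<partial>lebesgue)"
      unfolding conv_def
      by (intro nn_integral_eq_integral[symmetric] conv_integrable test_mollifier g)
         (auto simp: mollifier_nonneg g)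
    also have "\<dots> = (\<integral>\<^sup>+y. ennreal (?\<rho> (x - y) * g y) \<partial>lborel)" by (rule nn_integral_completion)
    also have "\<dots> = (\<integral>\<^sup>+y. ennreal (?\<rho> (x - y)) * ennreal (g' y) \<partial>lborel)"
      by (rule nn_integral_cong_AE, use ae in eventually_elim) (simp add: ennreal_mult' mollifier_nonneg)
    finally show ?thesis .
  qed
  have one: "(\<integral>\<^sup>+x. ennreal (?\<rho> (x - y)) \<partial>lborel) = 1" for y
  proof -
    have "test_function UNIV (\<lambda>x. ?\<rho> (x - y))"
      using test_reflect[OF test_mollifier[of k], of y] by (simp add: mollifier_even[of k y])
    then have "(\<integral>\<^sup>+x. ennreal (?\<rho> (x - y)) \<partial>lebesgue) = ennreal (LINT x|lebesgue. ?\<rho> (x - y))"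
      by (intro nn_integral_eq_integral test_integrable_lebesgue) (auto simp: mollifier_nonneg)
    then show ?thesis by (simp add: nn_integral_completion mollifier_integral)
  qed
  have "(\<integral>\<^sup>+x. ennreal (conv ?\<rho> g x) \<partial>lebesgue)
      = (\<integral>\<^sup>+x. \<integral>\<^sup>+y. ennreal (?\<rho> (x - y)) * ennreal (g' y) \<partial>lborel \<partial>lborel)"
    by (simp add: nn_integral_completion c)
  also have "\<dots> = (\<integral>\<^sup>+y. \<integral>\<^sup>+x. ennreal (?\<rho> (x - y)) * ennreal (g' y) \<partial>lborel \<partial>lborel)"
    by (rule lborel_pair.Fubini'[symmetric]) measurable
  also have "\<dots> = (\<integral>\<^sup>+y. ennreal (g' y) \<partial>lborel)"
    by (simp add: nn_integral_multc one)
  also have "\<dots> = (\<integral>\<^sup>+y. ennreal (g y) \<partial>lborel)"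
    by (rule nn_integral_cong_AE, use ae in eventually_elim) simp
  also have "\<dots> = (\<integral>\<^sup>+y. ennreal (g y) \<partial>lebesgue)" by (simp add: nn_integral_completion)
  also have "\<dots> = ennreal (LINT x|lebesgue. g x)" using g by (intro nn_integral_eq_integral) auto
  finally show ?thesis .
qed

lemma conv_L2:
  fixes f :: "'a::euclidean_space \<Rightarrow> real"
  assumes f: "integrable lebesgue f" "f \<in> L2 UNIV"
  shows "conv (mollifier k) f \<in> L2 UNIV" "sqint UNIV (conv (mollifier k) f) \<le> sqint UNIV f"
proof -
  have f2: "integrable lebesgue (\<lambda>x. (f x)\<^sup>2)" using L2_int[OF f(2)] by simp
  have meas: "conv (mollifier k) f \<in> borel_measurable lebesgue"
    using continuous_measurable_lebesgue_on[OF smooth_continuous[OF smooth_conv[OF test_mollifier f(1)]], where \<Omega>=UNIV]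
    by simp
  have le: "(\<integral>\<^sup>+x. ennreal ((norm (conv (mollifier k) f x))\<^sup>2) \<partial>lebesgue) \<le> ennreal (sqint UNIV f)"
  proof -
    have "(\<integral>\<^sup>+x. ennreal ((norm (conv (mollifier k) f x))\<^sup>2) \<partial>lebesgue)
        \<le> (\<integral>\<^sup>+x. ennreal (conv (mollifier k) (\<lambda>x. (f x)\<^sup>2) x) \<partial>lebesgue)"
      by (intro nn_integral_mono ennreal_leI) (simp add: conv_Jensen f(1) f2)
    then show ?thesis by (simp add: conv_nn_integral f2 sqint_def)
  qed
  show L: "conv (mollifier k) f \<in> L2 UNIV"
    unfolding L2_def using meas le by (auto intro!: integrableI_bounded simp: le_less_trans)
  show "sqint UNIV (conv (mollifier k) f) \<le> sqint UNIV f"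
    using le L2_nn_integral[OF L] by (simp add: sqint_nonneg)
qed

lemma conv_diff:
  assumes "integrable lebesgue f" "integrable lebesgue g"
  shows "conv (mollifier k) (\<lambda>x. f x - g x) x = conv (mollifier k) f x - conv (mollifier k) g x"
  using conv_integrable[OF test_mollifier assms(1), of k x] conv_integrable[OF test_mollifier assms(2), of k x]
  by (simp add: conv_def right_diff_distrib)

lemma L2_compact_support_integrable:
  assumes "f \<in> L2 UNIV" "compact K" "\<And>x. x \<notin> K \<Longrightarrow> f x = (0::real)"
  shows "integrable lebesgue f"
proof -
  have K: "K \<in> sets lebesgue" using assms(2) by (simp add: lmeasurable_compact fmeasurableD)
  have m: "indicator K \<in> borel_measurable lebesgue" using K by simp
  have "(indicator K :: 'a \<Rightarrow> real) \<in> L2 UNIV"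
    by (rule bounded_support_L2[where C=1, OF _ assms(2)]) (use m in \<open>auto simp: indicator_def\<close>)
  from L2_mult_integrable[OF assms(1) this] have "integrable lebesgue (\<lambda>x. f x * indicator K x)" by simp
  also have "(\<lambda>x. f x * indicator K x) = f" using assms(3) by (auto simp: fun_eq_iff indicator_def)
  finally show ?thesis .
qed

text \<open>A continuous function of compact support is uniformly continuous, so its mollifications
  converge uniformly. They all live on one compact set, whose finite measure converts uniform
  closeness into L2 closeness.\<close>

lemma L2_lim_conv_continuous:
  fixes g :: "'a::euclidean_space \<Rightarrow> real"
  assumes g: "continuous_on UNIV g" and K: "compact K" "\<And>x. x \<notin> K \<Longrightarrow> g x = 0"
  shows "L2_lim UNIV (\<lambda>k. conv (mollifier k) g) g"
proof -
  have ig: "integrable lebesgue g" using compact_support_integrable[OF g K, of UNIV] by simp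
  \<comment> \<open>Every mollifier radius is at most 1, so this set contains the supports of
    \<open>g\<close> and of all its mollifications.\<close>
  define L where "L = {x + y |x y. x \<in> K \<and> y \<in> cball 0 (1::real)}"
  have L: "compact L" unfolding L_def by (intro compact_sums K) auto
  have "uniformly_continuous_on UNIV g"
  proof -
    define M where "M = {x + y |x y. x \<in> L \<and> y \<in> cball 0 (1::real)}"
    have M: "compact M" unfolding M_def by (intro compact_sums L) auto
    have ucM: "uniformly_continuous_on M g"
      by (rule compact_uniformly_continuous[OF continuous_on_subset[OF g] M]) auto
    have sub: "A \<subseteq> {x + y |x y. x \<in> A \<and> y \<in> cball 0 (1::real)}" for A :: "'a set"
      by clarify (metis add.right_neutral centre_in_cball zero_le_one)
    have KL: "K \<subseteq> L" and LM: "L \<subseteq> M" using sub unfolding L_def M_def by blast+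
    show ?thesis
      unfolding uniformly_continuous_on_def
    proof (intro allI impI)
      fix e :: real assume "e > 0"
      then obtain d where d: "d > 0" "\<And>x x'. x \<in> M \<Longrightarrow> x' \<in> M \<Longrightarrow> dist x' x < d \<Longrightarrow> dist (g x') (g x) < e"
        using ucM unfolding uniformly_continuous_on_def by metis
      have "dist (g x') (g x) < e" if "dist x' x < min d 1" for x x'
      proof (cases "x \<in> K \<or> x' \<in> K")
        case True
        have "x \<in> L \<and> x' \<in> L"
        proof -
          have "z \<in> L" if "y \<in> K" "dist z y < 1" for y z
            using that unfolding L_def by (intro mem_thickeningI) auto
          then show ?thesis using True that KL by (auto simp: dist_commute)
        qed
        then show ?thesis using d(2)[of x x'] LM that by auto
      next
        case False
        then show ?thesis using K(2) \<open>e > 0\<close> by simp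
      qed
      then show "\<exists>d>0. \<forall>x\<in>UNIV. \<forall>x'\<in>UNIV. dist x' x < d \<longrightarrow> dist (g x') (g x) < e"
        using d(1) by (intro exI[of _ "min d 1"]) auto
    qed
  qed
  note uc = this[unfolded uniformly_continuous_on_def, simplified]
  have contc: "continuous_on UNIV (conv (mollifier k) g)" for k
    by (rule smooth_continuous[OF smooth_conv[OF test_mollifier ig]])
  have out: "conv (mollifier k) g x = 0" if "x \<notin> L" for k x
  proof (rule conv_eq_0)
    fix y assume "norm (x - y) \<le> 1 / real (Suc k)"
    moreover have "1 / real (Suc k) \<le> 1" by simp
    ultimately have "norm (x - y) \<le> 1" by linarith
    then have "y \<notin> K" using that unfolding L_def by (force intro: exI[of _ y] exI[of _ "x - y"])
    then show "g y = 0" by (rule K(2))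
  qed
  have gout: "g x = 0" if "x \<notin> L" for x
  proof (rule K(2))
    show "x \<notin> K" using that unfolding L_def by (force intro: exI[of _ x] exI[of _ "0::'a"])
  qed
  have est: "\<bar>conv (mollifier k) g x - g x\<bar> \<le> e"
    if d: "\<And>x x'. dist x' x < d \<Longrightarrow> dist (g x') (g x) < e" and k: "1 / real (Suc k) < d" for e d k x
  proof -
    have i: "integrable lebesgue (\<lambda>y. mollifier k (x - y))"
      by (rule test_integrable_lebesgue[OF test_reflect[OF test_mollifier]])
    have ic: "integrable lebesgue (\<lambda>y. mollifier k (x - y) * g y)" by (rule conv_integrable[OF test_mollifier ig])
    have "conv (mollifier k) g x - g x = (LINT y|lebesgue. mollifier k (x - y) * g y - g x * mollifier k (x - y))"
      using i ic by (simp add: conv_def mollifier_integral')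
    also have "norm \<dots> \<le> (LINT y|lebesgue. e * mollifier k (x - y))"
    proof (rule lint_norm_bound)
      fix y
      show "norm (mollifier k (x - y) * g y - g x * mollifier k (x - y)) \<le> e * mollifier k (x - y)"
      proof (cases "norm (x - y) \<le> 1 / real (Suc k)")
        case True
        then have "dist (g y) (g x) < e" using d[of y x] k by (simp add: dist_norm norm_minus_commute)
        then have "\<bar>g y - g x\<bar> * mollifier k (x - y) \<le> e * mollifier k (x - y)"
          by (intro mult_right_mono mollifier_nonneg) (simp add: dist_norm)
        moreover have "mollifier k (x - y) * g y - g x * mollifier k (x - y) = (g y - g x) * mollifier k (x - y)"
          by (simp add: algebra_simps)
        ultimately show ?thesis by (simp add: abs_mult mollifier_nonneg)
      qed (simp add: mollifier_outside)
    qed (use i ic in auto)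
    also have "\<dots> = e" using i by (simp add: mollifier_integral')
    finally show ?thesis by simp
  qed
  have iL: "integrable lebesgue (indicator L :: 'a \<Rightarrow> real)"
    using integrable_indicator_compact[OF L, of UNIV] by simp
  have le: "sqint UNIV (\<lambda>x. conv (mollifier k) g x - g x) \<le> e\<^sup>2 * measure lebesgue L"
    if "\<And>x. \<bar>conv (mollifier k) g x - g x\<bar> \<le> e" for e k
  proof -
    have "sqint UNIV (\<lambda>x. conv (mollifier k) g x - g x) \<le> (LINT x|lebesgue. e\<^sup>2 * indicator L x)"
      unfolding sqint_def
    proof (simp only: lebesgue_on_UNIV_eq, rule integral_mono)
      have "(\<lambda>x. conv (mollifier k) g x - g x) \<in> L2 UNIV"
        by (rule compact_support_L2[OF _ L]) (auto intro!: continuous_on_diff contc g simp: out gout)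
      from L2_int[OF this] show "integrable lebesgue (\<lambda>x. (norm (conv (mollifier k) g x - g x))\<^sup>2)" by simp
      fix x
      show "(norm (conv (mollifier k) g x - g x))\<^sup>2 \<le> e\<^sup>2 * indicator L x"
        using power_mono[OF that[of x], of 2] by (cases "x \<in> L") (auto simp: out gout)
    qed (use iL in auto)
    then show ?thesis by simp
  qed
  show ?thesis
    unfolding L2_lim_def
  proof (rule LIMSEQ_I)
    fix r :: real assume r: "r > 0"
    \<comment> \<open>The added 1 avoids division by a vanishing measure; the factor 2 in
      \<open>e\<close> makes the final estimate strict.\<close>
    define m where "m = measure lebesgue L + 1"
    have m: "m > 0" by (simp add: m_def add_nonneg_pos)
    define e where "e = sqrt (r / (2 * m))"
    have e: "e > 0" "e\<^sup>2 = r / (2 * m)" using r m by (auto simp: e_def)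
    obtain d where d: "d > 0" "\<And>x x'. dist x' x < d \<Longrightarrow> dist (g x') (g x) < e" using uc e(1) by metis
    obtain k0 where k0: "1 / real (Suc k0) < d" using nat_approx_posE[OF d(1)] by auto
    show "\<exists>no. \<forall>k\<ge>no. norm (sqint UNIV (\<lambda>x. conv (mollifier k) g x - g x) - 0) < r"
    proof (intro exI allI impI)
      fix k assume "k \<ge> k0"
      then have "1 / real (Suc k) \<le> 1 / real (Suc k0)" by (intro divide_left_mono) auto
      then have "sqint UNIV (\<lambda>x. conv (mollifier k) g x - g x) \<le> e\<^sup>2 * measure lebesgue L"
        using k0 by (intro le est[OF d(2)]) auto
      also have "\<dots> \<le> e\<^sup>2 * m" by (intro mult_left_mono) (auto simp: m_def)
      also have "\<dots> < r" using e(2) m r by simp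
      finally show "norm (sqint UNIV (\<lambda>x. conv (mollifier k) g x - g x) - 0) < r" by (simp add: sqint_nonneg)
    qed
  qed
qed

section \<open>Density of continuous functions and L2 convergence of mollifications\<close>

lemma L2_approx_bounded:
  fixes f :: "'a::euclidean_space \<Rightarrow> real"
  assumes f: "f \<in> L2 \<Omega>"
  shows "L2_lim \<Omega> (\<lambda>n x. max (- real n) (min (real n) (f x))) f"
proof (rule L2_lim_dominated)
  have [measurable]: "f \<in> borel_measurable (lebesgue_on \<Omega>)" by (rule L2_meas[OF f])
  show "(\<lambda>x. max (- real n) (min (real n) (f x))) \<in> borel_measurable (lebesgue_on \<Omega>)" for n by measurable
  show "f \<in> borel_measurable (lebesgue_on \<Omega>)" by measurable
  show "integrable (lebesgue_on \<Omega>) (\<lambda>x. (norm (f x))\<^sup>2)" by (rule L2_int[OF f])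
  show "AE x in lebesgue_on \<Omega>. (norm (max (- real n) (min (real n) (f x)) - f x))\<^sup>2 \<le> (norm (f x))\<^sup>2" for n
    by (intro AE_I2 power_mono) auto
  show "AE x in lebesgue_on \<Omega>. (\<lambda>n. max (- real n) (min (real n) (f x))) \<longlonglongrightarrow> f x"
  proof (rule AE_I2)
    fix x
    obtain n0 where n0: "\<bar>f x\<bar> \<le> real n0" using real_arch_simple by blast
    show "(\<lambda>n. max (- real n) (min (real n) (f x))) \<longlonglongrightarrow> f x"
    proof (rule tendsto_eventually, unfold eventually_sequentially, intro exI allI impI)
      fix n assume "n0 \<le> n"
      then have "\<bar>f x\<bar> \<le> real n" using n0 by linarith
      then show "max (- real n) (min (real n) (f x)) = f x" by linarith
    qed
  qed
qed

text \<open>A measurable function is an a.e. limit of continuous functions \<open>G m\<close>.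
  Clipping them at level \<open>n\<close> and cutting them off near \<open>K\<close> supplies a
  common dominating function, so that this limit becomes a limit in L2.\<close>

lemma L2_dense_continuous:
  fixes f :: "'a::euclidean_space \<Rightarrow> real"
  assumes f: "f \<in> L2 UNIV" and K: "compact K" "\<And>x. x \<notin> K \<Longrightarrow> f x = 0" and e: "e > 0"
  obtains g L where "continuous_on UNIV g" "compact L" "\<And>x. x \<notin> L \<Longrightarrow> g x = 0"
    "sqint UNIV (\<lambda>x. f x - g x) < e"
proof -
  let ?clip = "\<lambda>n t. max (- real n) (min (real n) t)"
  \<comment> \<open>The triangle inequality for \<open>sqint\<close> carries a factor 2, hence
    \<open>e / 4\<close> for each of the two errors.\<close>
  obtain n where n: "sqint UNIV (\<lambda>x. ?clip n (f x) - f x) < e / 4"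
    using L2_lim_eventually[OF L2_approx_bounded[OF f], of "e / 4"] e by (metis order_refl zero_less_divide_iff zero_less_numeral)
  have fm: "f \<in> borel_measurable lebesgue" using L2_meas[OF f] by simp
  have "f measurable_on UNIV" by (rule lebesgue_measurable_imp_measurable_on) (use fm in auto)
  then obtain N G where N: "negligible N" and G: "\<And>n. continuous_on UNIV (G n)"
    "\<And>x. x \<notin> N \<Longrightarrow> (\<lambda>n. G n x) \<longlonglongrightarrow> f x"
    unfolding measurable_on_def by auto
  \<comment> \<open>The point 0 is added to make the set nonempty, so that \<open>infdist\<close> is
    attained.\<close>
  define K' where "K' = insert 0 K"
  have K': "compact K'" "K' \<noteq> {}" "K \<subseteq> K'" using K by (auto simp: K'_def)
  define L where "L = {x + y |x y. x \<in> K' \<and> y \<in> cball 0 (1::real)}"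
  have L: "compact L" unfolding L_def by (intro compact_sums K') auto
  define c where "c x = max 0 (1 - infdist x K')" for x
  have c: "continuous_on UNIV c" "\<And>x. 0 \<le> c x" "\<And>x. c x \<le> 1" "\<And>x. x \<in> K' \<Longrightarrow> c x = 1"
    by (auto simp: c_def infdist_nonneg intro!: continuous_intros)
  have cout: "c x = 0" if "x \<notin> L" for x
  proof (rule ccontr)
    assume "c x \<noteq> 0"
    then have "infdist x K' < 1" by (auto simp: c_def max_def split: if_splits)
    moreover obtain y where "y \<in> K'" "infdist x K' = dist x y"
      using infdist_attains_inf[OF compact_imp_closed[OF K'(1)] K'(2)] by metis
    ultimately have "x \<in> L" unfolding L_def by (intro mem_thickeningI) auto
    then show False using that by blast
  qed
  define h where "h m x = ?clip n (G m x) * c x" for m x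
  have hc: "continuous_on UNIV (h m)" for m
    unfolding h_def by (intro continuous_intros G c)
  have hL: "h m x = 0" if "x \<notin> L" for m x using cout[OF that] by (simp add: h_def)
  have hb: "\<bar>h m x\<bar> \<le> real n" for m x
  proof -
    have "\<bar>h m x\<bar> = \<bar>?clip n (G m x)\<bar> * c x" using c(2) by (simp add: h_def abs_mult)
    also have "\<dots> \<le> real n * 1" using c by (intro mult_mono) auto
    finally show ?thesis by simp
  qed
  have "L2_lim UNIV h (\<lambda>x. ?clip n (f x))"
  proof (rule L2_lim_dominated)
    show "h k \<in> borel_measurable (lebesgue_on UNIV)" for k by (rule continuous_measurable_lebesgue_on[OF hc])
    show "(\<lambda>x. ?clip n (f x)) \<in> borel_measurable (lebesgue_on UNIV)" using fm by simp
    show "integrable (lebesgue_on UNIV) (\<lambda>x. (2 * real n)\<^sup>2 * indicator L x)"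
      using integrable_indicator_compact[OF L, of UNIV] by simp
    show "AE x in lebesgue_on UNIV. (norm (h k x - ?clip n (f x)))\<^sup>2 \<le> (2 * real n)\<^sup>2 * indicator L x" for k
    proof (rule AE_I2)
      fix x
      show "(norm (h k x - ?clip n (f x)))\<^sup>2 \<le> (2 * real n)\<^sup>2 * indicator L x"
      proof (cases "x \<in> L")
        case True
        have "norm (h k x - ?clip n (f x)) \<le> 2 * real n" using hb[of k x] by simp
        from power_mono[OF this norm_ge_zero, of 2] show ?thesis using True by simp
      next
        case False
        then have "x \<notin> K" unfolding L_def K'_def by (force intro: exI[of _ x] exI[of _ "0::'a"])
        then show ?thesis using False K(2) hL by simp
      qed
    qed
    have "AE x in lebesgue. x \<notin> N"
      using N by (simp add: negligible_iff_null_sets AE_not_in)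
    then show "AE x in lebesgue_on UNIV. (\<lambda>k. h k x) \<longlonglongrightarrow> ?clip n (f x)"
      unfolding lebesgue_on_UNIV_eq
    proof eventually_elim
      fix x assume "x \<notin> N"
      then have "(\<lambda>k. ?clip n (G k x) * c x) \<longlonglongrightarrow> ?clip n (f x) * c x"
        by (intro tendsto_intros tendsto_max tendsto_min G)
      moreover have "?clip n (f x) * c x = ?clip n (f x)"
        using K(2)[of x] c(4)[of x] K'(3) by (cases "x \<in> K") auto
      ultimately show "(\<lambda>k. h k x) \<longlonglongrightarrow> ?clip n (f x)" by (simp add: h_def)
    qed
  qed
  from L2_lim_eventually[OF this, of "e / 4"] e
  obtain m where m: "sqint UNIV (\<lambda>x. h m x - ?clip n (f x)) < e / 4" by auto
  have hL2: "h m \<in> L2 UNIV" by (rule compact_support_L2[OF hc L hL]) auto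
  have cL2: "(\<lambda>x. ?clip n (f x)) \<in> L2 UNIV"
    by (rule L2_bound[OF f, where C=1]) (use fm in auto)
  have "sqint UNIV (\<lambda>x. f x - h m x) < e"
    using sqint_triangle[OF f hL2 cL2] m n sqint_diff_commute[of UNIV f "\<lambda>x. ?clip n (f x)"] by simp
  then show ?thesis using that[OF hc L hL] by blast
qed

lemma L2_lim_conv:
  fixes f :: "'a::euclidean_space \<Rightarrow> real"
  assumes f: "f \<in> L2 UNIV" and K: "compact K" "\<And>x. x \<notin> K \<Longrightarrow> f x = 0"
  shows "L2_lim UNIV (\<lambda>k. conv (mollifier k) f) f"
  unfolding L2_lim_def
proof (rule LIMSEQ_I)
  fix r :: real assume r: "r > 0"
  \<comment> \<open>Two applications of \<open>sqint_triangle\<close> weigh the three errors by 2, 4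
    and 4, so that \<open>r / 12\<close> for each totals \<open>10 * r / 12\<close>. The error
    between the two mollifications is bounded by that between \<open>f\<close> and \<open>g\<close>,
    since mollification is a contraction.\<close>
  obtain g L where g: "continuous_on UNIV g" "compact L" "\<And>x. x \<notin> L \<Longrightarrow> g x = 0"
    "sqint UNIV (\<lambda>x. f x - g x) < r / 12"
    using L2_dense_continuous[OF f K, of "r/12"] r by auto
  have fi: "integrable lebesgue f" by (rule L2_compact_support_integrable[OF f K])
  have gL: "g \<in> L2 UNIV" by (rule compact_support_L2[OF g(1-3)]) auto
  have gi: "integrable lebesgue g" by (rule L2_compact_support_integrable[OF gL g(2,3)])
  obtain k0 where k0: "\<And>k. k \<ge> k0 \<Longrightarrow> sqint UNIV (\<lambda>x. conv (mollifier k) g x - g x) < r / 12"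
    using L2_lim_eventually[OF L2_lim_conv_continuous[OF g(1-3)], of "r/12"] r by auto
  show "\<exists>no. \<forall>k\<ge>no. norm (sqint UNIV (\<lambda>x. conv (mollifier k) f x - f x) - 0) < r"
  proof (intro exI allI impI)
    fix k assume k: "k \<ge> k0"
    note cf = conv_L2(1)[OF fi f, of k] and cg = conv_L2(1)[OF gi gL, of k]
    have "sqint UNIV (\<lambda>x. conv (mollifier k) f x - conv (mollifier k) g x)
        = sqint UNIV (conv (mollifier k) (\<lambda>x. f x - g x))"
      by (simp add: conv_diff[OF fi gi] sqint_def)
    also have "\<dots> \<le> sqint UNIV (\<lambda>x. f x - g x)"
      by (rule conv_L2(2)) (use fi gi L2_diff[OF f gL] in auto)
    finally have 1: "sqint UNIV (\<lambda>x. conv (mollifier k) f x - conv (mollifier k) g x) < r / 12" using g(4) by simp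
    have 2: "sqint UNIV (\<lambda>x. f x - conv (mollifier k) g x)
        \<le> 2 * sqint UNIV (\<lambda>x. f x - g x) + 2 * sqint UNIV (\<lambda>x. conv (mollifier k) g x - g x)"
      by (rule sqint_triangle[OF f cg gL])
    have "sqint UNIV (\<lambda>x. conv (mollifier k) f x - f x)
        \<le> 2 * sqint UNIV (\<lambda>x. conv (mollifier k) f x - conv (mollifier k) g x)
          + 2 * sqint UNIV (\<lambda>x. f x - conv (mollifier k) g x)"
      by (rule sqint_triangle[OF cf f cg])
    also have "\<dots> < r" using 1 2 g(4) k0[OF k] r by simp
    finally show "norm (sqint UNIV (\<lambda>x. conv (mollifier k) f x - f x) - 0) < r" by (simp add: sqint_nonneg)
  qed
qed

section \<open>Weak gradients\<close>

lemma open_sets_lebesgue: "open \<Omega> \<Longrightarrow> \<Omega> \<in> sets lebesgue"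
  by (metis borel_open sets_completionI_sets sets_lborel)

lemma locally_integrable_scaleR:
  "locally_integrable_on \<Omega> f \<Longrightarrow> locally_integrable_on \<Omega> (\<lambda>x. c *\<^sub>R f x)"
  unfolding locally_integrable_on_def by (auto intro: set_integrable_scaleR_right)

lemma locally_integrable_diff:
  "locally_integrable_on \<Omega> f \<Longrightarrow> locally_integrable_on \<Omega> g \<Longrightarrow> locally_integrable_on \<Omega> (\<lambda>x. f x - g x)"
  unfolding locally_integrable_on_def by (auto intro: set_integral_diff)

lemma locally_integrable_inner:
  assumes "locally_integrable_on \<Omega> G"
  shows "locally_integrable_on \<Omega> (\<lambda>x. G x \<bullet> b)"
  unfolding locally_integrable_on_def
proof (intro allI impI)
  fix K assume "compact K \<and> K \<subseteq> \<Omega>"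
  then have "integrable lebesgue (\<lambda>x. (indicator K x *\<^sub>R G x) \<bullet> b)"
    using assms unfolding locally_integrable_on_def set_integrable_def
    by (intro integrable_inner_left) auto
  then show "(\<lambda>x. G x \<bullet> b) absolutely_integrable_on K" unfolding set_integrable_def by simp
qed

lemma locally_integrable_test_mult:
  fixes G :: "'a::euclidean_space \<Rightarrow> 'b::euclidean_space"
  assumes G: "locally_integrable_on \<Omega> G" and \<Omega>: "\<Omega> \<in> sets lebesgue" and \<phi>: "test_function \<Omega> \<phi>"
  shows "integrable (lebesgue_on \<Omega>) (\<lambda>x. \<phi> x *\<^sub>R G x)" "integrable lebesgue (\<lambda>x. \<phi> x *\<^sub>R G x)"
proof -
  obtain K where K: "compact K" "K \<subseteq> \<Omega>" "\<And>x. x \<notin> K \<Longrightarrow> \<phi> x = 0" using \<phi> test_functionE by metis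
  obtain C where C: "\<And>x. \<bar>\<phi> x\<bar> \<le> C" using test_bounded[OF \<phi>] by blast
  have i: "integrable lebesgue (\<lambda>x. indicator K x *\<^sub>R G x)"
    using G K unfolding locally_integrable_on_def set_integrable_def by blast
  show j: "integrable lebesgue (\<lambda>x. \<phi> x *\<^sub>R G x)"
  proof (rule Bochner_Integration.integrable_bound)
    show "integrable lebesgue (\<lambda>x. C *\<^sub>R (indicator K x *\<^sub>R G x))" using i by (rule integrable_scaleR_right)
    have [measurable]: "\<phi> \<in> borel_measurable lebesgue" using test_measurable[OF \<phi>, of UNIV] by simp
    have [measurable]: "(\<lambda>x. indicator K x *\<^sub>R G x) \<in> borel_measurable lebesgue"
      using i by (rule borel_measurable_integrable)
    have "(\<lambda>x. \<phi> x *\<^sub>R (indicator K x *\<^sub>R G x)) \<in> borel_measurable lebesgue" by measurable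
    also have "(\<lambda>x. \<phi> x *\<^sub>R (indicator K x *\<^sub>R G x)) = (\<lambda>x. \<phi> x *\<^sub>R G x)"
      using K(3) by (auto simp: fun_eq_iff indicator_def)
    finally show "(\<lambda>x. \<phi> x *\<^sub>R G x) \<in> borel_measurable lebesgue" .
    show "AE x in lebesgue. norm (\<phi> x *\<^sub>R G x) \<le> norm (C *\<^sub>R (indicator K x *\<^sub>R G x))"
    proof (rule AE_I2)
      fix x
      have "\<bar>\<phi> x\<bar> \<le> \<bar>C\<bar>" using C[of x] by linarith
      then show "norm (\<phi> x *\<^sub>R G x) \<le> norm (C *\<^sub>R (indicator K x *\<^sub>R G x))"
        using K(3)[of x] by (cases "x \<in> K") (auto intro: mult_right_mono)
    qed
  qed
  then show "integrable (lebesgue_on \<Omega>) (\<lambda>x. \<phi> x *\<^sub>R G x)"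
    using integrable_lebesgue_on[OF \<Omega>, of "\<lambda>x. \<phi> x *\<^sub>R G x"] test_outside[OF \<phi>] by simp
qed

lemma locally_integrable_test_mult_real:
  fixes f :: "'a::euclidean_space \<Rightarrow> real"
  assumes "locally_integrable_on \<Omega> f" "\<Omega> \<in> sets lebesgue" "test_function \<Omega> \<phi>"
  shows "integrable (lebesgue_on \<Omega>) (\<lambda>x. \<phi> x * f x)" "integrable lebesgue (\<lambda>x. \<phi> x * f x)"
  using locally_integrable_test_mult[OF assms] by simp_all

lemma L2_locally_integrable:
  fixes f :: "'a::euclidean_space \<Rightarrow> 'b::euclidean_space"
  assumes f: "f \<in> L2 \<Omega>" and \<Omega>: "\<Omega> \<in> sets lebesgue"
  shows "locally_integrable_on \<Omega> f"
  unfolding locally_integrable_on_def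
proof (intro allI impI)
  fix K assume K: "compact K \<and> K \<subseteq> \<Omega>"
  have Km: "K \<inter> \<Omega> \<in> sets lebesgue" using K \<Omega> by (auto simp: lmeasurable_compact fmeasurableD)
  have "integrable (lebesgue_on \<Omega>) (\<lambda>x. indicator K x *\<^sub>R f x)"
  proof (rule Bochner_Integration.integrable_bound)
    show "integrable (lebesgue_on \<Omega>) (\<lambda>x. indicator K x + (norm (f x))\<^sup>2)"
      using K L2_int[OF f] integrable_indicator_compact[OF _ \<Omega>] by auto
    have [measurable]: "(indicator K :: 'a \<Rightarrow> real) \<in> borel_measurable (lebesgue_on \<Omega>)"
      using K by (intro borel_measurable_integrable integrable_indicator_compact \<Omega>) auto
    have [measurable]: "f \<in> borel_measurable (lebesgue_on \<Omega>)" by (rule L2_meas[OF f])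
    show "(\<lambda>x. indicator K x *\<^sub>R f x) \<in> borel_measurable (lebesgue_on \<Omega>)" by measurable
    have "t \<le> 1 + t\<^sup>2" for t :: real
      using zero_le_power2[of "t - 1/2"] by (simp add: power2_eq_square algebra_simps)
    then show "AE x in lebesgue_on \<Omega>. norm (indicator K x *\<^sub>R f x) \<le> norm (indicator K x + (norm (f x))\<^sup>2)"
      by (intro AE_I2) (auto simp: indicator_def)
  qed
  then have "integrable lebesgue (\<lambda>x. indicator K x *\<^sub>R f x)"
    using integrable_lebesgue_on[OF \<Omega>, of "\<lambda>x. indicator K x *\<^sub>R f x"] K by (auto simp: indicator_def)
  then show "f absolutely_integrable_on K" by (simp add: set_integrable_def)
qed

section \<open>The fundamental lemma of the calculus of variations\<close>

lemma AE_lebesgue_on_iff: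
  "\<Omega> \<in> sets lebesgue \<Longrightarrow> (AE x in lebesgue_on \<Omega>. P x) \<longleftrightarrow> (AE x in lebesgue. x \<in> \<Omega> \<longrightarrow> P x)"
  by (simp add: AE_restrict_space_iff)

text \<open>An open set is a countable union of compact sets, each with a cutoff equal to 1 on it,
  so only countably many null sets are collected. It reduces a.e. statements to compact support,
  where mollification is available.\<close>

lemma AE_cover_test:
  assumes \<Omega>: "open \<Omega>" and "\<And>\<eta>. test_function \<Omega> \<eta> \<Longrightarrow> AE x in lebesgue_on \<Omega>. \<eta> x \<noteq> 0 \<longrightarrow> P x"
  shows "AE x in lebesgue_on \<Omega>. P x"
proof -
  obtain C :: "nat \<Rightarrow> 'a set" where C: "\<And>n. compact (C n)" "\<And>n. C n \<subseteq> \<Omega>" "\<Union>(range C) = \<Omega>"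
    using open_Union_compact_subsets[OF \<Omega>] by metis
  have "\<exists>\<eta>. test_function \<Omega> \<eta> \<and> (\<forall>x\<in>C n. \<eta> x = 1)" for n
    using smooth_cutoff[OF C(1) \<Omega> C(2)] by metis
  then obtain \<eta> where \<eta>: "\<And>n. test_function \<Omega> (\<eta> n)" "\<And>n x. x \<in> C n \<Longrightarrow> \<eta> n x = 1" by metis
  have "AE x in lebesgue_on \<Omega>. \<forall>n. \<eta> n x \<noteq> 0 \<longrightarrow> P x"
    unfolding AE_all_countable using assms(2)[OF \<eta>(1)] by blast
  moreover have "AE x in lebesgue_on \<Omega>. x \<in> \<Omega>" by (rule AE_I2) simp
  ultimately show ?thesis
  proof eventually_elim
    fix x assume x: "\<forall>n. \<eta> n x \<noteq> 0 \<longrightarrow> P x" "x \<in> \<Omega>"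
    then obtain n where "x \<in> C n" using C(3) by blast
    then show "P x" using x \<eta>(2) by force
  qed
qed

text \<open>Testing with \<open>\<eta>\<^sup>2\<close> times mollifications of the indicator of \<open>{\<eta>\<^sup>2 d < 0}\<close> shows, in the limit,
  that the integral of \<open>\<eta>\<^sup>2 d\<close> over this set is nonnegative.\<close>

lemma fundamental_lemma_nonneg:
  fixes d :: "'a::euclidean_space \<Rightarrow> real"
  assumes \<Omega>: "open \<Omega>" and d: "locally_integrable_on \<Omega> d"
    and z: "\<And>\<phi>. test_function \<Omega> \<phi> \<Longrightarrow> (\<And>x. 0 \<le> \<phi> x) \<Longrightarrow> 0 \<le> (LINT x|lebesgue_on \<Omega>. \<phi> x * d x)"
  shows "AE x in lebesgue_on \<Omega>. 0 \<le> d x"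
proof (rule AE_cover_test[OF \<Omega>])
  fix \<eta>0 assume \<eta>0: "test_function \<Omega> \<eta>0"
  \<comment> \<open>The square is nonnegative and vanishes exactly where \<open>\<eta>0\<close>
    does, so the sign of \<open>d\<close> can be read off from
    \<open>\<eta> x * d x\<close>.\<close>
  define \<eta> where "\<eta> x = \<eta>0 x * \<eta>0 x" for x
  have \<eta>: "test_function \<Omega> \<eta>" unfolding \<eta>_def by (rule test_mult_smooth[OF \<eta>0 test_smooth[OF \<eta>0]])
  have \<eta>_nonneg: "\<eta> x \<ge> 0" for x by (simp add: \<eta>_def)
  have \<Omega>l: "\<Omega> \<in> sets lebesgue" by (rule open_sets_lebesgue[OF \<Omega>])
  obtain K where K: "compact K" "K \<subseteq> \<Omega>" "\<And>x. x \<notin> K \<Longrightarrow> \<eta> x = 0" using \<eta> test_functionE by metis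
  let ?f = "\<lambda>x. \<eta> x * d x" and ?s = "\<lambda>x. if \<eta> x * d x < 0 then 1 else 0 :: real"
  have fi: "integrable lebesgue ?f" by (rule locally_integrable_test_mult_real[OF d \<Omega>l \<eta>])
  have [measurable]: "?f \<in> borel_measurable lebesgue" using fi by (rule borel_measurable_integrable)
  have sm: "?s \<in> borel_measurable lebesgue" by measurable
  have sL: "?s \<in> L2 UNIV"
    by (rule bounded_support_L2[where C=1, OF _ K(1)]) (use sm K(3) in auto)
  have s0: "?s x = 0" if "x \<notin> K" for x using K(3)[OF that] by simp
  have si: "integrable lebesgue ?s" by (rule L2_compact_support_integrable[OF sL K(1) s0])
  let ?c = "\<lambda>k. conv (mollifier k) ?s"
  have c_nonneg: "0 \<le> ?c k x" for k x unfolding conv_def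
    by (intro integral_nonneg_AE) (auto simp: mollifier_nonneg)
  have c_le: "?c k x \<le> 1" for k x
  proof -
    have "?c k x \<le> (LINT y|lebesgue. mollifier k (x - y))" unfolding conv_def
      by (rule integral_mono[OF conv_integrable[OF test_mollifier si]
            test_integrable_lebesgue[OF test_reflect[OF test_mollifier]]])
         (auto simp: mollifier_nonneg)
    then show ?thesis by (simp add: mollifier_integral')
  qed
  have cs: "smooth_on UNIV (?c k)" for k by (rule smooth_conv[OF test_mollifier si])
  have c0: "0 \<le> (LINT x|lebesgue. ?c k x * ?f x)" for k
  proof -
    have t: "test_function \<Omega> (\<lambda>x. ?c k x * \<eta> x)" by (rule test_mult_smooth[OF \<eta> cs])
    have "(LINT x|lebesgue. ?c k x * ?f x) = (LINT x|lebesgue_on \<Omega>. (?c k x * \<eta> x) * d x)"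
      using test_outside[OF t] by (subst lint_lebesgue_on[OF \<Omega>l]) (auto simp: mult.assoc)
    then show ?thesis using z[OF t] c_nonneg \<eta>_nonneg by simp
  qed
  \<comment> \<open>L2 convergence gives pointwise convergence only along a subsequence. As the
    mollified indicators lie between 0 and 1, the modulus of \<open>?f\<close> dominates the
    products.\<close>
  obtain r where r: "strict_mono r" "AE x in lebesgue_on UNIV. (\<lambda>k. ?c (r k) x) \<longlonglongrightarrow> ?s x"
    using L2_lim_AE_subseq[OF L2_lim_conv[OF sL K(1) s0] conv_L2(1)[OF si sL] sL] by blast
  have "(\<lambda>k. LINT x|lebesgue. ?c (r k) x * ?f x) \<longlonglongrightarrow> (LINT x|lebesgue. ?s x * ?f x)"
  proof (rule integral_dominated_convergence[where w="\<lambda>x. \<bar>?f x\<bar>"])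
    show "AE x in lebesgue. (\<lambda>k. ?c (r k) x * ?f x) \<longlonglongrightarrow> ?s x * ?f x"
      using r(2) unfolding lebesgue_on_UNIV_eq by eventually_elim (rule tendsto_mult_right)
    show "(\<lambda>x. ?s x * ?f x) \<in> borel_measurable lebesgue" using sm by measurable
    show "(\<lambda>x. ?c (r k) x * ?f x) \<in> borel_measurable lebesgue" for k
      using continuous_measurable_lebesgue_on[OF smooth_continuous[OF cs[of "r k"]], of UNIV] by simp
    show "AE x in lebesgue. norm (?c (r k) x * ?f x) \<le> \<bar>?f x\<bar>" for k
      using c_nonneg[of "r k"] c_le[of "r k"] by (intro AE_I2) (simp add: abs_mult mult_left_le_one_le)
    show "integrable lebesgue (\<lambda>x. \<bar>?f x\<bar>)" using fi by (rule integrable_abs)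
  qed
  then have lim: "0 \<le> (LINT x|lebesgue. ?s x * ?f x)"
    by (rule tendsto_lowerbound) (use c0 in auto)
  have mi: "integrable lebesgue (\<lambda>x. max (- ?f x) 0)"
    using fi by (intro integrable_max) auto
  have "(\<lambda>x. ?s x * ?f x) = (\<lambda>x. - max (- ?f x) 0)" by (auto simp: fun_eq_iff max_def)
  then have "(LINT x|lebesgue. max (- ?f x) 0) \<le> 0" using lim by simp
  moreover have "0 \<le> (LINT x|lebesgue. max (- ?f x) 0)" by (intro integral_nonneg_AE) auto
  ultimately have "AE x in lebesgue. max (- ?f x) 0 = 0"
    using integral_nonneg_eq_0_iff_AE[OF mi] by simp
  then show "AE x in lebesgue_on \<Omega>. \<eta>0 x \<noteq> 0 \<longrightarrow> 0 \<le> d x"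
    unfolding AE_lebesgue_on_iff[OF \<Omega>l]
  proof eventually_elim
    fix x assume "max (- ?f x) 0 = 0"
    then have f: "0 \<le> ?f x" by (simp add: max_def split: if_splits)
    show "x \<in> \<Omega> \<longrightarrow> \<eta>0 x \<noteq> 0 \<longrightarrow> 0 \<le> d x"
    proof (intro impI)
      assume "\<eta>0 x \<noteq> 0"
      then have "\<eta> x > 0" unfolding \<eta>_def by (simp add: zero_less_mult_iff) linarith
      then show "0 \<le> d x" using f by (simp add: zero_le_mult_iff)
    qed
  qed
qed

lemma fundamental_lemma:
  fixes d :: "'a::euclidean_space \<Rightarrow> real"
  assumes \<Omega>: "open \<Omega>" and d: "locally_integrable_on \<Omega> d"
    and z: "\<And>\<phi>. test_function \<Omega> \<phi> \<Longrightarrow> (LINT x|lebesgue_on \<Omega>. \<phi> x * d x) = 0"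
  shows "AE x in lebesgue_on \<Omega>. d x = 0"
proof -
  have "AE x in lebesgue_on \<Omega>. 0 \<le> d x" by (rule fundamental_lemma_nonneg[OF \<Omega> d]) (simp add: z)
  moreover have "AE x in lebesgue_on \<Omega>. 0 \<le> (-1) *\<^sub>R d x"
    by (rule fundamental_lemma_nonneg[OF \<Omega> locally_integrable_scaleR[OF d]]) (simp add: z)
  ultimately show ?thesis by eventually_elim simp
qed

lemma weak_gradient_unique:
  fixes f :: "'a::euclidean_space \<Rightarrow> real"
  assumes \<Omega>: "open \<Omega>" and G: "has_weak_gradient \<Omega> f G" and H: "has_weak_gradient \<Omega> f H"
  shows "AE x in lebesgue_on \<Omega>. G x = H x"
proof -
  have \<Omega>l: "\<Omega> \<in> sets lebesgue" by (rule open_sets_lebesgue[OF \<Omega>])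
  have li: "locally_integrable_on \<Omega> G" "locally_integrable_on \<Omega> H"
    using G H by (auto simp: has_weak_gradient_def)
  have "AE x in lebesgue_on \<Omega>. (G x - H x) \<bullet> b = 0" for b
  proof (rule fundamental_lemma[OF \<Omega>])
    show "locally_integrable_on \<Omega> (\<lambda>x. (G x - H x) \<bullet> b)"
      by (intro locally_integrable_inner locally_integrable_diff li)
    fix \<phi> :: "'a \<Rightarrow> real" assume \<phi>: "test_function \<Omega> \<phi>"
    note i = locally_integrable_test_mult(1)[OF li(1) \<Omega>l \<phi>] locally_integrable_test_mult(1)[OF li(2) \<Omega>l \<phi>]
    have "(LINT x|lebesgue_on \<Omega>. \<phi> x *\<^sub>R G x) = (LINT x|lebesgue_on \<Omega>. \<phi> x *\<^sub>R H x)"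
      using G H \<phi> unfolding has_weak_gradient_def by (metis neg_equal_iff_equal)
    then have "(LINT x|lebesgue_on \<Omega>. \<phi> x *\<^sub>R G x) \<bullet> b - (LINT x|lebesgue_on \<Omega>. \<phi> x *\<^sub>R H x) \<bullet> b = 0"
      by simp
    also have "(LINT x|lebesgue_on \<Omega>. \<phi> x *\<^sub>R G x) \<bullet> b - (LINT x|lebesgue_on \<Omega>. \<phi> x *\<^sub>R H x) \<bullet> b
        = (LINT x|lebesgue_on \<Omega>. (\<phi> x *\<^sub>R G x) \<bullet> b - (\<phi> x *\<^sub>R H x) \<bullet> b)"
      using i by (simp only: integral_inner_left[symmetric] Bochner_Integration.integral_diff integrable_inner_left)
    finally show "(LINT x|lebesgue_on \<Omega>. \<phi> x * ((G x - H x) \<bullet> b)) = 0"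
      by (simp add: inner_diff_left right_diff_distrib)
  qed
  then have "AE x in lebesgue_on \<Omega>. \<forall>b\<in>Basis. (G x - H x) \<bullet> b = 0"
    by (intro AE_ball_countable[THEN iffD2] countable_finite) auto
  then show ?thesis
    by eventually_elim (metis euclidean_all_zero_iff right_minus_eq)
qed

text \<open>Lebesgue measure is complete. Thanks to this, a.e. equal representatives can be
  exchanged without asking for their measurability.\<close>

lemma borel_measurable_AE_on:
  fixes f :: "'a::euclidean_space \<Rightarrow> 'b::euclidean_space"
  assumes "\<Omega> \<in> sets lebesgue" "f \<in> borel_measurable (lebesgue_on \<Omega>)" "AE x in lebesgue_on \<Omega>. f x = g x"
  shows "g \<in> borel_measurable (lebesgue_on \<Omega>)"
proof (rule borel_measurable_if_D, rule borel_measurable_AE)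
  show "(\<lambda>x. if x \<in> \<Omega> then f x else 0) \<in> borel_measurable lebesgue"
    by (rule borel_measurable_if_I[OF assms(2,1)])
  show "AE x in lebesgue. (if x \<in> \<Omega> then f x else 0) = (if x \<in> \<Omega> then g x else 0)"
    using assms(3) unfolding AE_lebesgue_on_iff[OF assms(1)] by eventually_elim auto
qed

lemma L2_AE:
  assumes "\<Omega> \<in> sets lebesgue" "f \<in> L2 \<Omega>" "AE x in lebesgue_on \<Omega>. f x = g x"
  shows "g \<in> L2 \<Omega>"
  using L2_cong_AE[OF assms(2,3) borel_measurable_AE_on[OF assms(1) L2_meas[OF assms(2)] assms(3)]] .

text \<open>The gradient is carried along explicitly: \<open>weak_grad\<close> is an arbitrary
  choice and therefore linear only up to null sets, whereas pairs can be added and scaled exactly.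
  Testing in single directions \<open>b\<close> replaces the vector-valued integrals by
  \<open>ip\<close>.\<close>

definition sobolev_pair :: "'a::euclidean_space set \<Rightarrow> ('a \<Rightarrow> real) \<Rightarrow> ('a \<Rightarrow> 'a) \<Rightarrow> bool" where
  "sobolev_pair \<Omega> u G \<longleftrightarrow> u \<in> L2 \<Omega> \<and> G \<in> L2 \<Omega> \<and>
     (\<forall>\<phi> b. test_function \<Omega> \<phi> \<longrightarrow>
        ip \<Omega> u (\<lambda>x. frechet_derivative \<phi> (at x) b) = - ip \<Omega> \<phi> (\<lambda>x. G x \<bullet> b))"

lemma L2_inner: "G \<in> L2 \<Omega> \<Longrightarrow> (\<lambda>x. G x \<bullet> b) \<in> L2 \<Omega>"
  by (rule L2_bound[where C="norm b"])
     (auto dest: L2_meas simp: mult.commute[of "norm b"] intro!: AE_I2 Cauchy_Schwarz_ineq2)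

lemma sobolev_pair_iff:
  assumes \<Omega>: "\<Omega> \<in> sets lebesgue"
  shows "sobolev_pair \<Omega> u G \<longleftrightarrow> u \<in> L2 \<Omega> \<and> G \<in> L2 \<Omega> \<and> has_weak_gradient \<Omega> u G"
proof -
  have "has_weak_gradient \<Omega> u G \<longleftrightarrow> (\<forall>\<phi> b. test_function \<Omega> \<phi> \<longrightarrow>
        ip \<Omega> u (\<lambda>x. frechet_derivative \<phi> (at x) b) = - ip \<Omega> \<phi> (\<lambda>x. G x \<bullet> b))" (is "?L \<longleftrightarrow> ?R")
    if u: "u \<in> L2 \<Omega>" and G: "G \<in> L2 \<Omega>"
  proof -
    note lu = L2_locally_integrable[OF u \<Omega>] and lG = L2_locally_integrable[OF G \<Omega>]
    have eq: "(LINT x|lebesgue_on \<Omega>. u x *\<^sub>R gradient \<phi> x) \<bullet> b = ip \<Omega> u (\<lambda>x. frechet_derivative \<phi> (at x) b)"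
      "(LINT x|lebesgue_on \<Omega>. \<phi> x *\<^sub>R G x) \<bullet> b = ip \<Omega> \<phi> (\<lambda>x. G x \<bullet> b)"
      if \<phi>: "test_function \<Omega> \<phi>" for \<phi> b
    proof -
      have "integrable (lebesgue_on \<Omega>) (\<lambda>x. u x *\<^sub>R gradient \<phi> x)"
      proof -
        have "(\<lambda>x. u x *\<^sub>R gradient \<phi> x) = (\<lambda>x. \<Sum>b\<in>Basis. (frechet_derivative \<phi> (at x) b * u x) *\<^sub>R b)"
          by (simp add: gradient_def scaleR_sum_right mult.commute)
        then show ?thesis
          by (simp only:) (intro Bochner_Integration.integrable_sum integrable_scaleR_left
              locally_integrable_test_mult_real[OF lu \<Omega>] test_frechet \<phi>)
      qed
      from integral_inner_left[OF this, of b]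
      show "(LINT x|lebesgue_on \<Omega>. u x *\<^sub>R gradient \<phi> x) \<bullet> b = ip \<Omega> u (\<lambda>x. frechet_derivative \<phi> (at x) b)"
        by (simp add: ip_def gradient_smooth_inner test_smooth[OF \<phi>])
      show "(LINT x|lebesgue_on \<Omega>. \<phi> x *\<^sub>R G x) \<bullet> b = ip \<Omega> \<phi> (\<lambda>x. G x \<bullet> b)"
        using integral_inner_left[OF locally_integrable_test_mult(1)[OF lG \<Omega> \<phi>], of b] by (simp add: ip_def)
    qed
    show ?thesis
    proof
      assume L: ?L
      show ?R
      proof (intro allI impI)
        fix \<phi> :: "'a \<Rightarrow> real" and b :: 'a assume \<phi>: "test_function \<Omega> \<phi>"
        then have "(LINT x|lebesgue_on \<Omega>. u x *\<^sub>R gradient \<phi> x) = - (LINT x|lebesgue_on \<Omega>. \<phi> x *\<^sub>R G x)"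
          using L by (simp add: has_weak_gradient_def)
        then show "ip \<Omega> u (\<lambda>x. frechet_derivative \<phi> (at x) b) = - ip \<Omega> \<phi> (\<lambda>x. G x \<bullet> b)"
          using eq[OF \<phi>, of b] by simp
      qed
    next
      assume R: ?R
      show ?L unfolding has_weak_gradient_def
        by (auto intro!: lu lG euclidean_eqI[where 'a='a] simp: eq R)
    qed
  qed
  then show ?thesis unfolding sobolev_pair_def by blast
qed

lemma sobolev_pair_AE:
  assumes "open \<Omega>" "sobolev_pair \<Omega> u G" "AE x in lebesgue_on \<Omega>. u x = u' x" "AE x in lebesgue_on \<Omega>. G x = G' x"
  shows "sobolev_pair \<Omega> u' G'"
proof -
  have \<Omega>: "\<Omega> \<in> sets lebesgue" by (rule open_sets_lebesgue[OF assms(1)])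
  have u: "u \<in> L2 \<Omega>" "u' \<in> L2 \<Omega>" and G: "G \<in> L2 \<Omega>" "G' \<in> L2 \<Omega>"
    using assms L2_AE[OF \<Omega>] by (auto simp: sobolev_pair_def)
  have "ip \<Omega> u' (\<lambda>x. frechet_derivative \<phi> (at x) b) = ip \<Omega> u (\<lambda>x. frechet_derivative \<phi> (at x) b)"
    "ip \<Omega> \<phi> (\<lambda>x. G' x \<bullet> b) = ip \<Omega> \<phi> (\<lambda>x. G x \<bullet> b)"
    if "test_function \<Omega> \<phi>" for \<phi> b
  proof -
    show "ip \<Omega> u' (\<lambda>x. frechet_derivative \<phi> (at x) b) = ip \<Omega> u (\<lambda>x. frechet_derivative \<phi> (at x) b)"
      by (rule ip_cong_AE) (use u assms(3) test_L2[OF test_frechet[OF that] \<Omega>] in auto)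
    have "AE x in lebesgue_on \<Omega>. G' x \<bullet> b = G x \<bullet> b" using assms(4) by eventually_elim simp
    then show "ip \<Omega> \<phi> (\<lambda>x. G' x \<bullet> b) = ip \<Omega> \<phi> (\<lambda>x. G x \<bullet> b)"
      by (intro ip_cong_AE) (use G L2_inner test_L2[OF that \<Omega>] in auto)
  qed
  then show ?thesis using assms(2) u G by (simp add: sobolev_pair_def)
qed

lemma sobolev_pair_unique:
  assumes "open \<Omega>" "sobolev_pair \<Omega> u G" "sobolev_pair \<Omega> u' G'" "AE x in lebesgue_on \<Omega>. u x = u' x"
  shows "AE x in lebesgue_on \<Omega>. G x = G' x"
proof -
  have \<Omega>: "\<Omega> \<in> sets lebesgue" by (rule open_sets_lebesgue[OF assms(1)])
  have "sobolev_pair \<Omega> u' G" by (rule sobolev_pair_AE[OF assms(1,2,4)]) simp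
  then show ?thesis using assms(3) weak_gradient_unique[OF assms(1)] by (auto simp: sobolev_pair_iff[OF \<Omega>])
qed

lemma sobolev_pair_add:
  assumes \<Omega>: "\<Omega> \<in> sets lebesgue" and "sobolev_pair \<Omega> u G" "sobolev_pair \<Omega> v H"
  shows "sobolev_pair \<Omega> (\<lambda>x. u x + v x) (\<lambda>x. G x + H x)"
  using assms unfolding sobolev_pair_def
  by (auto simp: L2_add ip_add_left ip_add_right inner_add_left L2_inner
      test_L2(1)[OF test_frechet \<Omega>] test_L2(1)[OF _ \<Omega>])

lemma sobolev_pair_scaleR:
  assumes "sobolev_pair \<Omega> u G"
  shows "sobolev_pair \<Omega> (\<lambda>x. c * u x) (\<lambda>x. c *\<^sub>R G x)"
  using assms unfolding sobolev_pair_def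
  by (auto simp: L2_cmult L2_scaleR ip_cmult_left ip_cmult_right)

lemma sobolev_pair_diff:
  assumes \<Omega>: "\<Omega> \<in> sets lebesgue" and "sobolev_pair \<Omega> u G" "sobolev_pair \<Omega> v H"
  shows "sobolev_pair \<Omega> (\<lambda>x. u x - v x) (\<lambda>x. G x - H x)"
  using sobolev_pair_add[OF \<Omega> assms(2) sobolev_pair_scaleR[OF assms(3), of "-1"]] by simp

lemma sobolev_pair_test:
  assumes "test_function U \<phi>" "\<Omega> \<in> sets lebesgue"
  shows "sobolev_pair \<Omega> \<phi> (gradient \<phi>)"
  using smooth_has_weak_gradient[OF test_smooth[OF assms(1)] assms(2)] test_L2[OF assms]
  by (simp add: sobolev_pair_iff assms(2))

lemma L2_lim_inner:
  assumes "L2_lim \<Omega> F f" "\<And>k. F k \<in> L2 \<Omega>" "f \<in> L2 \<Omega>"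
  shows "L2_lim \<Omega> (\<lambda>k x. F k x \<bullet> b) (\<lambda>x. f x \<bullet> b)"
proof (rule L2_lim_bound[OF assms, where C="norm b"])
  show "AE x in lebesgue_on \<Omega>. norm (F k x \<bullet> b - f x \<bullet> b) \<le> norm b * norm (F k x - f x)" for k
    by (intro AE_I2) (metis Cauchy_Schwarz_ineq2 inner_diff_left mult.commute real_norm_def)
qed (intro L2_inner assms)+

text \<open>For a fixed test function both sides of the defining identity are continuous under L2
  convergence.\<close>

lemma sobolev_pair_closed:
  assumes \<Omega>: "\<Omega> \<in> sets lebesgue" and s: "\<And>k. sobolev_pair \<Omega> (u k) (G k)"
    and lim: "L2_lim \<Omega> u v" "L2_lim \<Omega> G H" and v: "v \<in> L2 \<Omega>" "H \<in> L2 \<Omega>"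
  shows "sobolev_pair \<Omega> v H"
  unfolding sobolev_pair_def
proof (intro conjI v allI impI)
  fix \<phi> :: "'a \<Rightarrow> real" and b assume \<phi>: "test_function \<Omega> \<phi>"
  have L: "u k \<in> L2 \<Omega>" "G k \<in> L2 \<Omega>" for k using s by (auto simp: sobolev_pair_def)
  have "(\<lambda>k. ip \<Omega> (u k) (\<lambda>x. frechet_derivative \<phi> (at x) b)) \<longlonglongrightarrow> ip \<Omega> v (\<lambda>x. frechet_derivative \<phi> (at x) b)"
    by (rule L2_lim_ip[OF lim(1) L2_lim_const L(1) _ v(1)]) (rule test_L2[OF test_frechet[OF \<phi>] \<Omega>])+
  moreover have "(\<lambda>k. - ip \<Omega> \<phi> (\<lambda>x. G k x \<bullet> b)) \<longlonglongrightarrow> - ip \<Omega> \<phi> (\<lambda>x. H x \<bullet> b)"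
    by (intro tendsto_minus L2_lim_ip[OF L2_lim_const L2_lim_inner[OF lim(2) L(2) v(2)]]
        test_L2(1)[OF \<phi> \<Omega>] L2_inner L v)
  moreover have "ip \<Omega> (u k) (\<lambda>x. frechet_derivative \<phi> (at x) b) = - ip \<Omega> \<phi> (\<lambda>x. G k x \<bullet> b)" for k
    using s[of k] \<phi> by (simp add: sobolev_pair_def)
  ultimately show "ip \<Omega> v (\<lambda>x. frechet_derivative \<phi> (at x) b) = - ip \<Omega> \<phi> (\<lambda>x. H x \<bullet> b)"
    using LIMSEQ_unique by simp
qed

lemma W12_iff:
  assumes \<Omega>: "open \<Omega>"
  shows "u \<in> W12 \<Omega> \<longleftrightarrow> (\<exists>G. sobolev_pair \<Omega> u G)"
proof -
  have "\<Omega> \<in> sets lebesgue" by (rule open_sets_lebesgue[OF \<Omega>])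
  then show ?thesis by (auto simp: W12_def sobolev_pair_iff)
qed

lemma weak_grad_AE:
  assumes \<Omega>: "open \<Omega>" and u: "sobolev_pair \<Omega> u G"
  shows "AE x in lebesgue_on \<Omega>. weak_grad \<Omega> u x = G x"
proof -
  have \<Omega>l: "\<Omega> \<in> sets lebesgue" by (rule open_sets_lebesgue[OF \<Omega>])
  have hw: "has_weak_gradient \<Omega> u G" using u by (simp add: sobolev_pair_iff[OF \<Omega>l])
  then have "has_weak_gradient \<Omega> u (weak_grad \<Omega> u)" unfolding weak_grad_def by (rule someI[of "has_weak_gradient \<Omega> u"])
  then show ?thesis using weak_gradient_unique[OF \<Omega> _ hw] by blast
qed

lemma sobolev_pair_weak_grad:
  assumes \<Omega>: "open \<Omega>" and u: "sobolev_pair \<Omega> u G"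
  shows "sobolev_pair \<Omega> u (weak_grad \<Omega> u)"
  by (rule sobolev_pair_AE[OF \<Omega> u]) (use weak_grad_AE[OF \<Omega> u] in auto)

lemma W12_norm_eq:
  assumes \<Omega>: "open \<Omega>" and u: "sobolev_pair \<Omega> u G"
  shows "W12_norm \<Omega> u = sqrt (sqint \<Omega> u + sqint \<Omega> G)"
proof -
  have "sqint \<Omega> (weak_grad \<Omega> u) = sqint \<Omega> G"
    using sobolev_pair_weak_grad[OF \<Omega> u] u weak_grad_AE[OF \<Omega> u]
    by (intro sqint_cong_AE) (auto simp: sobolev_pair_def)
  then show ?thesis by (simp add: W12_norm_def sqint_def)
qed

text \<open>That \<open>G\<close> is a weak gradient of \<open>w\<close> is not demanded; it follows
  from closedness in \<open>sobolev0_imp_sobolev\<close>. Thus membership can be shown merely by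
  exhibiting the approximating test functions.\<close>

definition sobolev0_pair :: "'a::euclidean_space set \<Rightarrow> ('a \<Rightarrow> real) \<Rightarrow> ('a \<Rightarrow> 'a) \<Rightarrow> bool" where
  "sobolev0_pair \<Omega> w G \<longleftrightarrow> w \<in> L2 \<Omega> \<and> G \<in> L2 \<Omega> \<and>
     (\<exists>\<phi>. (\<forall>k. test_function \<Omega> (\<phi> k)) \<and> L2_lim \<Omega> \<phi> w \<and> L2_lim \<Omega> (\<lambda>k. gradient (\<phi> k)) G)"

lemma sobolev0_pairE:
  assumes "sobolev0_pair \<Omega> w G"
  obtains \<phi> where "\<And>k. test_function \<Omega> (\<phi> k)" "L2_lim \<Omega> \<phi> w" "L2_lim \<Omega> (\<lambda>k. gradient (\<phi> k)) G"
    "w \<in> L2 \<Omega>" "G \<in> L2 \<Omega>"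
  using assms unfolding sobolev0_pair_def by blast

lemma sobolev0_pair_L2:
  "sobolev0_pair \<Omega> w G \<Longrightarrow> w \<in> L2 \<Omega>" "sobolev0_pair \<Omega> w G \<Longrightarrow> G \<in> L2 \<Omega>"
  by (auto simp: sobolev0_pair_def)

lemma sobolev_pair_L2:
  "sobolev_pair \<Omega> w G \<Longrightarrow> w \<in> L2 \<Omega>" "sobolev_pair \<Omega> w G \<Longrightarrow> G \<in> L2 \<Omega>"
  by (auto simp: sobolev_pair_def)

lemma sobolev0_imp_sobolev:
  assumes "\<Omega> \<in> sets lebesgue" "sobolev0_pair \<Omega> w G"
  shows "sobolev_pair \<Omega> w G"
proof -
  obtain \<phi> where \<phi>: "\<And>k. test_function \<Omega> (\<phi> k)" "L2_lim \<Omega> \<phi> w" "L2_lim \<Omega> (\<lambda>k. gradient (\<phi> k)) G"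
    "w \<in> L2 \<Omega>" "G \<in> L2 \<Omega>" using sobolev0_pairE[OF assms(2)] by metis
  show ?thesis by (rule sobolev_pair_closed[OF assms(1) sobolev_pair_test[OF \<phi>(1) assms(1)] \<phi>(2-5)])
qed

text \<open>The square of \<open>W12_norm\<close> splits into the two \<open>sqint\<close> terms, so
  convergence in that norm is convergence of functions and gradients separately.\<close>

lemma W12_0_iff:
  assumes \<Omega>: "open \<Omega>"
  shows "w \<in> W12_0 \<Omega> \<longleftrightarrow> (\<exists>G. sobolev0_pair \<Omega> w G)"
proof -
  have \<Omega>l: "\<Omega> \<in> sets lebesgue" by (rule open_sets_lebesgue[OF \<Omega>])
  have norm: "W12_norm \<Omega> (\<lambda>x. w x - \<phi> x)
      = sqrt (sqint \<Omega> (\<lambda>x. w x - \<phi> x) + sqint \<Omega> (\<lambda>x. G x - gradient \<phi> x))"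
    if "sobolev_pair \<Omega> w G" "test_function \<Omega> \<phi>" for G \<phi>
    by (rule W12_norm_eq[OF \<Omega> sobolev_pair_diff[OF \<Omega>l that(1) sobolev_pair_test[OF that(2) \<Omega>l]]])
  show ?thesis
  proof
    assume "w \<in> W12_0 \<Omega>"
    then obtain \<phi> G where \<phi>: "\<And>k::nat. test_function \<Omega> (\<phi> k)"
      "(\<lambda>k. W12_norm \<Omega> (\<lambda>x. w x - \<phi> k x)) \<longlonglongrightarrow> 0" and G: "sobolev_pair \<Omega> w G"
      unfolding W12_0_def by (auto simp: W12_iff[OF \<Omega>])
    have "(\<lambda>k. (W12_norm \<Omega> (\<lambda>x. w x - \<phi> k x))\<^sup>2) \<longlonglongrightarrow> 0" using tendsto_power[OF \<phi>(2), of 2] by simp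
    then have lim: "(\<lambda>k. sqint \<Omega> (\<lambda>x. w x - \<phi> k x) + sqint \<Omega> (\<lambda>x. G x - gradient (\<phi> k) x)) \<longlonglongrightarrow> 0"
      by (simp add: norm[OF G \<phi>(1)] sqint_nonneg)
    have "L2_lim \<Omega> \<phi> w"
      by (rule L2_lim_le[OF lim]) (simp add: sqint_diff_commute[of \<Omega> _ w] sqint_nonneg)
    moreover have "L2_lim \<Omega> (\<lambda>k. gradient (\<phi> k)) G"
      by (rule L2_lim_le[OF lim]) (simp add: sqint_diff_commute[of \<Omega> _ G] sqint_nonneg)
    ultimately show "\<exists>G. sobolev0_pair \<Omega> w G"
      using \<phi>(1) G unfolding sobolev0_pair_def sobolev_pair_def by blast
  next
    assume "\<exists>G. sobolev0_pair \<Omega> w G"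
    then obtain G \<phi> where G: "sobolev0_pair \<Omega> w G" and \<phi>: "\<And>k. test_function \<Omega> (\<phi> k)" "L2_lim \<Omega> \<phi> w"
      "L2_lim \<Omega> (\<lambda>k. gradient (\<phi> k)) G" using sobolev0_pairE by metis
    have s: "sobolev_pair \<Omega> w G" by (rule sobolev0_imp_sobolev[OF \<Omega>l G])
    have "(\<lambda>k. sqrt (sqint \<Omega> (\<lambda>x. \<phi> k x - w x) + sqint \<Omega> (\<lambda>x. gradient (\<phi> k) x - G x))) \<longlonglongrightarrow> sqrt (0 + 0)"
      using \<phi>(2,3) unfolding L2_lim_def by (intro tendsto_intros)
    then have "(\<lambda>k. W12_norm \<Omega> (\<lambda>x. w x - \<phi> k x)) \<longlonglongrightarrow> 0"
      by (simp add: norm[OF s \<phi>(1)] sqint_diff_commute[of \<Omega> _ w] sqint_diff_commute[of \<Omega> _ G])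
    then show "w \<in> W12_0 \<Omega>" using \<phi>(1) s unfolding W12_0_def by (auto simp: W12_iff[OF \<Omega>])
  qed
qed

lemma sobolev0_test:
  assumes "test_function \<Omega> \<phi>" "\<Omega> \<in> sets lebesgue"
  shows "sobolev0_pair \<Omega> \<phi> (gradient \<phi>)"
  unfolding sobolev0_pair_def using assms test_L2[OF assms]
  by (intro conjI exI[of _ "\<lambda>k. \<phi>"]) (auto simp: L2_lim_const)

text \<open>Diagonal choice: for each \<open>k\<close> a test function within
  \<open>1 / real (Suc k)\<close> of the \<open>k\<close>-th pair, in function and gradient at
  once.\<close>

lemma sobolev0_closed:
  assumes \<Omega>: "\<Omega> \<in> sets lebesgue" and s: "\<And>k. sobolev0_pair \<Omega> (u k) (G k)"
    and lim: "L2_lim \<Omega> u v" "L2_lim \<Omega> G H" and v: "v \<in> L2 \<Omega>" "H \<in> L2 \<Omega>"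
  shows "sobolev0_pair \<Omega> v H"
proof -
  note L = sobolev0_pair_L2[OF s]
  have "\<exists>\<phi>. test_function \<Omega> \<phi> \<and> sqint \<Omega> (\<lambda>x. \<phi> x - u k x) < 1 / real (Suc k)
      \<and> sqint \<Omega> (\<lambda>x. gradient \<phi> x - G k x) < 1 / real (Suc k)" for k
  proof -
    obtain \<phi> where \<phi>: "\<And>k. test_function \<Omega> (\<phi> k)" "L2_lim \<Omega> \<phi> (u k)" "L2_lim \<Omega> (\<lambda>k. gradient (\<phi> k)) (G k)"
      using sobolev0_pairE[OF s[of k]] by metis
    obtain n m where "\<And>j. j \<ge> n \<Longrightarrow> sqint \<Omega> (\<lambda>x. \<phi> j x - u k x) < 1 / real (Suc k)"
      "\<And>j. j \<ge> m \<Longrightarrow> sqint \<Omega> (\<lambda>x. gradient (\<phi> j) x - G k x) < 1 / real (Suc k)"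
      using L2_lim_eventually[OF \<phi>(2), of "1 / real (Suc k)"] L2_lim_eventually[OF \<phi>(3), of "1 / real (Suc k)"]
      by (metis of_nat_0_less_iff zero_less_Suc zero_less_divide_1_iff)
    then show ?thesis using \<phi>(1) by (intro exI[of _ "\<phi> (max n m)"]) simp
  qed
  then obtain \<phi> where \<phi>: "\<And>k. test_function \<Omega> (\<phi> k)"
    "\<And>k. sqint \<Omega> (\<lambda>x. \<phi> k x - u k x) < 1 / real (Suc k)"
    "\<And>k. sqint \<Omega> (\<lambda>x. gradient (\<phi> k) x - G k x) < 1 / real (Suc k)" by metis
  have inv: "(\<lambda>k. 1 / real (Suc k)) \<longlonglongrightarrow> 0" by (rule LIMSEQ_Suc[OF lim_1_over_n])
  have "L2_lim \<Omega> \<phi> v"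
  proof (rule L2_lim_le)
    show "(\<lambda>k. 2 * (1 / real (Suc k)) + 2 * sqint \<Omega> (\<lambda>x. u k x - v x)) \<longlonglongrightarrow> 0"
      using tendsto_add[OF tendsto_mult_right_zero[OF inv, of 2]
          tendsto_mult_right_zero[OF lim(1)[unfolded L2_lim_def], of 2]] by simp
    show "sqint \<Omega> (\<lambda>x. \<phi> k x - v x) \<le> 2 * (1 / real (Suc k)) + 2 * sqint \<Omega> (\<lambda>x. u k x - v x)" for k
      using sqint_triangle[OF test_L2(1)[OF \<phi>(1) \<Omega>] v(1) L(1), of k k] \<phi>(2)[of k]
        sqint_diff_commute[of \<Omega> v "u k"] by simp
  qed
  moreover have "L2_lim \<Omega> (\<lambda>k. gradient (\<phi> k)) H"
  proof (rule L2_lim_le)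
    show "(\<lambda>k. 2 * (1 / real (Suc k)) + 2 * sqint \<Omega> (\<lambda>x. G k x - H x)) \<longlonglongrightarrow> 0"
      using tendsto_add[OF tendsto_mult_right_zero[OF inv, of 2]
          tendsto_mult_right_zero[OF lim(2)[unfolded L2_lim_def], of 2]] by simp
    show "sqint \<Omega> (\<lambda>x. gradient (\<phi> k) x - H x) \<le> 2 * (1 / real (Suc k)) + 2 * sqint \<Omega> (\<lambda>x. G k x - H x)" for k
      using sqint_triangle[OF test_L2(2)[OF \<phi>(1) \<Omega>] v(2) L(2), of k k] \<phi>(3)[of k]
        sqint_diff_commute[of \<Omega> H "G k"] by simp
  qed
  ultimately show ?thesis using \<phi>(1) v unfolding sobolev0_pair_def by blast
qed

lemma L2_lim_AE:
  assumes "L2_lim \<Omega> F f" "\<And>k. F k \<in> L2 \<Omega>" "f \<in> L2 \<Omega>" "g \<in> L2 \<Omega>" "AE x in lebesgue_on \<Omega>. f x = g x"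
  shows "L2_lim \<Omega> F g"
proof -
  have "sqint \<Omega> (\<lambda>x. F k x - g x) = sqint \<Omega> (\<lambda>x. F k x - f x)" for k
  proof (rule sqint_cong_AE)
    show "AE x in lebesgue_on \<Omega>. F k x - g x = F k x - f x" using assms(5) by eventually_elim simp
  qed (intro L2_diff assms)+
  then show ?thesis using assms(1) by (simp add: L2_lim_def)
qed

lemma sobolev0_AE:
  assumes "\<Omega> \<in> sets lebesgue" "sobolev0_pair \<Omega> u G" "AE x in lebesgue_on \<Omega>. u x = u' x" "AE x in lebesgue_on \<Omega>. G x = G' x"
  shows "sobolev0_pair \<Omega> u' G'"
proof -
  note L = sobolev0_pair_L2[OF assms(2)]
  note L' = L2_AE[OF assms(1) L(1) assms(3)] L2_AE[OF assms(1) L(2) assms(4)]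
  show ?thesis
    by (rule sobolev0_closed[where u="\<lambda>k. u" and G="\<lambda>k. G", OF assms(1,2) _ _ L'])
       (rule L2_lim_AE[OF L2_lim_const]; fact L L' assms)+
qed

lemma sobolev0_add:
  assumes "\<Omega> \<in> sets lebesgue" "sobolev0_pair \<Omega> u G" "sobolev0_pair \<Omega> v H"
  shows "sobolev0_pair \<Omega> (\<lambda>x. u x + v x) (\<lambda>x. G x + H x)"
proof -
  obtain \<phi> where \<phi>: "\<And>k. test_function \<Omega> (\<phi> k)" "L2_lim \<Omega> \<phi> u" "L2_lim \<Omega> (\<lambda>k. gradient (\<phi> k)) G"
    "u \<in> L2 \<Omega>" "G \<in> L2 \<Omega>" using sobolev0_pairE[OF assms(2)] by metis
  obtain \<psi> where \<psi>: "\<And>k. test_function \<Omega> (\<psi> k)" "L2_lim \<Omega> \<psi> v" "L2_lim \<Omega> (\<lambda>k. gradient (\<psi> k)) H"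
    "v \<in> L2 \<Omega>" "H \<in> L2 \<Omega>" using sobolev0_pairE[OF assms(3)] by metis
  have "L2_lim \<Omega> (\<lambda>k x. \<phi> k x + \<psi> k x) (\<lambda>x. u x + v x)"
    by (intro L2_lim_add \<phi>(2,4) \<psi>(2,4) test_L2(1)[OF \<phi>(1) assms(1)] test_L2(1)[OF \<psi>(1) assms(1)])
  moreover have "gradient (\<lambda>x. \<phi> k x + \<psi> k x) = (\<lambda>x. gradient (\<phi> k) x + gradient (\<psi> k) x)" for k
    by (intro ext gradient_add test_smooth[OF \<phi>(1)] test_smooth[OF \<psi>(1)])
  moreover have "L2_lim \<Omega> (\<lambda>k x. gradient (\<phi> k) x + gradient (\<psi> k) x) (\<lambda>x. G x + H x)"
    by (intro L2_lim_add \<phi>(3,5) \<psi>(3,5) test_L2(2)[OF \<phi>(1) assms(1)] test_L2(2)[OF \<psi>(1) assms(1)])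
  ultimately show ?thesis using \<phi> \<psi> unfolding sobolev0_pair_def
    by (intro conjI exI[of _ "\<lambda>k x. \<phi> k x + \<psi> k x"]) (auto intro: L2_add test_add)
qed

lemma sobolev0_scaleR:
  assumes "\<Omega> \<in> sets lebesgue" "sobolev0_pair \<Omega> u G"
  shows "sobolev0_pair \<Omega> (\<lambda>x. c * u x) (\<lambda>x. c *\<^sub>R G x)"
proof -
  obtain \<phi> where \<phi>: "\<And>k. test_function \<Omega> (\<phi> k)" "L2_lim \<Omega> \<phi> u" "L2_lim \<Omega> (\<lambda>k. gradient (\<phi> k)) G"
    "u \<in> L2 \<Omega>" "G \<in> L2 \<Omega>" using sobolev0_pairE[OF assms(2)] by metis
  have "L2_lim \<Omega> (\<lambda>k x. c * \<phi> k x) (\<lambda>x. c * u x)" using L2_lim_scaleR[OF \<phi>(2), of c] by simp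
  moreover have "gradient (\<lambda>x. c * \<phi> k x) = (\<lambda>x. c *\<^sub>R gradient (\<phi> k) x)" for k
    by (intro ext gradient_cmult test_smooth[OF \<phi>(1)])
  moreover have "L2_lim \<Omega> (\<lambda>k x. c *\<^sub>R gradient (\<phi> k) x) (\<lambda>x. c *\<^sub>R G x)" by (rule L2_lim_scaleR[OF \<phi>(3)])
  ultimately show ?thesis using \<phi> unfolding sobolev0_pair_def
    by (intro conjI exI[of _ "\<lambda>k x. c * \<phi> k x"]) (auto intro: L2_cmult L2_scaleR test_cmult)
qed

lemma sobolev0_diff:
  assumes "\<Omega> \<in> sets lebesgue" "sobolev0_pair \<Omega> u G" "sobolev0_pair \<Omega> v H"
  shows "sobolev0_pair \<Omega> (\<lambda>x. u x - v x) (\<lambda>x. G x - H x)"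
  using sobolev0_add[OF assms(1,2) sobolev0_scaleR[OF assms(1,3), of "-1"]] by simp

lemma Poincare:
  fixes \<Omega> :: "'a::euclidean_space set"
  assumes "bounded \<Omega>" "\<Omega> \<in> sets lebesgue"
  obtains P where "P > 0" "\<And>w G. sobolev0_pair \<Omega> w G \<Longrightarrow> sqint \<Omega> w \<le> P * sqint \<Omega> G"
proof -
  obtain P where P: "P > 0" "\<And>\<phi>. test_function \<Omega> \<phi> \<Longrightarrow> sqint \<Omega> \<phi> \<le> P * sqint \<Omega> (gradient \<phi>)"
    using Poincare_test[OF assms] by blast
  have "sqint \<Omega> w \<le> P * sqint \<Omega> G" if s: "sobolev0_pair \<Omega> w G" for w G
  proof -
    obtain \<phi> where \<phi>: "\<And>k. test_function \<Omega> (\<phi> k)" "L2_lim \<Omega> \<phi> w" "L2_lim \<Omega> (\<lambda>k. gradient (\<phi> k)) G"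
      "w \<in> L2 \<Omega>" "G \<in> L2 \<Omega>" using sobolev0_pairE[OF s] by metis
    have "(\<lambda>k. sqint \<Omega> (\<phi> k)) \<longlonglongrightarrow> sqint \<Omega> w"
      by (rule L2_lim_sqint[OF \<phi>(2) test_L2(1)[OF \<phi>(1) assms(2)] \<phi>(4)])
    moreover have "(\<lambda>k. P * sqint \<Omega> (gradient (\<phi> k))) \<longlonglongrightarrow> P * sqint \<Omega> G"
      by (intro tendsto_mult tendsto_const L2_lim_sqint[OF \<phi>(3) test_L2(2)[OF \<phi>(1) assms(2)] \<phi>(5)])
    ultimately show ?thesis by (rule LIMSEQ_le) (use P(2)[OF \<phi>(1)] in auto)
  qed
  then show ?thesis using that P(1) by blast
qed

section \<open>Truncation and interior regularity\<close>

abbreviation pderiv_dir :: "('a::euclidean_space \<Rightarrow> real) \<Rightarrow> 'a \<Rightarrow> 'a \<Rightarrow> real" where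
  "pderiv_dir f b \<equiv> (\<lambda>x. frechet_derivative f (at x) b)"

lemma test_sum:
  assumes "finite I" "\<And>i. i \<in> I \<Longrightarrow> test_function \<Omega> (\<phi> i)"
  shows "test_function \<Omega> (\<lambda>x. \<Sum>i\<in>I. \<phi> i x)"
  using assms by (induction I rule: finite_induct) (auto intro: test_zero test_add)

lemma L2_lim_sum:
  assumes "finite I" "\<And>i. i \<in> I \<Longrightarrow> L2_lim \<Omega> (F i) (f i)" "\<And>i k. i \<in> I \<Longrightarrow> F i k \<in> L2 \<Omega>"
    "\<And>i. i \<in> I \<Longrightarrow> f i \<in> L2 \<Omega>"
  shows "L2_lim \<Omega> (\<lambda>k x. \<Sum>i\<in>I. F i k x) (\<lambda>x. \<Sum>i\<in>I. f i x)"
  using assms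
proof (induction I rule: finite_induct)
  case empty
  then show ?case by (simp add: L2_lim_const)
next
  case (insert i I)
  then have "L2_lim \<Omega> (\<lambda>k x. F i k x + (\<Sum>i\<in>I. F i k x)) (\<lambda>x. f i x + (\<Sum>i\<in>I. f i x))"
    by (intro L2_lim_add L2_sum) auto
  then show ?case using insert by simp
qed

text \<open>The mean value theorem is applied to the increment \<open>g\<close> in the direction
  \<open>c\<close>, along \<open>b\<close>, and after that to the derivative in the direction
  \<open>b\<close>, along \<open>c\<close>.\<close>

lemma second_difference:
  fixes \<phi> :: "'a::euclidean_space \<Rightarrow> real"
  assumes "smooth_on UNIV \<phi>"
  obtains \<sigma> \<tau> where "0 < \<sigma>" "\<sigma> < 1" "0 < \<tau>" "\<tau> < 1"
    "\<phi> (x + b + c) - \<phi> (x + b) - (\<phi> (x + c) - \<phi> x) = pderiv_dir (pderiv_dir \<phi> b) c (x + \<sigma> *\<^sub>R b + \<tau> *\<^sub>R c)"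
proof -
  define g where "g y = \<phi> (1 *\<^sub>R y + c) - \<phi> y" for y
  have gs: "smooth_on UNIV g" unfolding g_def by (intro smooth_diff smooth_affine assms)
  obtain \<sigma> where \<sigma>: "0 < \<sigma>" "\<sigma> < 1" "g (x + b) - g x = gradient g (x + \<sigma> *\<^sub>R b) \<bullet> b"
    using smooth_MVT[OF gs] by metis
  have "(g has_derivative (\<lambda>h. gradient \<phi> (y + c) \<bullet> h - gradient \<phi> y \<bullet> h)) (at y)" for y
  proof -
    have "((\<lambda>y. \<phi> (1 *\<^sub>R y + c)) has_derivative (\<lambda>h. gradient \<phi> (1 *\<^sub>R y + c) \<bullet> h)) (at y)"
      by (rule has_derivative_eq_rhs[OF has_derivative_compose[OF _ smooth_has_gradient[OF assms]]])
         (auto intro!: derivative_eq_intros)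
    from has_derivative_diff[OF this smooth_has_gradient[OF assms]] show ?thesis by (simp add: g_def[abs_def])
  qed
  from gradient_inner[OF this] have "gradient g (x + \<sigma> *\<^sub>R b) \<bullet> b
      = pderiv_dir \<phi> b (x + \<sigma> *\<^sub>R b + c) - pderiv_dir \<phi> b (x + \<sigma> *\<^sub>R b)"
    by (simp add: gradient_smooth_inner assms)
  moreover obtain \<tau> where \<tau>: "0 < \<tau>" "\<tau> < 1"
    "pderiv_dir \<phi> b (x + \<sigma> *\<^sub>R b + c) - pderiv_dir \<phi> b (x + \<sigma> *\<^sub>R b)
      = gradient (pderiv_dir \<phi> b) (x + \<sigma> *\<^sub>R b + \<tau> *\<^sub>R c) \<bullet> c"
    using smooth_MVT[OF smooth_frechet_derivative[OF assms]] by metis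
  ultimately show ?thesis using that[OF \<sigma>(1,2) \<tau>(1,2)] \<sigma>(3)
    by (simp add: g_def gradient_smooth_inner smooth_frechet_derivative assms add.commute add.left_commute)
qed

lemma pderiv_dir_scaleR:
  assumes "smooth_on UNIV f"
  shows "pderiv_dir f (s *\<^sub>R b) = (\<lambda>x. s * pderiv_dir f b x)"
  by (rule ext) (simp add: gradient_smooth_inner[OF assms, symmetric])

text \<open>The second difference over a small parallelogram does not depend on the order of
  \<open>b\<close> and \<open>c\<close>, so the two mixed derivatives agree at two points
  \<open>p n\<close> and \<open>q n\<close>. Both points tend to \<open>x\<close>, and continuity
  finishes the argument.\<close>

lemma smooth_symmetric_derivatives:
  fixes \<phi> :: "'a::euclidean_space \<Rightarrow> real"
  assumes \<phi>: "smooth_on UNIV \<phi>"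
  shows "pderiv_dir (pderiv_dir \<phi> b) c = pderiv_dir (pderiv_dir \<phi> c) b"
proof
  fix x
  define s where "s n = 1 / real (Suc n)" for n
  have s: "s n > 0" "s n \<le> 1" for n by (auto simp: s_def)
  have s0: "s \<longlonglongrightarrow> 0" unfolding s_def by (rule LIMSEQ_Suc[OF lim_1_over_n])
  have scale: "pderiv_dir (pderiv_dir \<phi> (s n *\<^sub>R b)) (s n *\<^sub>R c) y = s n * s n * pderiv_dir (pderiv_dir \<phi> b) c y" for n b c y
  proof -
    have sm: "smooth_on UNIV (pderiv_dir \<phi> b)" by (intro smooth_intros \<phi>)
    have "gradient (\<lambda>x. s n * pderiv_dir \<phi> b x) y = s n *\<^sub>R gradient (pderiv_dir \<phi> b) y"
      by (rule gradient_cmult[OF sm])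
    then show ?thesis
      by (simp add: pderiv_dir_scaleR[OF \<phi>] gradient_smooth_inner[symmetric] sm smooth_mult smooth_const)
  qed
  have ex: "\<exists>p. norm (p - x) \<le> s n * (norm b + norm c) \<and>
      \<phi> (x + s n *\<^sub>R b + s n *\<^sub>R c) - \<phi> (x + s n *\<^sub>R b) - (\<phi> (x + s n *\<^sub>R c) - \<phi> x)
        = s n * s n * pderiv_dir (pderiv_dir \<phi> b) c p" for n b c
  proof -
    obtain \<sigma> \<tau> where st: "0 < \<sigma>" "\<sigma> < 1" "0 < \<tau>" "\<tau> < 1"
      and eq: "\<phi> (x + s n *\<^sub>R b + s n *\<^sub>R c) - \<phi> (x + s n *\<^sub>R b) - (\<phi> (x + s n *\<^sub>R c) - \<phi> x)
      = pderiv_dir (pderiv_dir \<phi> (s n *\<^sub>R b)) (s n *\<^sub>R c) (x + \<sigma> *\<^sub>R s n *\<^sub>R b + \<tau> *\<^sub>R s n *\<^sub>R c)"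
      using second_difference[OF \<phi>, of x "s n *\<^sub>R b" "s n *\<^sub>R c"] by blast
    have "norm ((x + \<sigma> *\<^sub>R s n *\<^sub>R b + \<tau> *\<^sub>R s n *\<^sub>R c) - x) \<le> norm (\<sigma> *\<^sub>R s n *\<^sub>R b) + norm (\<tau> *\<^sub>R s n *\<^sub>R c)"
      using norm_triangle_ineq[of "\<sigma> *\<^sub>R s n *\<^sub>R b" "\<tau> *\<^sub>R s n *\<^sub>R c"] by (simp add: algebra_simps)
    also have "\<dots> = \<sigma> * (s n * norm b) + \<tau> * (s n * norm c)" using st s(1)[of n] by simp
    also have "\<dots> \<le> 1 * (s n * norm b) + 1 * (s n * norm c)"
      using st s(1)[of n] by (intro add_mono mult_right_mono) auto
    also have "\<dots> = s n * (norm b + norm c)" by (simp add: distrib_left)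
    finally show ?thesis using trans[OF eq scale] by blast
  qed
  have ex1: "\<exists>p q. norm (p - x) \<le> s n * (norm b + norm c) \<and> norm (q - x) \<le> s n * (norm b + norm c) \<and>
      pderiv_dir (pderiv_dir \<phi> b) c p = pderiv_dir (pderiv_dir \<phi> c) b q" for n
  proof -
    obtain p where p: "norm (p - x) \<le> s n * (norm b + norm c)"
      "\<phi> (x + s n *\<^sub>R b + s n *\<^sub>R c) - \<phi> (x + s n *\<^sub>R b) - (\<phi> (x + s n *\<^sub>R c) - \<phi> x)
        = s n * s n * pderiv_dir (pderiv_dir \<phi> b) c p" using ex[where n=n and b=b and c=c] by blast
    obtain q where q: "norm (q - x) \<le> s n * (norm c + norm b)"
      "\<phi> (x + s n *\<^sub>R c + s n *\<^sub>R b) - \<phi> (x + s n *\<^sub>R c) - (\<phi> (x + s n *\<^sub>R b) - \<phi> x)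
        = s n * s n * pderiv_dir (pderiv_dir \<phi> c) b q" using ex[where n=n and b=c and c=b] by blast
    have swap: "x + s n *\<^sub>R c + s n *\<^sub>R b = x + s n *\<^sub>R b + s n *\<^sub>R c" by (simp add: algebra_simps)
    have "s n * s n * pderiv_dir (pderiv_dir \<phi> b) c p = s n * s n * pderiv_dir (pderiv_dir \<phi> c) b q"
      unfolding p(2)[symmetric] q(2)[symmetric] swap by simp
    then show ?thesis using p(1) q(1) s(1)[of n] by (intro exI[of _ p] exI[of _ q]) (auto simp: add.commute)
  qed
  then obtain p q where pq: "\<And>n. norm (p n - x) \<le> s n * (norm b + norm c)"
    "\<And>n. norm (q n - x) \<le> s n * (norm b + norm c)"
    "\<And>n. pderiv_dir (pderiv_dir \<phi> b) c (p n) = pderiv_dir (pderiv_dir \<phi> c) b (q n)" by metis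
  have lim: "r \<longlonglongrightarrow> x" if "\<And>n. norm (r n - x) \<le> s n * (norm b + norm c)" for r
  proof -
    have "(\<lambda>n. r n - x) \<longlonglongrightarrow> 0"
      by (rule Lim_null_comparison[OF _ tendsto_mult_left_zero[OF s0, of "norm b + norm c"]])
         (use that in auto)
    then show ?thesis by (simp add: LIM_zero_iff)
  qed
  have cont: "isCont (pderiv_dir (pderiv_dir \<phi> b) c) x" for b c
    using smooth_continuous[OF smooth_frechet_derivative[OF smooth_frechet_derivative[OF \<phi>]]]
    by (simp add: continuous_on_eq_continuous_at)
  have "(\<lambda>n. pderiv_dir (pderiv_dir \<phi> b) c (p n)) \<longlonglongrightarrow> pderiv_dir (pderiv_dir \<phi> b) c x"
    by (rule isCont_tendsto_compose[OF cont lim]) (rule pq)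
  moreover have "(\<lambda>n. pderiv_dir (pderiv_dir \<phi> c) b (q n)) \<longlonglongrightarrow> pderiv_dir (pderiv_dir \<phi> c) b x"
    by (rule isCont_tendsto_compose[OF cont lim]) (rule pq)
  ultimately show "pderiv_dir (pderiv_dir \<phi> b) c x = pderiv_dir (pderiv_dir \<phi> c) b x"
    using pq(3) LIMSEQ_unique by simp
qed

lemma sqint_components:
  fixes f :: "'a::euclidean_space \<Rightarrow> 'b::euclidean_space"
  assumes "f \<in> L2 \<Omega>"
  shows "sqint \<Omega> f = (\<Sum>b\<in>Basis. sqint \<Omega> (\<lambda>x. f x \<bullet> b))"
proof -
  have "(norm v)\<^sup>2 = (\<Sum>b\<in>Basis. (norm (v \<bullet> b))\<^sup>2)" for v :: 'b
    by (subst power2_norm_eq_inner, subst euclidean_inner) (simp add: power2_eq_square)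
  then have "sqint \<Omega> f = (LINT x|lebesgue_on \<Omega>. (\<Sum>b\<in>Basis. (norm (f x \<bullet> b))\<^sup>2))"
    by (simp add: sqint_def)
  also have "\<dots> = (\<Sum>b\<in>Basis. sqint \<Omega> (\<lambda>x. f x \<bullet> b))"
    unfolding sqint_def by (intro Bochner_Integration.integral_sum L2_int L2_inner assms)
  finally show ?thesis .
qed

lemma L2_lim_components:
  fixes f :: "'a::euclidean_space \<Rightarrow> 'b::euclidean_space"
  assumes "\<And>k. F k \<in> L2 \<Omega>" "f \<in> L2 \<Omega>"
    and lim: "\<And>b. b \<in> Basis \<Longrightarrow> L2_lim \<Omega> (\<lambda>k x. F k x \<bullet> b) (\<lambda>x. f x \<bullet> b)"
  shows "L2_lim \<Omega> F f"
proof -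
  have "(\<lambda>k. \<Sum>b\<in>Basis. sqint \<Omega> (\<lambda>x. F k x \<bullet> b - f x \<bullet> b)) \<longlonglongrightarrow> (\<Sum>b\<in>(Basis::'b set). 0)"
    using lim unfolding L2_lim_def by (intro tendsto_sum)
  moreover have "sqint \<Omega> (\<lambda>x. F k x - f x) = (\<Sum>b\<in>Basis. sqint \<Omega> (\<lambda>x. F k x \<bullet> b - f x \<bullet> b))" for k
    using sqint_components[OF L2_diff[OF assms(1,2)]] by (simp add: inner_diff_left)
  ultimately show ?thesis by (simp add: L2_lim_def)
qed

text \<open>Two integrations by parts and symmetry turn the square of a mixed derivative into the
  product of two pure ones, without boundary terms. Control of the Laplacian in L2 thus controls
  every second derivative, which is the entire regularity estimate needed.\<close>

lemma sqint_hessian: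
  fixes \<phi> :: "'a::euclidean_space \<Rightarrow> real"
  assumes \<phi>: "test_function \<Omega> \<phi>" and \<Omega>: "\<Omega> \<in> sets lebesgue"
  shows "(\<Sum>b\<in>Basis. sqint \<Omega> (gradient (pderiv_dir \<phi> b)))
    = sqint \<Omega> (\<lambda>x. \<Sum>b\<in>Basis. pderiv_dir (pderiv_dir \<phi> b) b x)"
proof -
  note sm = test_smooth[OF \<phi>]
  note t1 = test_frechet[OF \<phi>] note t2 = test_frechet[OF t1]
  note sym = smooth_symmetric_derivatives
  have key: "sqint \<Omega> (pderiv_dir (pderiv_dir \<phi> b) c)
      = ip \<Omega> (pderiv_dir (pderiv_dir \<phi> b) b) (pderiv_dir (pderiv_dir \<phi> c) c)" for b c
  proof -
    have "sqint \<Omega> (pderiv_dir (pderiv_dir \<phi> b) c)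
        = (LINT x|lebesgue_on \<Omega>. pderiv_dir (pderiv_dir \<phi> b) c x * pderiv_dir (pderiv_dir \<phi> b) c x)"
      by (simp add: sqint_def power2_eq_square)
    also have "\<dots> = - (LINT x|lebesgue_on \<Omega>. pderiv_dir \<phi> b x * pderiv_dir (pderiv_dir (pderiv_dir \<phi> b) c) c x)"
      by (rule integration_by_parts_test[OF t1 test_smooth[OF t2] \<Omega>])
    also have "pderiv_dir (pderiv_dir (pderiv_dir \<phi> b) c) c = pderiv_dir (pderiv_dir (pderiv_dir \<phi> c) c) b"
      by (rule trans[OF arg_cong[OF sym[OF sm, of b c], of "\<lambda>f. pderiv_dir f c"] sym[OF test_smooth[OF t1]]])
    also have "- (LINT x|lebesgue_on \<Omega>. pderiv_dir \<phi> b x * pderiv_dir (pderiv_dir (pderiv_dir \<phi> c) c) b x)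
        = (LINT x|lebesgue_on \<Omega>. pderiv_dir (pderiv_dir \<phi> c) c x * pderiv_dir (pderiv_dir \<phi> b) b x)"
      by (rule integration_by_parts_test[OF t1 test_smooth[OF t2] \<Omega>, symmetric])
    finally show ?thesis by (simp add: ip_def mult.commute)
  qed
  note L = test_L2(1)[OF t2 \<Omega>]
  have "(\<Sum>b\<in>Basis. sqint \<Omega> (gradient (pderiv_dir \<phi> b)))
      = (\<Sum>b\<in>Basis. \<Sum>c\<in>Basis. sqint \<Omega> (pderiv_dir (pderiv_dir \<phi> b) c))"
    by (simp add: sqint_components[OF test_L2(2)[OF t1 \<Omega>]] gradient_smooth_inner test_smooth[OF t1])
  also have "\<dots> = (\<Sum>b\<in>Basis. \<Sum>c\<in>Basis. ip \<Omega> (pderiv_dir (pderiv_dir \<phi> b) b) (pderiv_dir (pderiv_dir \<phi> c) c))"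
    by (simp add: key)
  also have "\<dots> = (LINT x|lebesgue_on \<Omega>. (\<Sum>b\<in>Basis. \<Sum>c\<in>Basis.
      pderiv_dir (pderiv_dir \<phi> b) b x \<bullet> pderiv_dir (pderiv_dir \<phi> c) c x))"
    unfolding ip_def using L2_ip_integrable[OF L L]
    by (simp add: Bochner_Integration.integral_sum Bochner_Integration.integrable_sum)
  also have "\<dots> = sqint \<Omega> (\<lambda>x. \<Sum>b\<in>Basis. pderiv_dir (pderiv_dir \<phi> b) b x)"
    by (simp add: sqint_def power2_eq_square sum_product)
  finally show ?thesis .
qed

text \<open>Functions on the domain are total with arbitrary values elsewhere; these must be erased
  before convolving over the whole space.\<close>

definition zext :: "'a set \<Rightarrow> ('a \<Rightarrow> 'b::zero) \<Rightarrow> 'a \<Rightarrow> 'b" where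
  "zext \<Omega> f x = (if x \<in> \<Omega> then f x else 0)"

lemma zext_L2:
  fixes f :: "'a::euclidean_space \<Rightarrow> 'b::euclidean_space"
  assumes \<Omega>: "\<Omega> \<in> sets lebesgue" and f: "f \<in> L2 \<Omega>"
  shows "zext \<Omega> f \<in> L2 UNIV"
proof -
  have "zext \<Omega> f \<in> borel_measurable lebesgue"
    using borel_measurable_if_I[OF L2_meas[OF f] \<Omega>] by (simp add: zext_def[abs_def])
  moreover have "integrable lebesgue (\<lambda>x. (norm (zext \<Omega> f x))\<^sup>2)"
  proof -
    have "integrable (lebesgue_on \<Omega>) (\<lambda>x. (norm (zext \<Omega> f x))\<^sup>2)"
      using L2_int[OF f] by (rule Bochner_Integration.integrable_cong[THEN iffD1, rotated 2]) (auto simp: zext_def)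
    then show ?thesis using integrable_lebesgue_on[OF \<Omega>, of "\<lambda>x. (norm (zext \<Omega> f x))\<^sup>2"] by (auto simp: zext_def)
  qed
  ultimately show ?thesis by (simp add: L2_def)
qed

lemma lint_zext:
  fixes f g :: "'a::euclidean_space \<Rightarrow> real"
  assumes \<Omega>: "\<Omega> \<in> sets lebesgue"
  shows "(LINT x|lebesgue. zext \<Omega> f x * g x) = (LINT x|lebesgue_on \<Omega>. f x * g x)"
proof -
  have "(LINT x|lebesgue. zext \<Omega> f x * g x) = (LINT x|lebesgue_on \<Omega>. zext \<Omega> f x * g x)"
    by (rule lint_lebesgue_on[OF \<Omega>, symmetric]) (simp add: zext_def)
  also have "\<dots> = (LINT x|lebesgue_on \<Omega>. f x * g x)"
    by (rule Bochner_Integration.integral_cong) (auto simp: zext_def)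
  finally show ?thesis .
qed

lemma L2_restrict:
  fixes f :: "'a::euclidean_space \<Rightarrow> 'b::euclidean_space"
  assumes \<Omega>: "\<Omega> \<in> sets lebesgue" and f: "f \<in> L2 UNIV"
  shows "f \<in> L2 \<Omega>" "sqint \<Omega> f \<le> sqint UNIV f"
proof -
  have i: "integrable lebesgue (\<lambda>x. (norm (f x))\<^sup>2)" and m: "f \<in> borel_measurable lebesgue"
    using L2_int[OF f] L2_meas[OF f] by simp_all
  have j: "integrable lebesgue (\<lambda>x. indicator \<Omega> x *\<^sub>R (norm (f x))\<^sup>2)"
    using integrable_mult_indicator[OF \<Omega> i] .
  show "f \<in> L2 \<Omega>"
    using m j \<Omega> by (simp add: L2_def measurable_restrict_space1 integrable_restrict_space)
  have "sqint \<Omega> f = (LINT x|lebesgue. indicator \<Omega> x *\<^sub>R (norm (f x))\<^sup>2)"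
    using \<Omega> unfolding sqint_def by (subst integral_restrict_space) auto
  also have "\<dots> \<le> (LINT x|lebesgue. (norm (f x))\<^sup>2)"
    by (rule integral_mono[OF j i]) (auto simp: indicator_def)
  finally show "sqint \<Omega> f \<le> sqint UNIV f" by (simp add: sqint_def)
qed

lemma L2_lim_restrict:
  fixes f :: "'a::euclidean_space \<Rightarrow> 'b::euclidean_space"
  assumes \<Omega>: "\<Omega> \<in> sets lebesgue" and "L2_lim UNIV F f" "\<And>k. F k \<in> L2 UNIV" "f \<in> L2 UNIV"
  shows "L2_lim \<Omega> F f"
  by (rule L2_lim_le[OF assms(2)[unfolded L2_lim_def]]) (rule L2_restrict(2)[OF \<Omega> L2_diff[OF assms(3,4)]])

text \<open>The derivative is put on the reflected kernel as a function of the integration variable,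
  which flips the sign. In this form it can be moved to \<open>f\<close> by a weak integration by
  parts.\<close>

lemma conv_pderiv:
  assumes f: "integrable lebesgue f"
  shows "pderiv_dir (conv (mollifier k) f) b x
    = - (LINT y|lebesgue. f y * pderiv_dir (\<lambda>y. mollifier k (x - y)) b y)"
proof -
  have "pderiv_dir (conv (mollifier k) f) b x = gradient (conv (mollifier k) f) x \<bullet> b"
    by (simp add: gradient_smooth_inner smooth_conv[OF test_mollifier f])
  also have "\<dots> = (LINT y|lebesgue. f y * (gradient (mollifier k) (x - y) \<bullet> b))"
    using integral_inner_left[OF conv_gradient_integrable[OF test_mollifier[of k] f, of x], of b]
    by (simp add: gradient_conv[OF test_mollifier f])
  also have "(\<lambda>y. f y * (gradient (mollifier k) (x - y) \<bullet> b))
      = (\<lambda>y. - (f y * pderiv_dir (\<lambda>y. mollifier k (x - y)) b y))"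
    by (simp add: gradient_smooth_inner[OF test_smooth[OF test_reflect[OF test_mollifier]], symmetric]
        gradient_reflect test_smooth[OF test_mollifier] fun_eq_iff)
  finally show ?thesis by simp
qed

lemma L2_test_mult:
  assumes u: "u \<in> L2 \<Omega>" and \<eta>: "test_function U \<eta>"
  shows "(\<lambda>x. \<eta> x *\<^sub>R u x) \<in> L2 \<Omega>"
proof -
  obtain C where "\<And>x. \<bar>\<eta> x\<bar> \<le> C" using test_bounded[OF \<eta>] by blast
  then show ?thesis using L2_bounded_scaleR[OF u test_measurable[OF \<eta>]] by blast
qed

lemma L2_test_gradient_mult:
  fixes u :: "'a::euclidean_space \<Rightarrow> real"
  assumes u: "u \<in> L2 \<Omega>" and \<eta>: "test_function U \<eta>"
  shows "(\<lambda>x. u x *\<^sub>R gradient \<eta> x) \<in> L2 \<Omega>"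
proof -
  obtain C where C: "\<And>x. norm (gradient \<eta> x) \<le> C" using test_gradient_bounded[OF \<eta>] by blast
  show ?thesis
  proof (rule L2_bound[OF u, where C=C])
    show "(\<lambda>x. u x *\<^sub>R gradient \<eta> x) \<in> borel_measurable (lebesgue_on \<Omega>)"
      using L2_meas[OF u] test_gradient_measurable[OF \<eta>] by measurable
    show "AE x in lebesgue_on \<Omega>. norm (u x *\<^sub>R gradient \<eta> x) \<le> C * norm (u x)"
      using C by (intro AE_I2) (simp add: mult.commute[of C] mult_left_mono)
  qed
qed

lemma sobolev_pair_ibp:
  assumes "sobolev_pair \<Omega> u G" "test_function \<Omega> \<zeta>"
  shows "(LINT x|lebesgue_on \<Omega>. u x * pderiv_dir \<zeta> b x) = - (LINT x|lebesgue_on \<Omega>. \<zeta> x * (G x \<bullet> b))"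
  using assms by (simp add: sobolev_pair_def ip_def)

text \<open>Weak product rule for \<open>\<eta> * u\<close>. The cutoff supplies the compact
  support, so \<open>\<xi>\<close> may be any smooth function, in particular a reflected mollifier
  centred near or beyond the boundary.\<close>

lemma product_ibp:
  assumes \<Omega>: "\<Omega> \<in> sets lebesgue" and u: "sobolev_pair \<Omega> u G" and \<eta>: "test_function \<Omega> \<eta>" and \<xi>: "smooth_on UNIV \<xi>"
  shows "(LINT x|lebesgue_on \<Omega>. (\<eta> x * u x) * pderiv_dir \<xi> b x)
    = - (LINT x|lebesgue_on \<Omega>. ((\<eta> x *\<^sub>R G x + u x *\<^sub>R gradient \<eta> x) \<bullet> b) * \<xi> x)"
proof -
  note lu = L2_locally_integrable[OF sobolev_pair_L2(1)[OF u] \<Omega>]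
  note lG = locally_integrable_inner[OF L2_locally_integrable[OF sobolev_pair_L2(2)[OF u] \<Omega>], of b]
  have t: "test_function \<Omega> (\<lambda>x. \<xi> x * \<eta> x)" by (rule test_mult_smooth[OF \<eta> \<xi>])
  have i1: "integrable (lebesgue_on \<Omega>) (\<lambda>x. (pderiv_dir \<xi> b x * \<eta> x) * u x)"
    by (intro locally_integrable_test_mult_real[OF lu \<Omega>] test_mult_smooth \<eta> smooth_intros \<xi>)
  have i2: "integrable (lebesgue_on \<Omega>) (\<lambda>x. (\<xi> x * pderiv_dir \<eta> b x) * u x)"
    by (intro locally_integrable_test_mult_real[OF lu \<Omega>] test_mult_smooth test_frechet \<eta> \<xi>)
  have i3: "integrable (lebesgue_on \<Omega>) (\<lambda>x. (\<xi> x * \<eta> x) * (G x \<bullet> b))"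
    by (intro locally_integrable_test_mult_real[OF lG \<Omega>] t)
  have "(LINT x|lebesgue_on \<Omega>. u x * pderiv_dir (\<lambda>x. \<xi> x * \<eta> x) b x)
      = (LINT x|lebesgue_on \<Omega>. (\<xi> x * pderiv_dir \<eta> b x) * u x + (pderiv_dir \<xi> b x * \<eta> x) * u x)"
    unfolding frechet_mult[OF \<xi> test_smooth[OF \<eta>]] by (simp add: algebra_simps)
  then have "(LINT x|lebesgue_on \<Omega>. (\<xi> x * pderiv_dir \<eta> b x) * u x) + (LINT x|lebesgue_on \<Omega>. (pderiv_dir \<xi> b x * \<eta> x) * u x)
      = - (LINT x|lebesgue_on \<Omega>. (\<xi> x * \<eta> x) * (G x \<bullet> b))"
    using i1 i2 sobolev_pair_ibp[OF u t, of b] by simp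
  moreover have "(LINT x|lebesgue_on \<Omega>. ((\<eta> x *\<^sub>R G x + u x *\<^sub>R gradient \<eta> x) \<bullet> b) * \<xi> x)
      = (LINT x|lebesgue_on \<Omega>. (\<xi> x * \<eta> x) * (G x \<bullet> b) + (\<xi> x * pderiv_dir \<eta> b x) * u x)"
    by (simp add: inner_add_left gradient_smooth_inner[OF test_smooth[OF \<eta>]] algebra_simps)
  ultimately show ?thesis using i2 i3 by (simp add: mult_ac)
qed

text \<open>Mollification commutes with differentiation of the extended product, by
  \<open>conv_pderiv\<close> and \<open>product_ibp\<close>. The shift \<open>k0\<close> makes the
  radius small enough for the mollified functions to keep their support in the domain; they are the
  test functions that place \<open>\<eta> * u\<close> in the closure.\<close>

lemma test_localize:
  fixes \<Omega> :: "'a::euclidean_space set"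
  assumes \<Omega>: "open \<Omega>" and u: "sobolev_pair \<Omega> u G" and \<eta>: "test_function \<Omega> \<eta>"
  defines "f \<equiv> zext \<Omega> (\<lambda>x. \<eta> x * u x)" and "W \<equiv> zext \<Omega> (\<lambda>x. \<eta> x *\<^sub>R G x + u x *\<^sub>R gradient \<eta> x)"
  obtains k0 where "f \<in> L2 UNIV" "W \<in> L2 UNIV" "integrable lebesgue f" "\<And>b. integrable lebesgue (\<lambda>x. W x \<bullet> b)"
    "\<And>k. test_function \<Omega> (conv (mollifier (k + k0)) f)"
    "\<And>k b. pderiv_dir (conv (mollifier k) f) b = conv (mollifier k) (\<lambda>x. W x \<bullet> b)"
    "L2_lim \<Omega> (\<lambda>k. conv (mollifier (k + k0)) f) f"
    "\<And>b. L2_lim \<Omega> (\<lambda>k. conv (mollifier (k + k0)) (\<lambda>x. W x \<bullet> b)) (\<lambda>x. W x \<bullet> b)"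
    "L2_lim \<Omega> (\<lambda>k. gradient (conv (mollifier (k + k0)) f)) W"
    "sobolev0_pair \<Omega> f W"
proof -
  have \<Omega>l: "\<Omega> \<in> sets lebesgue" by (rule open_sets_lebesgue[OF \<Omega>])
  obtain K where K: "compact K" "K \<subseteq> \<Omega>" "\<And>x. x \<notin> K \<Longrightarrow> \<eta> x = 0" "\<And>x. x \<notin> K \<Longrightarrow> gradient \<eta> x = 0"
    using test_gradient_support[OF \<eta>] by metis
  note Lu = sobolev_pair_L2[OF u]
  have f: "f \<in> L2 UNIV" unfolding f_def
    using zext_L2[OF \<Omega>l L2_test_mult[OF Lu(1) \<eta>]] by simp
  have W: "W \<in> L2 UNIV" unfolding W_def
    by (intro zext_L2[OF \<Omega>l] L2_add L2_test_mult[OF Lu(2) \<eta>] L2_test_gradient_mult[OF Lu(1) \<eta>])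
  have f0: "f x = 0" if "x \<notin> K" for x using K that by (simp add: f_def zext_def)
  have W0: "W x = 0" if "x \<notin> K" for x using K that by (simp add: W_def zext_def)
  have fi: "integrable lebesgue f" by (rule L2_compact_support_integrable[OF f K(1) f0])
  have Wb: "(\<lambda>x. W x \<bullet> b) \<in> L2 UNIV" for b by (rule L2_inner[OF W])
  have Wi: "integrable lebesgue (\<lambda>x. W x \<bullet> b)" for b
    by (rule L2_compact_support_integrable[OF Wb K(1)]) (simp add: W0)
  obtain k0 where k0: "\<And>k. k \<ge> k0 \<Longrightarrow> (\<Union>x\<in>K. cball x (1 / real (Suc k))) \<subseteq> \<Omega>"
    using eventually_subset_mollifier[OF K(1) \<Omega> K(2)] by blast
  have t: "test_function \<Omega> (conv (mollifier (k + k0)) f)" for k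
    by (rule test_conv[OF fi K(1) f0 k0]) auto
  have D: "pderiv_dir (conv (mollifier k) f) b = conv (mollifier k) (\<lambda>x. W x \<bullet> b)" for k b
  proof
    fix x :: 'a
    let ?\<xi> = "\<lambda>y. mollifier k (x - y)"
    have \<xi>: "smooth_on UNIV ?\<xi>" by (rule test_smooth[OF test_reflect[OF test_mollifier]])
    have "pderiv_dir (conv (mollifier k) f) b x = - (LINT y|lebesgue_on \<Omega>. (\<eta> y * u y) * pderiv_dir ?\<xi> b y)"
      by (simp only: conv_pderiv[OF fi]) (simp only: f_def lint_zext[OF \<Omega>l])
    also have "\<dots> = (LINT y|lebesgue_on \<Omega>. ((\<eta> y *\<^sub>R G y + u y *\<^sub>R gradient \<eta> y) \<bullet> b) * ?\<xi> y)"
      by (simp only: product_ibp[OF \<Omega>l u \<eta> \<xi>] minus_minus)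
    also have "\<dots> = (LINT y|lebesgue. zext \<Omega> (\<lambda>y. (\<eta> y *\<^sub>R G y + u y *\<^sub>R gradient \<eta> y) \<bullet> b) y * ?\<xi> y)"
      by (rule lint_zext[OF \<Omega>l, symmetric])
    also have "\<dots> = conv (mollifier k) (\<lambda>x. W x \<bullet> b) x"
      unfolding conv_def by (rule Bochner_Integration.integral_cong) (auto simp: W_def zext_def)
    finally show "pderiv_dir (conv (mollifier k) f) b x = conv (mollifier k) (\<lambda>x. W x \<bullet> b) x" .
  qed
  have sub: "strict_mono (\<lambda>k. k + k0)" by (simp add: strict_mono_def)
  have l1: "L2_lim \<Omega> (\<lambda>k. conv (mollifier (k + k0)) f) f"
    by (rule L2_lim_restrict[OF \<Omega>l L2_lim_subseq[OF L2_lim_conv[OF f K(1) f0] sub] conv_L2(1)[OF fi f] f])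
  have l2: "L2_lim \<Omega> (\<lambda>k. conv (mollifier (k + k0)) (\<lambda>x. W x \<bullet> b)) (\<lambda>x. W x \<bullet> b)" for b
    by (rule L2_lim_restrict[OF \<Omega>l L2_lim_subseq[OF L2_lim_conv[OF Wb K(1)] sub] conv_L2(1)[OF Wi Wb] Wb])
       (simp add: W0)
  note WL = L2_restrict(1)[OF \<Omega>l W] and fL = L2_restrict(1)[OF \<Omega>l f]
  have l3: "L2_lim \<Omega> (\<lambda>k. gradient (conv (mollifier (k + k0)) f)) W"
    by (rule L2_lim_components[OF test_L2(2)[OF t \<Omega>l] WL])
       (use l2 in \<open>simp add: gradient_smooth_inner test_smooth[OF t] D\<close>)
  have s: "sobolev0_pair \<Omega> f W"
    unfolding sobolev0_pair_def using fL WL t l1 l3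
    by (intro conjI exI[of _ "\<lambda>k. conv (mollifier (k + k0)) f"]) auto
  show ?thesis by (rule that[OF f W fi Wi t D l1 l2 l3 s])
qed

lemma sobolev0_mult_test:
  assumes \<Omega>: "open \<Omega>" and u: "sobolev_pair \<Omega> u G" and \<eta>: "test_function \<Omega> \<eta>"
  shows "sobolev0_pair \<Omega> (\<lambda>x. \<eta> x * u x) (\<lambda>x. \<eta> x *\<^sub>R G x + u x *\<^sub>R gradient \<eta> x)"
proof -
  have \<Omega>l: "\<Omega> \<in> sets lebesgue" by (rule open_sets_lebesgue[OF \<Omega>])
  have "sobolev0_pair \<Omega> (zext \<Omega> (\<lambda>x. \<eta> x * u x)) (zext \<Omega> (\<lambda>x. \<eta> x *\<^sub>R G x + u x *\<^sub>R gradient \<eta> x))"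
    by (rule test_localize[OF assms])
  then show ?thesis
    by (rule sobolev0_AE[OF \<Omega>l]) (auto intro!: AE_I2 simp: zext_def)
qed

section \<open>Chain rule and truncation\<close>

lemma real_derivative_Lipschitz:
  assumes "\<And>t. (\<psi> has_real_derivative \<psi>' t) (at t)" "\<And>t. \<bar>\<psi>' t\<bar> \<le> C"
  shows "\<bar>\<psi> a - \<psi> b\<bar> \<le> C * \<bar>a - b\<bar>"
  using field_differentiable_bound[where S=UNIV and f=\<psi> and f'=\<psi>' and B=C and x=a and y=b] assms by simp

lemma continuous_compose_measurable:
  fixes g :: "real \<Rightarrow> real"
  shows "continuous_on UNIV g \<Longrightarrow> f \<in> borel_measurable M \<Longrightarrow> (\<lambda>x. g (f x)) \<in> borel_measurable M"
  by (rule measurable_compose[OF _ borel_measurable_continuous_onI])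

text \<open>The gradient of \<open>\<psi> (\<phi> k x)\<close> splits into
  \<open>\<psi>' (\<phi> k x)\<close> times \<open>gradient (\<phi> k) x - G x\<close>, which is
  small since \<open>\<psi>'\<close> is bounded, and \<open>\<psi>' (\<phi> k x)\<close> times
  \<open>G x\<close>, which converges by domination. The latter needs pointwise convergence, hence
  the subsequence \<open>r\<close>; \<open>\<psi> 0 = 0\<close> preserves compact supports.\<close>

lemma sobolev0_compose:
  assumes \<Omega>: "\<Omega> \<in> sets lebesgue" and w: "sobolev0_pair \<Omega> w G"
    and \<psi>: "smooth_on UNIV \<psi>" "\<psi> 0 = 0" and D: "\<And>t. (\<psi> has_real_derivative \<psi>' t) (at t)"
    and C: "\<And>t. \<bar>\<psi>' t\<bar> \<le> C" and cont: "continuous_on UNIV \<psi>'"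
  shows "sobolev0_pair \<Omega> (\<lambda>x. \<psi> (w x)) (\<lambda>x. \<psi>' (w x) *\<^sub>R G x)"
proof -
  obtain \<phi>0 where \<phi>0: "\<And>k. test_function \<Omega> (\<phi>0 k)" "L2_lim \<Omega> \<phi>0 w" "L2_lim \<Omega> (\<lambda>k. gradient (\<phi>0 k)) G"
    and L: "w \<in> L2 \<Omega>" "G \<in> L2 \<Omega>" using sobolev0_pairE[OF w] by metis
  obtain r where r: "strict_mono r" "AE x in lebesgue_on \<Omega>. (\<lambda>k. \<phi>0 (r k) x) \<longlonglongrightarrow> w x"
    using L2_lim_AE_subseq[OF \<phi>0(2) test_L2(1)[OF \<phi>0(1) \<Omega>] L(1)] by blast
  define \<phi> where "\<phi> k = \<phi>0 (r k)" for k
  have \<phi>: "test_function \<Omega> (\<phi> k)" for k by (simp add: \<phi>_def \<phi>0)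
  note T = test_L2[OF \<phi> \<Omega>]
  have l1: "L2_lim \<Omega> \<phi> w" using L2_lim_subseq[OF \<phi>0(2) r(1)] by (simp add: \<phi>_def[abs_def])
  have l2: "L2_lim \<Omega> (\<lambda>k. gradient (\<phi> k)) G"
    using L2_lim_subseq[OF \<phi>0(3) r(1)] by (simp add: \<phi>_def[abs_def])
  have ae: "AE x in lebesgue_on \<Omega>. (\<lambda>k. \<phi> k x) \<longlonglongrightarrow> w x" using r(2) by (simp add: \<phi>_def)
  note Lip = real_derivative_Lipschitz[OF D C]
  have cpsi: "continuous_on UNIV \<psi>" by (rule smooth_continuous[OF \<psi>(1)])
  have \<psi>wL: "(\<lambda>x. \<psi> (w x)) \<in> L2 \<Omega>"
    by (rule L2_bound[OF L(1) continuous_compose_measurable[OF cpsi L2_meas[OF L(1)]], where C=C])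
       (use Lip[of _ 0] \<psi>(2) in auto)
  have m\<psi>': "(\<lambda>x. \<psi>' (w x)) \<in> borel_measurable (lebesgue_on \<Omega>)"
    by (rule continuous_compose_measurable[OF cont L2_meas[OF L(1)]])
  have m\<psi>k: "(\<lambda>x. \<psi>' (\<phi> k x)) \<in> borel_measurable (lebesgue_on \<Omega>)" for k
    by (rule continuous_compose_measurable[OF cont L2_meas[OF T(1)]])
  have \<psi>'G: "(\<lambda>x. \<psi>' (w x) *\<^sub>R G x) \<in> L2 \<Omega>" by (rule L2_bounded_scaleR[OF L(2) m\<psi>' C])
  have t: "test_function \<Omega> (\<lambda>x. \<psi> (\<phi> k x))" for k by (rule test_compose[OF \<phi> \<psi>])
  have "L2_lim \<Omega> (\<lambda>k x. \<psi> (\<phi> k x)) (\<lambda>x. \<psi> (w x))"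
    by (rule L2_lim_bound[OF l1 T(1) L(1) test_L2(1)[OF t \<Omega>] \<psi>wL, where C=C]) (simp add: Lip)
  moreover have "L2_lim \<Omega> (\<lambda>k. gradient (\<lambda>x. \<psi> (\<phi> k x))) (\<lambda>x. \<psi>' (w x) *\<^sub>R G x)"
  proof -
    have g: "gradient (\<lambda>x. \<psi> (\<phi> k x)) = (\<lambda>x. \<psi>' (\<phi> k x) *\<^sub>R (gradient (\<phi> k) x - G x) + \<psi>' (\<phi> k x) *\<^sub>R G x)" for k
      by (rule ext) (simp add: gradient_compose[OF test_smooth[OF \<phi>] D] scaleR_diff_right)
    have h1: "(\<lambda>x. \<psi>' (\<phi> k x) *\<^sub>R (gradient (\<phi> k) x - G x)) \<in> L2 \<Omega>" for k
      by (rule L2_bounded_scaleR[OF L2_diff[OF T(2) L(2)] m\<psi>k C])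
    have h2: "(\<lambda>x. \<psi>' (\<phi> k x) *\<^sub>R G x) \<in> L2 \<Omega>" for k by (rule L2_bounded_scaleR[OF L(2) m\<psi>k C])
    have "L2_lim \<Omega> (\<lambda>k x. \<psi>' (\<phi> k x) *\<^sub>R (gradient (\<phi> k) x - G x)) (\<lambda>x. 0)"
      by (rule L2_lim_bound[OF l2 T(2) L(2) h1 L2_zero, where C=C])
         (auto intro!: AE_I2 mult_right_mono C)
    moreover have "L2_lim \<Omega> (\<lambda>k x. \<psi>' (\<phi> k x) *\<^sub>R G x) (\<lambda>x. \<psi>' (w x) *\<^sub>R G x)"
    proof (rule L2_lim_dominated[OF L2_meas[OF h2] L2_meas[OF \<psi>'G]])
      show "integrable (lebesgue_on \<Omega>) (\<lambda>x. (2 * C)\<^sup>2 * (norm (G x))\<^sup>2)" using L2_int[OF L(2)] by simp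
      show "AE x in lebesgue_on \<Omega>. (norm (\<psi>' (\<phi> k x) *\<^sub>R G x - \<psi>' (w x) *\<^sub>R G x))\<^sup>2 \<le> (2 * C)\<^sup>2 * (norm (G x))\<^sup>2" for k
      proof (rule AE_I2)
        fix x
        have "\<bar>\<psi>' (\<phi> k x) - \<psi>' (w x)\<bar> \<le> 2 * C" using C[of "\<phi> k x"] C[of "w x"] by linarith
        then have "norm (\<psi>' (\<phi> k x) *\<^sub>R G x - \<psi>' (w x) *\<^sub>R G x) \<le> 2 * C * norm (G x)"
          by (simp add: scaleR_diff_left[symmetric] mult_right_mono)
        from power_mono[OF this norm_ge_zero, of 2]
        show "(norm (\<psi>' (\<phi> k x) *\<^sub>R G x - \<psi>' (w x) *\<^sub>R G x))\<^sup>2 \<le> (2 * C)\<^sup>2 * (norm (G x))\<^sup>2"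
          by (simp add: power_mult_distrib)
      qed
      show "AE x in lebesgue_on \<Omega>. (\<lambda>k. \<psi>' (\<phi> k x) *\<^sub>R G x) \<longlonglongrightarrow> \<psi>' (w x) *\<^sub>R G x"
        using ae
      proof eventually_elim
        fix x assume "(\<lambda>k. \<phi> k x) \<longlonglongrightarrow> w x"
        moreover have "isCont \<psi>' (w x)" using cont by (simp add: continuous_on_eq_continuous_at)
        ultimately show "(\<lambda>k. \<psi>' (\<phi> k x) *\<^sub>R G x) \<longlonglongrightarrow> \<psi>' (w x) *\<^sub>R G x"
          by (intro tendsto_scaleR tendsto_const) (rule isCont_tendsto_compose)
      qed
    qed
    ultimately show ?thesis unfolding g
      using L2_lim_add[OF _ _ h1 h2 L2_zero \<psi>'G] by fastforce
  qed
  ultimately show ?thesis unfolding sobolev0_pair_def using \<psi>wL \<psi>'G t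
    by (intro conjI exI[of _ "\<lambda>k x. \<psi> (\<phi> k x)"]) auto
qed

lemma L2_lim_pointwise_dominated:
  assumes F: "\<And>k. F k \<in> borel_measurable (lebesgue_on \<Omega>)" and f: "f \<in> borel_measurable (lebesgue_on \<Omega>)"
    and g: "g \<in> L2 \<Omega>" and le: "\<And>k x. norm (F k x) \<le> norm (g x)" "\<And>x. norm (f x) \<le> norm (g x)"
    and lim: "\<And>x. (\<lambda>k. F k x) \<longlonglongrightarrow> f x"
  shows "L2_lim \<Omega> F f"
proof (rule L2_lim_dominated[OF F f])
  show "integrable (lebesgue_on \<Omega>) (\<lambda>x. 4 * (norm (g x))\<^sup>2)" using L2_int[OF g] by simp
  show "AE x in lebesgue_on \<Omega>. (norm (F k x - f x))\<^sup>2 \<le> 4 * (norm (g x))\<^sup>2" for k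
  proof (rule AE_I2)
    fix x
    have "norm (F k x - f x) \<le> 2 * norm (g x)"
      using norm_triangle_ineq4[of "F k x" "f x"] le(1)[of k x] le(2)[of x] by linarith
    from power_mono[OF this norm_ge_zero, of 2] show "(norm (F k x - f x))\<^sup>2 \<le> 4 * (norm (g x))\<^sup>2" 
      by (simp add: power_mult_distrib)
  qed
qed (use lim in auto)

lemma inverse_Suc_tendsto_0: "(\<lambda>k. 1 / real (Suc k)) \<longlonglongrightarrow> 0"
  by (rule LIMSEQ_Suc[OF lim_1_over_n])

lemma sobolev0_zero: "\<Omega> \<in> sets lebesgue \<Longrightarrow> sobolev0_pair \<Omega> (\<lambda>x. 0) (\<lambda>x. 0)"
proof -
  assume "\<Omega> \<in> sets lebesgue"
  moreover have "gradient (\<lambda>x. 0) = (\<lambda>x::'a. 0)" by (rule ext, rule gradient_eqI) simp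
  ultimately show ?thesis using sobolev0_test[OF test_zero] by metis
qed

text \<open>The functions \<open>\<delta> arctan (t/\<delta>)\<close> tend to 0 as \<open>\<delta> \<rightarrow> 0\<close>, but their derivatives tend to the indicator
  of \<open>{0}\<close>. Hence \<open>G\<close>, restricted to the zero set of \<open>w\<close>, is a weak gradient of 0.\<close>

lemma sobolev0_gradient_zero_set:
  assumes \<Omega>: "open \<Omega>" and w: "sobolev0_pair \<Omega> w G"
  shows "AE x in lebesgue_on \<Omega>. w x = 0 \<longrightarrow> G x = 0"
proof -
  have \<Omega>l: "\<Omega> \<in> sets lebesgue" by (rule open_sets_lebesgue[OF \<Omega>])
  note L = sobolev0_pair_L2[OF w]
  have [measurable]: "w \<in> borel_measurable (lebesgue_on \<Omega>)" "G \<in> borel_measurable (lebesgue_on \<Omega>)"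
    using L L2_meas by blast+
  define \<psi> where "\<psi> k t = (1 / real (Suc k)) * arctan (real (Suc k) * t)" for k t
  define \<psi>' where "\<psi>' k t = inverse (1 + (real (Suc k) * t)\<^sup>2)" for k t
  have nz: "1 + (real (Suc k) * t)\<^sup>2 \<noteq> 0" for k t
    using zero_le_power2[of "real (Suc k) * t"] by linarith
  have D: "(\<psi> k has_real_derivative \<psi>' k t) (at t)" for k t
    unfolding \<psi>_def \<psi>'_def
    by (auto intro!: derivative_eq_intros simp: inverse_eq_divide simp del: of_nat_Suc)
  have b: "\<bar>\<psi>' k t\<bar> \<le> 1" for k t unfolding \<psi>'_def
    by (simp add: inverse_le_1_iff)
  have c: "continuous_on UNIV (\<psi>' k)" for k unfolding \<psi>'_def
    by (intro continuous_intros) (use nz in auto)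
  have sm: "smooth_on UNIV (\<psi> k)" for k unfolding \<psi>_def by (intro smooth_intros)
  have s: "sobolev0_pair \<Omega> (\<lambda>x. \<psi> k (w x)) (\<lambda>x. \<psi>' k (w x) *\<^sub>R G x)" for k
    by (rule sobolev0_compose[OF \<Omega>l w sm _ D b c]) (simp add: \<psi>_def)
  note Ls = sobolev0_pair_L2[OF s]
  let ?H = "\<lambda>x. indicator {0} (w x) *\<^sub>R G x"
  have mH: "?H \<in> borel_measurable (lebesgue_on \<Omega>)" by measurable
  have HL: "?H \<in> L2 \<Omega>" by (rule L2_bound[OF L(2) mH, where C=1]) (auto simp: indicator_def)
  have "sobolev0_pair \<Omega> (\<lambda>x. 0) ?H"
  proof (rule sobolev0_closed[OF \<Omega>l s _ _ L2_zero HL])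
    show "L2_lim \<Omega> (\<lambda>k x. \<psi> k (w x)) (\<lambda>x. 0)"
    proof (rule L2_lim_pointwise_dominated[OF L2_meas[OF Ls(1)] _ L(1)])
      show "norm (\<psi> k (w x)) \<le> norm (w x)" for k x
        using real_derivative_Lipschitz[OF D[of k] b[of k], of "w x" 0] by (simp add: \<psi>_def)
      show "(\<lambda>k. \<psi> k (w x)) \<longlonglongrightarrow> 0" for x
      proof (rule Lim_null_comparison[OF _ tendsto_mult_left_zero[OF inverse_Suc_tendsto_0, of "pi/2"]], rule always_eventually, rule allI)
        fix k
        have "\<bar>arctan (real (Suc k) * w x)\<bar> \<le> pi / 2" using arctan_bounded[of "real (Suc k) * w x"] by linarith
        from mult_left_mono[OF this, of "1 / real (Suc k)"] show "norm (\<psi> k (w x)) \<le> 1 / real (Suc k) * (pi / 2)"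
          unfolding \<psi>_def by (simp add: abs_mult del: of_nat_Suc)
      qed
    qed auto
    show "L2_lim \<Omega> (\<lambda>k x. \<psi>' k (w x) *\<^sub>R G x) ?H"
    proof (rule L2_lim_pointwise_dominated[OF L2_meas[OF Ls(2)] mH L(2)])
      show "norm (\<psi>' k (w x) *\<^sub>R G x) \<le> norm (G x)" for k x
        using mult_right_mono[OF b[of k "w x"], of "norm (G x)"] by simp
      show "norm (?H x) \<le> norm (G x)" for x by (auto simp: indicator_def)
      show "(\<lambda>k. \<psi>' k (w x) *\<^sub>R G x) \<longlonglongrightarrow> ?H x" for x
      proof (cases "w x = 0")
        case True
        then show ?thesis by (simp add: \<psi>'_def)
      next
        case False
        have "filterlim (\<lambda>k. real (Suc k)) at_top sequentially"
          by (rule filterlim_compose[OF filterlim_real_sequentially filterlim_Suc])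
        then have "filterlim (\<lambda>k. (w x)\<^sup>2 * real (Suc k)) at_top sequentially"
          using False by (intro filterlim_tendsto_pos_mult_at_top[OF tendsto_const]) auto
        then have "filterlim (\<lambda>k. 1 + (real (Suc k) * w x)\<^sup>2) at_top sequentially"
        proof (rule filterlim_at_top_mono, intro always_eventually allI)
          fix k
          have "real (Suc k) \<le> (real (Suc k))\<^sup>2" by (simp add: power2_eq_square)
          then have "(w x)\<^sup>2 * real (Suc k) \<le> (w x)\<^sup>2 * (real (Suc k))\<^sup>2" by (intro mult_left_mono) auto
          then show "(w x)\<^sup>2 * real (Suc k) \<le> 1 + (real (Suc k) * w x)\<^sup>2"
            by (simp only: power_mult_distrib mult.commute[of "(real (Suc k))\<^sup>2"])
        qed
        then have "(\<lambda>k. \<psi>' k (w x)) \<longlonglongrightarrow> 0" unfolding \<psi>'_def by (rule tendsto_inverse_0_at_top)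
        then have "(\<lambda>k. \<psi>' k (w x) *\<^sub>R G x) \<longlonglongrightarrow> 0 *\<^sub>R G x" by (intro tendsto_intros)
        then show ?thesis using False by simp
      qed
    qed
  qed
  from sobolev_pair_unique[OF \<Omega> sobolev0_imp_sobolev[OF \<Omega>l this] sobolev0_imp_sobolev[OF \<Omega>l sobolev0_zero[OF \<Omega>l]]]
  have "AE x in lebesgue_on \<Omega>. ?H x = 0" by simp
  then show ?thesis by eventually_elim (auto simp: indicator_def)
qed

text \<open>The positive part is the limit of \<open>\<psi> k\<close>, a smoothed half of
  \<open>\<bar>t\<bar> + t\<close>, shifted by \<open>d k\<close> to vanish at 0. At
  \<open>t = 0\<close> every \<open>\<psi>' k\<close> equals 1/2, so the limit gradient retains
  \<open>(1/2) *\<^sub>R G\<close> on the zero set of \<open>w\<close>; this is discarded because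
  \<open>G\<close> vanishes there a.e.\<close>

lemma sobolev0_pos_part:
  assumes \<Omega>: "open \<Omega>" and w: "sobolev0_pair \<Omega> w G"
  shows "sobolev0_pair \<Omega> (\<lambda>x. max (w x) 0) (\<lambda>x. indicator {0<..} (w x) *\<^sub>R G x)"
proof -
  have \<Omega>l: "\<Omega> \<in> sets lebesgue" by (rule open_sets_lebesgue[OF \<Omega>])
  note L = sobolev0_pair_L2[OF w]
  have [measurable]: "w \<in> borel_measurable (lebesgue_on \<Omega>)" "G \<in> borel_measurable (lebesgue_on \<Omega>)"
    using L L2_meas by blast+
  define d where "d k = 1 / real (Suc k)" for k
  have d: "d k > 0" for k by (simp add: d_def)
  have d0: "d \<longlonglongrightarrow> 0" unfolding d_def by (rule inverse_Suc_tendsto_0)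
  define \<psi> where "\<psi> k t = (1/2) * (sqrt (t * t + d k * d k) - d k + t)" for k t
  define \<psi>' where "\<psi>' k t = (1/2) * (t / sqrt (t * t + d k * d k) + 1)" for k t
  have pos: "t * t + d k * d k > 0" for t k using d[of k] by (simp add: add_nonneg_pos)
  have D: "(\<psi> k has_real_derivative \<psi>' k t) (at t)" for k t
    unfolding \<psi>_def \<psi>'_def using pos[of t k]
    by (auto intro!: derivative_eq_intros simp: field_simps)
  have b: "\<bar>\<psi>' k t\<bar> \<le> 1" for k t
  proof -
    have "\<bar>t\<bar> = sqrt (t * t)" by simp
    also have "\<dots> \<le> sqrt (t * t + d k * d k)" by (intro real_sqrt_le_mono) simp
    finally have "\<bar>t / sqrt (t * t + d k * d k)\<bar> \<le> 1" using pos[of t k] by (simp add: divide_le_eq)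
    moreover have "\<bar>(1/2) * (q + 1)\<bar> \<le> 1" if "\<bar>q\<bar> \<le> 1" for q :: real using that by (auto simp: abs_le_iff)
    ultimately show ?thesis unfolding \<psi>'_def by blast
  qed
  have c: "continuous_on UNIV (\<psi>' k)" for k unfolding \<psi>'_def
    by (intro continuous_intros) (metis less_irrefl pos real_sqrt_eq_zero_cancel_iff)
  have sm: "smooth_on UNIV (\<psi> k)" for k unfolding \<psi>_def by (intro smooth_intros pos)
  have s: "sobolev0_pair \<Omega> (\<lambda>x. \<psi> k (w x)) (\<lambda>x. \<psi>' k (w x) *\<^sub>R G x)" for k
    by (rule sobolev0_compose[OF \<Omega>l w sm _ D b c]) (use d[of k] in \<open>simp add: \<psi>_def\<close>)
  note Ls = sobolev0_pair_L2[OF s]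
  let ?m = "\<lambda>x. max (w x) 0"
  let ?H = "\<lambda>x. (indicator {0<..} (w x) + (1/2) * indicator {0} (w x)) *\<^sub>R G x"
  have mm: "?m \<in> borel_measurable (lebesgue_on \<Omega>)" by measurable
  have mH: "?H \<in> borel_measurable (lebesgue_on \<Omega>)" by measurable
  have mL: "?m \<in> L2 \<Omega>" by (rule L2_bound[OF L(1) mm, where C=1]) auto
  have HL: "?H \<in> L2 \<Omega>" by (rule L2_bound[OF L(2) mH, where C=1]) (auto simp: indicator_def)
  have lim: "(\<lambda>k. sqrt (t * t + d k * d k)) \<longlonglongrightarrow> \<bar>t\<bar>" for t
  proof -
    have "(\<lambda>k. sqrt (t * t + d k * d k)) \<longlonglongrightarrow> sqrt (t * t + 0 * 0)" by (intro tendsto_intros d0)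
    then show ?thesis by simp
  qed
  have "sobolev0_pair \<Omega> ?m ?H"
  proof (rule sobolev0_closed[OF \<Omega>l s _ _ mL HL])
    show "L2_lim \<Omega> (\<lambda>k x. \<psi> k (w x)) ?m"
    proof (rule L2_lim_pointwise_dominated[OF L2_meas[OF Ls(1)] mm L(1)])
      show "norm (\<psi> k (w x)) \<le> norm (w x)" for k x
        using real_derivative_Lipschitz[OF D[of k] b[of k], of "w x" 0] d[of k] by (simp add: \<psi>_def)
      show "norm (?m x) \<le> norm (w x)" for x by auto
      show "(\<lambda>k. \<psi> k (w x)) \<longlonglongrightarrow> ?m x" for x
      proof -
        have "(\<lambda>k. \<psi> k (w x)) \<longlonglongrightarrow> (1/2) * (\<bar>w x\<bar> - 0 + w x)"
          unfolding \<psi>_def by (intro tendsto_intros lim d0)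
        moreover have "(1/2) * (\<bar>w x\<bar> - 0 + w x) = ?m x" by auto
        ultimately show ?thesis by simp
      qed
    qed
    show "L2_lim \<Omega> (\<lambda>k x. \<psi>' k (w x) *\<^sub>R G x) ?H"
    proof (rule L2_lim_pointwise_dominated[OF L2_meas[OF Ls(2)] mH L(2)])
      show "norm (\<psi>' k (w x) *\<^sub>R G x) \<le> norm (G x)" for k x
        using mult_right_mono[OF b[of k "w x"], of "norm (G x)"] by simp
      show "norm (?H x) \<le> norm (G x)" for x by (auto simp: indicator_def)
      show "(\<lambda>k. \<psi>' k (w x) *\<^sub>R G x) \<longlonglongrightarrow> ?H x" for x
      proof (cases "w x = 0")
        case True
        then show ?thesis by (simp add: \<psi>'_def)
      next
        case False
        then have "(\<lambda>k. \<psi>' k (w x) *\<^sub>R G x) \<longlonglongrightarrow> ((1/2) * (w x / \<bar>w x\<bar> + 1)) *\<^sub>R G x"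
          unfolding \<psi>'_def by (intro tendsto_intros lim) auto
        moreover have "(1/2) * (w x / \<bar>w x\<bar> + 1) = indicator {0<..} (w x) + (1/2) * indicator {0} (w x)"
          using False by (auto simp: indicator_def abs_if)
        ultimately show ?thesis by (simp only:)
      qed
    qed
  qed
  then show ?thesis
  proof (rule sobolev0_AE[OF \<Omega>l])
    show "AE x in lebesgue_on \<Omega>. ?H x = indicator {0<..} (w x) *\<^sub>R G x"
      using sobolev0_gradient_zero_set[OF \<Omega> w] by eventually_elim (auto simp: indicator_def)
  qed simp
qed

text \<open>Interior \<open>W\<^sup>2\<^sup>,\<^sup>2\<close> regularity: the mollified, localised solution converges in \<open>W\<^sup>2\<^sup>,\<^sup>2\<close> by
  \<open>sqint_hessian\<close>, so that the gradient, and then the second derivatives, vanish a.e. on the zero set.\<close>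

lemma laplacian_zero_set:
  fixes \<Omega> :: "'a::euclidean_space set"
  assumes \<Omega>: "open \<Omega>" and u: "sobolev_pair \<Omega> u G" and h: "h \<in> L2 \<Omega>"
    and eq: "\<And>\<phi>. test_function \<Omega> \<phi> \<Longrightarrow> ip \<Omega> G (gradient \<phi>) = - ip \<Omega> h \<phi>"
  shows "AE x in lebesgue_on \<Omega>. u x = 0 \<longrightarrow> h x = 0"
proof (rule AE_cover_test[OF \<Omega>])
  fix \<eta> assume \<eta>: "test_function \<Omega> \<eta>"
  have \<Omega>l: "\<Omega> \<in> sets lebesgue" by (rule open_sets_lebesgue[OF \<Omega>])
  note Lu = sobolev_pair_L2[OF u]
  define lap\<eta> where "lap\<eta> x = (\<Sum>b\<in>Basis. pderiv_dir (pderiv_dir \<eta> b) b x)" for x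
  let ?f = "zext \<Omega> (\<lambda>x. \<eta> x * u x)"
  let ?W = "zext \<Omega> (\<lambda>x. \<eta> x *\<^sub>R G x + u x *\<^sub>R gradient \<eta> x)"
  \<comment> \<open>The Laplacian of \<open>\<eta> * u\<close> by the product rule, where
    \<open>h\<close> plays the part of the Laplacian of \<open>u\<close>.\<close>
  let ?FF = "\<lambda>x. \<eta> x * h x + 2 * (\<Sum>b\<in>Basis. pderiv_dir \<eta> b x * (G x \<bullet> b)) + lap\<eta> x * u x"
  let ?F = "zext \<Omega> ?FF"
  obtain k0 where f: "?f \<in> L2 UNIV" and W: "?W \<in> L2 UNIV" and fi: "integrable lebesgue ?f"
    and Wi: "\<And>b. integrable lebesgue (\<lambda>x. ?W x \<bullet> b)"
    and t: "\<And>k. test_function \<Omega> (conv (mollifier (k + k0)) ?f)"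
    and D: "\<And>k b. pderiv_dir (conv (mollifier k) ?f) b = conv (mollifier k) (\<lambda>x. ?W x \<bullet> b)"
    and l1: "L2_lim \<Omega> (\<lambda>k. conv (mollifier (k + k0)) ?f) ?f"
    and l2: "\<And>b. L2_lim \<Omega> (\<lambda>k. conv (mollifier (k + k0)) (\<lambda>x. ?W x \<bullet> b)) (\<lambda>x. ?W x \<bullet> b)"
    and l3: "L2_lim \<Omega> (\<lambda>k. gradient (conv (mollifier (k + k0)) ?f)) ?W"
    and s0: "sobolev0_pair \<Omega> ?f ?W"
    apply (rule test_localize[OF \<Omega> u \<eta>])
    subgoal premises prems for k0 by (rule prems(1)[OF prems(2-)])
    done
  obtain K where K: "compact K" "K \<subseteq> \<Omega>" "\<And>x. x \<notin> K \<Longrightarrow> \<eta> x = 0"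
    using test_functionE[OF \<eta>] by metis
  have \<eta>K: "test_function K \<eta>" by (rule test_functionI[OF test_smooth[OF \<eta>] K(1) order_refl K(3)])
  have tlap: "test_function \<Omega> lap\<eta>" unfolding lap\<eta>_def
    by (rule test_sum) (auto intro: test_frechet \<eta>)
  have tlapK: "test_function K lap\<eta>" unfolding lap\<eta>_def
    by (rule test_sum) (auto intro: test_frechet \<eta>K)
  have \<eta>G: "(\<lambda>x. pderiv_dir \<eta> b x * (G x \<bullet> b)) \<in> L2 \<Omega>" for b
    using L2_test_mult[OF L2_inner[OF Lu(2)] test_frechet[OF \<eta>], of b b] by simp
  have F0: "?FF \<in> L2 \<Omega>"
    using L2_test_mult[OF h \<eta>] L2_test_mult[OF Lu(1) tlap] by (intro L2_add L2_cmult L2_sum \<eta>G) auto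
  have F: "?F \<in> L2 UNIV" by (rule zext_L2[OF \<Omega>l F0])
  have FK: "?F x = 0" if "x \<notin> K" for x
    using that K(3) test_outside[OF tlapK that] test_outside[OF test_frechet[OF \<eta>K] that] by (simp add: zext_def)
  have Fi: "integrable lebesgue ?F" by (rule L2_compact_support_integrable[OF F K(1) FK])
  note lu = L2_locally_integrable[OF Lu(1) \<Omega>l]
  note lG = locally_integrable_inner[OF L2_locally_integrable[OF Lu(2) \<Omega>l]]
  note lh = L2_locally_integrable[OF h \<Omega>l]
  \<comment> \<open>States that the divergence of \<open>?W\<close> is \<open>?F\<close>, tested
    with smooth functions of arbitrary support so that reflected mollifiers can be inserted.\<close>
  have weak: "(\<Sum>b\<in>Basis. LINT x|lebesgue. (?W x \<bullet> b) * pderiv_dir \<xi> b x) = - (LINT x|lebesgue. ?F x * \<xi> x)"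
    if \<xi>: "smooth_on UNIV \<xi>" for \<xi>
  proof -
    let ?I = "\<lambda>f. LINT x|lebesgue_on \<Omega>. f x"
    have t\<zeta>: "test_function \<Omega> (\<lambda>x. \<xi> x * \<eta> x)" by (rule test_mult_smooth[OF \<eta> \<xi>])
    have t\<zeta>b: "test_function \<Omega> (\<lambda>x. \<xi> x * pderiv_dir \<eta> b x)" for b
      by (intro test_mult_smooth test_frechet \<eta> \<xi>)
    have i1: "integrable (lebesgue_on \<Omega>) (\<lambda>x. (pderiv_dir \<xi> b x * \<eta> x) * (G x \<bullet> b))" for b
      by (intro locally_integrable_test_mult_real[OF lG \<Omega>l] test_mult_smooth \<eta> smooth_intros \<xi>)
    have i2: "integrable (lebesgue_on \<Omega>) (\<lambda>x. (\<xi> x * pderiv_dir \<eta> b x) * (G x \<bullet> b))" for b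
      by (intro locally_integrable_test_mult_real[OF lG \<Omega>l] t\<zeta>b)
    have i3: "integrable (lebesgue_on \<Omega>) (\<lambda>x. (\<xi> x * \<eta> x) * h x)"
      by (intro locally_integrable_test_mult_real[OF lh \<Omega>l] t\<zeta>)
    have i4: "integrable (lebesgue_on \<Omega>) (\<lambda>x. (pderiv_dir \<xi> b x * pderiv_dir \<eta> b x) * u x)" for b
      by (intro locally_integrable_test_mult_real[OF lu \<Omega>l] test_mult_smooth test_frechet \<eta> smooth_intros \<xi>)
    have i5: "integrable (lebesgue_on \<Omega>) (\<lambda>x. (\<xi> x * pderiv_dir (pderiv_dir \<eta> b) b x) * u x)" for b
      by (intro locally_integrable_test_mult_real[OF lu \<Omega>l] test_mult_smooth test_frechet \<eta> \<xi>)
    have e1: "(\<Sum>b\<in>Basis. ?I (\<lambda>x. (pderiv_dir \<xi> b x * \<eta> x) * (G x \<bullet> b)))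
        + (\<Sum>b\<in>Basis. ?I (\<lambda>x. (\<xi> x * pderiv_dir \<eta> b x) * (G x \<bullet> b))) = - ?I (\<lambda>x. (\<xi> x * \<eta> x) * h x)"
    proof -
      have "ip \<Omega> G (gradient (\<lambda>x. \<xi> x * \<eta> x)) = ?I (\<lambda>x. \<Sum>b\<in>Basis.
          (pderiv_dir \<xi> b x * \<eta> x) * (G x \<bullet> b) + (\<xi> x * pderiv_dir \<eta> b x) * (G x \<bullet> b))"
        unfolding ip_def
        by (subst euclidean_inner)
           (simp add: gradient_smooth_inner[OF test_smooth[OF t\<zeta>]] frechet_mult[OF \<xi> test_smooth[OF \<eta>]],
            simp add: algebra_simps)
      also have "\<dots> = (\<Sum>b\<in>Basis. ?I (\<lambda>x. (pderiv_dir \<xi> b x * \<eta> x) * (G x \<bullet> b)))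
        + (\<Sum>b\<in>Basis. ?I (\<lambda>x. (\<xi> x * pderiv_dir \<eta> b x) * (G x \<bullet> b)))"
        using i1 i2 by (simp add: Bochner_Integration.integral_sum sum.distrib)
      finally show ?thesis using eq[OF t\<zeta>] by (simp add: ip_def mult_ac)
    qed
    \<comment> \<open>The product of \<open>u\<close> with derivatives of \<open>\<eta>\<close> and
      \<open>\<xi>\<close> is integrated by parts once more. This yields the Laplacian of
      \<open>\<eta>\<close> and the second copy of the mixed term, hence the factor 2 in
      \<open>?FF\<close>.\<close>
    have e2: "?I (\<lambda>x. (pderiv_dir \<xi> b x * pderiv_dir \<eta> b x) * u x)
        = - ?I (\<lambda>x. (\<xi> x * pderiv_dir (pderiv_dir \<eta> b) b x) * u x) - ?I (\<lambda>x. (\<xi> x * pderiv_dir \<eta> b x) * (G x \<bullet> b))" for b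
    proof -
      have "?I (\<lambda>x. u x * pderiv_dir (\<lambda>x. \<xi> x * pderiv_dir \<eta> b x) b x)
          = ?I (\<lambda>x. (\<xi> x * pderiv_dir (pderiv_dir \<eta> b) b x) * u x + (pderiv_dir \<xi> b x * pderiv_dir \<eta> b x) * u x)"
        unfolding frechet_mult[OF \<xi> test_smooth[OF test_frechet[OF \<eta>]]] by (simp add: algebra_simps)
      also have "\<dots> = ?I (\<lambda>x. (\<xi> x * pderiv_dir (pderiv_dir \<eta> b) b x) * u x)
          + ?I (\<lambda>x. (pderiv_dir \<xi> b x * pderiv_dir \<eta> b x) * u x)"
        by (rule Bochner_Integration.integral_add[OF i5 i4])
      finally show ?thesis using sobolev_pair_ibp[OF u t\<zeta>b, of b b] by simp
    qed
    have "(LINT x|lebesgue. (?W x \<bullet> b) * pderiv_dir \<xi> b x)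
        = ?I (\<lambda>x. (pderiv_dir \<xi> b x * \<eta> x) * (G x \<bullet> b)) + ?I (\<lambda>x. (pderiv_dir \<xi> b x * pderiv_dir \<eta> b x) * u x)" for b
    proof -
      have "(\<lambda>x. ?W x \<bullet> b) = zext \<Omega> (\<lambda>x. (\<eta> x *\<^sub>R G x + u x *\<^sub>R gradient \<eta> x) \<bullet> b)"
        by (auto simp: zext_def)
      then have "(LINT x|lebesgue. (?W x \<bullet> b) * pderiv_dir \<xi> b x)
          = ?I (\<lambda>x. ((\<eta> x *\<^sub>R G x + u x *\<^sub>R gradient \<eta> x) \<bullet> b) * pderiv_dir \<xi> b x)"
        using lint_zext[OF \<Omega>l] by metis
      also have "\<dots> = ?I (\<lambda>x. (pderiv_dir \<xi> b x * \<eta> x) * (G x \<bullet> b) + (pderiv_dir \<xi> b x * pderiv_dir \<eta> b x) * u x)"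
        by (simp add: inner_add_left gradient_smooth_inner[OF test_smooth[OF \<eta>]] algebra_simps)
      also have "\<dots> = ?I (\<lambda>x. (pderiv_dir \<xi> b x * \<eta> x) * (G x \<bullet> b)) + ?I (\<lambda>x. (pderiv_dir \<xi> b x * pderiv_dir \<eta> b x) * u x)"
        by (rule Bochner_Integration.integral_add[OF i1 i4])
      finally show ?thesis .
    qed
    then have "(\<Sum>b\<in>Basis. LINT x|lebesgue. (?W x \<bullet> b) * pderiv_dir \<xi> b x)
        = - ?I (\<lambda>x. (\<xi> x * \<eta> x) * h x) - 2 * (\<Sum>b\<in>Basis. ?I (\<lambda>x. (\<xi> x * pderiv_dir \<eta> b x) * (G x \<bullet> b)))
          - (\<Sum>b\<in>Basis. ?I (\<lambda>x. (\<xi> x * pderiv_dir (pderiv_dir \<eta> b) b x) * u x))"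
      using e1 by (simp add: e2 sum.distrib sum_subtractf sum_negf)
    moreover have "(LINT x|lebesgue. ?F x * \<xi> x) = ?I (\<lambda>x. (\<xi> x * \<eta> x) * h x
        + 2 * (\<Sum>b\<in>Basis. (\<xi> x * pderiv_dir \<eta> b x) * (G x \<bullet> b))
        + (\<Sum>b\<in>Basis. (\<xi> x * pderiv_dir (pderiv_dir \<eta> b) b x) * u x))"
      unfolding lint_zext[OF \<Omega>l] lap\<eta>_def
      by (simp add: algebra_simps sum_distrib_left sum_distrib_right)
    moreover have "\<dots> = ?I (\<lambda>x. (\<xi> x * \<eta> x) * h x) + 2 * (\<Sum>b\<in>Basis. ?I (\<lambda>x. (\<xi> x * pderiv_dir \<eta> b x) * (G x \<bullet> b)))
        + (\<Sum>b\<in>Basis. ?I (\<lambda>x. (\<xi> x * pderiv_dir (pderiv_dir \<eta> b) b x) * u x))"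
      using i2 i3 i5 by (simp add: Bochner_Integration.integral_sum)
    ultimately show ?thesis by linarith
  qed
  let ?c = "\<lambda>k. mollifier (k + k0)"
  let ?P = "\<lambda>k b. conv (?c k) (\<lambda>x. ?W x \<bullet> b)" and ?Q = "\<lambda>k. conv (?c k) ?F"
  have P: "?P k b = pderiv_dir (conv (?c k) ?f) b" for k b using D by simp
  have tP: "test_function \<Omega> (?P k b)" for k b unfolding P by (rule test_frechet[OF t])
  \<comment> \<open>The Laplacian of the mollified function is the mollification of
    \<open>?F\<close>, and so converges in L2.\<close>
  have Q: "(\<lambda>x. \<Sum>b\<in>Basis. pderiv_dir (?P k b) b x) = ?Q k" for k
  proof
    fix x
    have "(\<Sum>b\<in>Basis. pderiv_dir (?P k b) b x)
        = - (\<Sum>b\<in>Basis. LINT y|lebesgue. (?W y \<bullet> b) * pderiv_dir (\<lambda>y. ?c k (x - y)) b y)"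
      by (simp add: conv_pderiv[OF Wi] sum_negf)
    also have "\<dots> = (LINT y|lebesgue. ?F y * ?c k (x - y))"
      by (subst weak) (auto intro: test_smooth[OF test_reflect[OF test_mollifier]])
    finally show "(\<Sum>b\<in>Basis. pderiv_dir (?P k b) b x) = ?Q k x" by (simp add: conv_def mult.commute)
  qed
  have limQ: "L2_lim \<Omega> ?Q ?F"
  proof -
    have "strict_mono (\<lambda>k. k + k0)" by (simp add: strict_mono_def)
    from L2_lim_subseq[OF L2_lim_conv[OF F K(1) FK] this]
    show ?thesis by (rule L2_lim_restrict[OF \<Omega>l _ conv_L2(1)[OF Fi F] F])
  qed
  have QL: "?Q k \<in> L2 \<Omega>" for k by (rule L2_restrict(1)[OF \<Omega>l conv_L2(1)[OF Fi F]])
  have FL: "?F \<in> L2 \<Omega>" by (rule L2_restrict(1)[OF \<Omega>l F])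
  have CQ: "L2_Cauchy \<Omega> ?Q" by (rule L2_lim_imp_Cauchy[OF limQ QL FL])
  \<comment> \<open>\<open>sqint_hessian\<close> for the difference of two mollifications: their
    second derivatives inherit the Cauchy property from \<open>?Q\<close>.\<close>
  have hess: "sqint \<Omega> (\<lambda>x. gradient (?P k b) x - gradient (?P l b) x) \<le> sqint \<Omega> (\<lambda>x. ?Q k x - ?Q l x)"
    if b: "b \<in> Basis" for k l b
  proof -
    define \<phi> where "\<phi> x = conv (?c k) ?f x - conv (?c l) ?f x" for x
    have t\<phi>: "test_function \<Omega> \<phi>" unfolding \<phi>_def by (rule test_diff[OF t t])
    have pd: "pderiv_dir \<phi> b = (\<lambda>x. ?P k b x - ?P l b x)" for b
      unfolding P \<phi>_def
      by (rule ext) (simp add: gradient_smooth_inner[symmetric] gradient_diff test_smooth[OF t]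
          smooth_diff inner_diff_left)
    have g: "gradient (pderiv_dir \<phi> b) = (\<lambda>x. gradient (?P k b) x - gradient (?P l b) x)" for b
      unfolding pd by (intro ext gradient_diff test_smooth[OF tP])
    have "sqint \<Omega> (\<lambda>x. gradient (?P k b) x - gradient (?P l b) x) \<le> (\<Sum>b\<in>Basis. sqint \<Omega> (gradient (pderiv_dir \<phi> b)))"
      unfolding g using b by (intro member_le_sum) (auto simp: sqint_nonneg)
    also have "\<dots> = sqint \<Omega> (\<lambda>x. \<Sum>b\<in>Basis. pderiv_dir (pderiv_dir \<phi> b) b x)"
      by (rule sqint_hessian[OF t\<phi> \<Omega>l])
    also have "(\<lambda>x. \<Sum>b\<in>Basis. pderiv_dir (pderiv_dir \<phi> b) b x) = (\<lambda>x. ?Q k x - ?Q l x)"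
    proof
      fix x
      have "pderiv_dir (pderiv_dir \<phi> b) b x = pderiv_dir (?P k b) b x - pderiv_dir (?P l b) b x" for b
        using fun_cong[OF g[of b], of x]
        by (simp add: gradient_smooth_inner[symmetric] test_smooth[OF tP] test_smooth[OF test_frechet[OF t\<phi>]] inner_diff_left)
      then show "(\<Sum>b\<in>Basis. pderiv_dir (pderiv_dir \<phi> b) b x) = ?Q k x - ?Q l x"
        by (simp add: sum_subtractf flip: Q)
    qed
    finally show ?thesis .
  qed
  have "\<exists>H. H \<in> L2 \<Omega> \<and> L2_lim \<Omega> (\<lambda>k. gradient (?P k b)) H" if b: "b \<in> Basis" for b
  proof -
    have "L2_Cauchy \<Omega> (\<lambda>k. gradient (?P k b))"
      using CQ hess[OF b] unfolding L2_Cauchy_def by (meson le_less_trans)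
    from L2_complete[OF this test_L2(2)[OF tP \<Omega>l]] show ?thesis by blast
  qed
  note ex = this
  define H where "H b = (SOME H. H \<in> L2 \<Omega> \<and> L2_lim \<Omega> (\<lambda>k. gradient (?P k b)) H)" for b
  have H: "H b \<in> L2 \<Omega>" "L2_lim \<Omega> (\<lambda>k. gradient (?P k b)) (H b)" if "b \<in> Basis" for b
    using someI_ex[OF ex[OF that]] unfolding H_def by blast+
  note WbL = L2_inner[OF L2_restrict(1)[OF \<Omega>l W]]
  have sH: "sobolev0_pair \<Omega> (\<lambda>x. ?W x \<bullet> b) (H b)" if "b \<in> Basis" for b
    unfolding sobolev0_pair_def using WbL H[OF that] tP l2
    by (intro conjI exI[of _ "\<lambda>k. ?P k b"]) auto
  have sumL: "(\<lambda>x. \<Sum>b\<in>Basis. H b x \<bullet> b) \<in> L2 \<Omega>" by (intro L2_sum L2_inner H)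
  have "L2_lim \<Omega> ?Q (\<lambda>x. \<Sum>b\<in>Basis. H b x \<bullet> b)"
  proof -
    have "L2_lim \<Omega> (\<lambda>k x. \<Sum>b\<in>Basis. gradient (?P k b) x \<bullet> b) (\<lambda>x. \<Sum>b\<in>Basis. H b x \<bullet> b)"
      by (rule L2_lim_sum) (auto intro!: L2_lim_inner H test_L2(2)[OF tP \<Omega>l] L2_inner)
    then show ?thesis by (simp add: gradient_smooth_inner test_smooth[OF tP] Q)
  qed
  from L2_lim_unique[OF limQ this QL FL sumL]
  have ae1: "AE x in lebesgue_on \<Omega>. ?F x = (\<Sum>b\<in>Basis. H b x \<bullet> b)" .
  have ae2: "AE x in lebesgue_on \<Omega>. ?f x = 0 \<longrightarrow> ?W x = 0" by (rule sobolev0_gradient_zero_set[OF \<Omega> s0])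
  have "AE x in lebesgue_on \<Omega>. \<forall>b\<in>Basis. ?W x \<bullet> b = 0 \<longrightarrow> H b x = 0"
    by (intro AE_ball_countable[THEN iffD2] countable_finite ballI sobolev0_gradient_zero_set[OF \<Omega> sH]) auto
  moreover have "AE x in lebesgue_on \<Omega>. x \<in> \<Omega>" by (rule AE_I2) simp
  ultimately show "AE x in lebesgue_on \<Omega>. \<eta> x \<noteq> 0 \<longrightarrow> u x = 0 \<longrightarrow> h x = 0"
    using ae1 ae2
  proof eventually_elim
    fix x assume H0: "\<forall>b\<in>Basis. ?W x \<bullet> b = 0 \<longrightarrow> H b x = 0" and x: "x \<in> \<Omega>"
      and FH: "?F x = (\<Sum>b\<in>Basis. H b x \<bullet> b)" and fW: "?f x = 0 \<longrightarrow> ?W x = 0"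
    show "\<eta> x \<noteq> 0 \<longrightarrow> u x = 0 \<longrightarrow> h x = 0"
    proof (intro impI)
      assume nz: "\<eta> x \<noteq> 0" and u0: "u x = 0"
      \<comment> \<open>Where \<open>\<eta>\<close> is nonzero, \<open>?W x = 0\<close> gives
        \<open>G x = 0\<close>, and the vanishing of the \<open>H b\<close> gives
        \<open>?F x = 0\<close>. With \<open>u\<close> and \<open>G\<close> gone, only
        \<open>\<eta> x * h x\<close> is left of \<open>?F x\<close>.\<close>
      then have "?W x = 0" using fW x by (simp add: zext_def)
      then have "G x = 0" and "?F x = 0" using nz u0 x H0 FH by (auto simp: zext_def)
      then show "h x = 0" using nz u0 x by (simp add: zext_def)
    qed
  qed
qed

section \<open>The obstacle problem\<close>

definition admissible ::
    "'a::euclidean_space set \<Rightarrow> ('a \<Rightarrow> real) \<Rightarrow> ('a \<Rightarrow> 'a) \<Rightarrow> ('a \<Rightarrow> real) \<Rightarrow> ('a \<Rightarrow> 'a) \<Rightarrow> bool" where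
  "admissible \<Omega> g Gg u G \<longleftrightarrow> (AE x in lebesgue_on \<Omega>. 0 \<le> u x) \<and>
     sobolev0_pair \<Omega> (\<lambda>x. u x - g x) (\<lambda>x. G x - Gg x)"

text \<open>The first-order condition for minimising half of \<open>sqint \<Omega> G\<close> plus
  \<open>ip \<Omega> f u\<close> over a convex set. Stability, comparison and the equation are all
  derived from it, without returning to the energy.\<close>

definition obstacle_solution ::
    "'a::euclidean_space set \<Rightarrow> ('a \<Rightarrow> real) \<Rightarrow> ('a \<Rightarrow> 'a) \<Rightarrow> ('a \<Rightarrow> real) \<Rightarrow> ('a \<Rightarrow> real) \<Rightarrow> ('a \<Rightarrow> 'a) \<Rightarrow> bool" where
  "obstacle_solution \<Omega> g Gg f u G \<longleftrightarrow> admissible \<Omega> g Gg u G \<and>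
     (\<forall>w W. admissible \<Omega> g Gg w W \<longrightarrow>
        0 \<le> ip \<Omega> G (\<lambda>x. W x - G x) + ip \<Omega> f (\<lambda>x. w x - u x))"

section \<open>Minimising sequences and quadratic estimates\<close>

lemma minimizing_sequence:
  fixes J :: "'x \<Rightarrow> real"
  assumes "S \<noteq> {}" "\<And>s. s \<in> S \<Longrightarrow> c \<le> J s"
  obtains s m where "\<And>k. s k \<in> S" "\<And>t. t \<in> S \<Longrightarrow> m \<le> J t" "\<And>k. J (s k) < m + 1 / real (Suc k)"
proof -
  define m where "m = Inf (J ` S)"
  have bdd: "bdd_below (J ` S)" using assms(2) by (auto intro!: bdd_belowI[of _ c])
  have le: "m \<le> J t" if "t \<in> S" for t unfolding m_def using that by (intro cInf_lower bdd) auto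
  have "\<exists>s\<in>S. J s < m + 1 / real (Suc k)" for k
  proof -
    have "Inf (J ` S) < m + 1 / real (Suc k)" by (simp add: m_def)
    then show ?thesis using cInf_less_iff[of "J ` S" "m + 1 / real (Suc k)"] bdd assms(1) by auto
  qed
  then obtain s where "\<And>k. s k \<in> S" "\<And>k. J (s k) < m + 1 / real (Suc k)" by metis
  then show ?thesis using that le by blast
qed

lemma small_differences_Cauchy:
  assumes "\<And>k l. sqint \<Omega> (\<lambda>x. F k x - F l x) \<le> c * (1 / real (Suc k) + 1 / real (Suc l))" "c > 0"
  shows "L2_Cauchy \<Omega> F"
  unfolding L2_Cauchy_def
proof (intro allI impI)
  fix e :: real assume "e > 0"
  then obtain N where N: "1 / real (Suc N) < e / (2 * c)"
    using nat_approx_posE[of "e / (2 * c)"] assms(2) by auto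
  show "\<exists>N. \<forall>m\<ge>N. \<forall>n\<ge>N. sqint \<Omega> (\<lambda>x. F m x - F n x) < e"
  proof (intro exI allI impI)
    fix m n assume "m \<ge> N" "n \<ge> N"
    then have "1 / real (Suc m) \<le> 1 / real (Suc N)" "1 / real (Suc n) \<le> 1 / real (Suc N)"
      by (auto intro!: divide_left_mono)
    moreover have "2 * (e / (2 * c)) = e / c" by simp
    ultimately have "1 / real (Suc m) + 1 / real (Suc n) < e / c" using N by linarith
    then have "c * (1 / real (Suc m) + 1 / real (Suc n)) < c * (e / c)" using assms(2) by (rule mult_strict_left_mono)
    also have "c * (e / c) = e" using assms(2) by simp
    finally show "sqint \<Omega> (\<lambda>x. F m x - F n x) < e" using assms(1)[of m n] by linarith
  qed
qed

text \<open>Young's inequality with a free weight \<open>s\<close>, obtained from the square of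
  \<open>2 * s * a + b\<close>. The weight decides how much of the quadratic energy is spent on a
  linear term.\<close>

lemma ip_lower_bound:
  assumes "a \<in> L2 \<Omega>" "b \<in> L2 \<Omega>" "s > 0"
  shows "- (s * sqint \<Omega> a + sqint \<Omega> b / (4 * s)) \<le> ip \<Omega> a b"
proof -
  have "0 \<le> sqint \<Omega> (\<lambda>x. (2 * s) *\<^sub>R a x + b x)" by (rule sqint_nonneg)
  also have "\<dots> = (2 * s)\<^sup>2 * sqint \<Omega> a + 2 * (2 * s) * ip \<Omega> a b + sqint \<Omega> b"
    using assms by (simp add: sqint_add L2_scaleR sqint_scaleR ip_scaleR_left)
  also have "\<dots> = 4 * s * (s * sqint \<Omega> a + ip \<Omega> a b + sqint \<Omega> b / (4 * s))"
    using assms(3) by (simp add: power2_eq_square distrib_left)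
  finally have "0 \<le> s * sqint \<Omega> a + ip \<Omega> a b + sqint \<Omega> b / (4 * s)"
    using assms(3) by (simp add: zero_le_mult_iff)
  then show ?thesis by linarith
qed

text \<open>Uniform convexity: the midpoint of two near-minimisers would fall below the infimum
  unless they are close. Minimising sequences are therefore Cauchy in norm, and weak compactness is
  not invoked.\<close>

lemma sqint_parallelogram:
  assumes "a \<in> L2 \<Omega>" "b \<in> L2 \<Omega>"
  shows "sqint \<Omega> (\<lambda>x. (1/2) *\<^sub>R (a x + b x)) = (1/2) * sqint \<Omega> a + (1/2) * sqint \<Omega> b - (1/4) * sqint \<Omega> (\<lambda>x. a x - b x)"
  unfolding sqint_scaleR using assms by (simp add: sqint_add sqint_diff power2_eq_square field_simps)

text \<open>A minimising sequence of \<open>\<phi> \<mapsto> \<parallel>\<phi>\<parallel>\<^sup>2 / 2 - T \<phi>\<close> converges to the representing function; there is no need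
  to extend \<open>T\<close> to the closure of the test functions.\<close>

lemma Riesz_test:
  fixes T :: "('a::euclidean_space \<Rightarrow> real) \<Rightarrow> real"
  assumes \<Omega>: "\<Omega> \<in> sets lebesgue"
    and lin: "\<And>\<phi> \<psi> c. test_function \<Omega> \<phi> \<Longrightarrow> test_function \<Omega> \<psi> \<Longrightarrow> T (\<lambda>x. \<phi> x + c * \<psi> x) = T \<phi> + c * T \<psi>"
    and bound: "\<And>\<phi>. test_function \<Omega> \<phi> \<Longrightarrow> (T \<phi>)\<^sup>2 \<le> C * sqint \<Omega> \<phi>"
  obtains \<theta> where "\<theta> \<in> L2 \<Omega>" "\<And>\<phi>. test_function \<Omega> \<phi> \<Longrightarrow> T \<phi> = ip \<Omega> \<theta> \<phi>"
proof -
  define J where "J \<phi> = (1/2) * sqint \<Omega> \<phi> - T \<phi>" for \<phi>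
  note L = test_L2(1)[OF _ \<Omega>]
  have lower: "- (\<bar>C\<bar> / 2) \<le> J \<phi>" if "\<phi> \<in> Collect (test_function \<Omega>)" for \<phi>
  proof -
    have \<phi>: "test_function \<Omega> \<phi>" using that by simp
    have "(T \<phi>)\<^sup>2 \<le> \<bar>C\<bar> * sqint \<Omega> \<phi>"
      using bound[OF \<phi>] mult_right_mono[OF abs_ge_self[of C] sqint_nonneg[of \<Omega> \<phi>]] by linarith
    also have "\<dots> \<le> ((\<bar>C\<bar> + sqint \<Omega> \<phi>) / 2)\<^sup>2"
      using zero_le_power2[of "\<bar>C\<bar> - sqint \<Omega> \<phi>"] by (simp add: power2_eq_square field_simps)
    finally have "T \<phi> \<le> (\<bar>C\<bar> + sqint \<Omega> \<phi>) / 2"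
      by (rule power2_le_imp_le) (simp add: sqint_nonneg)
    then show ?thesis by (simp add: J_def field_simps)
  qed
  have ne: "Collect (test_function \<Omega>) \<noteq> {}" using test_zero by auto
  obtain \<phi> m where \<phi>': "\<And>k. \<phi> k \<in> Collect (test_function \<Omega>)"
    and m': "\<And>\<psi>. \<psi> \<in> Collect (test_function \<Omega>) \<Longrightarrow> m \<le> J \<psi>"
    and Jk: "\<And>k. J (\<phi> k) < m + 1 / real (Suc k)"
    using minimizing_sequence[where J=J, OF ne lower] by blast
  have \<phi>: "test_function \<Omega> (\<phi> k)" for k using \<phi>'[of k] by simp
  have m: "m \<le> J \<psi>" if "test_function \<Omega> \<psi>" for \<psi> using m' that by simp
  have Cau: "L2_Cauchy \<Omega> \<phi>"
  proof (rule small_differences_Cauchy[where c=4])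
    fix k l
    let ?h = "\<lambda>x. (1/2) * (\<phi> k x + \<phi> l x)"
    have t: "test_function \<Omega> ?h" by (intro test_cmult test_add \<phi>)
    have "T ?h = T (\<lambda>x. (\<lambda>x. 0 + (1/2) * \<phi> k x) x + (1/2) * \<phi> l x)" by (simp add: distrib_left)
    also have "\<dots> = T (\<lambda>x. 0 + (1/2) * \<phi> k x) + (1/2) * T (\<phi> l)"
      by (rule lin[OF _ \<phi>]) (use test_cmult[OF \<phi>, of "1/2" k] in simp)
    also have "T (\<lambda>x. 0 + (1/2) * \<phi> k x) = T (\<lambda>x. 0) + (1/2) * T (\<phi> k)" by (rule lin[OF test_zero \<phi>])
    also have "T (\<lambda>x. 0) = 0" using bound[OF test_zero] by (simp add: sqint_def)
    finally have Th: "T ?h = (1/2) * T (\<phi> k) + (1/2) * T (\<phi> l)" by simp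
    have sqh: "sqint \<Omega> ?h = (1/2) * sqint \<Omega> (\<phi> k) + (1/2) * sqint \<Omega> (\<phi> l) - (1/4) * sqint \<Omega> (\<lambda>x. \<phi> k x - \<phi> l x)"
      using sqint_parallelogram[OF L[OF \<phi>] L[OF \<phi>], of k l] by simp
    define Jh where "Jh = J ?h"
    have "sqint \<Omega> (\<lambda>x. \<phi> k x - \<phi> l x) = 4 * (J (\<phi> k) + J (\<phi> l) - 2 * Jh)"
      unfolding Jh_def J_def Th sqh by (simp add: field_simps)
    moreover have "m \<le> Jh" unfolding Jh_def by (rule m[OF t])
    moreover have "s \<le> 4 * (c + d)" if "s = 4 * (a + b - 2 * h)" "m \<le> h" "a < m + c" "b < m + d"
      for s a b c d h :: real
    proof -
      have "a + b - 2 * h \<le> c + d" using that(2-4) by linarith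
      then show ?thesis using that(1) by simp
    qed
    ultimately show "sqint \<Omega> (\<lambda>x. \<phi> k x - \<phi> l x) \<le> 4 * (1 / real (Suc k) + 1 / real (Suc l))"
      using Jk[of k] Jk[of l] by blast
  qed simp
  obtain \<theta> where \<theta>: "\<theta> \<in> L2 \<Omega>" "L2_lim \<Omega> \<phi> \<theta>" using L2_complete[OF Cau L[OF \<phi>]] by blast
  have Jlim: "(\<lambda>k. J (\<phi> k)) \<longlonglongrightarrow> m"
  proof (rule tendsto_sandwich[OF _ _ tendsto_const])
    show "(\<lambda>k. m + 1 / real (Suc k)) \<longlonglongrightarrow> m"
      using tendsto_add[OF tendsto_const[of m] inverse_Suc_tendsto_0] by simp
  qed (use m[OF \<phi>] Jk in \<open>auto intro!: always_eventually less_imp_le\<close>)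
  have "T \<psi> = ip \<Omega> \<theta> \<psi>" if \<psi>: "test_function \<Omega> \<psi>" for \<psi>
  proof -
    have "0 \<le> 0 + 2 * t * (ip \<Omega> \<theta> \<psi> - T \<psi>) + t\<^sup>2 * sqint \<Omega> \<psi>" for t
    proof -
      \<comment> \<open>The perturbed function is \<open>\<phi> k\<close> and not its limit
        \<open>\<theta>\<close>, because only test functions compete for \<open>m\<close>; the limit
        is taken in the resulting inequality.\<close>
      have "m \<le> J (\<phi> k) + (t * (ip \<Omega> (\<phi> k) \<psi> - T \<psi>) + (t\<^sup>2 / 2) * sqint \<Omega> \<psi>)" for k
      proof -
        have "m \<le> J (\<lambda>x. \<phi> k x + t * \<psi> x)" by (intro m test_add test_cmult \<phi> \<psi>)
        also have "\<dots> = J (\<phi> k) + (t * (ip \<Omega> (\<phi> k) \<psi> - T \<psi>) + (t\<^sup>2 / 2) * sqint \<Omega> \<psi>)"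
          using sqint_add[OF L[OF \<phi>] L2_scaleR[OF L[OF \<psi>]], of k t]
          by (simp add: J_def lin[OF \<phi> \<psi>] ip_cmult_right sqint_scaleR[of _ t \<psi>, simplified] field_simps)
        finally show ?thesis .
      qed
      moreover have "(\<lambda>k. J (\<phi> k) + (t * (ip \<Omega> (\<phi> k) \<psi> - T \<psi>) + (t\<^sup>2 / 2) * sqint \<Omega> \<psi>))
          \<longlonglongrightarrow> m + (t * (ip \<Omega> \<theta> \<psi> - T \<psi>) + (t\<^sup>2 / 2) * sqint \<Omega> \<psi>)"
        by (intro tendsto_intros Jlim L2_lim_ip[OF \<theta>(2) L2_lim_const L[OF \<phi>] L[OF \<psi>] \<theta>(1) L[OF \<psi>]])
      ultimately have "m \<le> m + (t * (ip \<Omega> \<theta> \<psi> - T \<psi>) + (t\<^sup>2 / 2) * sqint \<Omega> \<psi>)"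
        by (intro tendsto_lowerbound[OF _ always_eventually]) auto
      then show ?thesis by (simp add: field_simps)
    qed
    from quadratic_nonneg_discriminant[OF this] show ?thesis by simp
  qed
  then show ?thesis using that \<theta>(1) by blast
qed

context
  fixes \<Omega> :: "'a::euclidean_space set" and g :: "'a \<Rightarrow> real" and Gg :: "'a \<Rightarrow> 'a"
  assumes \<Omega>: "open \<Omega>" and g: "sobolev_pair \<Omega> g Gg"
begin

lemma domain_sets: "\<Omega> \<in> sets lebesgue"
  by (rule open_sets_lebesgue[OF \<Omega>])

lemma admissible_pair:
  assumes "admissible \<Omega> g Gg u G"
  shows "sobolev_pair \<Omega> u G"
proof -
  have "sobolev0_pair \<Omega> (\<lambda>x. u x - g x) (\<lambda>x. G x - Gg x)" using assms by (simp add: admissible_def)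
  from sobolev_pair_add[OF domain_sets sobolev0_imp_sobolev[OF domain_sets this] g] show ?thesis by simp
qed

lemmas admissible_L2 = sobolev_pair_L2[OF admissible_pair]

lemma admissible_diff:
  assumes "admissible \<Omega> g Gg u G" "admissible \<Omega> g Gg v H"
  shows "sobolev0_pair \<Omega> (\<lambda>x. u x - v x) (\<lambda>x. G x - H x)"
proof -
  have "sobolev0_pair \<Omega> (\<lambda>x. (u x - g x) - (v x - g x)) (\<lambda>x. (G x - Gg x) - (H x - Gg x))"
    using assms unfolding admissible_def by (elim conjE) (rule sobolev0_diff[OF domain_sets])
  then show ?thesis by simp
qed

lemma admissible_add:
  assumes "admissible \<Omega> g Gg u G" "sobolev0_pair \<Omega> z Z" "AE x in lebesgue_on \<Omega>. 0 \<le> u x + z x"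
  shows "admissible \<Omega> g Gg (\<lambda>x. u x + z x) (\<lambda>x. G x + Z x)"
proof -
  have "sobolev0_pair \<Omega> (\<lambda>x. (u x - g x) + z x) (\<lambda>x. (G x - Gg x) + Z x)"
    using assms(1,2) unfolding admissible_def by (elim conjE) (rule sobolev0_add[OF domain_sets])
  then show ?thesis using assms(3) by (simp add: admissible_def algebra_simps)
qed

lemma admissible_convex:
  assumes u: "admissible \<Omega> g Gg u G" and v: "admissible \<Omega> g Gg v H" and t: "0 \<le> t" "t \<le> 1"
  shows "admissible \<Omega> g Gg (\<lambda>x. u x + t * (v x - u x)) (\<lambda>x. G x + t *\<^sub>R (H x - G x))"
proof (rule admissible_add[OF u sobolev0_scaleR[OF domain_sets admissible_diff[OF v u]]])
  have "AE x in lebesgue_on \<Omega>. 0 \<le> u x" "AE x in lebesgue_on \<Omega>. 0 \<le> v x"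
    using u v by (auto simp: admissible_def)
  then show "AE x in lebesgue_on \<Omega>. 0 \<le> u x + t * (v x - u x)"
  proof eventually_elim
    fix x assume "0 \<le> u x" "0 \<le> v x"
    then have "0 \<le> (1 - t) * u x + t * v x" using t by simp
    then show "0 \<le> u x + t * (v x - u x)" by (simp add: algebra_simps)
  qed
qed

text \<open>The gradients of a minimising sequence are Cauchy by the parallelogram identity, the
  functions by the Poincare inequality, and the constraints survive the limit. Convex combinations
  with any competitor then give the variational inequality, after division by
  \<open>t\<close>.\<close>

lemma obstacle_exists:
  assumes f: "f \<in> L2 \<Omega>" and P: "P > 0" "\<And>w G. sobolev0_pair \<Omega> w G \<Longrightarrow> sqint \<Omega> w \<le> P * sqint \<Omega> G"
    and ne: "admissible \<Omega> g Gg u0 G0"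
  shows "\<exists>u G. obstacle_solution \<Omega> g Gg f u G"
proof -
  define S where "S = {(u, G). admissible \<Omega> g Gg u G}"
  define J where "J = (\<lambda>(u, G :: 'a \<Rightarrow> 'a). (1/2) * sqint \<Omega> G + ip \<Omega> f u)"
  \<comment> \<open>Relative to the fixed competitor \<open>u0\<close> the energy is quadratic in
    the difference. Young's inequality with weights 2 and \<open>2 * P\<close> charges an eighth of
    \<open>sqint \<Omega> D\<close> to each linear term, less than the available half.\<close>
  define c where "c = (1/2) * sqint \<Omega> G0 + ip \<Omega> f u0 - 2 * sqint \<Omega> G0 - 2 * P * sqint \<Omega> f"
  note L0 = admissible_L2[OF ne]
  have lower: "c \<le> J s" if sS: "s \<in> S" for s
  proof -
    obtain u G where s: "s = (u, G)" and a: "admissible \<Omega> g Gg u G" using sS by (auto simp: S_def)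
    define d D where "d x = u x - u0 x" and "D x = G x - G0 x" for x
    have dD: "sobolev0_pair \<Omega> d D" unfolding d_def D_def by (rule admissible_diff[OF a ne])
    note L = sobolev0_pair_L2[OF dD]
    have uG: "u = (\<lambda>x. u0 x + d x)" "G = (\<lambda>x. G0 x + D x)" by (auto simp: d_def D_def)
    have "J s = (1/2) * sqint \<Omega> G0 + ip \<Omega> G0 D + (1/2) * sqint \<Omega> D + ip \<Omega> f u0 + ip \<Omega> f d"
      unfolding s J_def uG using L L0 f by (simp add: sqint_add ip_add_right)
    moreover have "- (2 * sqint \<Omega> G0 + sqint \<Omega> D / (4 * 2)) \<le> ip \<Omega> G0 D"
      by (rule ip_lower_bound[OF L0(2) L(2)]) simp
    moreover have "- ((2 * P) * sqint \<Omega> f + sqint \<Omega> d / (4 * (2 * P))) \<le> ip \<Omega> f d"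
      by (rule ip_lower_bound[OF f L(1)]) (use P in simp)
    moreover have "sqint \<Omega> d / (4 * (2 * P)) \<le> sqint \<Omega> D / 8"
      using P(1) P(2)[OF dD] by (simp add: field_simps)
    ultimately show ?thesis using sqint_nonneg[of \<Omega> D] by (simp add: c_def)
  qed
  have ne': "S \<noteq> {}" using ne by (auto simp: S_def)
  obtain s m where s: "\<And>k. s k \<in> S" and m: "\<And>t. t \<in> S \<Longrightarrow> m \<le> J t"
    and Jk: "\<And>k. J (s k) < m + 1 / real (Suc k)"
    using minimizing_sequence[where J=J, OF ne' lower] by blast
  define U V where "U k = fst (s k)" and "V k = snd (s k)" for k
  have sUV: "s k = (U k, V k)" for k by (simp add: U_def V_def)
  have a: "admissible \<Omega> g Gg (U k) (V k)" for k using s[of k] by (simp add: S_def sUV)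
  note L = admissible_L2[OF a]
  have diff: "sqint \<Omega> (\<lambda>x. V k x - V l x) \<le> 4 * (1 / real (Suc k) + 1 / real (Suc l))" for k l
  proof -
    let ?u = "\<lambda>x. U k x + (1/2) * (U l x - U k x)" and ?v = "\<lambda>x. V k x + (1/2) *\<^sub>R (V l x - V k x)"
    have h: "admissible \<Omega> g Gg ?u ?v" by (rule admissible_convex[OF a a]) auto
    have v: "?v = (\<lambda>x. (1/2) *\<^sub>R (V k x + V l x))"
    proof
      fix x
      have "V k x = (1/2) *\<^sub>R V k x + (1/2) *\<^sub>R V k x" by (simp add: scaleR_left.add[symmetric])
      then show "?v x = (1/2) *\<^sub>R (V k x + V l x)" by (simp add: algebra_simps)
    qed
    have ipu: "ip \<Omega> f ?u = ip \<Omega> f (U k) + (1/2) * (ip \<Omega> f (U l) - ip \<Omega> f (U k))"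
      by (simp only: ip_add_right[OF L(1) L2_cmult[OF L2_diff[OF L(1) L(1)]] f] ip_cmult_right ip_diff_right[OF L(1) L(1) f])
    have J1: "J (?u, ?v) = (1/2) * sqint \<Omega> ?v + (1/2) * ip \<Omega> f (U k) + (1/2) * ip \<Omega> f (U l)"
      unfolding J_def prod.case ipu by (simp add: field_simps)
    have sqv: "sqint \<Omega> ?v = (1/2) * sqint \<Omega> (V k) + (1/2) * sqint \<Omega> (V l) - (1/4) * sqint \<Omega> (\<lambda>x. V k x - V l x)"
      unfolding v by (rule sqint_parallelogram[OF L(2) L(2)])
    have "sqint \<Omega> (\<lambda>x. V k x - V l x) = 4 * (J (s k) + J (s l) - 2 * J (?u, ?v))"
      unfolding J1 sqv unfolding sUV J_def prod.case by (simp add: field_simps)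
    then show ?thesis using m[of "(?u, ?v)"] h Jk[of k] Jk[of l] by (simp add: S_def)
  qed
  have CV: "L2_Cauchy \<Omega> V" by (rule small_differences_Cauchy[OF diff]) simp
  have CU: "L2_Cauchy \<Omega> U"
  proof (rule small_differences_Cauchy[where c="P * 4"])
    fix k l
    have "sqint \<Omega> (\<lambda>x. U k x - U l x) \<le> P * sqint \<Omega> (\<lambda>x. V k x - V l x)"
      by (rule P(2)[OF admissible_diff[OF a a]])
    also have "\<dots> \<le> P * (4 * (1 / real (Suc k) + 1 / real (Suc l)))"
      using P(1) by (intro mult_left_mono diff) auto
    finally show "sqint \<Omega> (\<lambda>x. U k x - U l x) \<le> P * 4 * (1 / real (Suc k) + 1 / real (Suc l))"
      by (simp only: mult.assoc)
  qed (use P in simp)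
  obtain u where u: "u \<in> L2 \<Omega>" "L2_lim \<Omega> U u" using L2_complete[OF CU L(1)] by blast
  obtain G where G: "G \<in> L2 \<Omega>" "L2_lim \<Omega> V G" using L2_complete[OF CV L(2)] by blast
  note Lg = sobolev_pair_L2[OF g]
  have adm: "admissible \<Omega> g Gg u G"
    unfolding admissible_def
  proof
    obtain r where "strict_mono r" and r: "AE x in lebesgue_on \<Omega>. (\<lambda>k. U (r k) x) \<longlonglongrightarrow> u x"
      using L2_lim_AE_subseq[OF u(2) L(1) u(1)] by blast
    have "AE x in lebesgue_on \<Omega>. \<forall>k. 0 \<le> U k x"
      unfolding AE_all_countable using a by (simp add: admissible_def)
    then show "AE x in lebesgue_on \<Omega>. 0 \<le> u x"
      using r by eventually_elim (auto intro: LIMSEQ_le_const)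
    show "sobolev0_pair \<Omega> (\<lambda>x. u x - g x) (\<lambda>x. G x - Gg x)"
    proof (rule sobolev0_closed[OF domain_sets])
      show "sobolev0_pair \<Omega> (\<lambda>x. U k x - g x) (\<lambda>x. V k x - Gg x)" for k
        using a[of k] by (simp add: admissible_def)
      show "L2_lim \<Omega> (\<lambda>k x. U k x - g x) (\<lambda>x. u x - g x)"
        by (rule L2_lim_diff[OF u(2) L2_lim_const L(1) Lg(1) u(1) Lg(1)])
      show "L2_lim \<Omega> (\<lambda>k x. V k x - Gg x) (\<lambda>x. G x - Gg x)"
        by (rule L2_lim_diff[OF G(2) L2_lim_const L(2) Lg(2) G(1) Lg(2)])
    qed (intro L2_diff u G Lg)+
  qed
  have "(\<lambda>k. J (s k)) \<longlonglongrightarrow> J (u, G)"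
    unfolding sUV J_def prod.case
    by (intro tendsto_intros L2_lim_sqint[OF G(2) L(2) G(1)] L2_lim_ip[OF L2_lim_const u(2) f L(1) f u(1)])
  moreover have "(\<lambda>k. m + 1 / real (Suc k)) \<longlonglongrightarrow> m + 0" by (intro tendsto_intros inverse_Suc_tendsto_0)
  ultimately have "J (u, G) \<le> m + 0" by (rule LIMSEQ_le) (use Jk less_imp_le in blast)
  then have min: "J (u, G) \<le> J t" if "t \<in> S" for t using m[OF that] by simp
  have "0 \<le> ip \<Omega> G (\<lambda>x. W x - G x) + ip \<Omega> f (\<lambda>x. w x - u x)" if w: "admissible \<Omega> g Gg w W" for w W
  proof -
    note Lw = admissible_L2[OF w] note Lu = u(1) G(1)
    define A B where "A = ip \<Omega> G (\<lambda>x. W x - G x) + ip \<Omega> f (\<lambda>x. w x - u x)" and "B = sqint \<Omega> (\<lambda>x. W x - G x)"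
    have nonneg: "0 \<le> A + t / 2 * B" if t: "0 < t" "t \<le> 1" for t
    proof -
      let ?u = "\<lambda>x. u x + t * (w x - u x)" and ?v = "\<lambda>x. G x + t *\<^sub>R (W x - G x)"
      have "admissible \<Omega> g Gg ?u ?v" using t by (intro admissible_convex[OF adm w]) auto
      then have "J (u, G) \<le> J (?u, ?v)" by (intro min) (simp add: S_def)
      also have "J (?u, ?v) = J (u, G) + t * A + t\<^sup>2 / 2 * B"
        unfolding J_def prod.case A_def B_def
          sqint_add[OF Lu(2) L2_scaleR[OF L2_diff[OF Lw(2) Lu(2)]]] ip_scaleR_right sqint_scaleR
          ip_add_right[OF Lu(1) L2_cmult[OF L2_diff[OF Lw(1) Lu(1)]] f] ip_cmult_right
        by (simp add: field_simps)
      finally have "0 \<le> t * (A + t / 2 * B)" by (simp add: power2_eq_square algebra_simps)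
      then show ?thesis using t by (simp add: zero_le_mult_iff)
    qed
    have "0 \<le> A + (1 / real (Suc k)) / 2 * B" for k by (rule nonneg) auto
    moreover have "(\<lambda>k. A + (1 / real (Suc k)) / 2 * B) \<longlonglongrightarrow> A + 0 / 2 * B"
      by (intro tendsto_intros inverse_Suc_tendsto_0) simp
    ultimately have "0 \<le> A + 0 / 2 * B" by (intro LIMSEQ_le_const) auto
    then show ?thesis by (simp add: A_def)
  qed
  then show ?thesis using adm unfolding obstacle_solution_def by blast
qed

text \<open>Each solution is a competitor for the other; the sum of the two inequalities bounds the
  squared gradient distance by minus the product of \<open>f - f'\<close> and \<open>u - u'\<close>.
  The constant \<open>c\<close> is left open because it is used both with the first eigenvalue and
  with the inverse Poincare constant.\<close>

lemma obstacle_Lipschitz: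
  assumes u: "obstacle_solution \<Omega> g Gg f u G" and u': "obstacle_solution \<Omega> g Gg f' u' G'"
    and f: "f \<in> L2 \<Omega>" "f' \<in> L2 \<Omega>"
    and c: "c > 0" "\<And>w G. sobolev0_pair \<Omega> w G \<Longrightarrow> c * sqint \<Omega> w \<le> sqint \<Omega> G"
  shows "c * sqrt (sqint \<Omega> (\<lambda>x. u x - u' x)) \<le> sqrt (sqint \<Omega> (\<lambda>x. f x - f' x))"
proof -
  have a: "admissible \<Omega> g Gg u G" "admissible \<Omega> g Gg u' G'"
    using u u' by (auto simp: obstacle_solution_def)
  note L = admissible_L2[OF a(1)] admissible_L2[OF a(2)]
  have 1: "0 \<le> ip \<Omega> G (\<lambda>x. G' x - G x) + ip \<Omega> f (\<lambda>x. u' x - u x)"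
    "0 \<le> ip \<Omega> G' (\<lambda>x. G x - G' x) + ip \<Omega> f' (\<lambda>x. u x - u' x)"
    using u u' a by (auto simp: obstacle_solution_def)
  let ?n = "sqrt (sqint \<Omega> (\<lambda>x. u x - u' x))" and ?F = "sqrt (sqint \<Omega> (\<lambda>x. f x - f' x))"
  have "c * ?n\<^sup>2 \<le> sqint \<Omega> (\<lambda>x. G x - G' x)"
    using c(2)[OF admissible_diff[OF a]] by (simp add: sqint_nonneg)
  also have "\<dots> \<le> - ip \<Omega> (\<lambda>x. f x - f' x) (\<lambda>x. u x - u' x)"
    using 1 L f by (simp add: sqint_diff ip_diff_left ip_diff_right L2_diff sqint_ip ip_commute[of \<Omega> G' G])
  also have "\<dots> \<le> ?F * ?n"
    using ip_abs_le[OF L2_diff[OF f] L2_diff[OF L(1,3)]] by linarith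
  finally have *: "(c * ?n) * ?n \<le> ?F * ?n" by (simp add: power2_eq_square mult_ac)
  show ?thesis
  proof (cases "?n = 0")
    case False
    then have "?n > 0" using sqint_nonneg[of \<Omega> "\<lambda>x. u x - u' x"] by simp
    then show ?thesis using * by (simp only: mult_le_cancel_right_pos)
  qed (simp add: sqint_nonneg)
qed

text \<open>The competitors are the maximum of \<open>u\<close> and \<open>u'\<close> in the problem
  for \<open>f\<close> and their minimum in the problem for \<open>f'\<close>. Adding the
  inequalities leaves no gradient energy for the positive part \<open>z\<close> of
  \<open>u' - u\<close>, so \<open>z\<close> vanishes by the Poincare inequality.\<close>

lemma obstacle_comparison:
  assumes u: "obstacle_solution \<Omega> g Gg f u G" and u': "obstacle_solution \<Omega> g Gg f' u' G'"
    and f: "f \<in> L2 \<Omega>" "f' \<in> L2 \<Omega>" and le: "AE x in lebesgue_on \<Omega>. f x \<le> f' x"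
    and P: "P > 0" "\<And>w G. sobolev0_pair \<Omega> w G \<Longrightarrow> sqint \<Omega> w \<le> P * sqint \<Omega> G"
  shows "AE x in lebesgue_on \<Omega>. u' x \<le> u x"
proof -
  have a: "admissible \<Omega> g Gg u G" "admissible \<Omega> g Gg u' G'"
    using u u' by (auto simp: obstacle_solution_def)
  note L = admissible_L2[OF a(1)] admissible_L2[OF a(2)]
  have nn: "AE x in lebesgue_on \<Omega>. 0 \<le> u x" "AE x in lebesgue_on \<Omega>. 0 \<le> u' x"
    using a by (auto simp: admissible_def)
  define z where "z x = max (u' x - u x) 0" for x
  define Z where "Z x = indicator {0<..} (u' x - u x) *\<^sub>R (G' x - G x)" for x
  have zZ: "sobolev0_pair \<Omega> z Z" unfolding z_def Z_def by (rule sobolev0_pos_part[OF \<Omega> admissible_diff[OF a(2,1)]])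
  note Lz = sobolev0_pair_L2[OF zZ]
  have "admissible \<Omega> g Gg (\<lambda>x. u x + z x) (\<lambda>x. G x + Z x)"
    by (rule admissible_add[OF a(1) zZ]) (use nn(1) in \<open>auto simp: z_def elim: eventually_mono\<close>)
  then have 1: "0 \<le> ip \<Omega> G (\<lambda>x. (G x + Z x) - G x) + ip \<Omega> f (\<lambda>x. (u x + z x) - u x)"
    using u unfolding obstacle_solution_def by blast
  have m: "sobolev0_pair \<Omega> (\<lambda>x. - 1 * z x) (\<lambda>x. - 1 *\<^sub>R Z x)" by (rule sobolev0_scaleR[OF domain_sets zZ])
  have "AE x in lebesgue_on \<Omega>. 0 \<le> u' x + - 1 * z x"
    using nn by eventually_elim (auto simp: z_def)
  from admissible_add[OF a(2) m this]
  have 2: "0 \<le> ip \<Omega> G' (\<lambda>x. (G' x + - 1 *\<^sub>R Z x) - G' x) + ip \<Omega> f' (\<lambda>x. (u' x + - 1 * z x) - u' x)"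
    using u' unfolding obstacle_solution_def by blast
  have "ip \<Omega> (\<lambda>x. G' x - G x) Z = sqint \<Omega> Z"
    unfolding ip_def sqint_def Z_def
    by (intro Bochner_Integration.integral_cong) (auto simp: indicator_def power2_norm_eq_inner)
  moreover have "0 \<le> ip \<Omega> (\<lambda>x. f' x - f x) z"
    unfolding ip_def
  proof (rule integral_nonneg_AE)
    show "AE x in lebesgue_on \<Omega>. 0 \<le> (f' x - f x) \<bullet> z x"
      using le by eventually_elim (simp add: z_def)
  qed
  ultimately have "sqint \<Omega> Z \<le> 0"
    using 1 2 L Lz f by (simp add: ip_diff_left ip_minus_right)
  then have "sqint \<Omega> z \<le> 0" using P(2)[OF zZ] mult_left_mono[of "sqint \<Omega> Z" 0 P] P(1) by simp
  then have "AE x in lebesgue_on \<Omega>. z x = 0" using sqint_eq_0[OF Lz(1)] sqint_nonneg[of \<Omega> z] by simp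
  then show ?thesis by eventually_elim (simp add: z_def max_def split: if_splits)
qed

text \<open>Testing with \<open>u - min (\<eta> u) (\<epsilon> \<psi>\<^sup>+)\<close>, where \<open>\<eta> = 1\<close> on the support of \<open>\<psi>\<close>, and letting \<open>\<epsilon> \<rightarrow> 0\<close>.\<close>

lemma obstacle_upper:
  assumes u: "obstacle_solution \<Omega> g Gg f u G" and f: "f \<in> L2 \<Omega>" and \<psi>: "test_function \<Omega> \<psi>"
  defines "p \<equiv> \<lambda>x. max (\<psi> x) 0" and "P \<equiv> \<lambda>x. indicator {0<..} (\<psi> x) *\<^sub>R gradient \<psi> x"
  shows "ip \<Omega> G P + ip \<Omega> f (\<lambda>x. indicator {0<..} (u x) * p x) \<le> 0"
    and "0 \<le> ip \<Omega> G P + ip \<Omega> f p"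
proof -
  have a: "admissible \<Omega> g Gg u G" using u by (auto simp: obstacle_solution_def)
  note L = admissible_L2[OF a]
  have nn: "AE x in lebesgue_on \<Omega>. 0 \<le> u x" using a by (auto simp: admissible_def)
  have p: "sobolev0_pair \<Omega> p P" unfolding p_def P_def
    by (rule sobolev0_pos_part[OF \<Omega> sobolev0_test[OF \<psi> domain_sets]])
  note Lp = sobolev0_pair_L2[OF p]
  have p0: "0 \<le> p x" for x by (simp add: p_def)
  show "0 \<le> ip \<Omega> G P + ip \<Omega> f p"
  proof -
    have "admissible \<Omega> g Gg (\<lambda>x. u x + p x) (\<lambda>x. G x + P x)"
      by (rule admissible_add[OF a p]) (use nn p0 in \<open>auto elim: eventually_mono\<close>)
    then have "0 \<le> ip \<Omega> G (\<lambda>x. (G x + P x) - G x) + ip \<Omega> f (\<lambda>x. (u x + p x) - u x)"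
      using u unfolding obstacle_solution_def by blast
    then show ?thesis by simp
  qed
  obtain K where K: "compact K" "K \<subseteq> \<Omega>" "\<And>x. x \<notin> K \<Longrightarrow> \<psi> x = 0" using test_functionE[OF \<psi>] by metis
  obtain \<eta> where \<eta>: "test_function \<Omega> \<eta>" "\<And>x. 0 \<le> \<eta> x" "\<And>x. \<eta> x \<le> 1" "\<And>x. x \<in> K \<Longrightarrow> \<eta> x = 1"
    using smooth_cutoff[OF K(1) \<Omega> K(2)] by blast
  \<comment> \<open>The set where \<open>\<psi>\<close> is positive is open and lies in
    \<open>K\<close>, so \<open>\<eta>\<close> is locally constant there. On this set the cutoff
    changes neither \<open>u\<close> nor its gradient.\<close>
  have \<eta>1: "\<eta> x = 1" "gradient \<eta> x = 0" if "\<psi> x > 0" for x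
  proof -
    show "\<eta> x = 1" using that K(3)[of x] \<eta>(4)[of x] by (cases "x \<in> K") auto
    have o: "open {y. \<psi> y > 0}"
      by (intro open_Collect_less continuous_on_const test_continuous[OF \<psi>])
    have "(\<eta> has_derivative (\<lambda>h. 0 \<bullet> h)) (at x)"
    proof (rule has_derivative_transform_within_open[OF _ o])
      show "((\<lambda>y. 1) has_derivative (\<lambda>h. 0 \<bullet> h)) (at x)" by simp
      show "x \<in> {y. \<psi> y > 0}" using that by simp
      fix y assume "y \<in> {y. \<psi> y > 0}"
      then show "1 = \<eta> y" using K(3)[of y] \<eta>(4)[of y] by (cases "y \<in> K") auto
    qed
    then show "gradient \<eta> x = 0" by (rule gradient_eqI)
  qed
  define q where "q x = \<eta> x * u x" for x
  define Q where "Q x = \<eta> x *\<^sub>R G x + u x *\<^sub>R gradient \<eta> x" for x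
  have q: "sobolev0_pair \<Omega> q Q" unfolding q_def Q_def by (rule sobolev0_mult_test[OF \<Omega> admissible_pair[OF a] \<eta>(1)])
  note Lq = sobolev0_pair_L2[OF q]
  have [measurable]: "q \<in> borel_measurable (lebesgue_on \<Omega>)" "p \<in> borel_measurable (lebesgue_on \<Omega>)"
    "P \<in> borel_measurable (lebesgue_on \<Omega>)" "u \<in> borel_measurable (lebesgue_on \<Omega>)"
    using Lq Lp L L2_meas by blast+
  have zset: "AE x in lebesgue_on \<Omega>. q x = 0 \<longrightarrow> Q x = 0" by (rule sobolev0_gradient_zero_set[OF \<Omega> q])
  let ?I = "\<lambda>k x. indicator {0<..} (q x - (1 / real (Suc k)) * p x) :: real"
  let ?m = "\<lambda>k x. min (real (Suc k) * q x) (p x)"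
  have key: "ip \<Omega> G (\<lambda>x. ?I k x *\<^sub>R P x) + ip \<Omega> f (?m k) \<le> 0" for k
  proof -
    define e where "e = 1 / real (Suc k)"
    have e: "e > 0" "real (Suc k) * e = 1" by (auto simp: e_def)
    let ?w = "\<lambda>x. q x - e * p x" and ?W = "\<lambda>x. Q x - e *\<^sub>R P x"
    have w: "sobolev0_pair \<Omega> ?w ?W" by (intro sobolev0_diff sobolev0_scaleR domain_sets q p)
    \<comment> \<open>This is the minimum of \<open>q x\<close> and \<open>e * p x\<close>, written
      through a positive part so that \<open>sobolev0_pos_part\<close> provides its
      gradient.\<close>
    define z where "z x = q x - max (?w x) 0" for x
    define Z where "Z x = Q x - indicator {0<..} (?w x) *\<^sub>R ?W x" for x
    have zZ: "sobolev0_pair \<Omega> z Z" unfolding z_def Z_def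
      by (intro sobolev0_diff domain_sets q sobolev0_pos_part[OF \<Omega> w])
    note Lz = sobolev0_pair_L2[OF zZ]
    have m: "sobolev0_pair \<Omega> (\<lambda>x. - 1 * z x) (\<lambda>x. - 1 *\<^sub>R Z x)" by (rule sobolev0_scaleR[OF domain_sets zZ])
    have "AE x in lebesgue_on \<Omega>. 0 \<le> u x + - 1 * z x"
      using nn
    proof eventually_elim
      fix x assume "0 \<le> u x"
      then have "q x \<le> u x" using \<eta>(2,3)[of x] by (simp add: q_def mult_left_le_one_le)
      then show "0 \<le> u x + - 1 * z x" by (simp add: z_def)
    qed
    from admissible_add[OF a m this]
    have "0 \<le> ip \<Omega> G (\<lambda>x. (G x + - 1 *\<^sub>R Z x) - G x) + ip \<Omega> f (\<lambda>x. (u x + - 1 * z x) - u x)"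
      using u unfolding obstacle_solution_def by blast
    then have le0: "ip \<Omega> G Z + ip \<Omega> f z \<le> 0" by (simp add: ip_minus_right)
    have IL: "(\<lambda>x. ?I k x *\<^sub>R P x) \<in> L2 \<Omega>"
      by (rule L2_bounded_scaleR[OF Lp(2), where C=1]) (auto simp: indicator_def)
    \<comment> \<open>Where \<open>?w\<close> is positive, \<open>Z\<close> is
      \<open>e *\<^sub>R P\<close>. Elsewhere \<open>Z\<close> is \<open>Q\<close>, and the
      discarded product of \<open>G\<close> with \<open>Q\<close> is nonnegative: it is the square
      of the norm of \<open>G\<close> where \<open>\<psi>\<close> is positive, and it vanishes a.e.
      otherwise because \<open>q\<close> does.\<close>
    have "ip \<Omega> G (\<lambda>x. e *\<^sub>R (?I k x *\<^sub>R P x)) \<le> ip \<Omega> G Z"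
      unfolding ip_def
    proof (rule integral_mono_AE)
      show "integrable (lebesgue_on \<Omega>) (\<lambda>x. G x \<bullet> Z x)" by (rule L2_ip_integrable[OF L(2) Lz(2)])
      show "integrable (lebesgue_on \<Omega>) (\<lambda>x. G x \<bullet> (e *\<^sub>R (?I k x *\<^sub>R P x)))"
        by (rule L2_ip_integrable[OF L(2) L2_scaleR[OF IL]])
      show "AE x in lebesgue_on \<Omega>. G x \<bullet> (e *\<^sub>R (?I k x *\<^sub>R P x)) \<le> G x \<bullet> Z x"
        using zset nn
      proof eventually_elim
        fix x assume z0: "q x = 0 \<longrightarrow> Q x = 0" and u0: "0 \<le> u x"
        then have q0: "0 \<le> q x" using \<eta>(2)[of x] by (simp add: q_def)
        show "G x \<bullet> (e *\<^sub>R (?I k x *\<^sub>R P x)) \<le> G x \<bullet> Z x"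
        proof (cases "?w x > 0")
          case True
          then show ?thesis by (simp add: Z_def e_def indicator_def)
        next
          case False
          have "0 \<le> G x \<bullet> Q x"
          proof (cases "\<psi> x > 0")
            case True
            then show ?thesis by (simp add: Q_def \<eta>1)
          next
            case f: False
            then have "q x = 0" using False q0 by (simp add: p_def)
            then show ?thesis using z0 by simp
          qed
          then show ?thesis using False by (simp add: Z_def e_def indicator_def)
        qed
      qed
    qed
    moreover have zeq: "z = (\<lambda>x. e * ?m k x)"
    proof
      fix x
      have "e * ?m k x = min (e * (real (Suc k) * q x)) (e * p x)"
        using e(1) by (simp add: min_mult_distrib_left)
      also have "e * (real (Suc k) * q x) = q x" using e(2) by (simp add: mult.assoc[symmetric] mult.commute)
      finally show "z x = e * ?m k x" by (simp add: z_def min_def max_def)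
    qed
    ultimately have "e * ip \<Omega> G (\<lambda>x. ?I k x *\<^sub>R P x) + e * ip \<Omega> f (?m k) \<le> 0"
      using le0 unfolding zeq ip_cmult_right ip_scaleR_right by linarith
    then have "e * (ip \<Omega> G (\<lambda>x. ?I k x *\<^sub>R P x) + ip \<Omega> f (?m k)) \<le> 0"
      by (simp only: distrib_left)
    then show ?thesis using e(1) by (simp add: mult_le_0_iff)
  qed
  let ?PL = "\<lambda>x. indicator {0<..} (q x) *\<^sub>R P x" and ?pL = "\<lambda>x. indicator {0<..} (q x) * p x"
  have ind_lim: "(\<lambda>k. ?I k x) \<longlonglongrightarrow> indicator {0<..} (q x)" for x
  proof (cases "q x > 0")
    case True
    have "(\<lambda>k. q x - (1 / real (Suc k)) * p x) \<longlonglongrightarrow> q x - 0 * p x"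
      by (intro tendsto_intros inverse_Suc_tendsto_0)
    then have "\<forall>\<^sub>F k in sequentially. 0 < q x - (1 / real (Suc k)) * p x"
      using True by (intro order_tendstoD(1)[of _ "q x"]) auto
    then have "\<forall>\<^sub>F k in sequentially. ?I k x = indicator {0<..} (q x)"
      by eventually_elim (use True in \<open>auto simp: indicator_def\<close>)
    then show ?thesis by (rule tendsto_eventually)
  next
    case False
    have "?I k x = indicator {0<..} (q x)" for k
    proof -
      have "0 \<le> (1 / real (Suc k)) * p x" using p0[of x] by simp
      then show ?thesis using False by (simp add: indicator_def)
    qed
    then show ?thesis by simp
  qed
  have P_lim: "L2_lim \<Omega> (\<lambda>k x. ?I k x *\<^sub>R P x) ?PL"
  proof (rule L2_lim_pointwise_dominated[OF _ _ Lp(2)])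
    show "(\<lambda>k. ?I k x *\<^sub>R P x) \<longlonglongrightarrow> ?PL x" for x by (intro tendsto_scaleR tendsto_const ind_lim)
  qed (auto simp: indicator_def)
  have PkL: "(\<lambda>x. ?I k x *\<^sub>R P x) \<in> L2 \<Omega>" for k
    by (rule L2_bounded_scaleR[OF Lp(2), where C=1]) (auto simp: indicator_def)
  have PL: "?PL \<in> L2 \<Omega>"
    by (rule L2_bounded_scaleR[OF Lp(2), where C=1]) (auto simp: indicator_def)
  \<comment> \<open>\<open>q\<close> is nonnegative only a.e.; taking its positive part gives the
    bounds at every point that the domination lemma asks for.\<close>
  define m' where "m' k x = min (real (Suc k) * max (q x) 0) (p x)" for k x
  have m'_le: "0 \<le> m' k x" "m' k x \<le> p x" for k x using p0[of x] by (auto simp: m'_def)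
  have [measurable]: "m' k \<in> borel_measurable (lebesgue_on \<Omega>)" for k unfolding m'_def by measurable
  have m_lim: "L2_lim \<Omega> m' ?pL"
  proof (rule L2_lim_pointwise_dominated[OF _ _ Lp(1)])
    show "norm (m' k x) \<le> norm (p x)" for k x using m'_le[of k x] by simp
    show "norm (?pL x) \<le> norm (p x)" for x by (auto simp: indicator_def)
    show "(\<lambda>k. m' k x) \<longlonglongrightarrow> ?pL x" for x
    proof (cases "q x > 0")
      case True
      obtain n where n: "p x / q x \<le> real n" using real_arch_simple by blast
      have "\<forall>\<^sub>F k in sequentially. m' k x = ?pL x"
        unfolding eventually_sequentially
      proof (intro exI allI impI)
        fix k assume "n \<le> k"
        then have "p x / q x \<le> real (Suc k)" using n by linarith
        then have "p x \<le> real (Suc k) * q x" using True by (simp add: divide_le_eq)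
        then show "m' k x = ?pL x" using True by (simp add: m'_def)
      qed
      then show ?thesis by (rule tendsto_eventually)
    next
      case False
      then have "m' k x = ?pL x" for k using p0[of x] by (simp add: m'_def)
      then show ?thesis by simp
    qed
  qed measurable
  have m'L: "m' k \<in> L2 \<Omega>" for k
    by (rule L2_bound[OF Lp(1), where C=1]) (use m'_le(1)[of k] order_trans[OF m'_le(2)[of k] abs_ge_self] in auto)
  have mL: "?m k \<in> L2 \<Omega>" and m_eq: "ip \<Omega> f (?m k) = ip \<Omega> f (m' k)" for k
  proof -
    have ae: "AE x in lebesgue_on \<Omega>. m' k x = ?m k x"
      using nn
    proof eventually_elim
      fix x assume "0 \<le> u x"
      then have "0 \<le> q x" using \<eta>(2)[of x] by (simp add: q_def)
      then show "m' k x = ?m k x" by (simp add: m'_def max_def)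
    qed
    show mL: "?m k \<in> L2 \<Omega>" by (rule L2_AE[OF domain_sets m'L ae])
    show "ip \<Omega> f (?m k) = ip \<Omega> f (m' k)"
      by (rule ip_cong_AE[OF f f mL m'L]) (use ae in \<open>auto elim: eventually_mono\<close>)
  qed
  have pL: "?pL \<in> L2 \<Omega>"
    using L2_bounded_scaleR[OF Lp(1), of "\<lambda>x. indicator {0<..} (q x)" 1] by (auto simp: indicator_def)
  have "(\<lambda>k. ip \<Omega> G (\<lambda>x. ?I k x *\<^sub>R P x) + ip \<Omega> f (m' k)) \<longlonglongrightarrow> ip \<Omega> G ?PL + ip \<Omega> f ?pL"
    by (intro tendsto_add L2_lim_ip[OF L2_lim_const P_lim L(2) PkL L(2) PL]
        L2_lim_ip[OF L2_lim_const m_lim f m'L f pL])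
  then have le: "ip \<Omega> G ?PL + ip \<Omega> f ?pL \<le> 0"
    by (rule LIMSEQ_le_const2) (use key m_eq in simp)
  \<comment> \<open>Restricting \<open>P\<close> to the set where \<open>q\<close> is positive loses
    nothing: where \<open>\<psi>\<close> is positive but \<open>q\<close> vanishes, \<open>Q\<close>
    is \<open>G\<close> and vanishes a.e.\<close>
  have "ip \<Omega> G ?PL = ip \<Omega> G P"
    unfolding ip_def
  proof (rule integral_cong_AE)
    show "AE x in lebesgue_on \<Omega>. G x \<bullet> ?PL x = G x \<bullet> P x"
      using zset nn
    proof eventually_elim
      fix x assume z0: "q x = 0 \<longrightarrow> Q x = 0" and u0: "0 \<le> u x"
      show "G x \<bullet> ?PL x = G x \<bullet> P x"
      proof (cases "\<psi> x > 0")
        case True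
        then have "q x = u x" "Q x = G x" by (simp_all add: q_def Q_def \<eta>1)
        then show ?thesis using z0 u0 by (cases "u x = 0") auto
      next
        case False
        then show ?thesis by (simp add: P_def)
      qed
    qed
  qed (use L2_ip_integrable[OF L(2) PL] L2_ip_integrable[OF L(2) Lp(2)] in auto)
  moreover have "?pL = (\<lambda>x. indicator {0<..} (u x) * p x)"
  proof
    show "?pL x = indicator {0<..} (u x) * p x" for x
      by (cases "\<psi> x > 0") (auto simp: q_def \<eta>1 p_def)
  qed
  ultimately show "ip \<Omega> G P + ip \<Omega> f (\<lambda>x. indicator {0<..} (u x) * p x) \<le> 0" using le by (simp only:)
qed

text \<open>The functional \<open>T\<close> represents \<open>f\<close> minus the Laplacian of
  \<open>u\<close>. The bounds of \<open>obstacle_upper\<close> make it continuous in L2 with a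
  density \<open>\<theta>\<close> between 0 and \<open>?F\<close>. Since \<open>?F\<close> vanishes
  where \<open>u\<close> is positive, the Laplacian \<open>?h\<close> is \<open>f\<close> there;
  where \<open>u\<close> is 0, \<open>laplacian_zero_set\<close> gives
  \<open>?h = 0\<close>.\<close>

lemma obstacle_PDE:
  assumes u: "obstacle_solution \<Omega> g Gg f u G" and f: "f \<in> L2 \<Omega>" and \<phi>: "test_function \<Omega> \<phi>"
  shows "ip \<Omega> G (gradient \<phi>) = - ip \<Omega> (\<lambda>x. f x * indicator {0<..} (u x)) \<phi>"
proof -
  have a: "admissible \<Omega> g Gg u G" using u by (auto simp: obstacle_solution_def)
  note L = admissible_L2[OF a]
  have nn: "AE x in lebesgue_on \<Omega>. 0 \<le> u x" using a by (auto simp: admissible_def)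
  have [measurable]: "u \<in> borel_measurable (lebesgue_on \<Omega>)" by (rule L2_meas[OF L(1)])
  define T where "T \<psi> = ip \<Omega> G (gradient \<psi>) + ip \<Omega> f \<psi>" for \<psi>
  let ?F = "\<lambda>x. f x - f x * indicator {0<..} (u x)"
  have fu: "(\<lambda>x. f x * indicator {0<..} (u x)) \<in> L2 \<Omega>"
    using L2_bounded_scaleR[OF f, of "\<lambda>x. indicator {0<..} (u x)" 1] by (auto simp: indicator_def mult.commute)
  have F: "?F \<in> L2 \<Omega>" by (rule L2_diff[OF f fu])
  let ?p = "\<lambda>\<psi> x. max (\<psi> x) 0" and ?P = "\<lambda>\<psi> x. indicator {0<..} (\<psi> x) *\<^sub>R gradient \<psi> x"
  have s: "sobolev0_pair \<Omega> (?p \<psi>) (?P \<psi>)" if "test_function \<Omega> \<psi>" for \<psi>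
    by (rule sobolev0_pos_part[OF \<Omega> sobolev0_test[OF that domain_sets]])
  have bounds: "0 \<le> ip \<Omega> G (?P \<psi>) + ip \<Omega> f (?p \<psi>)" "ip \<Omega> G (?P \<psi>) + ip \<Omega> f (?p \<psi>) \<le> ip \<Omega> ?F (?p \<psi>)"
    if \<psi>: "test_function \<Omega> \<psi>" for \<psi>
  proof -
    show "0 \<le> ip \<Omega> G (?P \<psi>) + ip \<Omega> f (?p \<psi>)" by (rule obstacle_upper(2)[OF u f \<psi>])
    have "ip \<Omega> ?F (?p \<psi>) = ip \<Omega> f (?p \<psi>) - ip \<Omega> (\<lambda>x. f x * indicator {0<..} (u x)) (?p \<psi>)"
      by (rule ip_diff_left[OF f fu sobolev0_pair_L2(1)[OF s[OF \<psi>]]])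
    also have "ip \<Omega> (\<lambda>x. f x * indicator {0<..} (u x)) (?p \<psi>) = ip \<Omega> f (\<lambda>x. indicator {0<..} (u x) * ?p \<psi> x)"
      by (simp add: ip_def mult.assoc)
    finally show "ip \<Omega> G (?P \<psi>) + ip \<Omega> f (?p \<psi>) \<le> ip \<Omega> ?F (?p \<psi>)"
      using obstacle_upper(1)[OF u f \<psi>] by simp
  qed
  \<comment> \<open>The positive part of a test function is no test function, so \<open>T\<close> is
    not evaluated on it; its a.e. gradient \<open>?P\<close> is used directly. The function itself
    is the difference of two such parts.\<close>
  have T_pos: "T \<psi> = (ip \<Omega> G (?P \<psi>) + ip \<Omega> f (?p \<psi>)) - (ip \<Omega> G (?P (\<lambda>x. - 1 * \<psi> x)) + ip \<Omega> f (?p (\<lambda>x. - 1 * \<psi> x)))"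
    if \<psi>: "test_function \<Omega> \<psi>" for \<psi>
  proof -
    have \<psi>': "test_function \<Omega> (\<lambda>x. - 1 * \<psi> x)" by (rule test_cmult[OF \<psi>])
    note L1 = sobolev0_pair_L2[OF s[OF \<psi>]] note L2 = sobolev0_pair_L2[OF s[OF \<psi>']]
    have d: "sobolev0_pair \<Omega> (\<lambda>x. ?p \<psi> x - ?p (\<lambda>x. - 1 * \<psi> x) x) (\<lambda>x. ?P \<psi> x - ?P (\<lambda>x. - 1 * \<psi> x) x)"
      by (rule sobolev0_diff[OF domain_sets s[OF \<psi>] s[OF \<psi>']])
    have eq: "(\<lambda>x. ?p \<psi> x - ?p (\<lambda>x. - 1 * \<psi> x) x) = \<psi>" by (auto simp: fun_eq_iff max_def)
    have "AE x in lebesgue_on \<Omega>. ?P \<psi> x - ?P (\<lambda>x. - 1 * \<psi> x) x = gradient \<psi> x"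
      by (rule sobolev_pair_unique[OF \<Omega> sobolev0_imp_sobolev[OF domain_sets d] sobolev_pair_test[OF \<psi> domain_sets]])
         (auto simp: max_def)
    then have "ip \<Omega> G (gradient \<psi>) = ip \<Omega> G (\<lambda>x. ?P \<psi> x - ?P (\<lambda>x. - 1 * \<psi> x) x)"
      by (intro ip_cong_AE L test_L2[OF \<psi> domain_sets] L2_diff L1 L2) (auto elim: eventually_mono)
    also have "\<dots> = ip \<Omega> G (?P \<psi>) - ip \<Omega> G (?P (\<lambda>x. - 1 * \<psi> x))"
      by (rule ip_diff_right[OF L1(2) L2(2) L(2)])
    finally have 1: "ip \<Omega> G (gradient \<psi>) = ip \<Omega> G (?P \<psi>) - ip \<Omega> G (?P (\<lambda>x. - 1 * \<psi> x))" .
    have "ip \<Omega> f \<psi> = ip \<Omega> f (\<lambda>x. ?p \<psi> x - ?p (\<lambda>x. - 1 * \<psi> x) x)" by (simp only: eq)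
    also have "\<dots> = ip \<Omega> f (?p \<psi>) - ip \<Omega> f (?p (\<lambda>x. - 1 * \<psi> x))"
      by (rule ip_diff_right[OF L1(1) L2(1) f])
    finally show ?thesis unfolding T_def 1 by linarith
  qed
  have small: "\<bar>ip \<Omega> ?F (?p \<psi>)\<bar> \<le> sqrt (sqint \<Omega> ?F) * sqrt (sqint \<Omega> \<psi>)" if \<psi>: "test_function \<Omega> \<psi>" for \<psi>
  proof -
    note Lp = sobolev0_pair_L2(1)[OF s[OF \<psi>]]
    have "\<bar>ip \<Omega> ?F (?p \<psi>)\<bar> \<le> sqrt (sqint \<Omega> ?F) * sqrt (sqint \<Omega> (?p \<psi>))" by (rule ip_abs_le[OF F Lp])
    also have "\<dots> \<le> sqrt (sqint \<Omega> ?F) * sqrt (sqint \<Omega> \<psi>)"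
      by (intro mult_left_mono real_sqrt_le_mono sqint_mono Lp test_L2(1)[OF \<psi> domain_sets]) (auto simp: sqint_nonneg)
    finally show ?thesis .
  qed
  \<comment> \<open>Both terms of the difference in \<open>T_pos\<close> lie between 0 and the same
    product of norms, so no factor 2 is lost.\<close>
  have bound: "(T \<psi>)\<^sup>2 \<le> sqint \<Omega> ?F * sqint \<Omega> \<psi>" if \<psi>: "test_function \<Omega> \<psi>" for \<psi>
  proof -
    have \<psi>': "test_function \<Omega> (\<lambda>x. - 1 * \<psi> x)" by (rule test_cmult[OF \<psi>])
    have "sqint \<Omega> (\<lambda>x. - 1 * \<psi> x) = sqint \<Omega> \<psi>" by (simp add: sqint_def)
    then have "\<bar>T \<psi>\<bar> \<le> sqrt (sqint \<Omega> ?F) * sqrt (sqint \<Omega> \<psi>)"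
      using T_pos[OF \<psi>] bounds[OF \<psi>] bounds[OF \<psi>'] small[OF \<psi>] small[OF \<psi>'] by (simp only: abs_le_iff) linarith
    from power_mono[OF this abs_ge_zero, of 2] show ?thesis
      by (simp add: power_mult_distrib sqint_nonneg)
  qed
  have lin: "T (\<lambda>x. \<psi> x + c * \<xi> x) = T \<psi> + c * T \<xi>"
    if t: "test_function \<Omega> \<psi>" "test_function \<Omega> \<xi>" for \<psi> \<xi> c
  proof -
    have "gradient (\<lambda>x. \<psi> x + c * \<xi> x) = (\<lambda>x. gradient \<psi> x + c *\<^sub>R gradient \<xi> x)"
      using test_smooth[OF t(1)] test_smooth[OF t(2)] test_smooth[OF test_cmult[OF t(2)]]
      by (auto simp: fun_eq_iff gradient_add gradient_cmult)
    then show ?thesis unfolding T_def using t f L test_L2[OF t(1) domain_sets] test_L2[OF t(2) domain_sets]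
      by (simp add: ip_add_right ip_scaleR_right ip_cmult_right L2_scaleR L2_cmult distrib_left)
  qed
  obtain \<theta> where \<theta>: "\<theta> \<in> L2 \<Omega>" "\<And>\<psi>. test_function \<Omega> \<psi> \<Longrightarrow> T \<psi> = ip \<Omega> \<theta> \<psi>"
    using Riesz_test[OF domain_sets lin bound] by blast
  let ?h = "\<lambda>x. f x - \<theta> x"
  have h: "?h \<in> L2 \<Omega>" by (rule L2_diff[OF f \<theta>(1)])
  have eqh: "ip \<Omega> G (gradient \<psi>) = - ip \<Omega> ?h \<psi>" if \<psi>: "test_function \<Omega> \<psi>" for \<psi>
    using \<theta>(2)[OF \<psi>] f \<theta>(1) test_L2(1)[OF \<psi> domain_sets] by (simp add: T_def ip_diff_left)
  have zero: "AE x in lebesgue_on \<Omega>. u x = 0 \<longrightarrow> ?h x = 0"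
    by (rule laplacian_zero_set[OF \<Omega> admissible_pair[OF a] h eqh])
  have pos: "0 \<le> ip \<Omega> \<theta> \<psi>" "ip \<Omega> \<theta> \<psi> \<le> ip \<Omega> ?F \<psi>"
    if \<psi>: "test_function \<Omega> \<psi>" and nonneg: "\<And>x. 0 \<le> \<psi> x" for \<psi>
  proof -
    have p: "?p \<psi> = \<psi>" by (rule ext) (use nonneg in \<open>simp add: max_absorb1\<close>)
    have "AE x in lebesgue_on \<Omega>. ?P \<psi> x = gradient \<psi> x"
      by (rule sobolev_pair_unique[OF \<Omega> sobolev0_imp_sobolev[OF domain_sets s[OF \<psi>]] sobolev_pair_test[OF \<psi> domain_sets]])
         (rule AE_I2, rule fun_cong[OF p])
    then have P: "ip \<Omega> G (?P \<psi>) = ip \<Omega> G (gradient \<psi>)"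
      by (intro ip_cong_AE L test_L2[OF \<psi> domain_sets] sobolev0_pair_L2(2)[OF s[OF \<psi>]]) auto
    show "0 \<le> ip \<Omega> \<theta> \<psi>" "ip \<Omega> \<theta> \<psi> \<le> ip \<Omega> ?F \<psi>"
      using bounds[OF \<psi>] by (simp_all only: p P \<theta>(2)[OF \<psi>, symmetric] T_def)
  qed
  have ae1: "AE x in lebesgue_on \<Omega>. 0 \<le> \<theta> x"
  proof (rule fundamental_lemma_nonneg[OF \<Omega> L2_locally_integrable[OF \<theta>(1) domain_sets]])
    fix \<psi> assume "test_function \<Omega> \<psi>" "\<And>x. 0 \<le> \<psi> x"
    from pos(1)[OF this] show "0 \<le> (LINT x|lebesgue_on \<Omega>. \<psi> x * \<theta> x)" by (simp add: ip_def mult.commute)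
  qed
  have ae2: "AE x in lebesgue_on \<Omega>. 0 \<le> ?F x - \<theta> x"
  proof (rule fundamental_lemma_nonneg[OF \<Omega> L2_locally_integrable[OF L2_diff[OF F \<theta>(1)] domain_sets]])
    fix \<psi> assume \<psi>: "test_function \<Omega> \<psi>" "\<And>x. 0 \<le> \<psi> x"
    have "0 \<le> ip \<Omega> ?F \<psi> - ip \<Omega> \<theta> \<psi>" using pos(2)[OF \<psi>] by simp
    also have "\<dots> = ip \<Omega> (\<lambda>x. ?F x - \<theta> x) \<psi>"
      by (rule ip_diff_left[OF F \<theta>(1) test_L2(1)[OF \<psi>(1) domain_sets], symmetric])
    finally show "0 \<le> (LINT x|lebesgue_on \<Omega>. \<psi> x * (?F x - \<theta> x))" by (simp add: ip_def mult.commute)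
  qed
  \<comment> \<open>Where \<open>u x > 0\<close>, the bracket pins \<open>\<theta> x\<close> to 0;
    where \<open>u x = 0\<close>, regularity makes \<open>?h x\<close> vanish. Nonnegativity of
    \<open>u\<close> leaves no other case.\<close>
  have "AE x in lebesgue_on \<Omega>. ?h x = f x * indicator {0<..} (u x)"
    using zero ae1 ae2 nn by eventually_elim (auto simp: indicator_def split: if_splits)
  then have "ip \<Omega> ?h \<phi> = ip \<Omega> (\<lambda>x. f x * indicator {0<..} (u x)) \<phi>"
    by (intro ip_cong_AE h fu test_L2(1)[OF \<phi> domain_sets]) auto
  then show ?thesis using eqh[OF \<phi>] by simp
qed

end

section \<open>The system\<close>

text \<open>Minkowski's inequality. Summing the steps of an iteration cannot afford the factor 2 of
  \<open>sqint_triangle\<close>.\<close>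

lemma sqrt_sqint_triangle:
  assumes "f \<in> L2 \<Omega>" "g \<in> L2 \<Omega>"
  shows "sqrt (sqint \<Omega> (\<lambda>x. f x + g x)) \<le> sqrt (sqint \<Omega> f) + sqrt (sqint \<Omega> g)"
proof (rule real_le_lsqrt)
  have "sqint \<Omega> (\<lambda>x. f x + g x) = sqint \<Omega> f + 2 * ip \<Omega> f g + sqint \<Omega> g" by (rule sqint_add[OF assms])
  also have "\<dots> \<le> sqint \<Omega> f + 2 * (sqrt (sqint \<Omega> f) * sqrt (sqint \<Omega> g)) + sqint \<Omega> g"
    using ip_abs_le[OF assms] by linarith
  also have "\<dots> = (sqrt (sqint \<Omega> f) + sqrt (sqint \<Omega> g))\<^sup>2"
    by (simp add: power2_sum sqint_nonneg)
  finally show "sqint \<Omega> (\<lambda>x. f x + g x) \<le> (sqrt (sqint \<Omega> f) + sqrt (sqint \<Omega> g))\<^sup>2" .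
qed (auto simp: sqint_nonneg)

lemma geometric_Cauchy:
  assumes v: "\<And>k. v k \<in> L2 \<Omega>" and r: "0 \<le> r" "r < 1" and C: "0 \<le> C"
    and step: "\<And>k. sqrt (sqint \<Omega> (\<lambda>x. v (Suc k) x - v k x)) \<le> C * r ^ k"
  shows "L2_Cauchy \<Omega> v"
proof -
  let ?d = "\<lambda>m n. sqrt (sqint \<Omega> (\<lambda>x. v m x - v n x))"
  have tri: "?d l n \<le> ?d l m + ?d m n" for l m n
    using sqrt_sqint_triangle[of "\<lambda>x. v l x - v m x" \<Omega> "\<lambda>x. v m x - v n x"] v by (simp add: L2_diff)
  \<comment> \<open>The exact partial geometric sum is carried, since the limiting bound without
    \<open>1 - r ^ j\<close> would not reproduce itself in the induction.\<close>
  have "?d (n + j) n \<le> C * r ^ n * (1 - r ^ j) / (1 - r)" for n j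
  proof (induction j)
    case 0
    then show ?case by (simp add: sqint_def)
  next
    case (Suc j)
    have "?d (n + Suc j) n \<le> ?d (Suc (n + j)) (n + j) + ?d (n + j) n" using tri by simp
    also have "\<dots> \<le> C * r ^ (n + j) + C * r ^ n * (1 - r ^ j) / (1 - r)" by (intro add_mono step Suc)
    also have "\<dots> = C * r ^ n * (1 - r ^ Suc j) / (1 - r)"
      using r by (simp add: field_simps power_add)
    finally show ?case .
  qed
  moreover have "C * r ^ n * (1 - r ^ j) / (1 - r) \<le> C * r ^ n / (1 - r)" for n j
  proof (rule divide_right_mono)
    show "C * r ^ n * (1 - r ^ j) \<le> C * r ^ n"
      using r C by (intro mult_right_le_one_le mult_nonneg_nonneg) (auto simp: power_le_one)
  qed (use r in auto)
  ultimately have d: "?d (n + j) n \<le> C * r ^ n / (1 - r)" for n j by (meson order_trans)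
  show ?thesis
    unfolding L2_Cauchy_def
  proof (intro allI impI)
    fix e :: real assume e: "e > 0"
    have "(\<lambda>n. 2 * (C * r ^ n / (1 - r))) \<longlonglongrightarrow> 2 * (C * 0 / (1 - r))"
      using r by (intro tendsto_intros LIMSEQ_power_zero) auto
    then have "\<forall>\<^sub>F n in sequentially. 2 * (C * r ^ n / (1 - r)) < sqrt e"
      using e by (intro order_tendstoD(2)[of _ "2 * (C * 0 / (1 - r))"]) auto
    then obtain N where N: "2 * (C * r ^ N / (1 - r)) < sqrt e" by (auto simp: eventually_sequentially)
    show "\<exists>N. \<forall>m\<ge>N. \<forall>n\<ge>N. sqint \<Omega> (\<lambda>x. v m x - v n x) < e"
    proof (intro exI allI impI)
      fix m n assume "m \<ge> N" "n \<ge> N"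
      then have "?d m N \<le> C * r ^ N / (1 - r)" "?d n N \<le> C * r ^ N / (1 - r)"
        using d[of N "m - N"] d[of N "n - N"] by auto
      moreover have "?d m n \<le> ?d m N + ?d N n" by (rule tri)
      moreover have "?d N n = ?d n N" by (rule arg_cong[OF sqint_diff_commute])
      ultimately have "?d m n \<le> 2 * (C * r ^ N / (1 - r))" by linarith
      then have "?d m n < sqrt e" using N by (rule le_less_trans)
      then show "sqint \<Omega> (\<lambda>x. v m x - v n x) < e" by simp
    qed
  qed
qed

text \<open>Functions vanishing a.e. do not enter the infimum and are treated apart. For the others
  the quotient is formed with \<open>weak_grad\<close>, which agrees a.e. with
  \<open>G\<close>.\<close>

lemma first_eigenvalue_le:
  assumes \<Omega>: "open \<Omega>" and w: "sobolev0_pair \<Omega> w G"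
  shows "first_eigenvalue \<Omega> * sqint \<Omega> w \<le> sqint \<Omega> G"
proof (cases "zero_on \<Omega> w")
  case True
  then have "sqint \<Omega> w = 0" using sqint_eq_0[OF sobolev0_pair_L2(1)[OF w]] by (simp add: zero_on_def)
  then show ?thesis by (simp add: sqint_nonneg)
next
  case False
  have \<Omega>l: "\<Omega> \<in> sets lebesgue" by (rule open_sets_lebesgue[OF \<Omega>])
  have pos: "sqint \<Omega> w > 0"
    using False sqint_eq_0[OF sobolev0_pair_L2(1)[OF w]] sqint_nonneg[of \<Omega> w] by (simp add: zero_on_def)
  have s: "sobolev_pair \<Omega> w G" by (rule sobolev0_imp_sobolev[OF \<Omega>l w])
  have g: "sqint \<Omega> (weak_grad \<Omega> w) = sqint \<Omega> G"
    using sobolev_pair_L2(2)[OF sobolev_pair_weak_grad[OF \<Omega> s]] sobolev_pair_L2(2)[OF s] weak_grad_AE[OF \<Omega> s]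
    by (rule sqint_cong_AE)
  have "first_eigenvalue \<Omega>
      \<le> (LINT x|lebesgue_on \<Omega>. (norm (weak_grad \<Omega> w x))\<^sup>2) / (LINT x|lebesgue_on \<Omega>. (w x)\<^sup>2)"
    unfolding first_eigenvalue_def
  proof (rule cINF_lower)
    show "w \<in> {\<phi> \<in> W12_0 \<Omega>. \<not> zero_on \<Omega> \<phi>}" using False w by (auto simp: W12_0_iff[OF \<Omega>])
  qed (auto intro!: bdd_belowI2[of _ 0])
  then have "first_eigenvalue \<Omega> \<le> sqint \<Omega> G / sqint \<Omega> w" using g by (simp add: sqint_def)
  then show ?thesis using pos by (simp add: pos_le_divide_eq)
qed

lemma const_L2:
  assumes "bounded \<Omega>" "\<Omega> \<in> sets lebesgue"
  shows "(\<lambda>x. c :: real) \<in> L2 (\<Omega> :: 'a::euclidean_space set)"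
proof (rule L2_dominated)
  have "compact (closure \<Omega>)" using assms(1) by (simp add: compact_closure)
  from integrable_indicator_compact[OF this assms(2)]
  show "integrable (lebesgue_on \<Omega>) (\<lambda>x. c\<^sup>2 * indicator (closure \<Omega>) x)" by simp
  show "AE x in lebesgue_on \<Omega>. (norm c)\<^sup>2 \<le> c\<^sup>2 * indicator (closure \<Omega>) x"
    using closure_subset[of \<Omega>] by (intro AE_I2) (auto simp: indicator_def)
qed simp

text \<open>Needed because the fixed point of the iteration is reached only up to null sets: the
  limit agrees a.e. with the solution it generates.\<close>

lemma obstacle_cong_AE:
  assumes \<Omega>: "open \<Omega>" and g: "sobolev_pair \<Omega> g Gg" and u: "obstacle_solution \<Omega> g Gg f u G"
    and f: "f \<in> L2 \<Omega>" "f' \<in> L2 \<Omega>" "AE x in lebesgue_on \<Omega>. f x = f' x"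
  shows "obstacle_solution \<Omega> g Gg f' u G"
proof -
  have a: "admissible \<Omega> g Gg u G" using u by (simp add: obstacle_solution_def)
  have "ip \<Omega> f (\<lambda>x. w x - u x) = ip \<Omega> f' (\<lambda>x. w x - u x)" if w: "admissible \<Omega> g Gg w W" for w W
  proof -
    have "(\<lambda>x. w x - u x) \<in> L2 \<Omega>"
      by (intro L2_diff admissible_L2(1)[OF \<Omega> g w] admissible_L2(1)[OF \<Omega> g a])
    then show ?thesis by (intro ip_cong_AE f) auto
  qed
  then show ?thesis using u by (simp add: obstacle_solution_def)
qed

text \<open>The alternating iteration \<open>v \<mapsto> S\<^sub>2 (1 + \<mu> S\<^sub>1 (1 + \<mu> v))\<close> of the solution operators of the two obstacle
  problems, started at 0, is a contraction for \<open>-\<lambda>\<^sub>1 < \<mu> < 0\<close>; for \<open>\<mu> \<ge> 0\<close> both operators are antitone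
  in \<open>v\<close>, so that it is increasing and bounded above by \<open>S\<^sub>2 1\<close>.\<close>

lemma obstacle_system_solvable:
  fixes \<Omega> :: "'a::euclidean_space set"
  assumes \<Omega>: "open \<Omega>" "bounded \<Omega>"
    and g1: "sobolev_pair \<Omega> g1 G1" and g2: "sobolev_pair \<Omega> g2 G2"
    and ne1: "admissible \<Omega> g1 G1 w1 W1" and ne2: "admissible \<Omega> g2 G2 w2 W2"
    and \<mu>: "\<mu> > - first_eigenvalue \<Omega>"
  shows "\<exists>u G v H. obstacle_solution \<Omega> g1 G1 (\<lambda>x. 1 + \<mu> * v x) u G \<and>
    obstacle_solution \<Omega> g2 G2 (\<lambda>x. 1 + \<mu> * u x) v H"
proof -
  have \<Omega>l: "\<Omega> \<in> sets lebesgue" by (rule open_sets_lebesgue[OF \<Omega>(1)])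
  obtain P where P: "P > 0" "\<And>w G. sobolev0_pair \<Omega> w G \<Longrightarrow> sqint \<Omega> w \<le> P * sqint \<Omega> G"
    using Poincare[OF \<Omega>(2) \<Omega>l] by blast
  define F where "F v x = 1 + \<mu> * v x" for v :: "'a \<Rightarrow> real" and x
  have FL: "F v \<in> L2 \<Omega>" if "v \<in> L2 \<Omega>" for v
    unfolding F_def by (intro L2_add L2_cmult that const_L2 \<Omega> \<Omega>l)
  have Fd: "sqrt (sqint \<Omega> (\<lambda>x. F v x - F w x)) = \<bar>\<mu>\<bar> * sqrt (sqint \<Omega> (\<lambda>x. v x - w x))" for v w
    using sqint_scaleR[of \<Omega> \<mu> "\<lambda>x. v x - w x"] by (simp add: F_def real_sqrt_mult right_diff_distrib)
  \<comment> \<open>The choice fixes one representative per datum. Stability and comparison hold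
    between any two solutions, hence for the chosen ones.\<close>
  define S1 where "S1 f = (SOME u. \<exists>G. obstacle_solution \<Omega> g1 G1 f u G)" for f
  define S2 where "S2 f = (SOME u. \<exists>G. obstacle_solution \<Omega> g2 G2 f u G)" for f
  have S1: "\<exists>G. obstacle_solution \<Omega> g1 G1 f (S1 f) G" if "f \<in> L2 \<Omega>" for f
    unfolding S1_def by (rule someI_ex[of "\<lambda>u. \<exists>G. obstacle_solution \<Omega> g1 G1 f u G"]) (rule obstacle_exists[OF \<Omega>(1) g1 that P ne1])
  have S2: "\<exists>G. obstacle_solution \<Omega> g2 G2 f (S2 f) G" if "f \<in> L2 \<Omega>" for f
    unfolding S2_def by (rule someI_ex[of "\<lambda>u. \<exists>G. obstacle_solution \<Omega> g2 G2 f u G"]) (rule obstacle_exists[OF \<Omega>(1) g2 that P ne2])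
  have S1L: "S1 f \<in> L2 \<Omega>" and S1n: "AE x in lebesgue_on \<Omega>. 0 \<le> S1 f x" if "f \<in> L2 \<Omega>" for f
    using S1[OF that] admissible_L2(1)[OF \<Omega>(1) g1] by (auto simp: obstacle_solution_def admissible_def)
  have S2L: "S2 f \<in> L2 \<Omega>" and S2n: "AE x in lebesgue_on \<Omega>. 0 \<le> S2 f x" if "f \<in> L2 \<Omega>" for f
    using S2[OF that] admissible_L2(1)[OF \<Omega>(1) g2] by (auto simp: obstacle_solution_def admissible_def)
  have Lip1: "c * sqrt (sqint \<Omega> (\<lambda>x. S1 (F v) x - S1 (F w) x)) \<le> \<bar>\<mu>\<bar> * sqrt (sqint \<Omega> (\<lambda>x. v x - w x))"
    and Lip2: "c * sqrt (sqint \<Omega> (\<lambda>x. S2 (F v) x - S2 (F w) x)) \<le> \<bar>\<mu>\<bar> * sqrt (sqint \<Omega> (\<lambda>x. v x - w x))"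
    if "v \<in> L2 \<Omega>" "w \<in> L2 \<Omega>" "c > 0" "\<And>w G. sobolev0_pair \<Omega> w G \<Longrightarrow> c * sqint \<Omega> w \<le> sqint \<Omega> G" for v w c
    using S1[OF FL[OF that(1)]] S1[OF FL[OF that(2)]] S2[OF FL[OF that(1)]] S2[OF FL[OF that(2)]]
      obstacle_Lipschitz[OF \<Omega>(1) g1 _ _ FL[OF that(1)] FL[OF that(2)] that(3,4)]
      obstacle_Lipschitz[OF \<Omega>(1) g2 _ _ FL[OF that(1)] FL[OF that(2)] that(3,4)]
    unfolding Fd by blast+
  define v where "v k = ((\<lambda>v. S2 (F (S1 (F v)))) ^^ k) (\<lambda>x. 0)" for k
  define u where "u k = S1 (F (v k))" for k
  have v0: "v 0 = (\<lambda>x. 0)" and vS: "v (Suc k) = S2 (F (u k))" for k by (auto simp: v_def u_def)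
  have vL: "v k \<in> L2 \<Omega>" for k
  proof (induction k)
    case (Suc k)
    show ?case unfolding vS u_def by (intro S2L FL S1L Suc)
  qed (simp add: v0 L2_zero)
  have uL: "u k \<in> L2 \<Omega>" for k unfolding u_def by (intro S1L FL vL)
  \<comment> \<open>The two signs of \<open>\<mu>\<close> differ only in why \<open>v\<close>
    converges; the identification of the limit afterwards is common to both.\<close>
  have "\<exists>vl. vl \<in> L2 \<Omega> \<and> L2_lim \<Omega> v vl"
  proof (cases "\<mu> < 0")
    case True
    define c where "c = first_eigenvalue \<Omega>"
    have c: "c > 0" "\<bar>\<mu>\<bar> < c" using True \<mu> by (auto simp: c_def)
    \<comment> \<open>One step of the iteration passes through both solution operators, hence the
      square of the Lipschitz factor.\<close>
    define r where "r = (\<bar>\<mu>\<bar> / c) * (\<bar>\<mu>\<bar> / c)"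
    have q: "0 \<le> \<bar>\<mu>\<bar> / c" "\<bar>\<mu>\<bar> / c < 1" using c by auto
    have r: "0 \<le> r" "r < 1" unfolding r_def using q mult_strict_mono[OF q(2) q(2)] by auto
    note ev = first_eigenvalue_le[OF \<Omega>(1), folded c_def]
    have L1: "sqrt (sqint \<Omega> (\<lambda>x. S1 (F v) x - S1 (F w) x)) \<le> (\<bar>\<mu>\<bar> / c) * sqrt (sqint \<Omega> (\<lambda>x. v x - w x))"
      and L2: "sqrt (sqint \<Omega> (\<lambda>x. S2 (F v) x - S2 (F w) x)) \<le> (\<bar>\<mu>\<bar> / c) * sqrt (sqint \<Omega> (\<lambda>x. v x - w x))"
      if "v \<in> L2 \<Omega>" "w \<in> L2 \<Omega>" for v w
      using Lip1[OF that c(1) ev] Lip2[OF that c(1) ev] c(1) by (simp_all add: field_simps)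
    define C where "C = sqrt (sqint \<Omega> (\<lambda>x. v (Suc 0) x - v 0 x))"
    have "sqrt (sqint \<Omega> (\<lambda>x. v (Suc k) x - v k x)) \<le> C * r ^ k" for k
    proof (induction k)
      case (Suc k)
      have "sqrt (sqint \<Omega> (\<lambda>x. v (Suc (Suc k)) x - v (Suc k) x))
          \<le> (\<bar>\<mu>\<bar> / c) * sqrt (sqint \<Omega> (\<lambda>x. u (Suc k) x - u k x))"
        unfolding vS by (rule L2[OF uL uL])
      also have "\<dots> \<le> (\<bar>\<mu>\<bar> / c) * ((\<bar>\<mu>\<bar> / c) * sqrt (sqint \<Omega> (\<lambda>x. v (Suc k) x - v k x)))"
        unfolding u_def by (intro mult_left_mono L1 vL q)
      also have "\<dots> = r * sqrt (sqint \<Omega> (\<lambda>x. v (Suc k) x - v k x))" by (simp add: r_def mult.assoc)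
      also have "\<dots> \<le> r * (C * r ^ k)" by (intro mult_left_mono Suc r)
      finally show ?case by (simp add: mult_ac)
    qed (simp add: C_def)
    then have "L2_Cauchy \<Omega> v"
      by (intro geometric_Cauchy[OF vL r, of C]) (auto simp: C_def sqint_nonneg)
    from L2_complete[OF this vL] show ?thesis by blast
  next
    case False
    then have \<mu>0: "0 \<le> \<mu>" by simp
    have Fmono: "AE x in lebesgue_on \<Omega>. F v x \<le> F w x" if "AE x in lebesgue_on \<Omega>. v x \<le> w x" for v w
      using that by eventually_elim (simp add: F_def \<mu>0 mult_left_mono)
    have anti1: "AE x in lebesgue_on \<Omega>. S1 f' x \<le> S1 f x"
      if "f \<in> L2 \<Omega>" "f' \<in> L2 \<Omega>" "AE x in lebesgue_on \<Omega>. f x \<le> f' x" for f f'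
      using S1[OF that(1)] S1[OF that(2)] obstacle_comparison[OF \<Omega>(1) g1 _ _ that P] by blast
    have anti2: "AE x in lebesgue_on \<Omega>. S2 f' x \<le> S2 f x"
      if "f \<in> L2 \<Omega>" "f' \<in> L2 \<Omega>" "AE x in lebesgue_on \<Omega>. f x \<le> f' x" for f f'
      using S2[OF that(1)] S2[OF that(2)] obstacle_comparison[OF \<Omega>(1) g2 _ _ that P] by blast
    have vn: "AE x in lebesgue_on \<Omega>. 0 \<le> v k x" for k
    proof (cases k)
      case (Suc j)
      show ?thesis unfolding Suc vS by (intro S2n FL uL)
    qed (simp add: v0)
    have un: "AE x in lebesgue_on \<Omega>. 0 \<le> u k x" for k unfolding u_def by (intro S1n FL vL)
    have mono: "AE x in lebesgue_on \<Omega>. v k x \<le> v (Suc k) x" for k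
    proof (induction k)
      case 0
      then show ?case using vn[of "Suc 0"] by (simp add: v0)
    next
      case (Suc k)
      have "AE x in lebesgue_on \<Omega>. u (Suc k) x \<le> u k x"
        unfolding u_def by (intro anti1 FL vL Fmono Suc)
      then show ?case unfolding vS[of "Suc k"] vS[of k] by (intro anti2 FL uL Fmono)
    qed
    define vb where "vb = S2 (\<lambda>x. 1)"
    have oneL: "(\<lambda>x. 1 :: real) \<in> L2 \<Omega>" by (rule const_L2[OF \<Omega>(2) \<Omega>l])
    have vbL: "vb \<in> L2 \<Omega>" unfolding vb_def by (rule S2L[OF oneL])
    have bound: "AE x in lebesgue_on \<Omega>. v k x \<le> vb x" for k
    proof (cases k)
      case 0
      then show ?thesis using S2n[OF oneL] by (simp add: v0 vb_def)
    next
      case (Suc j)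
      have "AE x in lebesgue_on \<Omega>. 1 \<le> F (u j) x"
        using un[of j] by eventually_elim (simp add: F_def \<mu>0)
      then show ?thesis unfolding Suc vS vb_def by (intro anti2 oneL FL uL)
    qed
    have all: "AE x in lebesgue_on \<Omega>. \<forall>k. 0 \<le> v k x \<and> v k x \<le> v (Suc k) x \<and> v k x \<le> vb x"
      unfolding AE_all_countable
    proof
      fix k
      show "AE x in lebesgue_on \<Omega>. 0 \<le> v k x \<and> v k x \<le> v (Suc k) x \<and> v k x \<le> vb x"
        using vn[of k] mono[of k] bound[of k] by eventually_elim simp
    qed
    define vl where "vl x = lim (\<lambda>k. v k x)" for x
    have lim: "AE x in lebesgue_on \<Omega>. (\<lambda>k. v k x) \<longlonglongrightarrow> vl x \<and> (\<forall>k. 0 \<le> v k x \<and> v k x \<le> vl x) \<and> vl x \<le> vb x"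
      using all
    proof eventually_elim
      fix x assume a: "\<forall>k. 0 \<le> v k x \<and> v k x \<le> v (Suc k) x \<and> v k x \<le> vb x"
      then have "incseq (\<lambda>k. v k x)" by (simp add: incseq_SucI)
      then obtain l where l: "(\<lambda>k. v k x) \<longlonglongrightarrow> l" "\<forall>k. v k x \<le> l"
        using incseq_convergent[of "\<lambda>k. v k x" "vb x"] a by blast
      moreover have "l \<le> vb x" using l(1) a by (intro LIMSEQ_le_const2) auto
      moreover have "vl x = l" unfolding vl_def using l(1) by (rule limI)
      ultimately show "(\<lambda>k. v k x) \<longlonglongrightarrow> vl x \<and> (\<forall>k. 0 \<le> v k x \<and> v k x \<le> vl x) \<and> vl x \<le> vb x"
        using a by simp
    qed
    have [measurable]: "v k \<in> borel_measurable (lebesgue_on \<Omega>)" for k by (rule L2_meas[OF vL])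
    have vlm: "vl \<in> borel_measurable (lebesgue_on \<Omega>)" unfolding vl_def by measurable
    have "vl \<in> L2 \<Omega>"
    proof (rule L2_bound[OF vbL vlm, where C=1])
      show "AE x in lebesgue_on \<Omega>. norm (vl x) \<le> 1 * norm (vb x)"
        using lim
      proof eventually_elim
        fix x assume a: "(\<lambda>k. v k x) \<longlonglongrightarrow> vl x \<and> (\<forall>k. 0 \<le> v k x \<and> v k x \<le> vl x) \<and> vl x \<le> vb x"
        then have "0 \<le> v 0 x" "v 0 x \<le> vl x" "vl x \<le> vb x" by auto
        then show "norm (vl x) \<le> 1 * norm (vb x)" by simp
      qed
    qed
    moreover have "L2_lim \<Omega> v vl"
    proof (rule L2_lim_dominated[OF L2_meas[OF vL] vlm L2_int[OF vbL]])
      show "AE x in lebesgue_on \<Omega>. (\<lambda>k. v k x) \<longlonglongrightarrow> vl x" using lim by eventually_elim simp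
      show "AE x in lebesgue_on \<Omega>. (norm (v k x - vl x))\<^sup>2 \<le> (norm (vb x))\<^sup>2" for k
        using lim
      proof eventually_elim
        fix x assume a: "(\<lambda>k. v k x) \<longlonglongrightarrow> vl x \<and> (\<forall>k. 0 \<le> v k x \<and> v k x \<le> vl x) \<and> vl x \<le> vb x"
        then have "0 \<le> v k x" "v k x \<le> vl x" "vl x \<le> vb x" by auto
        then have "norm (v k x - vl x) \<le> norm (vb x)" by simp
        then show "(norm (v k x - vl x))\<^sup>2 \<le> (norm (vb x))\<^sup>2" by (rule power_mono) simp
      qed
    qed
    ultimately show ?thesis by blast
  qed
  then obtain vl where vl: "vl \<in> L2 \<Omega>" "L2_lim \<Omega> v vl" by blast
  define u' where "u' = S1 (F vl)"
  define v' where "v' = S2 (F u')"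
  have u'L: "u' \<in> L2 \<Omega>" unfolding u'_def by (intro S1L FL vl)
  have v'L: "v' \<in> L2 \<Omega>" unfolding v'_def by (intro S2L FL u'L)
  \<comment> \<open>Only continuity of the solution operators is at stake here, so the inverse
    Poincare constant serves for both signs of \<open>\<mu>\<close> and the size of the resulting
    factor does not matter.\<close>
  have c: "1 / P > 0" "\<And>w G. sobolev0_pair \<Omega> w G \<Longrightarrow> (1 / P) * sqint \<Omega> w \<le> sqint \<Omega> G"
    using P by (auto simp: field_simps)
  have "sqrt (sqint \<Omega> (\<lambda>x. v (Suc k) x - v' x)) \<le> (P * \<bar>\<mu>\<bar>) * ((P * \<bar>\<mu>\<bar>) * sqrt (sqint \<Omega> (\<lambda>x. v k x - vl x)))" for k
  proof -
    have "sqrt (sqint \<Omega> (\<lambda>x. v (Suc k) x - v' x)) \<le> (P * \<bar>\<mu>\<bar>) * sqrt (sqint \<Omega> (\<lambda>x. u k x - u' x))"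
      unfolding vS v'_def using Lip2[OF uL[of k] u'L c] P(1) by (simp add: field_simps)
    also have "\<dots> \<le> (P * \<bar>\<mu>\<bar>) * ((P * \<bar>\<mu>\<bar>) * sqrt (sqint \<Omega> (\<lambda>x. v k x - vl x)))"
      unfolding u_def u'_def using Lip1[OF vL[of k] vl(1) c] P(1)
      by (intro mult_left_mono) (auto simp: field_simps)
    finally show ?thesis .
  qed
  then have le: "sqint \<Omega> (\<lambda>x. v (Suc k) x - v' x) \<le> ((P * \<bar>\<mu>\<bar>) * (P * \<bar>\<mu>\<bar>))\<^sup>2 * sqint \<Omega> (\<lambda>x. v k x - vl x)" for k
    using power_mono[of "sqrt (sqint \<Omega> (\<lambda>x. v (Suc k) x - v' x))" _ 2]
    by (fastforce simp: sqint_nonneg power_mult_distrib mult.assoc)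
  have "L2_lim \<Omega> (\<lambda>k. v (Suc k)) v'"
    by (rule L2_lim_le[OF tendsto_mult_right_zero[OF vl(2)[unfolded L2_lim_def]] le])
  moreover have "L2_lim \<Omega> (\<lambda>k. v (Suc k)) vl"
    by (rule L2_lim_subseq[OF vl(2)]) (simp add: strict_mono_Suc_iff)
  ultimately have ae: "AE x in lebesgue_on \<Omega>. vl x = v' x"
    using L2_lim_unique[OF _ _ vL vl(1) v'L] by blast
  obtain G where G: "obstacle_solution \<Omega> g1 G1 (F vl) u' G" unfolding u'_def using S1[OF FL[OF vl(1)]] by blast
  obtain H where H: "obstacle_solution \<Omega> g2 G2 (F u') v' H" unfolding v'_def using S2[OF FL[OF u'L]] by blast
  have "AE x in lebesgue_on \<Omega>. F vl x = F v' x" using ae by eventually_elim (simp add: F_def)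
  from obstacle_cong_AE[OF \<Omega>(1) g1 G FL[OF vl(1)] FL[OF v'L] this]
  have "obstacle_solution \<Omega> g1 G1 (F v') u' G" .
  then show ?thesis using H unfolding F_def[abs_def] by blast
qed

lemma obstacle_weak_laplace:
  assumes \<Omega>: "open \<Omega>" and g: "sobolev_pair \<Omega> g Gg" and u: "obstacle_solution \<Omega> g Gg f u G" and f: "f \<in> L2 \<Omega>"
  shows "weak_laplace_eq \<Omega> u (\<lambda>x. f x * indicator {y. u y > 0} x)"
proof -
  have \<Omega>l: "\<Omega> \<in> sets lebesgue" by (rule open_sets_lebesgue[OF \<Omega>])
  have a: "admissible \<Omega> g Gg u G" using u by (simp add: obstacle_solution_def)
  have s: "sobolev_pair \<Omega> u G" by (rule admissible_pair[OF \<Omega> g a])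
  have [measurable]: "u \<in> borel_measurable (lebesgue_on \<Omega>)" by (rule L2_meas[OF sobolev_pair_L2(1)[OF s]])
  have eq: "(\<lambda>x. f x * indicator {y. u y > 0} x) = (\<lambda>x. f x * indicator {0<..} (u x))"
    by (auto simp: fun_eq_iff indicator_def)
  have L: "(\<lambda>x. f x * indicator {0<..} (u x)) \<in> L2 \<Omega>"
    using L2_bounded_scaleR[OF f, of "\<lambda>x. indicator {0<..} (u x)" 1] by (auto simp: indicator_def mult.commute)
  have "- (LINT x|lebesgue_on \<Omega>. weak_grad \<Omega> u x \<bullet> gradient \<phi> x)
      = (LINT x|lebesgue_on \<Omega>. f x * indicator {0<..} (u x) * \<phi> x)" if \<phi>: "test_function \<Omega> \<phi>" for \<phi>
  proof -
    have "ip \<Omega> (weak_grad \<Omega> u) (gradient \<phi>) = ip \<Omega> G (gradient \<phi>)"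
      using sobolev_pair_L2(2)[OF sobolev_pair_weak_grad[OF \<Omega> s]] sobolev_pair_L2(2)[OF s]
        test_L2(2)[OF \<phi> \<Omega>l] weak_grad_AE[OF \<Omega> s] by (intro ip_cong_AE) auto
    then show ?thesis using obstacle_PDE[OF \<Omega> g u f \<phi>] by (simp add: ip_def)
  qed
  then show ?thesis
    unfolding weak_laplace_eq_def eq using s L2_locally_integrable[OF L \<Omega>l] by (auto simp: W12_iff[OF \<Omega>])
qed

theorem theorem1p1:
  fixes \<Omega> :: "(real ^ 'n) set" and g1 g2 :: "real ^ 'n \<Rightarrow> real"
  assumes "smooth_bounded_domain \<Omega>"
    and "g1 \<in> W12 \<Omega>" and "g2 \<in> W12 \<Omega>"
    and "negative_part g1 \<in> W12_0 \<Omega>" and "negative_part g2 \<in> W12_0 \<Omega>"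
    and "\<not> zero_on \<Omega> g1" and "\<not> zero_on \<Omega> g2"
  shows "\<forall>\<mu>::real. \<mu> > - first_eigenvalue \<Omega> \<longrightarrow>
    (\<exists>u v. u \<in> W12 \<Omega> \<and> v \<in> W12 \<Omega> \<and>
       weak_laplace_eq \<Omega> u (\<lambda>x. (1 + \<mu> * v x) * indicator {y. u y > 0} x) \<and>
       weak_laplace_eq \<Omega> v (\<lambda>x. (1 + \<mu> * u x) * indicator {y. v y > 0} x) \<and>
       (AE x in lebesgue_on \<Omega>. u x \<ge> 0) \<and> (AE x in lebesgue_on \<Omega>. v x \<ge> 0) \<and>
       (\<lambda>x. u x - g1 x) \<in> W12_0 \<Omega> \<and> (\<lambda>x. v x - g2 x) \<in> W12_0 \<Omega>)"
proof (intro allI impI)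
  fix \<mu> :: real assume \<mu>: "\<mu> > - first_eigenvalue \<Omega>"
  have \<Omega>: "open \<Omega>" "bounded \<Omega>" using assms(1) by (auto simp: smooth_bounded_domain_def)
  have \<Omega>l: "\<Omega> \<in> sets lebesgue" by (rule open_sets_lebesgue[OF \<Omega>(1)])
  obtain G1 where g1: "sobolev_pair \<Omega> g1 G1" using assms(2) by (auto simp: W12_iff[OF \<Omega>(1)])
  obtain G2 where g2: "sobolev_pair \<Omega> g2 G2" using assms(3) by (auto simp: W12_iff[OF \<Omega>(1)])
  \<comment> \<open>Adding its negative part to \<open>g\<close> gives the positive part of
    \<open>g\<close>, which is nonnegative and differs from \<open>g\<close> by an element of
    \<open>W12_0 \<Omega>\<close>. The sign condition on the boundary data thus makes the obstacle
    problem feasible.\<close>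
  have adm: "\<exists>w W. admissible \<Omega> g G w W" if "negative_part g \<in> W12_0 \<Omega>" for g G
  proof -
    obtain H where "sobolev0_pair \<Omega> (negative_part g) H" using \<open>negative_part g \<in> W12_0 \<Omega>\<close> by (auto simp: W12_0_iff[OF \<Omega>(1)])
    moreover have "0 \<le> g x + negative_part g x" for x by (simp add: negative_part_def)
    ultimately have "admissible \<Omega> g G (\<lambda>x. g x + negative_part g x) (\<lambda>x. G x + H x)"
      by (simp add: admissible_def)
    then show ?thesis by blast
  qed
  obtain w1 W1 where ne1: "admissible \<Omega> g1 G1 w1 W1" using adm[OF assms(4)] by blast
  obtain w2 W2 where ne2: "admissible \<Omega> g2 G2 w2 W2" using adm[OF assms(5)] by blast
  obtain u G v H where u: "obstacle_solution \<Omega> g1 G1 (\<lambda>x. 1 + \<mu> * v x) u G"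
    and v: "obstacle_solution \<Omega> g2 G2 (\<lambda>x. 1 + \<mu> * u x) v H"
    using obstacle_system_solvable[OF \<Omega> g1 g2 ne1 ne2 \<mu>] by blast
  have a: "admissible \<Omega> g1 G1 u G" "admissible \<Omega> g2 G2 v H" using u v by (auto simp: obstacle_solution_def)
  note L = admissible_L2(1)[OF \<Omega>(1) g1 a(1)] admissible_L2(1)[OF \<Omega>(1) g2 a(2)]
  have fL: "(\<lambda>x. 1 + \<mu> * v x) \<in> L2 \<Omega>" "(\<lambda>x. 1 + \<mu> * u x) \<in> L2 \<Omega>"
    by (intro L2_add L2_cmult L const_L2 \<Omega> \<Omega>l)+
  note e1 = obstacle_weak_laplace[OF \<Omega>(1) g1 u fL(1)] and e2 = obstacle_weak_laplace[OF \<Omega>(1) g2 v fL(2)]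
  show "\<exists>u v. u \<in> W12 \<Omega> \<and> v \<in> W12 \<Omega> \<and>
       weak_laplace_eq \<Omega> u (\<lambda>x. (1 + \<mu> * v x) * indicator {y. u y > 0} x) \<and>
       weak_laplace_eq \<Omega> v (\<lambda>x. (1 + \<mu> * u x) * indicator {y. v y > 0} x) \<and>
       (AE x in lebesgue_on \<Omega>. u x \<ge> 0) \<and> (AE x in lebesgue_on \<Omega>. v x \<ge> 0) \<and>
       (\<lambda>x. u x - g1 x) \<in> W12_0 \<Omega> \<and> (\<lambda>x. v x - g2 x) \<in> W12_0 \<Omega>"
  proof (intro exI conjI)
    show "u \<in> W12 \<Omega>" "v \<in> W12 \<Omega>" using e1 e2 by (auto simp: weak_laplace_eq_def)
    show "AE x in lebesgue_on \<Omega>. u x \<ge> 0" "AE x in lebesgue_on \<Omega>. v x \<ge> 0"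
      using a by (auto simp: admissible_def)
    show "(\<lambda>x. u x - g1 x) \<in> W12_0 \<Omega>" "(\<lambda>x. v x - g2 x) \<in> W12_0 \<Omega>"
      using a by (auto simp: admissible_def W12_0_iff[OF \<Omega>(1)])
  qed (fact e1 e2)+
qed

end
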